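(* Let $(\Bbbk,q,Q)$ be any of the three triples $(\mathbb C,\zeta,\zeta^m)$, $(\mathcal O,\hat q,\hat Q)$, $(K,\hat q,\hat Q)$ of the context, and let $b_n$ be the blob algebra over $\Bbbk$ with Jucys--Murphy elements $L_1,\dots,L_n$ and diagram basis $\{m_{\mathfrak s\mathfrak t}\}$. Suppose that $\boldsymbol\lambda\in\mathrm{Bip}_1(n)$, $\mathfrak s,\mathfrak t\in\mathrm{Std}(\boldsymbol\lambda)$ and $1\le k\le n$. Then $$L_km_{\mathfrak s\mathfrak t}\equiv c_{\mathfrak s}(k)\,m_{\mathfrak s\mathfrak t}+\sum_{\mathfrak u\in\mathrm{Std}(\boldsymbol\lambda),\ \mathfrak u\succ\mathfrak s}a_{\mathfrak u}\,m_{\mathfrak u\mathfrak t}\mod b_n^{\boldsymbol\lambda}$$ for some scalars $a_{\mathfrak u}\in\Bbbk$.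
   Context: Base rings. $l\ge3$ is odd, $\zeta=e^{2\pi i/l}$, $m\in\mathbb Z$, and with $Q=\zeta^m$ one assumes $\zeta^4\neq1$, $Q\ne Q^{-1}$, $Q\ne\zeta^2Q^{-1}$, $Q^{-1}\neq\zeta^2Q$. $R$ is the localization of $\mathbb C[\hat q^{\pm1},\hat Q^{\pm1}]$ ($\hat q,\hat Q$ indeterminates) at the multiplicative set generated by $\hat q^4-1$, $\hat Q-\hat Q^{-1}$, $\hat Q-\hat Q^{-1}\hat q^2$, $\hat Q^{-1}-\hat Q\hat q^2$; $\mathfrak m=\langle\hat q-\zeta,\hat Q-\hat q^m\rangle$ (a maximal ideal), $\mathcal O=R_{\mathfrak m}$ and $K=\mathbb C(\hat q,\hat Q)$. Blob algebra $b_n$ over $\Bbbk$: generators $e,U_1,\dots,U_{n-1}$, relations $U_i^2=-(q+q^{-1})U_i$; $U_iU_jU_i=U_i$ if $|i-j|=1$; $U_iU_j=U_jU_i$ if $|i-j|>1$; $U_1eU_1=y_eU_1$; $e^2=e$; $U_ie=eU_i$ for $i\ge2$, where $y_e=-(Qq^{-1}-Q^{-1}q)/(Q-Q^{-1})$. Put $L_1=Q-(Q-Q^{-1})e$ and $L_{k+1}=(U_k+q)L_k(U_k+q)$. Diagrams. An $(n,n)$-bridge is a planar diagram with $n$ points on a top edge and $n$ on a bottom edge, joined pairwise by $n$ non-crossing lines between the edges (vertical lines join top to bottom; horizontal lines join points of the same edge). A blob diagram is an $(n,n)$-bridge in which some lines carry one decoration (blob); no line to the right of the leftmost vertical line may be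 decorated, and to the left of it only outermost lines in nested formations may be decorated. The blob diagrams form a $\Bbbk$-basis of $b_n$: the product $ab$ places $a$ on top of $b$, several blobs on a line are replaced by one, and each closed loop is removed with factor $y_e$ if decorated and $-(q+q^{-1})$ if not. $U_i$ is the undecorated diagram with horizontal lines joining $i,i+1$ on both edges and all other lines straight vertical; $e$ is the identity diagram with a blob on the first line. Bitableaux. $\mathrm{Bip}_1(n)$ is the set of one-line bipartitions $((a),(b))$, $a,b\ge0$, $a+b=n$. A standard $((a),(b))$-bitableau is a bijective filling of a row of $a$ boxes (first component) and a row of $b$ boxes (second component) with $1,\dots,n$, increasing along each row; $\mathrm{Std}(\boldsymbol\lambda)$ is the set of these. For $\mathfrak t\in\mathrm{Std}(\boldsymbol\lambda)$ set $\mathfrak t(0)=0$ and $\mathfrak t(j)=\mathfrak t(j-1)+1$ (resp. $-1$) if $j$ is in the first (resp. second) component. For integers, $x\succeq y$ iff $|x|<|y|$, or $|x|=|y|$ and $x\le y$. $((a),(b))\succeq((a'),(b'))$ iff $a-b\succeq a'-b'$; and for $\mathfrak s,\mathfrak t\in\mathrm{Std}(\boldsymbol\lambda)$, $\mathfrak s\succeq\mathfrak t$ iff $\mathfrak s(j)\succeq\mathfrak t(j)$ for all $j$. $\succ$ means $\succeq$ and $\ne$. The basis $m_{\mathfrak s\mathfrak t}$. In a blob diagram, a horizontal line $(a_1,b_1)$ covers $(a_2,b_2)$ on the same edge if $a_1<a_2<b_2<b_1$; the leftmost vertical line covers all lines to its right. A node is covered if its line is decorated or is covered by a decorated line; otherwise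 uncovered. Let a blob diagram have $v$ vertical lines and $h=(n-v)/2$ horizontal lines on each edge. If $v=0$ or the leftmost vertical line is undecorated, let $\boldsymbol\lambda=((h+v),(h))$ and let $\mathfrak t_{top}$ (resp. $\mathfrak t_{bot}$) be the standard $\boldsymbol\lambda$-bitableau whose second component consists of the top (resp. bottom) nodes that are uncovered right endpoints or covered left endpoints of horizontal lines. If $v>0$ and the leftmost vertical line is decorated, let $\boldsymbol\lambda=((h),(h+v))$ and let the first component of $\mathfrak t_{top}$ (resp. $\mathfrak t_{bot}$) consist of the top (resp. bottom) nodes that are uncovered left endpoints or covered right endpoints of horizontal lines. This is a bijection between blob diagrams and pairs of standard bitableaux of the same one-line shape; $m_{\mathfrak s\mathfrak t}$ is the blob diagram with $\mathfrak t_{top}=\mathfrak s$, $\mathfrak t_{bot}=\mathfrak t$. $b_n^{\boldsymbol\lambda}$ is the $\Bbbk$-span (an ideal) of all $m_{\mathfrak a\mathfrak b}$ of shape $\boldsymbol\mu\succ\boldsymbol\lambda$. Content: if $k$ lies in the $c$-th box of the first (resp. second) component of $\mathfrak t$, then $c_{\mathfrak t}(k)=q^{2(c-1)}Q$ (resp. $q^{2(c-1)}Q^{-1}$). *)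

theory Defs
  imports
    Complex_Main
    "HOL-Library.Disjoint_Sets"
    "HOL-Library.Poly_Mapping"
    "HOL-Computational_Algebra.Polynomial"
    "HOL-Computational_Algebra.Fraction_Field"
begin

section \<open>Blob diagrams\<close>

datatype node = Top nat | Bot nat

definition nodes :: "nat \<Rightarrow> node set" where
  "nodes n = Top ` {1..n} \<union> Bot ` {1..n}"

text \<open>A line is the set of its two endpoints; \<open>blobs\<close> is the set of decorated lines.\<close>

datatype diagram = Diagram (lines: "node set set") (blobs: "node set set")

text \<open>Position of a node in clockwise order around the rectangle. Two lines cross iff their
  endpoints alternate in this order.\<close>

fun boundary_pos :: "nat \<Rightarrow> node \<Rightarrow> nat" where
  "boundary_pos n (Top i) = i"
| "boundary_pos n (Bot i) = 2 * n + 1 - i"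

definition noncrossing :: "nat \<Rightarrow> node set set \<Rightarrow> bool" where
  "noncrossing n L \<longleftrightarrow>
     \<not> (\<exists>w x y z. {w, y} \<in> L \<and> {x, z} \<in> L \<and> boundary_pos n w < boundary_pos n x \<and>
         boundary_pos n x < boundary_pos n y \<and> boundary_pos n y < boundary_pos n z)"

definition bridge :: "nat \<Rightarrow> node set set \<Rightarrow> bool" where
  "bridge n L \<longleftrightarrow> partition_on (nodes n) L \<and> (\<forall>l\<in>L. card l = 2) \<and> noncrossing n L"

definition vertical_lines :: "node set set \<Rightarrow> node set set" where
  "vertical_lines L = {l \<in> L. \<exists>i j. l = {Top i, Bot j}}"

definition top_lines :: "node set set \<Rightarrow> node set set" where
  "top_lines L = {l \<in> L. \<exists>i j. i < j \<and> l = {Top i, Top j}}"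

definition leftmost_vertical :: "node set set \<Rightarrow> node set \<Rightarrow> bool" where
  "leftmost_vertical L l \<longleftrightarrow>
     l \<in> L \<and> (\<exists>i j. l = {Top i, Bot j} \<and> (\<forall>i' j'. {Top i', Bot j'} \<in> L \<longrightarrow> i \<le> i'))"

definition right_of :: "node set \<Rightarrow> node set \<Rightarrow> bool" where
  "right_of l' l \<longleftrightarrow>
     (\<exists>i j. l = {Top i, Bot j} \<and> (\<forall>k. Top k \<in> l' \<longrightarrow> i < k) \<and> (\<forall>k. Bot k \<in> l' \<longrightarrow> j < k))"

definition covers :: "node set set \<Rightarrow> node set \<Rightarrow> node set \<Rightarrow> bool" where
  "covers L l l' \<longleftrightarrow> l \<in> L \<and> l' \<in> L \<and>
     ((\<exists>edge\<in>{Top, Bot}. \<exists>a1 b1 a2 b2. l = {edge a1, edge b1} \<and> l' = {edge a2, edge b2} \<and>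
         a1 < a2 \<and> a2 < b2 \<and> b2 < b1) \<or>
      leftmost_vertical L l \<and> right_of l' l)"

text \<open>A line may be decorated iff it is neither to the right of the leftmost vertical line nor
  nested inside another horizontal line, that is, iff no line covers it.\<close>

definition blob_diagrams :: "nat \<Rightarrow> diagram set" where
  "blob_diagrams n = {D. bridge n (lines D) \<and> blobs D \<subseteq> lines D \<and>
     (\<forall>l\<in>blobs D. \<not> (\<exists>l'. covers (lines D) l' l))}"

definition id_diagram :: "nat \<Rightarrow> diagram" where
  "id_diagram n = Diagram ((\<lambda>j. {Top j, Bot j}) ` {1..n}) {}"

definition e_diagram :: "nat \<Rightarrow> diagram" where
  "e_diagram n = Diagram ((\<lambda>j. {Top j, Bot j}) ` {1..n}) {{Top 1, Bot 1}}"

definition U_diagram :: "nat \<Rightarrow> nat \<Rightarrow> diagram" where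
  "U_diagram n i =
     Diagram ({{Top i, Top (i + 1)}, {Bot i, Bot (i + 1)}} \<union>
              (\<lambda>j. {Top j, Bot j}) ` ({1..n} - {i, i + 1})) {}"

section \<open>Concatenation of diagrams\<close>

text \<open>When \<open>D\<close> is placed on top of \<open>D'\<close>, the bottom nodes of \<open>D\<close> and the top nodes of \<open>D'\<close> are
  identified and become the points \<open>Middle i\<close>. The strands of the result are the connected
  components of the resulting graph on \<open>3n\<close> points; those consisting of middle points only are the
  closed loops.\<close>

datatype point = Upper nat | Middle nat | Lower nat

fun place_above :: "node \<Rightarrow> point" where
  "place_above (Top i) = Upper i"
| "place_above (Bot i) = Middle i"

fun place_below :: "node \<Rightarrow> point" where
  "place_below (Top i) = Middle i"
| "place_below (Bot i) = Lower i"

definition stack :: "node set set \<Rightarrow> node set set \<Rightarrow> point set set" where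
  "stack L L' = (\<lambda>l. place_above ` l) ` L \<union> (\<lambda>l. place_below ` l) ` L'"

definition strands :: "nat \<Rightarrow> diagram \<Rightarrow> diagram \<Rightarrow> point set set" where
  "strands n D D' =
     (\<lambda>x. {y. (x, y) \<in> {(u, v). {u, v} \<in> stack (lines D) (lines D')}\<^sup>*}) `
     (Upper ` {1..n} \<union> Middle ` {1..n} \<union> Lower ` {1..n})"

definition decorated_strand :: "diagram \<Rightarrow> diagram \<Rightarrow> point set \<Rightarrow> bool" where
  "decorated_strand D D' C \<longleftrightarrow> (\<exists>l \<in> stack (blobs D) (blobs D'). l \<subseteq> C)"

definition outer_nodes :: "point set \<Rightarrow> node set" where
  "outer_nodes C = {Top i | i. Upper i \<in> C} \<union> {Bot i | i. Lower i \<in> C}"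

definition concat_diagram :: "nat \<Rightarrow> diagram \<Rightarrow> diagram \<Rightarrow> diagram" where
  "concat_diagram n D D' =
     Diagram {outer_nodes C | C. C \<in> strands n D D' \<and> outer_nodes C \<noteq> {}}
             {outer_nodes C | C. C \<in> strands n D D' \<and> outer_nodes C \<noteq> {} \<and>
                decorated_strand D D' C}"

definition plain_loops :: "nat \<Rightarrow> diagram \<Rightarrow> diagram \<Rightarrow> point set set" where
  "plain_loops n D D' =
     {C \<in> strands n D D'. outer_nodes C = {} \<and> \<not> decorated_strand D D' C}"

definition blob_loops :: "nat \<Rightarrow> diagram \<Rightarrow> diagram \<Rightarrow> point set set" where
  "blob_loops n D D' =
     {C \<in> strands n D D'. outer_nodes C = {} \<and> decorated_strand D D' C}"

section \<open>The blob algebra\<close>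

text \<open>The blob algebra is realised on its basis of blob diagrams, with concatenation as product;
  its generators \<open>e\<close>, \<open>U\<^sub>i\<close> are the diagrams \<open>e_diagram\<close>, \<open>U_diagram\<close> and its unit is \<open>id_diagram\<close>. The parameters \<open>q\<close>, \<open>Q\<close> live in
  a field \<open>'a\<close>. The blob algebra over a subring \<open>A\<close> of \<open>'a\<close> that contains \<open>q\<close>, \<open>Q\<close>, their inverses
  and the inverse of \<open>Q - Q\<^sup>-\<^sup>1\<close> consists of the formal linear combinations of blob diagrams with
  coefficients in \<open>A\<close>.\<close>

definition y_e :: "'a::field \<Rightarrow> 'a \<Rightarrow> 'a" where
  "y_e q Q = - (Q * inverse q - inverse Q * q) / (Q - inverse Q)"

definition dia :: "diagram \<Rightarrow> (diagram \<Rightarrow>\<^sub>0 'a::field)" where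
  "dia D = Poly_Mapping.single D 1"

definition scale :: "'a::field \<Rightarrow> (diagram \<Rightarrow>\<^sub>0 'a) \<Rightarrow> (diagram \<Rightarrow>\<^sub>0 'a)" where
  "scale c x = Poly_Mapping.map ((*) c) x"

definition dia_mult :: "'a::field \<Rightarrow> 'a \<Rightarrow> nat \<Rightarrow> diagram \<Rightarrow> diagram \<Rightarrow> (diagram \<Rightarrow>\<^sub>0 'a)" where
  "dia_mult q Q n D D' =
     scale (y_e q Q ^ card (blob_loops n D D') * (- (q + inverse q)) ^ card (plain_loops n D D'))
           (dia (concat_diagram n D D'))"

definition blob_mult ::
  "'a::field \<Rightarrow> 'a \<Rightarrow> nat \<Rightarrow> (diagram \<Rightarrow>\<^sub>0 'a) \<Rightarrow> (diagram \<Rightarrow>\<^sub>0 'a) \<Rightarrow> (diagram \<Rightarrow>\<^sub>0 'a)" where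
  "blob_mult q Q n x y =
     (\<Sum>D \<in> Poly_Mapping.keys x. \<Sum>D' \<in> Poly_Mapping.keys y.
        scale (Poly_Mapping.lookup x D * Poly_Mapping.lookup y D') (dia_mult q Q n D D'))"

definition U_plus_q :: "'a::field \<Rightarrow> nat \<Rightarrow> nat \<Rightarrow> (diagram \<Rightarrow>\<^sub>0 'a)" where
  "U_plus_q q n i = dia (U_diagram n i) + scale q (dia (id_diagram n))"

text \<open>The Jucys--Murphy elements \<open>L\<^sub>1, \<dots>, L\<^sub>n\<close>; the value at index \<open>0\<close> is a dummy.\<close>

fun JM :: "'a::field \<Rightarrow> 'a \<Rightarrow> nat \<Rightarrow> nat \<Rightarrow> (diagram \<Rightarrow>\<^sub>0 'a)" where
  "JM q Q n 0 = 0"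
| "JM q Q n (Suc 0) =
     scale Q (dia (id_diagram n)) - scale (Q - inverse Q) (dia (e_diagram n))"
| "JM q Q n (Suc (Suc k)) =
     blob_mult q Q n (blob_mult q Q n (U_plus_q q n (Suc k)) (JM q Q n (Suc k)))
       (U_plus_q q n (Suc k))"

section \<open>One-line bipartitions and bitableaux\<close>

text \<open>The pair \<open>(a, b)\<close> stands for the one-line bipartition \<open>((a), (b))\<close>, and a pair of lists for
  a bitableau with these two rows.\<close>

type_synonym bipartition = "nat \<times> nat"
type_synonym bitableau = "nat list \<times> nat list"

definition Bip1 :: "nat \<Rightarrow> bipartition set" where
  "Bip1 n = {(a, b). a + b = n}"

definition Std :: "bipartition \<Rightarrow> bitableau set" where
  "Std lam = {(r1, r2). length r1 = fst lam \<and> length r2 = snd lam \<and>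
      distinct (r1 @ r2) \<and> set (r1 @ r2) = {1..fst lam + snd lam} \<and>
      sorted_wrt (<) r1 \<and> sorted_wrt (<) r2}"

fun tab_path :: "bitableau \<Rightarrow> nat \<Rightarrow> int" where
  "tab_path \<tau> 0 = 0"
| "tab_path \<tau> (Suc j) = tab_path \<tau> j + (if Suc j \<in> set (fst \<tau>) then 1 else - 1)"

definition int_succeq :: "int \<Rightarrow> int \<Rightarrow> bool" where
  "int_succeq x y \<longleftrightarrow> \<bar>x\<bar> < \<bar>y\<bar> \<or> \<bar>x\<bar> = \<bar>y\<bar> \<and> x \<le> y"

definition bip_succ :: "bipartition \<Rightarrow> bipartition \<Rightarrow> bool" where
  "bip_succ \<mu> lam \<longleftrightarrow>
     int_succeq (int (fst \<mu>) - int (snd \<mu>)) (int (fst lam) - int (snd lam)) \<and> \<mu> \<noteq> lam"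

definition tab_succ :: "bitableau \<Rightarrow> bitableau \<Rightarrow> bool" where
  "tab_succ \<sigma> \<tau> \<longleftrightarrow>
     (\<forall>j \<le> length (fst \<tau>) + length (snd \<tau>). int_succeq (tab_path \<sigma> j) (tab_path \<tau> j)) \<and> \<sigma> \<noteq> \<tau>"

definition box_index :: "nat list \<Rightarrow> nat \<Rightarrow> nat" where
  "box_index r k = (THE c. 1 \<le> c \<and> c \<le> length r \<and> r ! (c - 1) = k)"

definition tab_content :: "'a::field \<Rightarrow> 'a \<Rightarrow> bitableau \<Rightarrow> nat \<Rightarrow> 'a" where
  "tab_content q Q \<tau> k =
     (if k \<in> set (fst \<tau>) then q ^ (2 * (box_index (fst \<tau>) k - 1)) * Q
      else q ^ (2 * (box_index (snd \<tau>) k - 1)) * inverse Q)"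

section \<open>The diagram basis indexed by bitableaux\<close>

definition covered_line :: "diagram \<Rightarrow> node set \<Rightarrow> bool" where
  "covered_line D l \<longleftrightarrow> l \<in> blobs D \<or> (\<exists>l'\<in>blobs D. covers (lines D) l' l)"

text \<open>In the following, \<open>edge\<close> is one of the constructors \<open>Top\<close>, \<open>Bot\<close>.\<close>

definition left_endpoints :: "diagram \<Rightarrow> (nat \<Rightarrow> node) \<Rightarrow> bool \<Rightarrow> nat set" where
  "left_endpoints D edge cov =
     {i. \<exists>j. i < j \<and> {edge i, edge j} \<in> lines D \<and> covered_line D {edge i, edge j} = cov}"

definition right_endpoints :: "diagram \<Rightarrow> (nat \<Rightarrow> node) \<Rightarrow> bool \<Rightarrow> nat set" where
  "right_endpoints D edge cov =
     {j. \<exists>i. i < j \<and> {edge i, edge j} \<in> lines D \<and> covered_line D {edge i, edge j} = cov}"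

definition leftmost_decorated :: "diagram \<Rightarrow> bool" where
  "leftmost_decorated D \<longleftrightarrow> (\<exists>l\<in>blobs D. leftmost_vertical (lines D) l)"

definition diagram_shape :: "diagram \<Rightarrow> bipartition" where
  "diagram_shape D =
     (let v = card (vertical_lines (lines D)); h = card (top_lines (lines D))
      in if leftmost_decorated D then (h, h + v) else (h + v, h))"

definition edge_tableau :: "nat \<Rightarrow> (nat \<Rightarrow> node) \<Rightarrow> diagram \<Rightarrow> bitableau" where
  "edge_tableau n edge D =
     (if leftmost_decorated D then
        let S = left_endpoints D edge False \<union> right_endpoints D edge True
        in (sorted_list_of_set S, sorted_list_of_set ({1..n} - S))
      else
        let S = right_endpoints D edge False \<union> left_endpoints D edge True
        in (sorted_list_of_set ({1..n} - S), sorted_list_of_set S))"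

definition blob_diagram_of :: "nat \<Rightarrow> bitableau \<Rightarrow> bitableau \<Rightarrow> diagram" where
  "blob_diagram_of n \<sigma> \<tau> =
     (THE D. D \<in> blob_diagrams n \<and>
        diagram_shape D = (length (fst \<sigma>), length (snd \<sigma>)) \<and>
        edge_tableau n Top D = \<sigma> \<and> edge_tableau n Bot D = \<tau>)"

definition mst :: "nat \<Rightarrow> bitableau \<Rightarrow> bitableau \<Rightarrow> (diagram \<Rightarrow>\<^sub>0 'a::field)" where
  "mst n \<sigma> \<tau> = dia (blob_diagram_of n \<sigma> \<tau>)"

text \<open>The \<open>A\<close>-span of a set of diagrams, and the ideal \<open>b\<^sub>n\<^bsup>lam\<^esup>\<close> of the blob algebra over \<open>A\<close>.\<close>

definition dia_span :: "'a::field set \<Rightarrow> diagram set \<Rightarrow> (diagram \<Rightarrow>\<^sub>0 'a) set" where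
  "dia_span A S =
     {x. Poly_Mapping.keys x \<subseteq> S \<and> (\<forall>D. Poly_Mapping.lookup x D \<in> A)}"

definition blob_ideal :: "'a::field set \<Rightarrow> nat \<Rightarrow> bipartition \<Rightarrow> (diagram \<Rightarrow>\<^sub>0 'a) set" where
  "blob_ideal A n lam =
     dia_span A {blob_diagram_of n \<alpha> \<beta> | \<alpha> \<beta> \<mu>.
       \<mu> \<in> Bip1 n \<and> bip_succ \<mu> lam \<and> \<alpha> \<in> Std \<mu> \<and> \<beta> \<in> Std \<mu>}"

section \<open>Base rings\<close>

definition zeta :: "nat \<Rightarrow> complex" where
  "zeta l = exp (2 * complex_of_real pi * \<i> / of_nat l)"

text \<open>\<open>K = \<complex>(q, Q)\<close> is the fraction field of \<open>\<complex>[q][Q]\<close>: the inner polynomial variable is \<open>q\<close>, the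
  outer one is \<open>Q\<close>. All rings below are subrings of \<open>K\<close>.\<close>

type_synonym ratfun = "complex poly poly fract"

definition const_rf :: "complex \<Rightarrow> ratfun" where
  "const_rf c = Fract [:[:c:]:] 1"

definition q_hat :: ratfun where
  "q_hat = Fract [:[:0, 1:]:] 1"

definition Q_hat :: ratfun where
  "Q_hat = Fract [:0, 1:] 1"

definition laurent_ring :: "ratfun set" where
  "laurent_ring = {Fract f 1 / (q_hat ^ i * Q_hat ^ j) | f i j. True}"

definition denominators :: "ratfun set" where
  "denominators =
     {(q_hat ^ 4 - 1) ^ a * (Q_hat - inverse Q_hat) ^ b *
      (Q_hat - inverse Q_hat * q_hat ^ 2) ^ c * (inverse Q_hat - Q_hat * q_hat ^ 2) ^ d
      | a b c d. True}"

definition R_ring :: "ratfun set" where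
  "R_ring = {x / s | x s. x \<in> laurent_ring \<and> s \<in> denominators}"

definition max_ideal :: "nat \<Rightarrow> int \<Rightarrow> ratfun set" where
  "max_ideal l m =
     {(q_hat - const_rf (zeta l)) * x + (Q_hat - q_hat powi m) * y | x y.
        x \<in> R_ring \<and> y \<in> R_ring}"

definition O_ring :: "nat \<Rightarrow> int \<Rightarrow> ratfun set" where
  "O_ring l m = {x / s | x s. x \<in> R_ring \<and> s \<in> R_ring - max_ideal l m}"

end

theory Submission
  imports Defs
begin

text \<open>Reading the boundary of the rectangle clockwise from the left wall, a blob diagram becomes a
  noncrossing matching of \<open>1, \<dots>, 2n\<close> with decorations on some outermost arcs, and such matchings
  correspond to integer paths from \<open>0\<close> to \<open>0\<close> with steps \<open>\<plusminus>1\<close>: the absolute value counts the open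
  arcs, the sign is negative below a decorated arc. The two halves of the path are the paths
  \<open>t(j)\<close> of the two bitableaux of the diagram. Multiplication by \<open>U\<^sub>i\<close> or \<open>e\<close> can only move the path
  up in the order \<open>\<succeq>\<close>, except that \<open>U\<^sub>i\<close> creates a peak at \<open>i\<close>; this also handles the ideal
  \<open>b\<^sub>n\<^bsup>\<lambda>\<^esup>\<close>, whose diagrams are those with a larger value in the middle of the path.

  Triangularity of \<open>L\<^sub>k\<close> on a diagram \<open>D\<close> is shown by induction on \<open>k\<close>. If some arc lies to the left of \<open>k\<close>, there is an
  innermost one \<open>(i, i + 1)\<close> preceded by straight lines only. If it is undecorated, it can be slid to
  the right because \<open>U\<^sub>i\<close> commutes with \<open>L\<^sub>k\<close> for \<open>i \<le> k - 2\<close>, until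
  \<open>L\<^sub>k U\<^sub>k\<^sub>-\<^sub>2 U\<^sub>k\<^sub>-\<^sub>1 = q\<^sup>2 U\<^sub>k\<^sub>-\<^sub>2 L\<^sub>k\<^sub>-\<^sub>2 U\<^sub>k\<^sub>-\<^sub>1\<close> lowers \<open>k\<close>. If it is decorated, it is the arc \<open>(1, 2)\<close> and
  \<open>D = e D'\<close> where \<open>D'\<close> has no decoration there; for \<open>k \<ge> 2\<close>, \<open>e\<close> commutes with \<open>L\<^sub>k\<close>. If no arc lies to the
  left of \<open>k\<close>, either \<open>k\<close> is also straight and all products in the expansion of \<open>L\<^sub>k D\<close> other than multiples of
  \<open>D\<close> and \<open>e D\<close> have a lower path at \<open>k\<close>, or \<open>(k - 1, k)\<close> is an arc and
  \<open>L\<^sub>k U\<^sub>k\<^sub>-\<^sub>1 = q\<^bsup>2(k-2)\<^esup> L\<^sub>k\<^sub>-\<^sub>1\<^sup>-\<^sup>1 U\<^sub>k\<^sub>-\<^sub>1\<close>, where the inverse has the same shape with \<open>q, Q\<close> inverted.\<close>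

section \<open>Chord diagrams\<close>

text \<open>One order on paths does three jobs: it is the tableau order on the first half, the shape
  order at the middle value, and agreement of the second halves fixes the bottom tableau. So it
  suffices to control what \<open>e\<close> and \<open>U_i\<close> do to single diagrams. The
  obstacle is the peak that \<open>U_i\<close> creates at \<open>i\<close>: expanding
  \<open>L_k D\<close> into products bounds the paths only from position \<open>k\<close> on. This
  is harmless if all earlier nodes open lines, since the path of \<open>D\<close> then has the
  largest possible absolute value there; all other diagrams are treated by operator identities
  instead of expansion. These come from \<open>g_i = U_i + q\<close>, which satisfy
  \<open>(g_i - q)(g_i + q^{-1}) = 0\<close> and the braid relations, while \<open>y_e\<close> has
  the value that makes \<open>L_1\<close> and \<open>g_1\<close> satisfy the braid relation of type
  B. The condition \<open>\<zeta>^4 \<noteq> 1\<close> is used as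
  \<open>q + q^{-1} \<noteq> 0\<close>: a diagram with a plain arc \<open>(i, i + 1)\<close> then
  lies in the image of \<open>U_i\<close>.\<close>

text \<open>Position \<open>i\<close> stands for the top node \<open>i\<close> and position \<open>2n + 1 - i\<close> for the bottom node \<open>i\<close>. Outside
  \<open>{1..N}\<close> the partner function is the identity and nothing is decorated, so that equal diagrams are
  equal as terms.\<close>

datatype arcs = Arcs (mate: "nat \<Rightarrow> nat") (deco: "nat \<Rightarrow> bool")

definition matching :: "nat \<Rightarrow> arcs \<Rightarrow> bool" where
  "matching N X \<longleftrightarrow> (\<forall>x. mate X (mate X x) = x) \<and> (\<forall>x. mate X x = x \<longleftrightarrow> x \<notin> {1..N}) \<and>
     (\<forall>x. deco X (mate X x) = deco X x) \<and> (\<forall>x. deco X x \<longrightarrow> x \<in> {1..N})"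

text \<open>Cutting the boundary open at the left wall turns both ways of being covered, nesting on
  one edge and lying to the right of the leftmost vertical line, into nesting of arcs; so one clause
  expresses all restrictions on decorations.\<close>

definition valid :: "nat \<Rightarrow> arcs \<Rightarrow> bool" where
  "valid N X \<longleftrightarrow> matching N X \<and>
     (\<forall>x y. x < y \<longrightarrow> y < mate X x \<longrightarrow> mate X x < mate X y \<longrightarrow> False) \<and>
     (\<forall>x w. deco X x \<longrightarrow> w < x \<longrightarrow> x < mate X w \<longrightarrow> False)"

text \<open>The diagram of \<open>U\<^sub>i X\<close>. The entries at \<open>i\<close> and \<open>i + 1\<close> are updated last, which also gives the correct
  result when \<open>i\<close> and \<open>i + 1\<close> are already joined and a loop is closed.\<close>

definition join :: "nat \<Rightarrow> arcs \<Rightarrow> arcs" where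
  "join i X = Arcs
     ((mate X)(mate X i := mate X (Suc i), mate X (Suc i) := mate X i, i := Suc i, Suc i := i))
     ((deco X)(mate X i := deco X i \<or> deco X (Suc i), mate X (Suc i) := deco X i \<or> deco X (Suc i),
        i := False, Suc i := False))"

definition blob1 :: "arcs \<Rightarrow> arcs" where
  "blob1 X = Arcs (mate X) ((deco X)(1 := True, mate X 1 := True))"

definition opened :: "arcs \<Rightarrow> nat \<Rightarrow> nat set" where
  "opened X j = {x. x \<le> j \<and> j < mate X x}"

abbreviation height :: "arcs \<Rightarrow> nat \<Rightarrow> nat" where
  "height X j \<equiv> card (opened X j)"

definition marked :: "arcs \<Rightarrow> nat \<Rightarrow> bool" where
  "marked X j \<longleftrightarrow> (\<exists>x \<in> opened X j. deco X x)"

definition path :: "arcs \<Rightarrow> nat \<Rightarrow> int" where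
  "path X j = (if marked X j then - int (height X j) else int (height X j))"

lemma matchingD:
  assumes "matching N X"
  shows "mate X (mate X x) = x" "mate X x = x \<longleftrightarrow> x \<notin> {1..N}"
    "deco X (mate X x) = deco X x" "deco X x \<Longrightarrow> x \<in> {1..N}"
  using assms unfolding matching_def by blast+

lemma valid_matching: "valid N X \<Longrightarrow> matching N X"
  by (simp add: valid_def)

lemma noncross: "valid N X \<Longrightarrow> x < y \<Longrightarrow> y < mate X x \<Longrightarrow> mate X x < mate X y \<Longrightarrow> False"
  unfolding valid_def by blast

lemma outermost: "valid N X \<Longrightarrow> deco X x \<Longrightarrow> w < x \<Longrightarrow> x < mate X w \<Longrightarrow> False"
  unfolding valid_def by blast

lemma mate_range:
  assumes "matching N X" shows "mate X x \<in> {1..N} \<longleftrightarrow> x \<in> {1..N}"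
  using matchingD[OF assms] by metis

lemma mate_inj: "matching N X \<Longrightarrow> mate X x = mate X y \<longleftrightarrow> x = y"
  by (metis matchingD(1))

lemma mate_join:
  "mate (join i X) x = (if x = Suc i then i else if x = i then Suc i else
     if x = mate X (Suc i) then mate X i else if x = mate X i then mate X (Suc i) else mate X x)"
  by (simp add: join_def)

lemma deco_join:
  "deco (join i X) x = (x \<noteq> i \<and> x \<noteq> Suc i \<and> (if x = mate X i \<or> x = mate X (Suc i)
     then deco X i \<or> deco X (Suc i) else deco X x))"
  by (simp add: join_def)

lemma join_matching:
  assumes "matching N X" "1 \<le> i" "i < N"
  shows "matching N (join i X)"
proof -
  note m = matchingD[OF assms(1)]
  have i: "i \<in> {1..N}" "Suc i \<in> {1..N}" using assms by auto
  define p where "p = mate X"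
  define a where "a = mate X i"
  define b where "b = mate X (Suc i)"
  have r: "a \<in> {1..N}" "b \<in> {1..N}" using mate_range[OF assms(1)] i by (auto simp: a_def b_def)
  have ne: "a \<noteq> i" "b \<noteq> Suc i" "a \<noteq> b"
    using i m mate_inj[OF assms(1), of i "Suc i"] by (auto simp: a_def b_def)
  have pp: "p a = i" "p b = Suc i" "p i = a" "p (Suc i) = b" using m by (auto simp: p_def a_def b_def)
  have inv: "\<And>x. p (p x) = x" and fp: "\<And>x. p x = x \<longleftrightarrow> x \<notin> {1..N}"
    and dp: "\<And>x. deco X (p x) = deco X x" using m by (simp_all add: p_def)
  have jm: "mate (join i X) x = (if x = Suc i then i else if x = i then Suc i else
     if x = b then a else if x = a then b else p x)" for x
    by (simp add: mate_join p_def a_def b_def)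
  have dj: "deco (join i X) x = (x \<noteq> i \<and> x \<noteq> Suc i \<and> (if x = a \<or> x = b
     then deco X i \<or> deco X (Suc i) else deco X x))" for x
    by (simp add: deco_join a_def b_def)
  have ni: "p x \<noteq> i \<and> p x \<noteq> Suc i \<and> p x \<noteq> a \<and> p x \<noteq> b"
    if "x \<noteq> i" "x \<noteq> Suc i" "x \<noteq> a" "x \<noteq> b" for x
    using inv pp that by metis
  \<comment> \<open>Only when \<open>i\<close> and \<open>i + 1\<close> are already joined do the
    four updated positions collapse to two; the verifications below split on this.\<close>
  have bi: "b = i \<longleftrightarrow> a = Suc i" using pp inv by metis
  have A: "mate (join i X) (mate (join i X) x) = x" for x
    proof (cases "x = i \<or> x = Suc i \<or> x = a \<or> x = b")
    case True then show ?thesis using ne bi by (cases "a = Suc i"; elim disjE) (simp_all add: jm)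
  next
    case False then show ?thesis using ni[of x] inv[of x] by (simp add: jm)
  qed
  have B: "mate (join i X) x = x \<longleftrightarrow> x \<notin> {1..N}" for x
    using ne fp[of x] r i by (auto simp: jm)
  have C: "deco (join i X) (mate (join i X) x) = deco (join i X) x" for x
    proof (cases "x = i \<or> x = Suc i \<or> x = a \<or> x = b")
    case True then show ?thesis using ne bi by (cases "a = Suc i"; elim disjE) (simp_all add: jm dj)
  next
    case False then show ?thesis using ni[of x] dp[of x] by (simp add: jm dj)
  qed
  have D: "deco (join i X) x \<Longrightarrow> x \<in> {1..N}" for x
    using m(4)[of x] r i by (auto simp: dj split: if_splits)
  show ?thesis unfolding matching_def using A B C D by blast
qed

lemma blob1_matching:
  assumes "matching N X" "1 \<le> N"
  shows "matching N (blob1 X)"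
proof -
  note m = matchingD[OF assms(1)]
  have r: "mate X 1 \<in> {1..N}" using mate_range[OF assms(1)] assms by auto
  show ?thesis unfolding matching_def blob1_def using m r assms(2) by (auto dest: m(4)) (metis m(1))+
qed

text \<open>With this symmetric form of planarity no case distinction on the order of endpoints is needed:
  for the new arc \<open>(a, b)\<close> of \<open>join i X\<close>, a node lies between \<open>a\<close> and \<open>b\<close> iff it lies between the ends of
  exactly one of the two arcs that were joined.\<close>

definition between :: "nat \<Rightarrow> nat \<Rightarrow> nat \<Rightarrow> bool" where
  "between u v x \<longleftrightarrow> u < x \<and> x < v \<or> v < x \<and> x < u"

lemma valid_between:
  assumes "matching N X"
  shows "valid N X \<longleftrightarrow>
    (\<forall>w x. x \<noteq> w \<longrightarrow> x \<noteq> mate X w \<longrightarrow> between w (mate X w) x = between w (mate X w) (mate X x)) \<and>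
    (\<forall>w x. deco X x \<longrightarrow> \<not> between w (mate X w) x)" (is "_ \<longleftrightarrow> ?A \<and> ?B")
proof
  note m = matchingD[OF assms]
  assume v: "valid N X"
  have ?B
    using outermost[OF v] m(1) unfolding between_def by metis
  moreover have ?A
  proof (intro allI impI)
    fix w x assume ne: "x \<noteq> w" "x \<noteq> mate X w"
    then have ne': "mate X x \<noteq> w" "mate X x \<noteq> mate X w" using m(1) by metis+
    \<comment> \<open>The eight instances list all orders in which the ends of the two arcs could
      alternate, with either end and either arc coming first.\<close>
    show "between w (mate X w) x = between w (mate X w) (mate X x)"
      using ne ne' m(1)[of w] m(1)[of x] noncross[OF v, of w x] noncross[OF v, of w "mate X x"]
        noncross[OF v, of "mate X w" x] noncross[OF v, of "mate X w" "mate X x"]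
        noncross[OF v, of x w] noncross[OF v, of x "mate X w"]
        noncross[OF v, of "mate X x" w] noncross[OF v, of "mate X x" "mate X w"]
      unfolding between_def by (smt (verit) linorder_neqE_nat)
  qed
  ultimately show "?A \<and> ?B" by blast
next
  note m = matchingD[OF assms]
  assume AB: "?A \<and> ?B"
  have False if "x < y" "y < mate X x" "mate X x < mate X y" for x y
    using AB[THEN conjunct1, rule_format, of y x] that by (auto simp: between_def)
  moreover have False if "deco X x" "w < x" "x < mate X w" for x w
    using AB that by (auto simp: between_def)
  ultimately show "valid N X" using assms unfolding valid_def by blast
qed

lemma join_valid:
  assumes v: "valid N X" and i: "1 \<le> i" "i < N"
  shows "valid N (join i X)"
proof -
  note mt = valid_matching[OF v]
  note m = matchingD[OF mt]
  have i': "i \<in> {1..N}" "Suc i \<in> {1..N}" using i by auto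
  define p where "p = mate X"
  define a where "a = mate X i"
  define b where "b = mate X (Suc i)"
  have ne: "a \<noteq> i" "b \<noteq> Suc i" "a \<noteq> b"
    using i' m mate_inj[OF mt, of i "Suc i"] by (auto simp: a_def b_def)
  have pp: "p a = i" "p b = Suc i" "p i = a" "p (Suc i) = b" using m by (auto simp: p_def a_def b_def)
  have inv: "\<And>x. p (p x) = x" using m by (simp add: p_def)
  have nc: "\<And>w x. x \<noteq> w \<Longrightarrow> x \<noteq> p w \<Longrightarrow> between w (p w) x = between w (p w) (p x)"
    and om: "\<And>w x. deco X x \<Longrightarrow> \<not> between w (p w) x"
    using v valid_between[OF mt] by (auto simp: p_def)
  have jm: "mate (join i X) x = (if x = Suc i then i else if x = i then Suc i else
     if x = b then a else if x = a then b else p x)" for x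
    by (simp add: mate_join p_def a_def b_def)
  have dj: "deco (join i X) x = (x \<noteq> i \<and> x \<noteq> Suc i \<and> (if x = a \<or> x = b
     then deco X i \<or> deco X (Suc i) else deco X x))" for x
    by (simp add: deco_join a_def b_def)
  have ni: "p x \<noteq> i \<and> p x \<noteq> Suc i \<and> p x \<noteq> a \<and> p x \<noteq> b"
    if "x \<noteq> i" "x \<noteq> Suc i" "x \<noteq> a" "x \<noteq> b" for x
    using inv pp that by metis
  have xor: "between a b x \<longleftrightarrow> between i a x \<noteq> between (Suc i) b x"
    if "x \<noteq> i" "x \<noteq> Suc i" "x \<noteq> a" "x \<noteq> b" for x
    using that ne unfolding between_def by linarith
  \<comment> \<open>No arc other than those ending at \<open>i\<close> or \<open>i + 1\<close>
    separates these neighbours, hence \<open>a\<close> and \<open>b\<close> lie on the same side of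
    every third arc.\<close>
  have adj: "between u w i = between u w (Suc i)"
    if "i \<noteq> u" "Suc i \<noteq> u" "i \<noteq> w" "Suc i \<noteq> w" for u w
    using that unfolding between_def by linarith
  have sym: "between u w x = between w u x" for u w x by (auto simp: between_def)
  have none: "\<not> between i (Suc i) x" "\<not> between (Suc i) i x" for x by (auto simp: between_def)
  have N: "between w (mate (join i X) w) x = between w (mate (join i X) w) (mate (join i X) x)"
    if xw: "x \<noteq> w" "x \<noteq> mate (join i X) w" for w x
  proof -
    consider "w = i \<or> w = Suc i" | "w = a \<or> w = b" "w \<noteq> i" "w \<noteq> Suc i"
      | "w \<noteq> i" "w \<noteq> Suc i" "w \<noteq> a" "w \<noteq> b" by blast
    then show ?thesis
    proof cases
      case 1 then show ?thesis using none by (auto simp: jm)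
    next
      case 2
      then have bb: "between w (mate (join i X) w) y = between a b y" for y using sym by (auto simp: jm)
      have xab: "x \<noteq> a" "x \<noteq> b" using xw 2 by (auto simp: jm split: if_splits)
      show ?thesis
      proof (cases "x = i \<or> x = Suc i")
        case True
        have "between a b i = between a b (Suc i)"
          using adj[of a b] 2 ne xab True pp inv by (metis jm)
        then show ?thesis using bb True by (auto simp: jm)
      next
        case False
        note n = ni[of x] 
        have jx: "mate (join i X) x = p x" using False xab by (simp add: jm)
        show ?thesis unfolding bb jx
          using xor[of x] xor[of "p x"] n False xab nc[of x i] nc[of x "Suc i"] pp by auto
      qed
    next
      case 3
      then have jw: "mate (join i X) w = p w" by (simp add: jm)
      note nw = ni[OF 3]
      have i1: "between w (p w) i = between w (p w) (Suc i)" using adj 3 nw by metis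
      have i2: "between w (p w) a = between w (p w) i"
        using nc[of a w] 3 nw pp by auto
      have i3: "between w (p w) b = between w (p w) (Suc i)"
        using nc[of b w] 3 nw pp by auto
      show ?thesis unfolding jw using i1 i2 i3 nc[of x w] xw jw by (auto simp: jm)
    qed
  qed
  have D: "\<not> between w (mate (join i X) w) x" if dx: "deco (join i X) x" for w x
  proof -
    have xi: "x \<noteq> i" "x \<noteq> Suc i" using dx by (auto simp: dj)
    consider "w = i \<or> w = Suc i" | "w = a \<or> w = b" "w \<noteq> i" "w \<noteq> Suc i"
      | "w \<noteq> i" "w \<noteq> Suc i" "w \<noteq> a" "w \<noteq> b" by blast
    then show ?thesis
    proof cases
      case 1 then show ?thesis using none by (auto simp: jm)
    next
      case 2
      then have bb: "between w (mate (join i X) w) y = between a b y" for y using sym by (auto simp: jm)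
      show ?thesis
      proof (cases "x = a \<or> x = b")
        case True then show ?thesis unfolding bb by (auto simp: between_def)
      next
        case False
        then have "deco X x" using dx by (simp add: dj)
        then show ?thesis unfolding bb using xor[of x] xi False om[of x i] om[of x "Suc i"] pp by auto
      qed
    next
      case 3
      then have jw: "mate (join i X) w = p w" by (simp add: jm)
      note nw = ni[OF 3]
      have i1: "between w (p w) i = between w (p w) (Suc i)" using adj 3 nw by metis
      have i2: "between w (p w) a = between w (p w) i"
        using nc[of a w] 3 nw pp by auto
      have i3: "between w (p w) b = between w (p w) (Suc i)"
        using nc[of b w] 3 nw pp by auto
      show ?thesis unfolding jw using i1 i2 i3 om[of x w] om[of i w] om[of "Suc i" w] dx by (auto simp: dj split: if_splits)
    qed
  qed
  show ?thesis using valid_between[OF join_matching[OF mt i]] N D by blast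
qed

text \<open>Nothing precedes node 1 on the boundary, so no arc encloses the one through it, and
  decorating it is always allowed.\<close>

lemma blob1_valid:
  assumes v: "valid N X" and N: "1 \<le> N"
  shows "valid N (blob1 X)"
proof -
  note mt = valid_matching[OF v]
  note m = matchingD[OF mt]
  \<comment> \<open>Position 0 is its own mate, so an arc strictly around 1, which would have to end
    at 0, cannot exist.\<close>
  have m0: "mate X 0 = 0" using m(2) by auto
  have om: "\<not> between w (mate X w) x" if "deco X x" for w x
    using v that unfolding valid_between[OF mt] by auto
  have nc: "between w (mate X w) x = between w (mate X w) (mate X x)"
    if "x \<noteq> w" "x \<noteq> mate X w" for w x
    using v that unfolding valid_between[OF mt] by auto
  have b1: "\<not> between w (mate X w) 1" for w
    using m0 m(1)[of w] by (auto simp: between_def)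
  have "\<not> between w (mate X w) (mate X 1)" for w
  proof (cases "w = 1 \<or> w = mate X 1")
    case True then show ?thesis using m(1) by (auto simp: between_def)
  next
    case False
    then have "1 \<noteq> w" "1 \<noteq> mate X w" using m(1)[of w] by auto
    then show ?thesis using nc[of 1 w] b1 by simp
  qed
  then show ?thesis
    unfolding valid_between[OF blob1_matching[OF mt N]] using om b1 nc by (simp add: blob1_def)
qed

section \<open>Paths\<close>

lemma finite_opened [simp]: "finite (opened X j)"
  by (rule finite_subset[of _ "{..j}"]) (auto simp: opened_def)

lemma opened_Suc_opener:
  assumes "matching N X" "Suc j < mate X (Suc j)"
  shows "opened X (Suc j) = insert (Suc j) (opened X j)" "Suc j \<notin> opened X j"
proof -
  have "mate X y \<noteq> Suc j" if "y \<le> j" for y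
    using assms(2) that matchingD(1)[OF assms(1), of y] by auto
  then show "opened X (Suc j) = insert (Suc j) (opened X j)"
    using assms(2) by (auto simp: opened_def le_Suc_eq) (metis Suc_lessI)
qed (simp add: opened_def)

lemma opened_Suc_closer:
  assumes "matching N X" "mate X (Suc j) < Suc j"
  shows "opened X (Suc j) = opened X j - {mate X (Suc j)}" "mate X (Suc j) \<in> opened X j"
proof -
  have inv: "mate X (mate X x) = x" for x using matchingD[OF assms(1)] by blast
  have "mate X y = Suc j \<longleftrightarrow> y = mate X (Suc j)" for y using inv by metis
  then have eq: "Suc j < mate X x \<longleftrightarrow> j < mate X x \<and> x \<noteq> mate X (Suc j)" for x
    using assms(2) by (metis Suc_lessD Suc_lessI less_irrefl)
  show "opened X (Suc j) = opened X j - {mate X (Suc j)}"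
  proof (rule set_eqI)
    fix x
    show "x \<in> opened X (Suc j) \<longleftrightarrow> x \<in> opened X j - {mate X (Suc j)}"
      using eq[of x] assms(2) by (cases "x = Suc j") (simp_all add: opened_def le_Suc_eq)
  qed
  show "mate X (Suc j) \<in> opened X j" using assms(2) inv[of "Suc j"] by (simp add: opened_def)
qed

lemma height_Suc:
  assumes "matching N X" "Suc j \<le> N"
  shows "int (height X (Suc j)) = int (height X j) + (if Suc j < mate X (Suc j) then 1 else - 1)"
proof (cases "Suc j < mate X (Suc j)")
  case True
  then show ?thesis using opened_Suc_opener[OF assms(1) True] by simp
next
  case False
  then have "mate X (Suc j) < Suc j" using matchingD(2)[OF assms(1), of "Suc j"] assms(2) by force
  note op = opened_Suc_closer[OF assms(1) this]
  have "height X j = Suc (height X (Suc j))" using card.remove[OF finite_opened op(2)] op(1) by simp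
  then show ?thesis using False by simp
qed

text \<open>Arcs open at the same place are nested, and a decorated one lies inside no other, so it
  was opened first. Therefore a single sign can record the decoration of the whole stack of open
  arcs.\<close>

lemma opened_decorated_least:
  assumes "valid N X" "x \<in> opened X j" "deco X x" "y \<in> opened X j"
  shows "x \<le> y"
  using outermost[OF assms(1,3), of y] assms(2,4) by (force simp: opened_def)

lemma path_0:
  assumes "matching N X" shows "path X 0 = 0"
proof -
  have "x \<notin> opened X 0" for x
    using matchingD(2)[OF assms, of 0] by (cases "x = 0") (auto simp: opened_def)
  then have "opened X 0 = {}" by blast
  then show ?thesis by (simp add: path_def)
qed

lemma card_swap: "finite A \<Longrightarrow> w \<in> A \<Longrightarrow> u \<notin> A \<Longrightarrow> card (insert u (A - {w})) = card A"
  by (metis DiffD1 card.remove card_insert_disjoint finite_Diff)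

lemma abs_path: "\<bar>path X j\<bar> = int (height X j)"
  by (simp add: path_def)

lemma path_beyond:
  assumes "matching N X" "N \<le> j"
  shows "path X j = 0"
proof -
  have "opened X j = {}"
    using assms mate_range[OF assms(1)] matchingD(2)[OF assms(1)] unfolding opened_def
    by (smt (verit, best) Collect_empty_eq atLeastAtMost_iff le_trans not_le)
  then show ?thesis by (simp add: path_def)
qed

text \<open>A decorated arc can only open where no other arc is open. So an opening arc moves the
  value away from 0, and the sign is chosen only at 0.\<close>

lemma path_Suc_opener:
  assumes v: "valid N X" and o: "Suc j < mate X (Suc j)"
  shows "path X (Suc j) = path X j + (if marked X (Suc j) then - 1 else 1)"
proof -
  note op = opened_Suc_opener[OF valid_matching[OF v] o]
  have m: "marked X (Suc j) \<longleftrightarrow> marked X j \<or> deco X (Suc j)"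
    using op by (auto simp: marked_def)
  have "opened X j = {}" if "deco X (Suc j)"
  proof (rule ccontr)
    assume "opened X j \<noteq> {}"
    then obtain y where y: "y \<in> opened X j" by blast
    then have "y \<in> opened X (Suc j)" using op by blast
    then have "Suc j \<le> y" using opened_decorated_least[OF v _ that] op by blast
    then show False using y by (simp add: opened_def)
  qed
  then show ?thesis using m op by (auto simp: path_def)
qed

lemma path_Suc_closer:
  assumes v: "valid N X" and c: "mate X (Suc j) < Suc j"
  shows "path X (Suc j) = path X j + (if marked X j then 1 else - 1)"
proof -
  note mt = valid_matching[OF v]
  note op = opened_Suc_closer[OF mt c]
  have h: "int (height X j) = int (height X (Suc j)) + 1"
    using card.remove[OF finite_opened op(2)] op(1) by simp
  have 1: "marked X (Suc j) \<Longrightarrow> marked X j" using op by (auto simp: marked_def)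
  \<comment> \<open>The decorated arc encloses all other open arcs and closes last, so the sign
    survives as long as anything is open.\<close>
  have 2: "marked X (Suc j)" if "marked X j" "opened X (Suc j) \<noteq> {}"
  proof -
    from that(1) obtain w where w: "w \<in> opened X j" "deco X w" by (auto simp: marked_def)
    from that(2) obtain y where y: "y \<in> opened X (Suc j)" by blast
    have "w \<le> y" using opened_decorated_least[OF v w] y op by blast
    have "w \<noteq> mate X (Suc j)"
    proof
      assume "w = mate X (Suc j)"
      then have "mate X w = Suc j" using matchingD(1)[OF mt] by simp
      moreover have "w \<noteq> y" using \<open>w = _\<close> y op by blast
      moreover have "y \<noteq> Suc j" using c y by (auto simp: opened_def)
      ultimately show False using noncross[OF v, of w y] \<open>w \<le> y\<close> y by (auto simp: opened_def)
    qed
    then show ?thesis using w op by (auto simp: marked_def)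
  qed
  show ?thesis using h 1 2 by (auto simp: path_def)
qed

section \<open>Paths under joining and decorating\<close>

lemma succeq_refl [simp]: "int_succeq x x"
  by (simp add: int_succeq_def)

lemma succeq_trans: "int_succeq x y \<Longrightarrow> int_succeq y z \<Longrightarrow> int_succeq x z"
  by (auto simp: int_succeq_def)

lemma succeq_antisym: "int_succeq x y \<Longrightarrow> int_succeq y x \<Longrightarrow> x = y"
  by (auto simp: int_succeq_def)

text \<open>At equal absolute value the order prefers the negative sign. Moving up thus means having
  fewer open arcs, or equally many without losing a decoration.\<close>

lemma path_succeqI:
  assumes "height G j < height E j \<or> height G j = height E j \<and> (marked E j \<longrightarrow> marked G j)"
  shows "int_succeq (path G j) (path E j)"
  using assms by (auto simp: int_succeq_def path_def)

text \<open>From \<open>i + 1\<close> on the stack of open arcs depends only on whether the two old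
  partners lie up to \<open>j\<close> or beyond: it stays the same, one open arc gets another left
  end, or two arcs are lost.\<close>

lemma join_opened:
  assumes mt: "matching N X" and i: "1 \<le> i" "i < N" "i < j"
  defines "a \<equiv> mate X i" and "b \<equiv> mate X (Suc i)"
  shows "a \<le> j \<Longrightarrow> b \<le> j \<Longrightarrow> opened (join i X) j = opened X j \<and> i \<notin> opened X j \<and> Suc i \<notin> opened X j \<and> a \<notin> opened X j \<and> b \<notin> opened X j"
    and "a \<le> j \<Longrightarrow> j < b \<Longrightarrow> opened (join i X) j = insert a (opened X j - {Suc i}) \<and> Suc i \<in> opened X j \<and> a \<notin> opened X j \<and> i \<notin> opened X j"
    and "j < a \<Longrightarrow> b \<le> j \<Longrightarrow> opened (join i X) j = insert b (opened X j - {i}) \<and> i \<in> opened X j \<and> b \<notin> opened X j \<and> Suc i \<notin> opened X j"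
    and "j < a \<Longrightarrow> j < b \<Longrightarrow> opened (join i X) j = opened X j - {i, Suc i} \<and> i \<in> opened X j \<and> Suc i \<in> opened X j"
proof -
  have inv: "mate X (mate X x) = x" for x using matchingD[OF mt] by blast
  have ab: "mate X a = i" "mate X b = Suc i" "mate X i = a" "mate X (Suc i) = b" using inv by (simp_all add: a_def b_def)
  have ne: "a \<noteq> b" using mate_inj[OF mt, of i "Suc i"] by (simp add: a_def b_def)
  have jm: "mate (join i X) x = (if x = Suc i then i else if x = i then Suc i else
     if x = b then a else if x = a then b else mate X x)" for x
    by (simp add: mate_join a_def b_def)
  note d = opened_def jm
  have ai: "a \<noteq> i" "b \<noteq> Suc i" using matchingD(2)[OF mt] i by (auto simp: a_def b_def)
  show "a \<le> j \<Longrightarrow> b \<le> j \<Longrightarrow> opened (join i X) j = opened X j \<and> i \<notin> opened X j \<and> Suc i \<notin> opened X j \<and> a \<notin> opened X j \<and> b \<notin> opened X j"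
    using i ab ne ai by (auto simp: d split: if_splits)
  show "a \<le> j \<Longrightarrow> j < b \<Longrightarrow> opened (join i X) j = insert a (opened X j - {Suc i}) \<and> Suc i \<in> opened X j \<and> a \<notin> opened X j \<and> i \<notin> opened X j"
    using i ab ne ai by (auto simp: d split: if_splits)
  show "j < a \<Longrightarrow> b \<le> j \<Longrightarrow> opened (join i X) j = insert b (opened X j - {i}) \<and> i \<in> opened X j \<and> b \<notin> opened X j \<and> Suc i \<notin> opened X j"
    using i ab ne ai by (auto simp: d split: if_splits)
  show "j < a \<Longrightarrow> j < b \<Longrightarrow> opened (join i X) j = opened X j - {i, Suc i} \<and> i \<in> opened X j \<and> Suc i \<in> opened X j"
    using i ab ne ai by (auto simp: d split: if_splits)
qed

text \<open>From \<open>i + 1\<close> on no arc is added, and the merged arc inherits the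
  decorations of both joined arcs. At \<open>i\<close> itself the new arc makes a peak, which the
  hypothesis \<open>i < j\<close> excludes.\<close>

lemma join_succeq:
  assumes v: "valid N X" and i: "1 \<le> i" "i < N" "i < j"
  shows "int_succeq (path (join i X) j) (path X j)"
proof -
  note mt = valid_matching[OF v]
  define a where "a = mate X i"
  define b where "b = mate X (Suc i)"
  note jo = join_opened[OF mt i, folded a_def b_def]
  have dj: "deco (join i X) x = (x \<noteq> i \<and> x \<noteq> Suc i \<and> (if x = a \<or> x = b
     then deco X i \<or> deco X (Suc i) else deco X x))" for x
    by (simp add: deco_join a_def b_def)
  have ai: "a \<noteq> i" "b \<noteq> Suc i" using matchingD(2)[OF mt] i by (auto simp: a_def b_def)
  consider "a \<le> j" "b \<le> j" | "a \<le> j" "j < b" | "j < a" "b \<le> j" | "j < a" "j < b" by linarith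
  then show ?thesis
  proof cases
    case 1
    note o = jo(1)[OF 1]
    then have "deco (join i X) x = deco X x" if "x \<in> opened X j" for x
      using that by (auto simp: dj)
    then have "marked X j \<longrightarrow> marked (join i X) j" using o by (auto simp: marked_def)
    then show ?thesis using o by (intro path_succeqI) simp
  next
    case 2
    note o = jo(2)[OF 2]
    have "a \<noteq> Suc i" using 2 matchingD(1)[OF mt, of i] i by (auto simp: a_def b_def)
    have dd: "deco (join i X) x = deco X x" if "x \<in> opened X j" "x \<noteq> Suc i" "x \<noteq> b" for x
      using that o by (auto simp: dj)
    have "deco (join i X) a = (deco X i \<or> deco X (Suc i))" using ai \<open>a \<noteq> Suc i\<close> by (simp add: dj)
    moreover have "b \<notin> opened X j" using 2 by (simp add: opened_def)
    ultimately have "marked (join i X) j" if "marked X j"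
      using that o dd by (auto simp: marked_def)
    then show ?thesis using o card_swap[OF finite_opened, of "Suc i" X j a] by (intro path_succeqI) auto
  next
    case 3
    note o = jo(3)[OF 3]
    have "b \<noteq> i" using 3 matchingD(1)[OF mt, of "Suc i"] i by (auto simp: a_def b_def)
    have dd: "deco (join i X) x = deco X x" if "x \<in> opened X j" "x \<noteq> i" "x \<noteq> a" for x
      using that o by (auto simp: dj)
    have "deco (join i X) b = (deco X i \<or> deco X (Suc i))" using ai \<open>b \<noteq> i\<close> by (simp add: dj)
    moreover have "a \<notin> opened X j" using 3 by (simp add: opened_def)
    ultimately have "marked (join i X) j" if "marked X j"
      using that o dd by (auto simp: marked_def)
    then show ?thesis using o card_swap[OF finite_opened, of i X j b] by (intro path_succeqI) auto
  next
    case 4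
    note o = jo(4)[OF 4]
    then have "opened (join i X) j \<subset> opened X j" by blast
    then have "height (join i X) j < height X j" by (simp add: psubset_card_mono)
    then show ?thesis by (intro path_succeqI) simp
  qed
qed

text \<open>Needed with \<open>k = n\<close>: a product that keeps the middle value keeps the bottom
  half of the path. If both joined arcs ran beyond \<open>k\<close>, the height at \<open>k\<close>
  would have dropped; if only one does, it runs on with a new left end, and a decoration gained by
  it would show in the sign at \<open>k\<close>.\<close>

lemma join_path_tail:
  assumes v: "valid N X" and i: "1 \<le> i" "i < N" "i < k" and kj: "k \<le> j"
    and eq: "path (join i X) k = path X k"
  shows "path (join i X) j = path X j"
proof -
  note mt = valid_matching[OF v]
  note vG = join_valid[OF v i(1,2)]
  have ij: "i < j" using i kj by simp
  define a where "a = mate X i"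
  define b where "b = mate X (Suc i)"
  note jo = join_opened[OF mt i(1,2) ij, folded a_def b_def]
  note jk = join_opened[OF mt i, folded a_def b_def]
  have dj: "deco (join i X) x = (x \<noteq> i \<and> x \<noteq> Suc i \<and> (if x = a \<or> x = b
     then deco X i \<or> deco X (Suc i) else deco X x))" for x
    by (simp add: deco_join a_def b_def)
  have inv: "mate X (mate X x) = x" for x using matchingD[OF mt] by blast
  have ai: "a \<noteq> i" "b \<noteq> Suc i" using matchingD(2)[OF mt] i by (auto simp: a_def b_def)
  have same: "path (join i X) j = path X j" if "a \<le> j" "b \<le> j"
  proof -
    note o = jo(1)[OF that]
    then have "deco (join i X) x = deco X x" if "x \<in> opened X j" for x
      using that by (auto simp: dj)
    then have "marked X j = marked (join i X) j" using o by (auto simp: marked_def)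
    then show ?thesis using o by (simp add: path_def)
  qed
  \<comment> \<open>Common form of two mirror cases: the arc from \<open>c''\<close> to
    \<open>c'\<close> is open at \<open>j\<close> and now starts at \<open>c\<close>, while
    \<open>c1\<close> was joined to \<open>c\<close>.\<close>
  have moved: "path (join i X) j = path X j"
    if c: "c \<le> k" "j < c'" and o: "opened (join i X) j = insert c (opened X j - {c''})" "c'' \<in> opened X j" "c \<notin> opened X j" "c1 \<notin> opened X j"
      and ok: "opened (join i X) k = insert c (opened X k - {c''})" "c'' \<in> opened X k" "c \<notin> opened X k" "c1 \<notin> opened X k"
      and cc: "c = a \<and> c'' = Suc i \<and> c1 = i \<and> c' = b \<and> c \<noteq> Suc i \<or> c = b \<and> c'' = i \<and> c1 = Suc i \<and> c' = a \<and> c \<noteq> i" for c c' c'' c1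
  proof -
    have "marked (join i X) j = marked X j"
    proof
      assume mX: "marked X j"
      then obtain x where x: "x \<in> opened X j" "deco X x" by (auto simp: marked_def)
      have "x \<noteq> c'" using x c by (auto simp: opened_def)
      then show "marked (join i X) j"
        using x o ai cc by (cases "x = c''") (auto simp: marked_def dj)
    next
      assume "marked (join i X) j"
      then obtain x where x: "x \<in> opened (join i X) j" "deco (join i X) x" by (auto simp: marked_def)
      show "marked X j"
      proof (cases "x = c")
        case False
        have "x \<noteq> c'" using x c by (auto simp: opened_def)
        with False have "x \<in> opened X j" "deco X x" using x o(1) dj[of x] cc matchingD(3)[OF mt, of i] matchingD(3)[OF mt, of "Suc i"]
          by (auto simp: a_def b_def split: if_splits)
        then show ?thesis by (auto simp: marked_def)
      next
        case True
        \<comment> \<open>The decoration of the merged arc makes the new path negative at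
          \<open>k\<close>, hence also the old one. The old decorated arc must be the replaced one,
          since two distinct decorated arcs are never open together.\<close>
        have ck: "c \<in> opened (join i X) k" using ok by simp
        then have "marked (join i X) k" using x True by (auto simp: marked_def)
        moreover have "height (join i X) k > 0" using ck by (metis card_gt_0_iff empty_iff finite_opened)
        ultimately have "path X k < 0" using eq by (simp add: path_def)
        then have "marked X k" by (auto simp: path_def split: if_splits)
        then obtain w where w: "w \<in> opened X k" "deco X w" by (auto simp: marked_def)
        have "w = c''"
        proof (rule ccontr)
          have wc: "w \<noteq> c'" using w(1) c kj by (auto simp: opened_def)
          assume nw: "w \<noteq> c''"
          then have wG: "w \<in> opened (join i X) k" using w ok by blast
          have "w \<noteq> a" "w \<noteq> b" "w \<noteq> i" "w \<noteq> Suc i" using w(1) ok(4) ok(3) nw cc wc by auto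
          then have "deco (join i X) w" using w dj by simp
          then have "w = c" using opened_decorated_least[OF vG] wG ck x True by (metis le_antisym)
          then show False using w ok by blast
        qed
        then show ?thesis using w o by (auto simp: marked_def)
      qed
    qed
    then show ?thesis using o card_swap[OF finite_opened, of c'' X j c] by (simp add: path_def)
  qed
  consider "a \<le> j" "b \<le> j" | "a \<le> k" "j < b" | "j < a" "b \<le> k" | "k < a" "k < b" 
    | "k < a" "a \<le> j" "j < b" | "k < b" "b \<le> j" "j < a" using kj by linarith
  then show ?thesis
  proof cases
    case 1 then show ?thesis by (rule same)
  next
    case 2
    have "a \<noteq> Suc i" using 2 i kj inv[of i] by (auto simp: a_def b_def)
    then show ?thesis using 2 kj jo(2) jk(2) by (intro moved[of a b "Suc i" i]) auto
  next
    case 3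
    have "b \<noteq> i" using 3 i kj inv[of "Suc i"] by (auto simp: a_def b_def)
    then show ?thesis using 3 kj jo(3) jk(3) by (intro moved[of b a i "Suc i"]) auto
  next
    case 4
    note o = jk(4)[OF 4]
    then have "opened (join i X) k \<subset> opened X k" by blast
    then have "height (join i X) k < height X k" by (simp add: psubset_card_mono)
    then show ?thesis using abs_path[of "join i X" k] abs_path[of X k] eq by simp
  next
    case 5
    have "height (join i X) k < height X k" using jk(4) 5 by (intro psubset_card_mono) auto
    then show ?thesis using abs_path[of "join i X" k] abs_path[of X k] eq by simp
  next
    case 6
    have "height (join i X) k < height X k" using jk(4) 6 by (intro psubset_card_mono) auto
    then show ?thesis using abs_path[of "join i X" k] abs_path[of X k] eq by simp
  qed
qed

lemma opened_blob1 [simp]: "opened (blob1 X) j = opened X j"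
  by (simp add: opened_def blob1_def)

lemma blob1_marked:
  assumes mt: "matching N X"
  shows "marked (blob1 X) j \<longleftrightarrow> marked X j \<or> 1 \<in> opened X j"
proof -
  have "mate X 1 \<in> opened X j \<Longrightarrow> 1 \<in> opened X j"
    using matchingD(1,2)[OF mt] by (cases "mate X 1 = 0") (auto simp: opened_def, metis atLeastAtMost_iff less_eq_Suc_le not_less_eq_eq not_one_le_zero)
  moreover have "deco (blob1 X) x \<longleftrightarrow> x = 1 \<or> x = mate X 1 \<or> deco X x" for x by (simp add: blob1_def)
  ultimately show ?thesis unfolding marked_def opened_blob1 by metis
qed

lemma blob1_succeq:
  assumes "matching N X"
  shows "int_succeq (path (blob1 X) j) (path X j)"
  by (rule path_succeqI) (simp add: blob1_marked[OF assms])

lemma opened_least_pos: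
  assumes "matching N X" "x \<in> opened X j" shows "1 \<le> x"
  using matchingD(2)[OF assms(1), of x] assms(2) by (force simp: opened_def)

text \<open>If the arc through 1 is still open at \<open>j\<close>, it is open at \<open>k\<close>,
  and the equality there says that it was decorated already.\<close>

lemma blob1_path_tail:
  assumes v: "valid N X" and kj: "k \<le> j" and k: "1 \<le> k"
    and eq: "path (blob1 X) k = path X k"
  shows "path (blob1 X) j = path X j"
proof (cases "1 \<in> opened X j \<and> \<not> marked X j")
  case True
  then have o: "1 \<in> opened X k" using kj k by (auto simp: opened_def)
  then have "height X k > 0" by (metis card_gt_0_iff empty_iff finite_opened)
  then have "marked X k" using eq o blob1_marked[OF valid_matching[OF v], of k] by (auto simp: path_def split: if_splits)
  then obtain w where w: "w \<in> opened X k" "deco X w" by (auto simp: marked_def)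
  then have "w \<le> 1" using opened_decorated_least[OF v w o] by simp
  then have "w = 1" using opened_least_pos[OF valid_matching[OF v] w(1)] by simp
  then show ?thesis using True w by (auto simp: marked_def)
next
  case False
  then have "marked (blob1 X) j = marked X j" using blob1_marked[OF valid_matching[OF v]] by auto
  then show ?thesis by (simp add: path_def)
qed

section \<open>Blob algebra relations on single chord diagrams\<close>

lemma arcs_eqI:
  assumes "\<And>x. mate X x = mate Y x" "\<And>x. deco X x = deco Y x" shows "X = Y"
  using assms by (intro arcs.expand) (simp add: fun_eq_iff)

lemma join_arc [simp]: "mate (join i X) i = Suc i" "mate (join i X) (Suc i) = i"
  "\<not> deco (join i X) i" "\<not> deco (join i X) (Suc i)"
  by (simp_all add: mate_join deco_join)

text \<open>This is \<open>U_i U_{i+1} U_i = U_i\<close> on a diagram that already carries the plain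
  arc \<open>(i, i + 1)\<close>: the arc is slid to the right and back. In this form it also
  recovers a diagram from the slid one.\<close>

lemma join_cancel_right:
  assumes mt: "matching N X" and a: "mate X i = Suc i" "\<not> deco X i"
  shows "join i (join (Suc i) X) = X"
proof -
  have inv: "mate X (mate X x) = x" "deco X (mate X x) = deco X x" for x using matchingD[OF mt] by blast+
  define c where "c = mate X (Suc (Suc i))"
  have f: "mate X (Suc i) = i" "mate X c = Suc (Suc i)" "\<not> deco X (Suc i)" "deco X c = deco X (Suc (Suc i))"
    using inv a by (metis c_def)+
  have ne: "c \<noteq> i" "c \<noteq> Suc i" using f a by auto
  show ?thesis
    by (rule arcs_eqI) (use f a ne in \<open>simp_all add: mate_join deco_join flip: c_def, blast\<close>)
qed

lemma join_cancel_left: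
  assumes mt: "matching N X" and a: "mate X (Suc i) = Suc (Suc i)" "\<not> deco X (Suc i)"
  shows "join (Suc i) (join i X) = X"
proof -
  have inv: "mate X (mate X x) = x" "deco X (mate X x) = deco X x" for x using matchingD[OF mt] by blast+
  define c where "c = mate X i"
  have f: "mate X (Suc (Suc i)) = Suc i" "mate X c = i" "\<not> deco X (Suc (Suc i))" "deco X c = deco X i"
    using inv a by (metis c_def)+
  have ne: "c \<noteq> Suc (Suc i)" "c \<noteq> Suc i" using f a by auto
  show ?thesis
    by (rule arcs_eqI) (use f a ne in \<open>simp_all add: mate_join deco_join flip: c_def, blast\<close>)
qed

text \<open>The coefficient of \<open>join i X\<close> in the product of \<open>U_i\<close> with
  \<open>X\<close>.\<close>

definition scal :: "'a::field \<Rightarrow> 'a \<Rightarrow> nat \<Rightarrow> arcs \<Rightarrow> 'a" where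
  "scal \<delta> y i X = (if mate X i = Suc i then if deco X i then y else \<delta> else 1)"

text \<open>Which join closes a loop can depend on the order: if two arcs connect
  \<open>{i, i + 1}\<close> with \<open>{j, j + 1}\<close>, the loop is closed by whichever join
  comes second. Only the product of the factors is symmetric.\<close>

lemma join_commute:
  assumes mt: "matching N X" and ij: "1 \<le> i" "Suc i < j" "j < N"
  shows "join i (join j X) = join j (join i X)"
    "scal \<delta> y i (join j X) * scal \<delta> y j X = scal \<delta> y j (join i X) * scal \<delta> y i X"
proof -
  have inv: "mate X (mate X x) = x" "deco X (mate X x) = deco X x" for x using matchingD[OF mt] by blast+
  define a where "a = mate X i"
  define b where "b = mate X (Suc i)"
  define c where "c = mate X j"
  define d where "d = mate X (Suc j)"
  have ne0: "a \<noteq> i" "b \<noteq> Suc i" "c \<noteq> j" "d \<noteq> Suc j"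
    using matchingD(2)[OF mt] ij by (auto simp: a_def b_def c_def d_def)
  have ne1: "a \<noteq> b" "a \<noteq> c" "a \<noteq> d" "b \<noteq> c" "b \<noteq> d" "c \<noteq> d"
    using mate_inj[OF mt] ij by (auto simp: a_def b_def c_def d_def)
  have idx: "i \<noteq> j" "i \<noteq> Suc j" "Suc i \<noteq> j" "Suc i \<noteq> Suc j" "j \<noteq> i" "Suc j \<noteq> i" "j \<noteq> Suc i" "Suc j \<noteq> Suc i" using ij by auto
  have iff: "b = i \<longleftrightarrow> a = Suc i" "c = i \<longleftrightarrow> a = j" "d = i \<longleftrightarrow> a = Suc j" "c = Suc i \<longleftrightarrow> b = j"
    "d = Suc i \<longleftrightarrow> b = Suc j" "d = j \<longleftrightarrow> c = Suc j"
    using inv(1) by (metis a_def b_def c_def d_def)+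
  have da: "deco X a = deco X i" "deco X b = deco X (Suc i)" "deco X c = deco X j" "deco X d = deco X (Suc j)"
    using inv by (simp_all add: a_def b_def c_def d_def)
  have p: "mate X i = a" "mate X (Suc i) = b" "mate X j = c" "mate X (Suc j) = d"
    by (simp_all add: a_def b_def c_def d_def)
  \<comment> \<open>The cases list how the four nodes can be joined among themselves; in the last
    one there is no such connection.\<close>
  consider "a = Suc i" "c = Suc j" | "a = Suc i" "c \<noteq> Suc j" | "a \<noteq> Suc i" "c = Suc j"
    | "a = j" "b = Suc j" | "a = Suc j" "b = j" 
    | "a = j" "b \<noteq> Suc j" | "a = Suc j" "b \<noteq> j" | "b = j" "a \<noteq> Suc j" | "b = Suc j" "a \<noteq> j"
    | "a \<noteq> Suc i" "c \<noteq> Suc j" "a \<noteq> j" "a \<noteq> Suc j" "b \<noteq> j" "b \<noteq> Suc j"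
    by blast
  then have "mate (join i (join j X)) x = mate (join j (join i X)) x \<and>
    deco (join i (join j X)) x = deco (join j (join i X)) x \<and>
    scal \<delta> y i (join j X) * scal \<delta> y j X = scal \<delta> y j (join i X) * scal \<delta> y i X" for x
  proof cases
    case 1 then show ?thesis using ne0 ne1 idx iff da by (simp add: mate_join deco_join p scal_def; blast)
  next
    case 2 then show ?thesis using ne0 ne1 idx iff da by (simp add: mate_join deco_join p scal_def; blast)
  next
    case 3 then show ?thesis using ne0 ne1 idx iff da by (simp add: mate_join deco_join p scal_def; blast)
  next
    case 4 then show ?thesis using ne0 ne1 idx iff da by (simp add: mate_join deco_join p scal_def; blast)
  next
    case 5 then show ?thesis using ne0 ne1 idx iff da by (simp add: mate_join deco_join p scal_def; blast)
  next
    case 6 then show ?thesis using ne0 ne1 idx iff da by (simp add: mate_join deco_join p scal_def; blast)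
  next
    case 7 then show ?thesis using ne0 ne1 idx iff da by (simp add: mate_join deco_join p scal_def; blast)
  next
    case 8 then show ?thesis using ne0 ne1 idx iff da by (simp add: mate_join deco_join p scal_def; blast)
  next
    case 9 then show ?thesis using ne0 ne1 idx iff da by (simp add: mate_join deco_join p scal_def; blast)
  next
    case 10 then show ?thesis using ne0 ne1 idx iff da by (simp add: mate_join deco_join p scal_def; blast)
  qed
  then show "join i (join j X) = join j (join i X)"
    "scal \<delta> y i (join j X) * scal \<delta> y j X = scal \<delta> y j (join i X) * scal \<delta> y i X"
    by (auto intro: arcs_eqI)
qed

lemma join_idem: "join i (join i X) = join i X" "scal \<delta> y i (join i X) = \<delta>"
  by (rule arcs_eqI) (simp_all add: mate_join deco_join scal_def)

lemma mate_blob1 [simp]: "mate (blob1 X) = mate X"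
  by (simp add: blob1_def)

lemma deco_blob1: "deco (blob1 X) x \<longleftrightarrow> x = 1 \<or> x = mate X 1 \<or> deco X x"
  by (simp add: blob1_def)

lemma blob1_idem: "blob1 (blob1 X) = blob1 X"
  by (rule arcs_eqI) (auto simp: deco_blob1)

lemma blob1_id: "matching N X \<Longrightarrow> deco X 1 \<Longrightarrow> blob1 X = X"
  using matchingD(3)[of N X 1] by (intro arcs_eqI) (auto simp: deco_blob1)

lemma join_1_blob1: "join 1 (blob1 (join 1 X)) = join 1 X" "scal \<delta> y 1 (blob1 (join 1 X)) = y"
  by (rule arcs_eqI) (auto simp: mate_join deco_join deco_blob1 scal_def)

text \<open>If the arc through 1 is one of the joined arcs, the merged arc inherits its blob, so the
  order of the operations does not matter; and a loop closed at \<open>i \<ge> 2\<close> does not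
  pass through node 1.\<close>

lemma join_blob1:
  assumes mt: "matching N X" and i: "2 \<le> i" "i < N"
  shows "join i (blob1 X) = blob1 (join i X)" "scal \<delta> y i (blob1 X) = scal \<delta> y i X"
proof -
  have inv: "mate X (mate X x) = x" "deco X (mate X x) = deco X x" for x using matchingD[OF mt] by blast+
  define a where "a = mate X i"
  define b where "b = mate X (Suc i)"
  define c where "c = mate X 1"
  have ne: "a \<noteq> i" "b \<noteq> Suc i" "a \<noteq> b" "i \<noteq> 1" "a \<noteq> c" "b \<noteq> c" "c \<noteq> 1"
    using matchingD(2)[OF mt] mate_inj[OF mt] i by (auto simp: a_def b_def c_def)
  have iff: "a = 1 \<longleftrightarrow> c = i" "b = 1 \<longleftrightarrow> c = Suc i" "b = i \<longleftrightarrow> a = Suc i"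
    using inv(1) by (metis a_def b_def c_def)+
  have p: "mate X i = a" "mate X (Suc i) = b" "mate X 1 = c" "mate X (Suc 0) = c"
    by (simp_all add: a_def b_def c_def)
  have da: "deco X a = deco X i" "deco X b = deco X (Suc i)" 
    using inv by (simp_all add: a_def b_def c_def)
  have "mate (join i (blob1 X)) x = mate (blob1 (join i X)) x" for x by (simp add: mate_join)
  moreover have "deco (join i (blob1 X)) x = deco (blob1 (join i X)) x" for x
  proof -
    consider "c = i" | "c = Suc i" | "c \<noteq> i" "c \<noteq> Suc i" by blast
    then show ?thesis
    proof cases
      case 1 then show ?thesis using ne iff da by (simp add: mate_join deco_join deco_blob1 p; blast)
    next
      case 2 then show ?thesis using ne iff da by (simp add: mate_join deco_join deco_blob1 p; blast)
    next
      case 3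
      then show ?thesis using ne iff i
        unfolding mate_join deco_join deco_blob1 mate_blob1 p by (cases "x = 1"; cases "x = c") simp_all
    qed
  qed
  ultimately show "join i (blob1 X) = blob1 (join i X)" by (intro arcs_eqI)
  show "scal \<delta> y i (blob1 X) = scal \<delta> y i X"
    using ne iff i by (cases "c = i"; cases "c = Suc i") (simp_all add: scal_def deco_blob1 p)
qed

lemma marked_iff_neg: "marked X j \<longleftrightarrow> path X j < 0"
proof -
  have "height X j > 0" if "marked X j" using that by (auto simp: marked_def card_gt_0_iff)
  then show ?thesis by (auto simp: path_def)
qed

text \<open>A plain arc between neighbours is a peak of the absolute value: away from 0 it follows
  the sign of the path, and at 0 being plain means going up.\<close>

lemma path_peak:
  assumes v: "valid N X" and a: "mate X (Suc i) = Suc (Suc i)" "\<not> deco X (Suc i)"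
  shows "path X (Suc i) = path X i + (if path X i < 0 then - 1 else 1)" "path X (Suc (Suc i)) = path X i"
proof -
  have o: "Suc i < mate X (Suc i)" using a by simp
  have c: "mate X (Suc (Suc i)) < Suc (Suc i)" using a matchingD(1)[OF valid_matching[OF v], of "Suc i"] by simp
  have "marked X (Suc i) = marked X i"
    using opened_Suc_opener[OF valid_matching[OF v] o] a by (simp add: marked_def)
  then have mk: "marked X (Suc i) \<longleftrightarrow> path X i < 0" by (simp only: marked_iff_neg)
  show 1: "path X (Suc i) = path X i + (if path X i < 0 then - 1 else 1)"
    using path_Suc_opener[OF v o] unfolding mk .
  show "path X (Suc (Suc i)) = path X i"
    using path_Suc_closer[OF v c] unfolding mk 1 by simp
qed

text \<open>The arc moves from \<open>(m + 1, m + 2)\<close> to \<open>(m, m + 1)\<close>, and the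
  line that ended at \<open>m\<close> now ends at \<open>m + 2\<close>. The peak passes one step of
  the path, so only the values at \<open>m\<close> and \<open>m + 1\<close> change.\<close>

lemma path_shift:
  assumes v: "valid N F" and m: "1 \<le> m" "Suc m < N" and a: "mate F (Suc m) = Suc (Suc m)" "\<not> deco F (Suc m)"
  shows "j < m \<or> Suc m < j \<Longrightarrow> path (join m F) j = path F j"
    "path (join m F) m = path F (m - 1) + (if path F (m - 1) < 0 then - 1 else 1)"
    "path (join m F) (Suc m) = path F (m - 1)"
proof -
  note mt = valid_matching[OF v]
  have mN: "m < N" using m by simp
  have inv: "mate F (mate F x) = x" "deco F (mate F x) = deco F x" for x using matchingD[OF mt] by blast+
  define c where "c = mate F m"
  have pm: "mate F m = c" by (simp add: c_def)
  have f: "mate F (Suc (Suc m)) = Suc m" "mate F c = m" "\<not> deco F (Suc (Suc m))" "deco F c = deco F m"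
    using inv a by (metis c_def)+
  have ne: "c \<noteq> Suc (Suc m)" "c \<noteq> Suc m" "c \<noteq> m" using f a matchingD(2)[OF mt, of m] m by (auto simp: c_def)
  show A: "path (join m F) j = path F j" if j: "j < m \<or> Suc m < j" for j
    using j
  proof
    assume j: "j < m"
    have "opened (join m F) j = opened F j" using j ne f a pm by (auto simp: opened_def mate_join)
    moreover have "deco (join m F) x = deco F x" if "x \<le> j" for x
      using j that ne f a by (auto simp: deco_join pm)
    ultimately show ?thesis by (simp add: path_def marked_def opened_def cong: conj_cong)
  next
    assume j: "Suc m < j"
    then have mj: "m < j" by simp
    note jo = join_opened[OF mt m(1) mN mj, unfolded a pm]
    show ?thesis
    proof (cases "c \<le> j")
      case True
      then have o: "opened (join m F) j = opened F j" "m \<notin> opened F j" "Suc m \<notin> opened F j" "c \<notin> opened F j" "Suc (Suc m) \<notin> opened F j"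
        using jo(1) j by auto
      then have "deco (join m F) x = deco F x" if "x \<in> opened F j" for x
        using that by (auto simp: deco_join pm a)
      then show ?thesis using o by (simp add: path_def marked_def)
    next
      case False
      then have o: "opened (join m F) j = insert (Suc (Suc m)) (opened F j - {m})" "m \<in> opened F j" 
        "Suc m \<notin> opened F j" "Suc (Suc m) \<notin> opened F j"
        using jo(3) j by auto
      have cn: "c \<notin> opened F j" using False by (simp add: opened_def)
      have "deco (join m F) x = deco F x" if "x \<in> opened F j" "x \<noteq> m" for x
        using that o cn by (auto simp: deco_join pm a)
      moreover have "deco (join m F) (Suc (Suc m)) = deco F m" using a by (simp add: deco_join pm)
      ultimately have "marked (join m F) j = marked F j" using o by (auto simp: marked_def)
      then show ?thesis using o card_swap[OF finite_opened o(2,4)] by (simp add: path_def)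
    qed
  qed
  obtain m' where m': "m = Suc m'" using m by (cases m) auto
  show "path (join m F) m = path F (m - 1) + (if path F (m - 1) < 0 then - 1 else 1)"
    "path (join m F) (Suc m) = path F (m - 1)"
    using path_peak[OF join_valid[OF v m(1) mN], of m'] A[of m'] by (simp_all add: m')
qed

section \<open>Bijection between chord diagrams and integer paths\<close>

lemma opener_iff:
  assumes "matching N X" "Suc j \<le> N"
  shows "Suc j < mate X (Suc j) \<longleftrightarrow> \<bar>path X j\<bar> < \<bar>path X (Suc j)\<bar>"
  using height_Suc[OF assms] by (auto simp: abs_path)

lemma deco_opener_iff:
  assumes v: "valid N X" and o: "Suc j < mate X (Suc j)"
  shows "deco X (Suc j) \<longleftrightarrow> path X j = 0 \<and> path X (Suc j) < 0"
proof -
  note op = opened_Suc_opener[OF valid_matching[OF v] o]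
  have "opened X j = {}" if "deco X (Suc j)"
  proof (rule ccontr)
    assume "opened X j \<noteq> {}"
    then obtain y where y: "y \<in> opened X j" by blast
    then have "y \<in> opened X (Suc j)" using op by blast
    then have "Suc j \<le> y" using opened_decorated_least[OF v _ that] op by blast
    then show False using y by (simp add: opened_def)
  qed
  moreover have "path X j = 0 \<longleftrightarrow> opened X j = {}" by (simp add: path_def)
  moreover have "marked X (Suc j) \<longleftrightarrow> marked X j \<or> deco X (Suc j)"
    using op by (auto simp: marked_def)
  moreover have "opened X j = {} \<Longrightarrow> \<not> marked X j" by (simp add: marked_def)
  ultimately show ?thesis unfolding marked_iff_neg[symmetric] by blast
qed

text \<open>An opener is therefore matched to the first later position where the height falls below
  its value at the opener. This rule recovers the matching from the path.\<close>

lemma height_inside_arc: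
  assumes v: "valid N X" and o: "x < mate X x"
  shows "height X (mate X x) < height X x"
    "x \<le> z \<Longrightarrow> z < mate X x \<Longrightarrow> height X x \<le> height X z"
proof -
  note inv = matchingD(1)[OF valid_matching[OF v]]
  have "opened X (mate X x) \<subset> opened X x"
  proof
    show "opened X (mate X x) \<subseteq> opened X x"
    proof
      fix w assume w: "w \<in> opened X (mate X x)"
      then have "w \<noteq> mate X x" using inv[of x] o by (auto simp: opened_def)
      then have "\<not> x < w" using noncross[OF v, of x w] w by (auto simp: opened_def)
      then show "w \<in> opened X x" using w o by (auto simp: opened_def)
    qed
    show "opened X (mate X x) \<noteq> opened X x" using o by (auto simp: opened_def)
  qed
  then show "height X (mate X x) < height X x" by (simp add: psubset_card_mono)
  assume z: "x \<le> z" "z < mate X x"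
  have "opened X x \<subseteq> opened X z"
  proof
    fix w assume w: "w \<in> opened X x"
    have "mate X x < mate X w" if "w \<noteq> x"
    proof -
      have "mate X w \<noteq> mate X x" using that inv by metis
      moreover have "w < x" "x < mate X w" using w that by (simp_all add: opened_def)
      ultimately show ?thesis using noncross[OF v, of w x] by fastforce
    qed
    then show "w \<in> opened X z" using w z by (cases "w = x") (auto simp: opened_def)
  qed
  then show "height X x \<le> height X z" by (simp add: card_mono)
qed

text \<open>The absolute values show the openers and, by first return, their mates; a decoration
  shows as a step from 0 to a negative value.\<close>

lemma path_inj:
  assumes vX: "valid N X" and vY: "valid N Y" and eq: "\<And>j. j \<le> N \<Longrightarrow> path X j = path Y j"
  shows "X = Y"
proof -
  note mX = valid_matching[OF vX] and mY = valid_matching[OF vY]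
  have h: "height X j = height Y j" if "j \<le> N" for j
    using eq[OF that] abs_path[of X j] abs_path[of Y j] by simp
  have op: "x < mate X x \<longleftrightarrow> x < mate Y x" if "x \<in> {1..N}" for x
    using that opener_iff[OF mX, of "x - 1"] opener_iff[OF mY, of "x - 1"] eq[of x] eq[of "x - 1"] by (cases x) auto
  have up: "mate X x = mate Y x" if x: "x \<in> {1..N}" "x < mate X x" for x
  proof -
    have y: "x < mate Y x" using op x by blast
    have r: "mate X x \<le> N" "mate Y x \<le> N" using mate_range[OF mX] mate_range[OF mY] x by auto
    have hx: "height X x = height Y x" using h x by auto
    show ?thesis
    proof (rule linorder_cases[of "mate X x" "mate Y x"])
      assume "mate X x < mate Y x"
      then show ?thesis
        using height_inside_arc(2)[OF vY y, of "mate X x"] height_inside_arc(1)[OF vX x(2)] h[OF r(1)] hx x by simp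
    next
      assume "mate Y x < mate X x"
      then show ?thesis
        using height_inside_arc(2)[OF vX x(2), of "mate Y x"] height_inside_arc(1)[OF vY y] h[OF r(2)] hx y by simp
    qed
  qed
  have mate: "mate X x = mate Y x" for x
  proof (cases "x \<in> {1..N}")
    case False then show ?thesis using matchingD(2)[OF mX] matchingD(2)[OF mY] by metis
  next
    case True
    show ?thesis
    proof (cases "x < mate X x")
      case True with up \<open>x \<in> {1..N}\<close> show ?thesis by blast
    next
      case False
      then have "mate X x < x" using True matchingD(2)[OF mX, of x] by force
      then have "mate Y (mate X x) = x"
        using up[of "mate X x"] matchingD(1)[OF mX, of x] mate_range[OF mX, of x] True by simp
      then show ?thesis using matchingD(1)[OF mY, of "mate X x"] by simp
    qed
  qed
  have dup: "deco X x = deco Y x" if x: "x \<in> {1..N}" "x < mate X x" for x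
    using deco_opener_iff[OF vX, of "x - 1"] deco_opener_iff[OF vY, of "x - 1"] x mate eq[of x] eq[of "x - 1"]
    by (cases x) auto
  have "deco X x = deco Y x" for x
  proof (cases "x \<in> {1..N}")
    case False then show ?thesis using matchingD(4)[OF mX] matchingD(4)[OF mY] by metis
  next
    case True
    show ?thesis
    proof (cases "x < mate X x")
      case True with dup \<open>x \<in> {1..N}\<close> show ?thesis by blast
    next
      case False
      then have "mate X x < x" using True matchingD(2)[OF mX, of x] by force
      then have "deco X (mate X x) = deco Y (mate X x)"
        using dup[of "mate X x"] matchingD(1)[OF mX, of x] mate_range[OF mX, of x] True by simp
      then show ?thesis using matchingD(3)[OF mX] matchingD(3)[OF mY] mate by metis
    qed
  qed
  then show ?thesis using mate by (intro arcs_eqI)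
qed

lemma sign_constant:
  fixes P :: "nat \<Rightarrow> int"
  assumes "\<And>j. j < N \<Longrightarrow> \<bar>P (Suc j) - P j\<bar> = 1" "a \<le> b" "b \<le> N" "\<And>z. a \<le> z \<Longrightarrow> z \<le> b \<Longrightarrow> P z \<noteq> 0"
  shows "P a < 0 \<longleftrightarrow> P b < 0"
  using assms(2-4)
proof (induction b rule: dec_induct)
  case (step b)
  have "P b \<noteq> 0" "P (Suc b) \<noteq> 0" using step by auto
  moreover have "\<bar>P (Suc b) - P b\<bar> = 1" using assms(1) step by simp
  ultimately show ?case using step by fastforce
qed simp

theorem path_surj:
  fixes P :: "nat \<Rightarrow> int"
  assumes P0: "P 0 = 0" and PN: "P N = 0" and st: "\<And>j. j < N \<Longrightarrow> \<bar>P (Suc j) - P j\<bar> = 1"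
  shows "\<exists>X. valid N X \<and> (\<forall>j \<le> N. path X j = P j)"
proof -
  define H where "H j = nat \<bar>P j\<bar>" for j
  have H0: "H 0 = 0" "H N = 0" using P0 PN by (simp_all add: H_def)
  have step: "H (Suc j) = Suc (H j) \<or> H j = Suc (H (Suc j))" if "j < N" for j
    using st[OF that] unfolding H_def by (cases "P j = 0") (auto simp: abs_if split: if_splits)
  \<comment> \<open>Steps are numbered from 0, so node \<open>x + 1\<close> stands for the step from
    \<open>x\<close> to \<open>x + 1\<close>. \<open>M x y\<close> pairs an up-step of the absolute
    value with the step that first returns to its initial level.\<close>
  define M where "M x y \<longleftrightarrow> x < y \<and> y < N \<and> H x = H (Suc y) \<and> (\<forall>z. x < z \<and> z \<le> y \<longrightarrow> H (Suc y) < H z)" for x y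
  have Mr: "M x y \<Longrightarrow> M x y' \<Longrightarrow> y = y'" for x y y'
    unfolding M_def by (metis Suc_leI le_SucI less_irrefl linorder_neqE_nat nat_less_le not_less_eq_eq less_Suc_eq_le)
  have Ml: "M x y \<Longrightarrow> M x' y \<Longrightarrow> x = x'" for x y x'
    unfolding M_def by (metis less_irrefl linorder_neqE_nat less_imp_le)
  have Mup: "H (Suc x) = Suc (H x)" "x < N" if "M x y" for x y
    using that step[of x] unfolding M_def by (auto dest: spec[of _ "Suc x"])
  have Mdown: "H y = Suc (H (Suc y))" "y < N" if "M x y" for x y
    using that step[of y] unfolding M_def by (auto dest: spec[of _ y])
  have exR: "\<exists>y. M x y" if x: "x < N" "H (Suc x) = Suc (H x)" for x
  proof -
    define y where "y = (LEAST y. x < y \<and> H (Suc y) \<le> H x)"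
    \<comment> \<open>The last step ends at height 0, so a return to the level of \<open>x\<close>
      exists.\<close>
    have "x < N - 1 \<and> H (Suc (N - 1)) \<le> H x" using x H0 by (cases "x = N - 1") auto
    then have y: "x < y \<and> H (Suc y) \<le> H x" "y \<le> N - 1"
      unfolding y_def by (rule LeastI) (rule Least_le, fact)
    have z: "H x < H (Suc z)" if "x \<le> z" "z < y" for z
      using not_less_Least[of z "\<lambda>y. x < y \<and> H (Suc y) \<le> H x"] that x unfolding y_def[symmetric] by (cases "z = x") auto
    have "H x < H y" using z[of "y - 1"] y by auto
    moreover have "y < N" using y x by linarith
    ultimately have "H (Suc y) = H x" using step[of y] y by auto
    moreover have "H x < H z" if "x < z" "z \<le> y" for z using z[of "z - 1"] that by auto
    ultimately have "M x y" using y \<open>y < N\<close> by (auto simp: M_def)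
    then show ?thesis ..
  qed
  have exL: "\<exists>x. M x y" if y: "y < N" "H y = Suc (H (Suc y))" for y
  proof -
    define x where "x = (GREATEST x. x < y \<and> H x \<le> H (Suc y))"
    have y0: "0 < y" using y H0 by (cases y) auto
    have x: "x < y \<and> H x \<le> H (Suc y)" unfolding x_def
      by (rule GreatestI_nat[of _ 0 y]) (use H0 y0 in auto)
    have z: "H (Suc y) < H z" if "x < z" "z < y" for z
      using Greatest_le_nat[of "\<lambda>x. x < y \<and> H x \<le> H (Suc y)" z y] that unfolding x_def[symmetric] by fastforce
    have z': "H (Suc y) < H z" if "x < z" "z \<le> y" for z
      using z[of z] that y by (cases "z = y") auto
    have "H x = H (Suc y)" using z'[of "Suc x"] x step[of x] y by force
    then have "M x y" using x y z' by (auto simp: M_def)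
    then show ?thesis ..
  qed
  define mt where "mt x = (if x \<in> {1..N} then if \<exists>y. M (x - 1) y then Suc (SOME y. M (x - 1) y)
     else Suc (SOME y. M y (x - 1)) else x)" for x
  \<comment> \<open>The sign can change only at 0, so it is enough to decorate the arcs that leave 0
    downwards.\<close>
  define dc where "dc x \<longleftrightarrow> (\<exists>u v. M u v \<and> (x = Suc u \<or> x = Suc v) \<and> P u = 0 \<and> P (Suc u) < 0)" for x
  have mtM: "mt (Suc u) = Suc v \<and> mt (Suc v) = Suc u" if "M u v" for u v
  proof -
    have r: "Suc u \<in> {1..N}" "Suc v \<in> {1..N}" using that by (auto simp: M_def)
    have "\<not> M v w" for w using Mup[of v w] Mdown[OF that] by auto
    moreover have "(SOME y. M u y) = v" "(SOME y. M y v) = u"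
      using that Mr Ml by (auto intro!: some_equality)
    ultimately show ?thesis using r that by (auto simp: mt_def)
  qed
  have no: "\<not> M w u" "\<not> M v w" if "M u v" for u v w
    using Mup(1)[OF that] Mdown(1)[OF that] Mup(1)[of v w] Mdown(1)[of w u] by auto
  have dcM: "dc (Suc u) \<longleftrightarrow> P u = 0 \<and> P (Suc u) < 0" "dc (Suc v) \<longleftrightarrow> P u = 0 \<and> P (Suc u) < 0" if "M u v" for u v
  proof -
    have "M u w \<Longrightarrow> w = v" "M w v \<Longrightarrow> w = u" for w using that Ml Mr by blast+
    then have e: "M u' v' \<and> (Suc u = Suc u' \<or> Suc u = Suc v') \<longleftrightarrow> u' = u \<and> v' = v"
      "M u' v' \<and> (Suc v = Suc u' \<or> Suc v = Suc v') \<longleftrightarrow> u' = u \<and> v' = v" for u' v'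
      using that no[OF that] by blast+
    show "dc (Suc u) \<longleftrightarrow> P u = 0 \<and> P (Suc u) < 0" "dc (Suc v) \<longleftrightarrow> P u = 0 \<and> P (Suc u) < 0"
      unfolding dc_def conj_assoc[symmetric] e by simp_all
  qed
  have part: "(\<exists>y. M x y) \<or> (\<exists>y. M y x)" if "x < N" for x
    using step[OF that] exR exL that by blast
  have cases: "x \<notin> {1..N} \<or> (\<exists>u v. M u v \<and> (x = Suc u \<and> mt x = Suc v \<or> x = Suc v \<and> mt x = Suc u))" for x
  proof (cases "x \<in> {1..N}")
    case True
    then have "x - 1 < N" "x = Suc (x - 1)" by auto
    then show ?thesis using part[of "x - 1"] mtM by metis
  qed simp
  have out: "x \<notin> {1..N} \<Longrightarrow> mt x = x" for x by (auto simp: mt_def)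
  define X where "X = Arcs mt dc"
  have X: "mate X = mt" "deco X = dc" by (simp_all add: X_def)
  have matching: "matching N X"
    unfolding matching_def X
  proof (intro conjI allI impI)
    fix x
    show "mt (mt x) = x" using cases[of x] mtM out by metis
    show "(mt x = x) = (x \<notin> {1..N})" using cases[of x] out by (auto simp: M_def)
    show "dc (mt x) = dc x"
    proof (cases "x \<in> {1..N}")
      case True
      then obtain u v where uv: "M u v" "x = Suc u \<and> mt x = Suc v \<or> x = Suc v \<and> mt x = Suc u" using cases by blast
      show ?thesis using uv(2) dcM[OF uv(1)] by auto
    qed (simp add: out)
    assume "dc x" then show "x \<in> {1..N}" by (auto simp: dc_def M_def)
  qed
  have arcM: "\<exists>u v. M u v \<and> x = Suc u \<and> mt x = Suc v" if "x < mt x" for x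
    using cases[of x] out[of x] that by (auto simp: M_def)
  have valid: "valid N X"
    unfolding valid_def
  proof (intro conjI allI impI matching; unfold X)
    fix x y assume xy: "x < y" "y < mt x" "mt x < mt y"
    obtain u v where u: "M u v" "x = Suc u" "mt x = Suc v" using arcM[of x] xy by auto
    obtain u' v' where u': "M u' v'" "y = Suc u'" "mt y = Suc v'" using arcM[of y] xy by auto
    \<comment> \<open>A crossing would put the level of the arc \<open>(u', v')\<close> both above
      and below that of \<open>(u, v)\<close>.\<close>
    have "H (Suc v) < H u'" using u u' xy by (auto simp: M_def)
    moreover have "H (Suc v') < H (Suc v)" using u u' xy by (auto simp: M_def)
    ultimately show False using u' by (simp add: M_def)
  next
    fix x w assume xw: "dc x" "w < x" "x < mt w"
    obtain u v where u: "M u v" "w = Suc u" "mt w = Suc v" using arcM[of w] xw by auto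
    obtain u' v' where u': "M u' v'" "x = Suc u' \<or> x = Suc v'" "P u' = 0" using xw(1) unfolding dc_def by blast
    have "H u' = 0" "H (Suc v') = 0" using u' by (auto simp: H_def M_def)
    moreover have "u < z \<Longrightarrow> z \<le> v \<Longrightarrow> H (Suc v) < H z" for z using u(1) by (auto simp: M_def)
    from this[of u'] this[of "Suc v'"] have "u < u' \<Longrightarrow> u' \<le> v \<Longrightarrow> H u' \<noteq> 0" 
      "u < Suc v' \<Longrightarrow> Suc v' \<le> v \<Longrightarrow> H (Suc v') \<noteq> 0" by auto
    ultimately show False using u(2,3) u'(2) xw by auto
  qed
  have height: "height X j = H j" if "j \<le> N" for j
    using that
  proof (induction j)
    case 0
    have "height X 0 = 0" using path_0[OF matching] abs_path[of X 0] by simp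
    then show ?case using H0 by simp
  next
    case (Suc j)
    have "Suc j < mate X (Suc j) \<longleftrightarrow> H (Suc j) = Suc (H j)"
    proof -
      obtain u v where uv: "M u v" "j = u \<and> mt (Suc j) = Suc v \<or> j = v \<and> mt (Suc j) = Suc u"
        using cases[of "Suc j"] Suc.prems by auto
      have "u < v" using uv(1) by (simp add: M_def)
      then show ?thesis using uv(2) Mup(1)[OF uv(1)] Mdown(1)[OF uv(1)] unfolding X by auto
    qed
    moreover have "height X j = H j" using Suc by simp
    ultimately show ?case using height_Suc[OF matching Suc.prems] step[of j] Suc.prems
      by (cases "H (Suc j) = Suc (H j)") simp_all
  qed
  have marked: "marked X j \<longleftrightarrow> P j < 0" if j: "j \<le> N" for j
  proof
    assume "marked X j"
    then obtain x where x: "x \<le> j" "j < mt x" "dc x" by (auto simp: marked_def opened_def X)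
    obtain u v where u: "M u v" "x = Suc u" "mt x = Suc v" using arcM[of x] x by auto
    have "P (Suc u) < 0" using x(3) dcM[OF u(1)] u(2) by simp
    moreover have "P z \<noteq> 0" if "Suc u \<le> z" "z \<le> j" for z
    proof -
      have "H (Suc v) < H z" using u x that by (auto simp: M_def)
      then show ?thesis by (auto simp: H_def)
    qed
    moreover have "Suc u \<le> j" using x u by simp
    ultimately show "P j < 0" using sign_constant[where P = P and N = N and a = "Suc u" and b = j, OF st _ j] by blast
  next
    assume neg: "P j < 0"
    \<comment> \<open>The arc opening at the last visit to 0 before \<open>j\<close> is the
      decorated one: the path keeps its sign from there to \<open>j\<close>, and this arc closes
      only at a visit to 0.\<close>
    define u where "u = (GREATEST z. z < j \<and> H z = 0)"
    have "0 < j \<and> H 0 = 0" using neg P0 H0 by (cases j) simp_all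
    then have u: "u < j \<and> H u = 0"
      unfolding u_def by (rule GreatestI_nat[where P = "\<lambda>z. z < j \<and> H z = 0" and b = j]) simp
    have z: "P z \<noteq> 0" if "u < z" "z \<le> j" for z
    proof (cases "z = j")
      case False
      then have "\<not> (z < j \<and> H z = 0)"
        using Greatest_le_nat[of "\<lambda>z. z < j \<and> H z = 0" z j] that unfolding u_def[symmetric] by force
      then show ?thesis using False that by (simp add: H_def)
    qed (use neg in simp)
    have neg': "P (Suc u) < 0" using sign_constant[where P = P and N = N and a = "Suc u" and b = j, OF st _ j] z u neg by auto
    have "H (Suc u) = Suc (H u)" using neg' u step[of u] j by (auto simp: H_def)
    then obtain v where v: "M u v" using exR[of u] u j by auto
    have "j \<le> v"
    proof (rule ccontr)
      assume "\<not> j \<le> v"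
      then have "P (Suc v) \<noteq> 0" using z[of "Suc v"] v by (auto simp: M_def)
      then show False using v u by (auto simp: M_def H_def)
    qed
    moreover have "dc (Suc u)" using dcM[OF v] neg' u by (simp add: H_def)
    ultimately show "marked X j" using mtM[OF v] u unfolding marked_def opened_def X
      by (intro bexI[of _ "Suc u"]) simp_all
  qed
  have "path X j = P j" if "j \<le> N" for j
    using height[OF that] marked[OF that] by (simp add: path_def H_def)
  then show ?thesis using valid by blast
qed

section \<open>Blob diagrams as chord diagrams\<close>

definition node_at :: "nat \<Rightarrow> nat \<Rightarrow> node" where
  "node_at n x = (if x \<le> n then Top x else Bot (2 * n + 1 - x))"

definition diagram_of :: "nat \<Rightarrow> arcs \<Rightarrow> diagram" where
  "diagram_of n X = Diagram ((\<lambda>x. {node_at n x, node_at n (mate X x)}) ` {1..2 * n})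
     ((\<lambda>x. {node_at n x, node_at n (mate X x)}) ` {x \<in> {1..2 * n}. deco X x})"

lemma node_at_inj: "x \<in> {1..2 * n} \<Longrightarrow> y \<in> {1..2 * n} \<Longrightarrow> node_at n x = node_at n y \<longleftrightarrow> x = y"
  by (auto simp: node_at_def)

lemma boundary_pos_node_at: "x \<in> {1..2 * n} \<Longrightarrow> boundary_pos n (node_at n x) = x"
  by (auto simp: node_at_def)

lemma node_at_boundary_pos: "u \<in> nodes n \<Longrightarrow> node_at n (boundary_pos n u) = u \<and> boundary_pos n u \<in> {1..2 * n}"
  by (auto simp: nodes_def node_at_def)

lemma node_at_nodes:
  assumes "x \<in> {1..2 * n}" shows "node_at n x \<in> nodes n"
proof (cases "x \<le> n")
  case False
  then have "2 * n + 1 - x \<in> {1..n}" using assms by auto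
  then show ?thesis using False unfolding nodes_def node_at_def by simp
qed (use assms in \<open>simp add: nodes_def node_at_def\<close>)

lemma nodes_node_at: "nodes n = node_at n ` {1..2 * n}"
  using node_at_boundary_pos node_at_nodes by (metis (no_types, lifting) image_eqI subsetI subset_antisym image_subsetI)

lemma mate_in: "matching N X \<Longrightarrow> x \<in> {1..N} \<Longrightarrow> mate X x \<in> {1..N}"
  using mate_range by blast

lemma line_mem:
  assumes "matching (2 * n) X" "x \<in> {1..2 * n}" "y \<in> {1..2 * n}"
  shows "{node_at n x, node_at n y} \<in> lines (diagram_of n X) \<longleftrightarrow> y = mate X x"
    "{node_at n x, node_at n y} \<in> blobs (diagram_of n X) \<longleftrightarrow> y = mate X x \<and> deco X x"
proof -
  have eq: "{node_at n x, node_at n y} = {node_at n z, node_at n (mate X z)} \<longleftrightarrow> x = z \<and> y = mate X z \<or> x = mate X z \<and> y = z"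
    if "z \<in> {1..2 * n}" for z
    using that assms mate_in[OF assms(1) that] by (auto simp: doubleton_eq_iff node_at_inj)
  have "{node_at n x, node_at n y} \<in> lines (diagram_of n X) \<longleftrightarrow> (\<exists>z\<in>{1..2 * n}. {node_at n x, node_at n y} = {node_at n z, node_at n (mate X z)})"
    by (auto simp: diagram_of_def)
  also have "\<dots> \<longleftrightarrow> (\<exists>z\<in>{1..2 * n}. x = z \<and> y = mate X z \<or> x = mate X z \<and> y = z)"
    using eq by (intro bex_cong) auto
  finally show "{node_at n x, node_at n y} \<in> lines (diagram_of n X) \<longleftrightarrow> y = mate X x"
    using assms matchingD(1)[OF assms(1)] by metis
  have "{node_at n x, node_at n y} \<in> blobs (diagram_of n X) \<longleftrightarrow>
      (\<exists>z\<in>{1..2 * n}. deco X z \<and> {node_at n x, node_at n y} = {node_at n z, node_at n (mate X z)})"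
    by (auto simp: diagram_of_def)
  also have "\<dots> \<longleftrightarrow> (\<exists>z\<in>{1..2 * n}. deco X z \<and> (x = z \<and> y = mate X z \<or> x = mate X z \<and> y = z))"
    using eq by (intro bex_cong) auto
  finally show "{node_at n x, node_at n y} \<in> blobs (diagram_of n X) \<longleftrightarrow> y = mate X x \<and> deco X x"
    using assms matchingD(1,3)[OF assms(1)] by metis
qed

lemma line_cases:
  assumes "matching (2 * n) X" "{u, v} \<in> lines (diagram_of n X)"
  obtains x where "x \<in> {1..2 * n}" "u = node_at n x" "v = node_at n (mate X x)"
proof -
  obtain z where z: "z \<in> {1..2 * n}" "{u, v} = {node_at n z, node_at n (mate X z)}" using assms(2) by (auto simp: diagram_of_def)
  then consider "u = node_at n z" "v = node_at n (mate X z)" | "v = node_at n z" "u = node_at n (mate X z)"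
    by (auto simp: doubleton_eq_iff)
  then show ?thesis
  proof cases
    case 1 then show ?thesis using that z by blast
  next
    case 2 then show ?thesis using that[of "mate X z"] mate_in[OF assms(1) z(1)] matchingD(1)[OF assms(1)] by simp
  qed
qed

lemma diagram_of_bridge:
  assumes v: "valid (2 * n) X" shows "bridge n (lines (diagram_of n X))"
proof -
  note mt = valid_matching[OF v]
  have L: "lines (diagram_of n X) = (\<lambda>x. {node_at n x, node_at n (mate X x)}) ` {1..2 * n}" by (simp add: diagram_of_def)
  have "partition_on (nodes n) (lines (diagram_of n X))"
  proof (rule partition_onI)
    show "\<Union> (lines (diagram_of n X)) = nodes n"
      unfolding L nodes_node_at using mate_in[OF mt] by auto
    show "{} \<notin> lines (diagram_of n X)" unfolding L by auto
    fix l l' assume l: "l \<in> lines (diagram_of n X)" "l' \<in> lines (diagram_of n X)" "l \<noteq> l'"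
    then obtain x y where xy: "x \<in> {1..2 * n}" "l = {node_at n x, node_at n (mate X x)}" "y \<in> {1..2 * n}" "l' = {node_at n y, node_at n (mate X y)}"
      unfolding L by blast
    have "x \<noteq> y" "x \<noteq> mate X y" using l xy matchingD(1)[OF mt, of y] by auto
    moreover have "mate X x \<noteq> y" "mate X x \<noteq> mate X y"
      using \<open>x \<noteq> y\<close> \<open>x \<noteq> mate X y\<close> matchingD(1)[OF mt] by metis+
    ultimately show "disjnt l l'"
      using xy mate_in[OF mt] by (simp add: node_at_inj disjnt_def)
  qed
  moreover have "card l = 2" if l: "l \<in> lines (diagram_of n X)" for l
  proof -
    obtain x where x: "x \<in> {1..2 * n}" "l = {node_at n x, node_at n (mate X x)}" using l unfolding L by blast
    have "node_at n x \<noteq> node_at n (mate X x)" using x node_at_inj[OF x(1) mate_in[OF mt x(1)]] matchingD(2)[OF mt, of x] by auto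
    then show ?thesis using x by simp
  qed
  moreover have "noncrossing n (lines (diagram_of n X))"
    unfolding noncrossing_def
  proof (clarify)
    fix w x y z
    assume l: "{w, y} \<in> lines (diagram_of n X)" "{x, z} \<in> lines (diagram_of n X)"
      and lt: "boundary_pos n w < boundary_pos n x" "boundary_pos n x < boundary_pos n y" "boundary_pos n y < boundary_pos n z"
    obtain a where a: "a \<in> {1..2 * n}" "w = node_at n a" "y = node_at n (mate X a)" using line_cases[OF mt l(1)] by blast
    obtain b where b: "b \<in> {1..2 * n}" "x = node_at n b" "z = node_at n (mate X b)" using line_cases[OF mt l(2)] by blast
    show False
      using lt a b mate_in[OF mt a(1)] mate_in[OF mt b(1)] noncross[OF v, of a b] by (simp add: boundary_pos_node_at)
  qed
  ultimately show ?thesis by (simp add: bridge_def)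
qed

lemma covers_nested:
  assumes mt: "matching (2 * n) X" and c: "covers (lines (diagram_of n X)) l' l"
    and l': "l' = {node_at n w, node_at n (mate X w)}" "w \<in> {1..2 * n}"
    and l: "l = {node_at n x, node_at n (mate X x)}" "x \<in> {1..2 * n}"
  shows "(w < x \<and> x < mate X w) \<or> (mate X w < x \<and> x < w)"
proof -
  note m = mate_in[OF mt l'(2)] mate_in[OF mt l(2)]
  from c consider (T) a1 b1 a2 b2 where "l' = {Top a1, Top b1}" "l = {Top a2, Top b2}" "a1 < a2" "a2 < b2" "b2 < b1"
    | (B) a1 b1 a2 b2 where "l' = {Bot a1, Bot b1}" "l = {Bot a2, Bot b2}" "a1 < a2" "a2 < b2" "b2 < b1"
    | (V) "right_of l l'" by (auto simp: covers_def)
  then show ?thesis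
  proof cases
    case T
    then show ?thesis using l l' m by (auto simp: doubleton_eq_iff node_at_def split: if_splits)
  next
    case B
    then show ?thesis using l l' m by (auto simp: doubleton_eq_iff node_at_def split: if_splits)
  next
    case V
    then obtain i j where ij: "l' = {Top i, Bot j}" "\<And>k. Top k \<in> l \<Longrightarrow> i < k" "\<And>k. Bot k \<in> l \<Longrightarrow> j < k"
      by (auto simp: right_of_def)
    have "(x \<le> n \<longrightarrow> i < x) \<and> (n < x \<longrightarrow> j < 2 * n + 1 - x)"
      using ij(2)[of x] ij(3)[of "2 * n + 1 - x"] l by (auto simp: node_at_def)
    then show ?thesis using ij(1) l' m l(2) by (auto simp: doubleton_eq_iff node_at_def split: if_splits)
  qed
qed

text \<open>Among the vertical lines only the leftmost one covers anything, which is what the last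
  hypothesis secures for a vertical \<open>w\<close>; a horizontal line only encloses lines of its
  own edge.\<close>

lemma nested_covers:
  assumes mt: "matching (2 * n) X" and o: "w < x" "x < mate X x" "mate X x < mate X w" "w \<in> {1..2 * n}"
    and lm: "w \<le> n \<Longrightarrow> n < mate X w \<Longrightarrow> (\<And>u. u \<le> n \<Longrightarrow> n < mate X u \<Longrightarrow> w \<le> u)"
  shows "covers (lines (diagram_of n X)) {node_at n w, node_at n (mate X w)} {node_at n x, node_at n (mate X x)}"
proof -
  note mw = mate_in[OF mt o(4)]
  have x: "x \<in> {1..2 * n}" using o mw by auto
  have l: "{node_at n w, node_at n (mate X w)} \<in> lines (diagram_of n X)" "{node_at n x, node_at n (mate X x)} \<in> lines (diagram_of n X)"
    using o(4) x by (auto simp: diagram_of_def)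
  consider "mate X w \<le> n" | "n < w" | "w \<le> n" "n < mate X w" by linarith
  then show ?thesis
  proof cases
    case 1
    then have "{node_at n w, node_at n (mate X w)} = {Top w, Top (mate X w)}" "{node_at n x, node_at n (mate X x)} = {Top x, Top (mate X x)}"
      using o by (simp_all add: node_at_def)
    then show ?thesis using l o unfolding covers_def by blast
  next
    case 2
    then have "{node_at n w, node_at n (mate X w)} = {Bot (2 * n + 1 - mate X w), Bot (2 * n + 1 - w)}"
      "{node_at n x, node_at n (mate X x)} = {Bot (2 * n + 1 - mate X x), Bot (2 * n + 1 - x)}"
      using o by (simp_all add: node_at_def insert_commute)
    moreover have "2 * n + 1 - mate X w < 2 * n + 1 - mate X x" "2 * n + 1 - mate X x < 2 * n + 1 - x"
      "2 * n + 1 - x < 2 * n + 1 - w" using o mw by auto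
    ultimately show ?thesis using l unfolding covers_def by blast
  next
    case 3
    then have e: "{node_at n w, node_at n (mate X w)} = {Top w, Bot (2 * n + 1 - mate X w)}" by (simp add: node_at_def)
    have "leftmost_vertical (lines (diagram_of n X)) {Top w, Bot (2 * n + 1 - mate X w)}"
      unfolding leftmost_vertical_def
    proof (intro conjI exI allI impI)
      show "{Top w, Bot (2 * n + 1 - mate X w)} \<in> lines (diagram_of n X)" using l e by simp
      fix i' j' assume "{Top i', Bot j'} \<in> lines (diagram_of n X)"
      then obtain u where u: "u \<in> {1..2 * n}" "Top i' = node_at n u" "Bot j' = node_at n (mate X u)" by (rule line_cases[OF mt])
      then have "i' = u" "u \<le> n" "n < mate X u" by (auto simp: node_at_def split: if_splits)
      then show "w \<le> i'" using lm 3 by blast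
    qed simp
    moreover have "right_of {node_at n x, node_at n (mate X x)} {Top w, Bot (2 * n + 1 - mate X w)}"
      unfolding right_of_def
      by (intro exI[of _ w] exI[of _ "2 * n + 1 - mate X w"]) (use o mw in \<open>auto simp: node_at_def split: if_splits\<close>)
    ultimately show ?thesis using l e unfolding covers_def by simp
  qed
qed

lemma diagram_of_blob_diagram:
  assumes v: "valid (2 * n) X" shows "diagram_of n X \<in> blob_diagrams n"
proof -
  note mt = valid_matching[OF v]
  have "\<not> covers (lines (diagram_of n X)) l' l" if l: "l \<in> blobs (diagram_of n X)" for l l'
  proof
    assume c: "covers (lines (diagram_of n X)) l' l"
    then have "l' \<in> lines (diagram_of n X)" by (simp add: covers_def)
    then obtain w where w: "w \<in> {1..2 * n}" "l' = {node_at n w, node_at n (mate X w)}" by (auto simp: diagram_of_def)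
    obtain x where x: "x \<in> {1..2 * n}" "l = {node_at n x, node_at n (mate X x)}" "deco X x" using l by (auto simp: diagram_of_def)
    show False using covers_nested[OF mt c w(2,1) x(2,1)] outermost[OF v x(3), of w] outermost[OF v x(3), of "mate X w"]
        matchingD(1)[OF mt, of w] by auto
  qed
  moreover have "blobs (diagram_of n X) \<subseteq> lines (diagram_of n X)" by (auto simp: diagram_of_def)
  ultimately show ?thesis using diagram_of_bridge[OF v] by (auto simp: blob_diagrams_def)
qed

lemma diagram_of_surj:
  assumes D: "D \<in> blob_diagrams n"
  shows "\<exists>X. valid (2 * n) X \<and> diagram_of n X = D"
proof -
  have P: "partition_on (nodes n) (lines D)" and c2: "\<And>l. l \<in> lines D \<Longrightarrow> card l = 2"
    and nc: "noncrossing n (lines D)" and bl: "blobs D \<subseteq> lines D"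
    and unc: "\<And>l l'. l \<in> blobs D \<Longrightarrow> \<not> covers (lines D) l' l"
    using D by (auto simp: blob_diagrams_def bridge_def)
  have ex: "\<exists>!y. y \<in> {1..2 * n} \<and> y \<noteq> x \<and> {node_at n x, node_at n y} \<in> lines D" if x: "x \<in> {1..2 * n}" for x
  proof -
    have "node_at n x \<in> \<Union> (lines D)" using partition_onD1[OF P] node_at_nodes[OF x] by simp
    then obtain l where l: "l \<in> lines D" "node_at n x \<in> l" by blast
    then obtain v where v: "l = {node_at n x, v}" "v \<noteq> node_at n x" using c2[OF l(1)]
      by (metis card_2_iff doubleton_eq_iff insertE singletonD insert_commute)
    have "v \<in> nodes n" using l v partition_onD1[OF P] by blast
    then obtain y where y: "y \<in> {1..2 * n}" "v = node_at n y" unfolding nodes_node_at by blast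
    show ?thesis
    proof (rule ex1I[of _ y])
      show "y \<in> {1..2 * n} \<and> y \<noteq> x \<and> {node_at n x, node_at n y} \<in> lines D" using y v l by auto
      fix z assume z: "z \<in> {1..2 * n} \<and> z \<noteq> x \<and> {node_at n x, node_at n z} \<in> lines D"
      then have "{node_at n x, node_at n z} = l"
        using partition_onD2[OF P] l unfolding disjoint_def by (metis IntI empty_iff insertI1)
      then show "z = y" using v y z by (auto simp: doubleton_eq_iff node_at_inj)
    qed
  qed
  define p where "p x = (if x \<in> {1..2 * n} then THE y. y \<in> {1..2 * n} \<and> y \<noteq> x \<and> {node_at n x, node_at n y} \<in> lines D else x)" for x
  define d where "d x \<longleftrightarrow> x \<in> {1..2 * n} \<and> {node_at n x, node_at n (p x)} \<in> blobs D" for x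
  have p: "p x \<in> {1..2 * n}" "p x \<noteq> x" "{node_at n x, node_at n (p x)} \<in> lines D" if "x \<in> {1..2 * n}" for x
    using theI'[OF ex[OF that]] that by (auto simp: p_def)
  have pI: "p x = y" if "x \<in> {1..2 * n}" "y \<in> {1..2 * n}" "y \<noteq> x" "{node_at n x, node_at n y} \<in> lines D" for x y
    using ex[OF that(1)] p[OF that(1)] that by blast
  have out: "x \<notin> {1..2 * n} \<Longrightarrow> p x = x" for x by (auto simp: p_def)
  have inv: "p (p x) = x" for x
  proof (cases "x \<in> {1..2 * n}")
    case True
    then show ?thesis using p[OF True] by (intro pI) (auto simp: insert_commute)
  qed (simp add: out)
  define X where "X = Arcs p d"
  have X: "mate X = p" "deco X = d" by (simp_all add: X_def)
  have mt: "matching (2 * n) X"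
    unfolding matching_def X
  proof (intro conjI allI impI)
    fix x
    show "p (p x) = x" by (rule inv)
    show "(p x = x) = (x \<notin> {1..2 * n})" using p(2) out by blast
    show "d (p x) = d x"
    proof (cases "x \<in> {1..2 * n}")
      case True
      then show ?thesis using p(1)[OF True] by (simp add: d_def inv insert_commute)
    qed (simp add: out)
    assume "d x" then show "x \<in> {1..2 * n}" by (simp add: d_def)
  qed
  have mkX: "diagram_of n X = D"
  proof (rule diagram.expand)
    have lin: "\<exists>x\<in>{1..2 * n}. l = {node_at n x, node_at n (p x)}" if l: "l \<in> lines D" for l
    proof -
      obtain u v where uv: "l = {u, v}" "u \<noteq> v" using c2[OF l] by (auto simp: card_2_iff)
      then have "u \<in> nodes n" "v \<in> nodes n" using l partition_onD1[OF P] by blast+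
      then obtain x y where xy: "x \<in> {1..2 * n}" "u = node_at n x" "y \<in> {1..2 * n}" "v = node_at n y" unfolding nodes_node_at by blast
      then have "p x = y" using uv l by (intro pI) auto
      then show ?thesis using xy uv by blast
    qed
    have "lines (diagram_of n X) = lines D" using lin p(3) by (auto simp: diagram_of_def X)
    moreover have "blobs (diagram_of n X) = blobs D"
      using lin bl by (fastforce simp: diagram_of_def X d_def)
    ultimately show "lines (diagram_of n X) = lines D \<and> blobs (diagram_of n X) = blobs D" by simp
  qed
  have ncX: False if xy: "x < y" "y < p x" "p x < p y" for x y
  proof -
    have "x \<in> {1..2 * n}" using xy out[of x] by force
    moreover have "y \<in> {1..2 * n}" using xy out[of y] by force
    ultimately show False
      using nc p[of x] p[of y] xy unfolding noncrossing_def by (metis boundary_pos_node_at)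
  qed
  have omo: False if dx: "d x" "x < p x" and w: "w < x" "p x < p w" for x w
  proof -
    have xr: "x \<in> {1..2 * n}" using dx by (simp add: d_def)
    have wr: "w \<in> {1..2 * n}" using w dx out[of w] by force
    \<comment> \<open>A vertical line around \<open>x\<close> need not be the leftmost one, but then
      the leftmost encloses it and covers the line of \<open>x\<close> as well.\<close>
    define w0 where "w0 = (if w \<le> n \<and> n < p w then LEAST u. u \<le> n \<and> n < p u else w)"
    have w0: "w0 \<le> w \<and> p w \<le> p w0 \<and> (w0 \<le> n \<longrightarrow> n < p w0 \<longrightarrow> (\<forall>u. u \<le> n \<longrightarrow> n < p u \<longrightarrow> w0 \<le> u))"
    proof (cases "w \<le> n \<and> n < p w")
      case True
      then have a: "w0 \<le> n \<and> n < p w0" "w0 \<le> w" unfolding w0_def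
        using LeastI[of "\<lambda>u. u \<le> n \<and> n < p u" w] Least_le[of "\<lambda>u. u \<le> n \<and> n < p u" w] by auto
      have "w0 \<le> u" if "u \<le> n" "n < p u" for u
        unfolding w0_def using True that by (auto intro: Least_le)
      moreover have "p w \<le> p w0" using ncX[of w0 w] a True by (cases "w0 = w"; cases "p w0 < p w") auto
      ultimately show ?thesis using a by blast
    qed (auto simp: w0_def)
    have "w0 \<in> {1..2 * n}" using w0 w dx wr out[of w0] by force
    then have "covers (lines (diagram_of n X)) {node_at n w0, node_at n (mate X w0)} {node_at n x, node_at n (mate X x)}"
      using w0 w dx by (intro nested_covers[OF mt]) (auto simp: X)
    then show False using unc[of "{node_at n x, node_at n (p x)}"] dx unfolding mkX X by (auto simp: d_def)
  qed
  have "valid (2 * n) X"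
    unfolding valid_def X
  proof (intro conjI allI impI mt)
    fix x y assume "x < y" "y < p x" "p x < p y" then show False by (rule ncX)
  next
    fix x w assume xw: "d x" "w < x" "x < p w"
    have ne: "p x \<noteq> p w" "p x \<noteq> w" "p x \<noteq> x" using xw inv[of x] inv[of w] p(2)[of x] by (auto simp: d_def)
    have b: "w < p x" "p x < p w" using ncX[of w x] ncX[of "p x" w] xw ne inv[of x] by force+
    have "d (p x)" using matchingD(3)[OF mt, of x] xw by (simp add: X)
    then show False using omo[of x w] omo[of "p x" w] xw b ne inv[of x] by (cases "x < p x") auto
  qed
  then show ?thesis using mkX by blast
qed

lemma diagram_of_inj:
  assumes "matching (2 * n) X" "matching (2 * n) Y" "diagram_of n X = diagram_of n Y" shows "X = Y"
proof (rule arcs_eqI)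
  fix x
  show m: "mate X x = mate Y x"
  proof (cases "x \<in> {1..2 * n}")
    case True
    then show ?thesis using line_mem(1)[OF assms(1) True mate_in[OF assms(1) True]] line_mem(1)[OF assms(2) True mate_in[OF assms(1) True]] assms(3) by simp
  qed (use matchingD(2)[OF assms(1), of x] matchingD(2)[OF assms(2), of x] in auto)
  show "deco X x = deco Y x"
  proof (cases "x \<in> {1..2 * n}")
    case True
    then show ?thesis using line_mem(2)[OF assms(1) True mate_in[OF assms(1) True]] line_mem(2)[OF assms(2) True mate_in[OF assms(1) True]] assms(3) m by simp
  qed (use matchingD(4)[OF assms(1), of x] matchingD(4)[OF assms(2), of x] in auto)
qed

section \<open>Tableaux\<close>

lemma decorated_arc_over:
  assumes v: "valid N X" and x: "x \<in> opened X j" and mk: "marked X j"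
  obtains w where "w \<le> x" "deco X w" "w = x \<or> w < x \<and> mate X x < mate X w" "w \<in> opened X j"
proof -
  obtain w where w: "w \<in> opened X j" "deco X w" using mk by (auto simp: marked_def)
  have "w \<le> x" using opened_decorated_least[OF v w x] .
  moreover have "mate X x < mate X w" if "w \<noteq> x"
  proof -
    have "mate X w \<noteq> mate X x" using that mate_inj[OF valid_matching[OF v]] by simp
    moreover have "w < x" "x < mate X w" using w x that \<open>w \<le> x\<close> by (simp_all add: opened_def)
    ultimately show ?thesis using noncross[OF v, of w x] by (cases "mate X w < mate X x") auto
  qed
  ultimately show ?thesis using that[of w] w by force
qed

text \<open>An arc open together with a decorated one is either that arc or enclosed by it. So the
  covered lines are exactly those that open into a negative value of the path.\<close>

lemma covered_line_iff:
  assumes v: "valid (2 * n) X" and o: "x \<in> {1..2 * n}" "x < mate X x"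
  shows "covered_line (diagram_of n X) {node_at n x, node_at n (mate X x)} \<longleftrightarrow> marked X x"
proof
  note mt = valid_matching[OF v]
  have xo: "x \<in> opened X x" using o by (simp add: opened_def)
  {
    assume "covered_line (diagram_of n X) {node_at n x, node_at n (mate X x)}"
    then consider "{node_at n x, node_at n (mate X x)} \<in> blobs (diagram_of n X)" |
      l' where "l' \<in> blobs (diagram_of n X)" "covers (lines (diagram_of n X)) l' {node_at n x, node_at n (mate X x)}"
      by (auto simp: covered_line_def)
    then show "marked X x"
    proof cases
      case 1
      then show ?thesis using line_mem(2)[OF mt o(1) mate_in[OF mt o(1)]] xo by (auto simp: marked_def)
    next
      case (2 l')
      obtain w where w: "w \<in> {1..2 * n}" "deco X w" "l' = {node_at n w, node_at n (mate X w)}" using 2(1) by (auto simp: diagram_of_def)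
      have "(w < x \<and> x < mate X w) \<or> (mate X w < x \<and> x < w)"
        by (rule covers_nested[OF mt 2(2) w(3,1) refl o(1)])
      then have "w \<in> opened X x \<or> mate X w \<in> opened X x" using matchingD(1)[OF mt, of w] by (auto simp: opened_def)
      then show ?thesis using w(2) matchingD(3)[OF mt, of w] by (auto simp: marked_def)
    qed
  }
  assume "marked X x"
  then obtain w where w: "deco X w" "w = x \<or> w < x \<and> mate X x < mate X w" using decorated_arc_over[OF v xo] by metis
  have wr: "w \<in> {1..2 * n}" using matchingD(4)[OF mt w(1)] .
  have wb: "{node_at n w, node_at n (mate X w)} \<in> blobs (diagram_of n X)" using line_mem(2)[OF mt wr mate_in[OF mt wr]] w by simp
  show "covered_line (diagram_of n X) {node_at n x, node_at n (mate X x)}"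
  proof (cases "w = x")
    case False
    then have wx: "w < x" "mate X x < mate X w" using w by auto
    have "w \<le> u" if "w \<le> n" "n < mate X w" "u \<le> n" "n < mate X u" for u
      using outermost[OF v w(1), of u] that by force
    then have "covers (lines (diagram_of n X)) {node_at n w, node_at n (mate X w)} {node_at n x, node_at n (mate X x)}"
      using wx o wr by (intro nested_covers[OF mt]) auto
    then show ?thesis using wb by (auto simp: covered_line_def)
  qed (use wb in \<open>simp add: covered_line_def\<close>)
qed

text \<open>For a right end the sign has to be read one position earlier: once the decorated arc
  itself has closed, the path is back at 0.\<close>

lemma covered_line_closer:
  assumes v: "valid (2 * n) X" and o: "x \<in> {1..2 * n}" "mate X x < x"
  shows "covered_line (diagram_of n X) {node_at n (mate X x), node_at n x} \<longleftrightarrow> marked X (x - 1)"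
proof -
  note mt = valid_matching[OF v]
  note m = mate_in[OF mt o(1)] matchingD(1)[OF mt, of x]
  have "covered_line (diagram_of n X) {node_at n (mate X x), node_at n (mate X (mate X x))} \<longleftrightarrow> marked X (mate X x)"
    using m o by (intro covered_line_iff[OF v]) auto
  moreover have "marked X (mate X x) \<longleftrightarrow> marked X (x - 1)"
  proof
    assume mk: "marked X (mate X x)"
    have "mate X x \<in> opened X (mate X x)" using m o by (simp add: opened_def)
    then obtain w where "w \<le> mate X x" "deco X w" "w = mate X x \<or> w < mate X x \<and> mate X (mate X x) < mate X w"
      using decorated_arc_over[OF v _ mk] by metis
    then show "marked X (x - 1)" using m o unfolding marked_def by (intro bexI[of _ w]) (auto simp: opened_def)
  next
    assume mk: "marked X (x - 1)"
    have "mate X x \<in> opened X (x - 1)" using m o by (auto simp: opened_def)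
    then obtain w where "w \<le> mate X x" "deco X w" "w = mate X x \<or> w < mate X x \<and> mate X (mate X x) < mate X w"
      using decorated_arc_over[OF v _ mk] by metis
    then show "marked X (mate X x)" using m o unfolding marked_def by (intro bexI[of _ w]) (auto simp: opened_def)
  qed
  ultimately show ?thesis using m by simp
qed

text \<open>The arcs open in the middle are the vertical lines; a decorated one among them lies
  inside no other and is thus the leftmost.\<close>

lemma leftmost_decorated_iff:
  assumes v: "valid (2 * n) X"
  shows "leftmost_decorated (diagram_of n X) \<longleftrightarrow> marked X n"
proof
  note mt = valid_matching[OF v]
  {
    assume "leftmost_decorated (diagram_of n X)"
    then obtain i j where ij: "{Top i, Bot j} \<in> blobs (diagram_of n X)" by (auto simp: leftmost_decorated_def leftmost_vertical_def)
    then obtain x where x: "x \<in> {1..2 * n}" "deco X x" "{Top i, Bot j} = {node_at n x, node_at n (mate X x)}" by (auto simp: diagram_of_def)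
    then have "x \<le> n \<and> n < mate X x \<or> mate X x \<le> n \<and> n < x"
      by (auto simp: node_at_def doubleton_eq_iff split: if_splits)
    then have "x \<in> opened X n \<or> mate X x \<in> opened X n" using matchingD(1)[OF mt, of x] by (auto simp: opened_def)
    then show "marked X n" using x(2) matchingD(3)[OF mt, of x] by (auto simp: marked_def)
  }
  assume "marked X n"
  then obtain w where w: "w \<in> opened X n" "deco X w" by (auto simp: marked_def)
  have wr: "w \<in> {1..2 * n}" using matchingD(4)[OF mt w(2)] .
  have wn: "w \<le> n" "n < mate X w" using w by (auto simp: opened_def)
  have wb: "{node_at n w, node_at n (mate X w)} \<in> blobs (diagram_of n X)" using line_mem(2)[OF mt wr mate_in[OF mt wr]] w by simp
  have e: "{node_at n w, node_at n (mate X w)} = {Top w, Bot (2 * n + 1 - mate X w)}" using wn by (simp add: node_at_def)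
  have "leftmost_vertical (lines (diagram_of n X)) {node_at n w, node_at n (mate X w)}"
    unfolding leftmost_vertical_def
  proof (intro conjI exI allI impI)
    show "{node_at n w, node_at n (mate X w)} \<in> lines (diagram_of n X)" using wr by (auto simp: diagram_of_def)
    show "{node_at n w, node_at n (mate X w)} = {Top w, Bot (2 * n + 1 - mate X w)}" by (rule e)
    fix i' j' assume "{Top i', Bot j'} \<in> lines (diagram_of n X)"
    then obtain u where u: "u \<in> {1..2 * n}" "Top i' = node_at n u" "Bot j' = node_at n (mate X u)" by (rule line_cases[OF mt])
    then have u': "i' = u" "u \<le> n" "n < mate X u" by (auto simp: node_at_def split: if_splits)
    show "w \<le> i'" using outermost[OF v w(2), of u] u' wn by force
  qed
  then show "leftmost_decorated (diagram_of n X)" using wb by (auto simp: leftmost_decorated_def)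
qed

definition up_top :: "nat \<Rightarrow> arcs \<Rightarrow> nat set" where
  "up_top n X = {i \<in> {1..n}. path X i - path X (i - 1) = 1}"

text \<open>The bottom edge is read from left to right, against the boundary order: node
  \<open>i\<close> contributes the backward step from \<open>2n + 1 - i\<close> to
  \<open>2n - i\<close>.\<close>

definition up_bot :: "nat \<Rightarrow> arcs \<Rightarrow> nat set" where
  "up_bot n X = {i \<in> {1..n}. path X (2 * n - i) - path X (2 * n + 1 - i) = 1}"

section \<open>Bitableaux and shapes read off from the path\<close>

lemma opener_or_closer:
  assumes "matching N X" "x \<in> {1..N}"
  shows "x < mate X x \<or> mate X x < x"
  using matchingD(2)[OF assms(1), of x] assms(2) by force

lemma step_opener:
  assumes "valid N X" "x \<in> {1..N}" "x < mate X x"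
  shows "path X x = path X (x - 1) + (if marked X x then - 1 else 1)"
  using path_Suc_opener[OF assms(1), of "x - 1"] assms by simp

lemma step_closer:
  assumes "valid N X" "x \<in> {1..N}" "mate X x < x"
  shows "path X x = path X (x - 1) + (if marked X (x - 1) then 1 else - 1)"
  using path_Suc_closer[OF assms(1), of "x - 1"] assms by simp

lemma path_step_abs:
  assumes "valid N X" "x \<in> {1..N}"
  shows "\<bar>path X x - path X (x - 1)\<bar> = 1"
  using opener_or_closer[OF valid_matching[OF assms(1)] assms(2)] step_opener[OF assms] step_closer[OF assms] by auto

text \<open>All vertical lines share the status of the leftmost one: either it is decorated and
  covers the others, or none of them is covered. Both ends of a vertical line can therefore be
  judged by the middle value of the path.\<close>

lemma vertical_marked:
  assumes v: "valid N X" and x: "x \<in> opened X n"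
  shows "marked X n \<longleftrightarrow> marked X x" "marked X n \<longleftrightarrow> marked X (mate X x - 1)"
proof -
  have xo: "x \<le> n" "n < mate X x" using x by (auto simp: opened_def)
  have *: "marked X k" if a: "marked X j" "x \<in> opened X j" "x \<in> opened X k" for j k
  proof -
    obtain w where "w \<le> x" "deco X w" "w = x \<or> w < x \<and> mate X x < mate X w"
      using decorated_arc_over[OF v a(2,1)] by metis
    then show ?thesis using a(3) unfolding marked_def by (intro bexI[of _ w]) (auto simp: opened_def)
  qed
  have "x \<in> opened X x" "x \<in> opened X (mate X x - 1)" using xo by (auto simp: opened_def)
  then show "marked X n \<longleftrightarrow> marked X x" "marked X n \<longleftrightarrow> marked X (mate X x - 1)" using * x by blast+
qed

lemma endpoints_top:
  assumes v: "valid (2 * n) X"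
  shows "left_endpoints (diagram_of n X) Top cov = {i \<in> {1..n}. i < mate X i \<and> mate X i \<le> n \<and> marked X i = cov}"
    "right_endpoints (diagram_of n X) Top cov = {i \<in> {1..n}. mate X i < i \<and> marked X (i - 1) = cov}"
proof -
  note mt = valid_matching[OF v]
  have l: "i < j \<and> {Top i, Top j} \<in> lines (diagram_of n X) \<longleftrightarrow> i \<in> {1..n} \<and> i < mate X i \<and> mate X i \<le> n \<and> j = mate X i" for i j
  proof
    assume a: "i < j \<and> {Top i, Top j} \<in> lines (diagram_of n X)"
    then obtain x where x: "x \<in> {1..2 * n}" "Top i = node_at n x" "Top j = node_at n (mate X x)" using line_cases[OF mt] by blast
    then show "i \<in> {1..n} \<and> i < mate X i \<and> mate X i \<le> n \<and> j = mate X i" using a by (auto simp: node_at_def split: if_splits)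
  next
    assume a: "i \<in> {1..n} \<and> i < mate X i \<and> mate X i \<le> n \<and> j = mate X i"
    then have "{node_at n i, node_at n j} \<in> lines (diagram_of n X)" using line_mem(1)[OF mt, of i j] by auto
    then show "i < j \<and> {Top i, Top j} \<in> lines (diagram_of n X)" using a by (simp add: node_at_def)
  qed
  have c: "covered_line (diagram_of n X) {Top i, Top (mate X i)} = marked X i" if "i \<in> {1..n}" "i < mate X i" "mate X i \<le> n" for i
    using covered_line_iff[OF v, of i] that by (simp add: node_at_def)
  show "left_endpoints (diagram_of n X) Top cov = {i \<in> {1..n}. i < mate X i \<and> mate X i \<le> n \<and> marked X i = cov}"
    unfolding left_endpoints_def conj_assoc[symmetric] l by (intro Collect_cong) (auto simp: c)
  have l': "i < j \<and> {Top i, Top j} \<in> lines (diagram_of n X) \<longleftrightarrow> j \<in> {1..n} \<and> mate X j < j \<and> i = mate X j" for i j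
    unfolding l using matchingD(1)[OF mt, of i] matchingD(1)[OF mt, of j] mate_in[OF mt, of j] by auto
  have c': "covered_line (diagram_of n X) {Top (mate X j), Top j} = marked X (j - 1)" if "j \<in> {1..n}" "mate X j < j" for j
    using covered_line_closer[OF v, of j] that by (simp add: node_at_def)
  show "right_endpoints (diagram_of n X) Top cov = {i \<in> {1..n}. mate X i < i \<and> marked X (i - 1) = cov}"
    unfolding right_endpoints_def conj_assoc[symmetric] l' by (intro Collect_cong) (auto simp: c')
qed

text \<open>Each branch of the definition lists the component without vertical ends. As vertical
  lines are covered precisely in the decorated branch, they fall into the component that the sign
  rule for horizontal left ends would give them, and in both branches the first row consists of the
  nodes where the path goes up.\<close>

lemma edge_tableau_top:
  assumes v: "valid (2 * n) X"
  shows "edge_tableau n Top (diagram_of n X) = (sorted_list_of_set (up_top n X), sorted_list_of_set ({1..n} - up_top n X))"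
proof -
  note mt = valid_matching[OF v]
  have st: "i \<in> up_top n X \<longleftrightarrow> (if i < mate X i then \<not> marked X i else marked X (i - 1))" if i: "i \<in> {1..n}" for i
    using opener_or_closer[OF mt, of i] step_opener[OF v, of i] step_closer[OF v, of i] i by (auto simp: up_top_def split: if_splits)
  have vm: "marked X n = marked X i" if "i \<in> {1..n}" "n < mate X i" for i
    using vertical_marked(1)[OF v, of i n] that by (auto simp: opened_def)
  show ?thesis
  proof (cases "marked X n")
    case True
    have "left_endpoints (diagram_of n X) Top False \<union> right_endpoints (diagram_of n X) Top True = up_top n X"
    proof (rule set_eqI)
      fix i
      show "i \<in> left_endpoints (diagram_of n X) Top False \<union> right_endpoints (diagram_of n X) Top True \<longleftrightarrow> i \<in> up_top n X"
      proof (cases "i \<in> {1..n}")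
        case i: True
        show ?thesis using st[OF i] vm[OF i] True i opener_or_closer[OF mt, of i] unfolding endpoints_top[OF v]
          by (cases "n < mate X i") auto
      qed (auto simp: endpoints_top[OF v] up_top_def)
    qed
    then show ?thesis using True by (simp add: edge_tableau_def leftmost_decorated_iff[OF v] Let_def)
  next
    case False
    have "right_endpoints (diagram_of n X) Top False \<union> left_endpoints (diagram_of n X) Top True = {1..n} - up_top n X"
    proof (rule set_eqI)
      fix i
      show "i \<in> right_endpoints (diagram_of n X) Top False \<union> left_endpoints (diagram_of n X) Top True \<longleftrightarrow> i \<in> {1..n} - up_top n X"
      proof (cases "i \<in> {1..n}")
        case i: True
        show ?thesis using st[OF i] vm[OF i] False i opener_or_closer[OF mt, of i] unfolding endpoints_top[OF v]
          by (cases "n < mate X i") auto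
      qed (auto simp: endpoints_top[OF v])
    qed
    moreover have "{1..n} - ({1..n} - up_top n X) = up_top n X" by (auto simp: up_top_def)
    ultimately show ?thesis using False by (simp add: edge_tableau_def leftmost_decorated_iff[OF v] Let_def)
  qed
qed

lemma endpoints_bot:
  assumes v: "valid (2 * n) X"
  shows "left_endpoints (diagram_of n X) Bot cov = {i \<in> {1..n}. mate X (2 * n + 1 - i) < 2 * n + 1 - i \<and> n < mate X (2 * n + 1 - i) \<and> marked X (2 * n - i) = cov}"
    "right_endpoints (diagram_of n X) Bot cov = {i \<in> {1..n}. 2 * n + 1 - i < mate X (2 * n + 1 - i) \<and> marked X (2 * n + 1 - i) = cov}"
proof -
  note mt = valid_matching[OF v]
  have B: "Bot i = node_at n (2 * n + 1 - i)" if "i \<in> {1..n}" for i using that by (auto simp: node_at_def)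
  have l: "i < j \<and> {Bot i, Bot j} \<in> lines (diagram_of n X) \<longleftrightarrow> i \<in> {1..n} \<and> mate X (2 * n + 1 - i) < 2 * n + 1 - i \<and>
     n < mate X (2 * n + 1 - i) \<and> j = 2 * n + 1 - mate X (2 * n + 1 - i)" for i j
  proof
    assume a: "i < j \<and> {Bot i, Bot j} \<in> lines (diagram_of n X)"
    then obtain x where x: "x \<in> {1..2 * n}" "Bot i = node_at n x" "Bot j = node_at n (mate X x)" using line_cases[OF mt] by blast
    then have "n < x" "i = 2 * n + 1 - x" "n < mate X x" "j = 2 * n + 1 - mate X x" by (auto simp: node_at_def split: if_splits)
    moreover from this x have "2 * n + 1 - i = x" by auto
    ultimately show "i \<in> {1..n} \<and> mate X (2 * n + 1 - i) < 2 * n + 1 - i \<and>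
     n < mate X (2 * n + 1 - i) \<and> j = 2 * n + 1 - mate X (2 * n + 1 - i)" using a x(1) by auto
  next
    assume a: "i \<in> {1..n} \<and> mate X (2 * n + 1 - i) < 2 * n + 1 - i \<and>
     n < mate X (2 * n + 1 - i) \<and> j = 2 * n + 1 - mate X (2 * n + 1 - i)"
    define x where "x = 2 * n + 1 - i"
    have x: "x \<in> {1..2 * n}" "n < x" "i = 2 * n + 1 - x" "mate X x < x" "n < mate X x" "j = 2 * n + 1 - mate X x" using a by (auto simp: x_def)
    then have "{node_at n x, node_at n (mate X x)} \<in> lines (diagram_of n X)" by (auto simp: diagram_of_def)
    moreover have "node_at n x = Bot i" "node_at n (mate X x) = Bot j" using x by (simp_all add: node_at_def)
    ultimately show "i < j \<and> {Bot i, Bot j} \<in> lines (diagram_of n X)" using x by auto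
  qed
  have c: "covered_line (diagram_of n X) {Bot i, Bot (2 * n + 1 - mate X (2 * n + 1 - i))} = marked X (2 * n - i)"
    if "i \<in> {1..n}" "mate X (2 * n + 1 - i) < 2 * n + 1 - i" "n < mate X (2 * n + 1 - i)" for i
  proof -
    have "node_at n (2 * n + 1 - i) = Bot i" "node_at n (mate X (2 * n + 1 - i)) = Bot (2 * n + 1 - mate X (2 * n + 1 - i))"
      using that by (auto simp: node_at_def)
    moreover have "2 * n + 1 - i \<in> {1..2 * n}" "2 * n + 1 - i - 1 = 2 * n - i" using that by auto
    ultimately show ?thesis using covered_line_closer[OF v, of "2 * n + 1 - i"] that by (simp add: insert_commute)
  qed
  show "left_endpoints (diagram_of n X) Bot cov = {i \<in> {1..n}. mate X (2 * n + 1 - i) < 2 * n + 1 - i \<and> n < mate X (2 * n + 1 - i) \<and> marked X (2 * n - i) = cov}"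
    unfolding left_endpoints_def conj_assoc[symmetric] l by (intro Collect_cong) (auto simp: c simp del: One_nat_def)
  have l': "i < j \<and> {Bot i, Bot j} \<in> lines (diagram_of n X) \<longleftrightarrow> j \<in> {1..n} \<and> 2 * n + 1 - j < mate X (2 * n + 1 - j) \<and>
     i = 2 * n + 1 - mate X (2 * n + 1 - j)" for i j
  proof
    assume a: "i < j \<and> {Bot i, Bot j} \<in> lines (diagram_of n X)"
    then obtain x where x: "x \<in> {1..2 * n}" "Bot i = node_at n x" "Bot j = node_at n (mate X x)" using line_cases[OF mt] by blast
    then have "n < x" "i = 2 * n + 1 - x" "n < mate X x" "j = 2 * n + 1 - mate X x" by (auto simp: node_at_def split: if_splits)
    moreover from this x mate_in[OF mt x(1)] have "2 * n + 1 - j = mate X x" by auto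
    ultimately show "j \<in> {1..n} \<and> 2 * n + 1 - j < mate X (2 * n + 1 - j) \<and>
     i = 2 * n + 1 - mate X (2 * n + 1 - j)" using a x(1) mate_in[OF mt x(1)] matchingD(1)[OF mt, of x] by auto
  next
    assume a: "j \<in> {1..n} \<and> 2 * n + 1 - j < mate X (2 * n + 1 - j) \<and> i = 2 * n + 1 - mate X (2 * n + 1 - j)"
    define x where "x = 2 * n + 1 - j"
    have x: "x \<in> {1..2 * n}" "n < x" "j = 2 * n + 1 - x" "x < mate X x" "i = 2 * n + 1 - mate X x" using a by (auto simp: x_def)
    then have "{node_at n x, node_at n (mate X x)} \<in> lines (diagram_of n X)" by (auto simp: diagram_of_def)
    moreover have "node_at n x = Bot j" "node_at n (mate X x) = Bot i" using x by (simp_all add: node_at_def)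
    ultimately show "i < j \<and> {Bot i, Bot j} \<in> lines (diagram_of n X)" using x mate_in[OF mt x(1)] by (auto simp: insert_commute)
  qed
  have c': "covered_line (diagram_of n X) {Bot (2 * n + 1 - mate X (2 * n + 1 - j)), Bot j} = marked X (2 * n + 1 - j)"
    if "j \<in> {1..n}" "2 * n + 1 - j < mate X (2 * n + 1 - j)" for j
  proof -
    have "node_at n (2 * n + 1 - j) = Bot j" "node_at n (mate X (2 * n + 1 - j)) = Bot (2 * n + 1 - mate X (2 * n + 1 - j))"
      using that by (auto simp: node_at_def)
    moreover have "2 * n + 1 - j \<in> {1..2 * n}" using that by auto
    ultimately show ?thesis using covered_line_iff[OF v, of "2 * n + 1 - j"] that by (simp add: insert_commute)
  qed
  show "right_endpoints (diagram_of n X) Bot cov = {i \<in> {1..n}. 2 * n + 1 - i < mate X (2 * n + 1 - i) \<and> marked X (2 * n + 1 - i) = cov}"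
    unfolding right_endpoints_def conj_assoc[symmetric] l' by (intro Collect_cong) (auto simp: c' simp del: One_nat_def)
qed

lemma edge_tableau_bot:
  assumes v: "valid (2 * n) X"
  shows "edge_tableau n Bot (diagram_of n X) = (sorted_list_of_set (up_bot n X), sorted_list_of_set ({1..n} - up_bot n X))"
proof -
  note mt = valid_matching[OF v]
  have st: "i \<in> up_bot n X \<longleftrightarrow> (if 2 * n + 1 - i < mate X (2 * n + 1 - i) then marked X (2 * n + 1 - i) else \<not> marked X (2 * n - i))"
    if i: "i \<in> {1..n}" for i
  proof -
    have "2 * n + 1 - i \<in> {1..2 * n}" "2 * n + 1 - i - 1 = 2 * n - i" using i by auto
    then show ?thesis
      using opener_or_closer[OF mt, of "2 * n + 1 - i"] step_opener[OF v, of "2 * n + 1 - i"] step_closer[OF v, of "2 * n + 1 - i"] i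
      unfolding up_bot_def by (auto simp del: One_nat_def split: if_splits)
  qed
  have vm: "marked X n = marked X (2 * n - i)" if "i \<in> {1..n}" "mate X (2 * n + 1 - i) \<le> n" for i
  proof -
    have "2 * n + 1 - i - 1 = 2 * n - i" "n < 2 * n + 1 - i" using that by auto
    then show ?thesis
      using vertical_marked(2)[OF v, of "mate X (2 * n + 1 - i)" n] that matchingD(1)[OF mt, of "2 * n + 1 - i"] by (simp add: opened_def)
  qed
  have oc: "2 * n + 1 - i < mate X (2 * n + 1 - i) \<or> mate X (2 * n + 1 - i) < 2 * n + 1 - i" if "i \<in> {1..n}" for i
  proof -
    have "2 * n + 1 - i \<in> {1..2 * n}" using that by auto
    then show ?thesis by (rule opener_or_closer[OF mt])
  qed
  show ?thesis
  proof (cases "marked X n")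
    case True
    have "left_endpoints (diagram_of n X) Bot False \<union> right_endpoints (diagram_of n X) Bot True = up_bot n X"
    proof (rule set_eqI)
      fix i
      show "i \<in> left_endpoints (diagram_of n X) Bot False \<union> right_endpoints (diagram_of n X) Bot True \<longleftrightarrow> i \<in> up_bot n X"
      proof (cases "i \<in> {1..n}")
        case i: True
        show ?thesis using st[OF i] vm[OF i] True i oc[OF i] unfolding endpoints_bot[OF v]
          by (cases "mate X (2 * n + 1 - i) \<le> n") auto
      qed (auto simp: endpoints_bot[OF v] up_bot_def)
    qed
    then show ?thesis using True by (simp add: edge_tableau_def leftmost_decorated_iff[OF v] Let_def)
  next
    case False
    have "right_endpoints (diagram_of n X) Bot False \<union> left_endpoints (diagram_of n X) Bot True = {1..n} - up_bot n X"
    proof (rule set_eqI)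
      fix i
      show "i \<in> right_endpoints (diagram_of n X) Bot False \<union> left_endpoints (diagram_of n X) Bot True \<longleftrightarrow> i \<in> {1..n} - up_bot n X"
      proof (cases "i \<in> {1..n}")
        case i: True
        show ?thesis using st[OF i] vm[OF i] False i oc[OF i] unfolding endpoints_bot[OF v]
          by (cases "mate X (2 * n + 1 - i) \<le> n") auto
      qed (auto simp: endpoints_bot[OF v])
    qed
    moreover have "{1..n} - ({1..n} - up_bot n X) = up_bot n X" by (auto simp: up_bot_def)
    ultimately show ?thesis using False by (simp add: edge_tableau_def leftmost_decorated_iff[OF v] Let_def)
  qed
qed

lemma tab_path_card:
  assumes "F = set (fst \<tau>)"
  shows "tab_path \<tau> j = 2 * int (card (F \<inter> {1..j})) - int j"
proof (induction j)
  case (Suc j)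
  show ?case
  proof (cases "Suc j \<in> F")
    case True
    then have "F \<inter> {1..Suc j} = insert (Suc j) (F \<inter> {1..j})" by auto
    then show ?thesis using Suc True assms by simp
  next
    case False
    then have "F \<inter> {1..Suc j} = F \<inter> {1..j}" by (auto simp: le_Suc_eq)
    then show ?thesis using Suc False assms by simp
  qed
qed simp

lemma strict_sorted_set: "sorted_wrt (<) r \<Longrightarrow> sorted_list_of_set (set r) = (r :: nat list)"
  by (rule sorted_list_of_set.idem_if_sorted_distinct) (auto simp: strict_sorted_iff)

lemma Std_iff:
  "\<sigma> \<in> Std (a, b) \<longleftrightarrow> (\<exists>F \<subseteq> {1..a + b}. card F = a \<and>
     \<sigma> = (sorted_list_of_set F, sorted_list_of_set ({1..a + b} - F)))"
proof
  assume s: "\<sigma> \<in> Std (a, b)"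
  obtain r1 r2 where r: "\<sigma> = (r1, r2)" by (cases \<sigma>)
  have *: "length r1 = a" "length r2 = b" "distinct r1" "set r1 \<inter> set r2 = {}" "set r1 \<union> set r2 = {1..a + b}"
    "sorted_wrt (<) r1" "sorted_wrt (<) r2"
    using s by (auto simp: Std_def r)
  have "set r2 = {1..a + b} - set r1" using * by blast
  then have "r2 = sorted_list_of_set ({1..a + b} - set r1)" using strict_sorted_set[OF *(7)] by simp
  moreover have "card (set r1) = a" using * distinct_card by fastforce
  ultimately show "\<exists>F \<subseteq> {1..a + b}. card F = a \<and>
     \<sigma> = (sorted_list_of_set F, sorted_list_of_set ({1..a + b} - F))"
    using * r strict_sorted_set[OF *(6)] by (intro exI[of _ "set r1"]) auto
next
  assume "\<exists>F \<subseteq> {1..a + b}. card F = a \<and>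
     \<sigma> = (sorted_list_of_set F, sorted_list_of_set ({1..a + b} - F))"
  then obtain F where F: "F \<subseteq> {1..a + b}" "card F = a" "\<sigma> = (sorted_list_of_set F, sorted_list_of_set ({1..a + b} - F))" by blast
  have fin: "finite F" using F finite_subset by blast
  have "card ({1..a + b} - F) = b" using F fin by (simp add: card_Diff_subset)
  then show "\<sigma> \<in> Std (a, b)" using F fin by (auto simp: Std_def strict_sorted_iff)
qed

lemma up_top_sub: "up_top n X \<subseteq> {1..n}" and up_bot_sub: "up_bot n X \<subseteq> {1..n}"
  by (auto simp: up_top_def up_bot_def)

lemma finite_up [simp]: "finite (up_top n X)" "finite (up_bot n X)"
  using finite_subset[OF up_top_sub] finite_subset[OF up_bot_sub] by auto

lemma tab_path_top:
  assumes v: "valid (2 * n) X" and j: "j \<le> n"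
  shows "tab_path (edge_tableau n Top (diagram_of n X)) j = path X j"
  using j
proof (induction j)
  case 0
  then show ?case using path_0[OF valid_matching[OF v]] by simp
next
  case (Suc j)
  have s: "\<bar>path X (Suc j) - path X j\<bar> = 1" using path_step_abs[OF v, of "Suc j"] Suc.prems by simp
  have i: "Suc j \<in> up_top n X \<longleftrightarrow> path X (Suc j) - path X j = 1" using Suc.prems by (simp add: up_top_def)
  show ?case using Suc s i by (auto simp: edge_tableau_top[OF v])
qed

lemma tab_path_bot:
  assumes v: "valid (2 * n) X" and j: "j \<le> n"
  shows "tab_path (edge_tableau n Bot (diagram_of n X)) j = path X (2 * n - j)"
  using j
proof (induction j)
  case 0
  then show ?case using path_beyond[OF valid_matching[OF v], of "2 * n"] by simp
next
  case (Suc j)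
  have e: "2 * n - j - 1 = 2 * n - Suc j" "2 * n + 1 - Suc j = 2 * n - j" using Suc.prems by auto
  have "\<bar>path X (2 * n - j) - path X (2 * n - Suc j)\<bar> = 1"
    using path_step_abs[OF v, of "2 * n - j"] Suc.prems unfolding e by force
  moreover have "Suc j \<in> up_bot n X \<longleftrightarrow> path X (2 * n - Suc j) - path X (2 * n - j) = 1"
    using Suc.prems by (simp add: up_bot_def)
  ultimately show ?case using Suc by (auto simp: edge_tableau_bot[OF v])
qed

lemma path_n_card:
  assumes v: "valid (2 * n) X"
  shows "path X n = 2 * int (card (up_top n X)) - int n" "path X n = 2 * int (card (up_bot n X)) - int n"
proof -
  have "up_top n X \<inter> {1..n} = up_top n X" "up_bot n X \<inter> {1..n} = up_bot n X"
    using up_top_sub up_bot_sub by blast+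
  moreover have "set (fst (edge_tableau n Top (diagram_of n X))) = up_top n X" "set (fst (edge_tableau n Bot (diagram_of n X))) = up_bot n X"
    by (simp_all add: edge_tableau_top[OF v] edge_tableau_bot[OF v])
  moreover have "2 * n - n = n" by simp
  ultimately show "path X n = 2 * int (card (up_top n X)) - int n" "path X n = 2 * int (card (up_bot n X)) - int n"
    using tab_path_card[of "up_top n X" "edge_tableau n Top (diagram_of n X)" n] tab_path_top[OF v order_refl]
      tab_path_card[of "up_bot n X" "edge_tableau n Bot (diagram_of n X)" n] tab_path_bot[OF v order_refl]
    by metis+
qed

lemma card_up_eq: "valid (2 * n) X \<Longrightarrow> card (up_top n X) = card (up_bot n X)"
  using path_n_card by fastforce

lemma card_up_le: "card (up_top n X) \<le> n"
  using card_mono[OF _ up_top_sub[of n X]] by simp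

lemma arc_inj:
  assumes mt: "matching (2 * n) X" and "x \<in> {1..2 * n}" "y \<in> {1..2 * n}" "x < mate X x" "y < mate X y"
    and "{node_at n x, node_at n (mate X x)} = {node_at n y, node_at n (mate X y)}"
  shows "x = y"
  using assms mate_in[OF mt assms(2)] mate_in[OF mt assms(3)] by (auto simp: doubleton_eq_iff node_at_inj)

lemma diagram_shape_diagram_of:
  assumes v: "valid (2 * n) X"
  shows "diagram_shape (diagram_of n X) = (card (up_top n X), n - card (up_top n X))"
proof -
  note mt = valid_matching[OF v]
  let ?arc = "\<lambda>x. {node_at n x, node_at n (mate X x)}"
  define T where "T = {x. x < mate X x \<and> mate X x \<le> n}"
  have r: "x \<in> {1..2 * n}" if "x \<noteq> mate X x" for x using that matchingD(2)[OF mt, of x] by metis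
  have vl: "vertical_lines (lines (diagram_of n X)) = ?arc ` opened X n"
  proof
    show "vertical_lines (lines (diagram_of n X)) \<subseteq> ?arc ` opened X n"
    proof
      fix l assume "l \<in> vertical_lines (lines (diagram_of n X))"
      then obtain i j where l: "l = {Top i, Bot j}" "{Top i, Bot j} \<in> lines (diagram_of n X)" by (auto simp: vertical_lines_def)
      obtain x where "x \<in> {1..2 * n}" "Top i = node_at n x" "Bot j = node_at n (mate X x)" using line_cases[OF mt l(2)] by blast
      then show "l \<in> ?arc ` opened X n" using l by (intro image_eqI[of _ _ x]) (auto simp: node_at_def opened_def split: if_splits)
    qed
    show "?arc ` opened X n \<subseteq> vertical_lines (lines (diagram_of n X))"
    proof
      fix l assume "l \<in> ?arc ` opened X n"
      then obtain x where x: "x \<le> n" "n < mate X x" "l = ?arc x" by (auto simp: opened_def)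
      then have "x \<in> {1..2 * n}" using r[of x] by auto
      then have "l \<in> lines (diagram_of n X)" using x by (auto simp: diagram_of_def)
      moreover have "l = {Top x, Bot (2 * n + 1 - mate X x)}" using x by (simp add: node_at_def)
      ultimately show "l \<in> vertical_lines (lines (diagram_of n X))" by (auto simp: vertical_lines_def)
    qed
  qed
  have tl: "top_lines (lines (diagram_of n X)) = ?arc ` T"
  proof
    show "top_lines (lines (diagram_of n X)) \<subseteq> ?arc ` T"
    proof
      fix l assume "l \<in> top_lines (lines (diagram_of n X))"
      then obtain i j where l: "i < j" "l = {Top i, Top j}" "{Top i, Top j} \<in> lines (diagram_of n X)" by (auto simp: top_lines_def)
      obtain x where "x \<in> {1..2 * n}" "Top i = node_at n x" "Top j = node_at n (mate X x)" using line_cases[OF mt l(3)] by blast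
      then show "l \<in> ?arc ` T" using l by (intro image_eqI[of _ _ x]) (auto simp: node_at_def T_def split: if_splits)
    qed
    show "?arc ` T \<subseteq> top_lines (lines (diagram_of n X))"
    proof
      fix l assume "l \<in> ?arc ` T"
      then obtain x where x: "x < mate X x" "mate X x \<le> n" "l = ?arc x" by (auto simp: T_def)
      then have "x \<in> {1..2 * n}" using r[of x] by auto
      then have "l \<in> lines (diagram_of n X)" using x by (auto simp: diagram_of_def)
      moreover have "l = {Top x, Top (mate X x)}" using x by (simp add: node_at_def)
      ultimately show "l \<in> top_lines (lines (diagram_of n X))" using x by (auto simp: top_lines_def)
    qed
  qed
  have "inj_on ?arc (opened X n)"
  proof (rule inj_onI)
    fix x y assume a: "x \<in> opened X n" "y \<in> opened X n" "?arc x = ?arc y"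
    then have "x < mate X x" "y < mate X y" by (auto simp: opened_def)
    then show "x = y" using arc_inj[OF mt] r[of x] r[of y] a(3) by auto
  qed
  then have cv: "card (vertical_lines (lines (diagram_of n X))) = height X n" unfolding vl by (rule card_image)
  have "inj_on ?arc T"
  proof (rule inj_onI)
    fix x y assume a: "x \<in> T" "y \<in> T" "?arc x = ?arc y"
    then have "x < mate X x" "y < mate X y" by (auto simp: T_def)
    then show "x = y" using arc_inj[OF mt] r[of x] r[of y] a(3) by auto
  qed
  then have ct: "card (top_lines (lines (diagram_of n X))) = card T" unfolding tl by (rule card_image)
  have fT: "finite T" by (rule finite_subset[of _ "{..n}"]) (auto simp: T_def)
  have inv: "mate X (mate X x) = x" for x using matchingD(1)[OF mt] .
  \<comment> \<open>The top nodes are the ends of vertical lines and the two ends of each horizontal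
    line, whence \<open>n = v + 2h\<close>; the middle value of the path is \<open>v\<close> up to
    sign.\<close>
  have part: "{1..n} = opened X n \<union> (T \<union> mate X ` T)"
  proof (rule set_eqI)
    fix x
    have "x \<in> mate X ` T \<longleftrightarrow> mate X x < x \<and> x \<le> n"
      unfolding image_iff T_def using inv by (metis (mono_tags, lifting) mem_Collect_eq)
    then show "x \<in> {1..n} \<longleftrightarrow> x \<in> opened X n \<union> (T \<union> mate X ` T)"
      using r[of x] opener_or_closer[OF mt, of x] by (auto simp: opened_def T_def)
  qed
  have d1: "opened X n \<inter> (T \<union> mate X ` T) = {}"
    using inv by (auto simp: opened_def T_def)
  have d2: "T \<inter> mate X ` T = {}"
    using inv by (auto simp: T_def)
  have "inj_on (mate X) T" using inv by (metis inj_onI)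
  then have "card (mate X ` T) = card T" by (rule card_image)
  then have n: "n = height X n + 2 * card T"
    using card_Un_disjoint[OF finite_opened _ d1] card_Un_disjoint[OF fT _ d2] fT part by (metis card_atLeastAtMost diff_Suc_1 finite_UnI finite_imageI mult_2)
  have "path X n = 2 * int (card (up_top n X)) - int n" by (rule path_n_card[OF v])
  then have "(if marked X n then - int (height X n) else int (height X n)) = 2 * int (card (up_top n X)) - int n"
    by (simp add: path_def)
  then show ?thesis
    unfolding diagram_shape_def Let_def cv ct leftmost_decorated_iff[OF v] using n by (auto split: if_splits)
qed

lemma up_sets_inj:
  assumes vX: "valid (2 * n) X" and vY: "valid (2 * n) Y"
    and e: "up_top n X = up_top n Y" "up_bot n X = up_bot n Y"
  shows "X = Y"
proof (rule path_inj[OF vX vY])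
  fix j assume j: "j \<le> 2 * n"
  show "path X j = path Y j"
  proof (cases "j \<le> n")
    case True
    then show ?thesis using tab_path_top[OF vX True] tab_path_top[OF vY True] e
      by (simp add: edge_tableau_top[OF vX] edge_tableau_top[OF vY])
  next
    case False
    then have "2 * n - j \<le> n" "2 * n - (2 * n - j) = j" using j by auto
    then show ?thesis using tab_path_bot[OF vX, of "2 * n - j"] tab_path_bot[OF vY, of "2 * n - j"] e
      by (simp add: edge_tableau_bot[OF vX] edge_tableau_bot[OF vY])
  qed
qed

text \<open>The two tableaux give the two halves of the path, and the path determines the
  diagram.\<close>

lemma blob_diagram_of_diagram_of:
  assumes v: "valid (2 * n) X"
  shows "blob_diagram_of n (edge_tableau n Top (diagram_of n X)) (edge_tableau n Bot (diagram_of n X)) = diagram_of n X"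
  unfolding blob_diagram_of_def
proof (rule the_equality)
  show "diagram_of n X \<in> blob_diagrams n \<and>
    diagram_shape (diagram_of n X) = (length (fst (edge_tableau n Top (diagram_of n X))), length (snd (edge_tableau n Top (diagram_of n X)))) \<and>
    edge_tableau n Top (diagram_of n X) = edge_tableau n Top (diagram_of n X) \<and> edge_tableau n Bot (diagram_of n X) = edge_tableau n Bot (diagram_of n X)"
    using diagram_of_blob_diagram[OF v] up_top_sub by (simp add: diagram_shape_diagram_of[OF v] edge_tableau_top[OF v] card_Diff_subset)
  fix D assume D: "D \<in> blob_diagrams n \<and>
    diagram_shape D = (length (fst (edge_tableau n Top (diagram_of n X))), length (snd (edge_tableau n Top (diagram_of n X)))) \<and>
    edge_tableau n Top D = edge_tableau n Top (diagram_of n X) \<and> edge_tableau n Bot D = edge_tableau n Bot (diagram_of n X)"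
  then obtain Y where Y: "valid (2 * n) Y" "diagram_of n Y = D" using diagram_of_surj by blast
  have "up_top n Y = up_top n X"
    using D unfolding Y(2)[symmetric] edge_tableau_top[OF Y(1)] edge_tableau_top[OF v]
    by (metis Pair_inject finite_up(1) set_sorted_list_of_set)
  moreover have "up_bot n Y = up_bot n X"
    using D unfolding Y(2)[symmetric] edge_tableau_bot[OF Y(1)] edge_tableau_bot[OF v]
    by (metis Pair_inject finite_up(2) set_sorted_list_of_set)
  ultimately show "D = diagram_of n X" using up_sets_inj[OF Y(1) v] Y(2) by simp
qed

lemma edge_tableau_Std:
  assumes v: "valid (2 * n) X"
  shows "edge_tableau n Top (diagram_of n X) \<in> Std (card (up_top n X), n - card (up_top n X))"
    "edge_tableau n Bot (diagram_of n X) \<in> Std (card (up_top n X), n - card (up_top n X))"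
proof -
  have e: "card (up_top n X) + (n - card (up_top n X)) = n" using card_up_le[of n X] by simp
  show "edge_tableau n Top (diagram_of n X) \<in> Std (card (up_top n X), n - card (up_top n X))"
    unfolding Std_iff e edge_tableau_top[OF v] using up_top_sub by blast
  show "edge_tableau n Bot (diagram_of n X) \<in> Std (card (up_top n X), n - card (up_top n X))"
    unfolding Std_iff e edge_tableau_bot[OF v] using up_bot_sub card_up_eq[OF v] by metis
qed

lemma tableaux_diagram:
  assumes lam: "lam \<in> Bip1 n" and s: "s \<in> Std lam" and t: "t \<in> Std lam"
  obtains X where "valid (2 * n) X" "edge_tableau n Top (diagram_of n X) = s" "edge_tableau n Bot (diagram_of n X) = t"
    "lam = (card (up_top n X), n - card (up_top n X))"
proof -
  obtain a b where ab: "lam = (a, b)" "a + b = n" using lam by (auto simp: Bip1_def)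
  obtain F where F: "F \<subseteq> {1..n}" "card F = a" "s = (sorted_list_of_set F, sorted_list_of_set ({1..n} - F))"
    using s unfolding ab Std_iff by auto
  obtain G where G: "G \<subseteq> {1..n}" "card G = a" "t = (sorted_list_of_set G, sorted_list_of_set ({1..n} - G))"
    using t unfolding ab Std_iff by auto
  have fin: "finite F" "finite G" using F G finite_subset by blast+
  have Fs: "set (fst s) = F" "set (fst t) = G" using F G fin by simp_all
  have "F \<inter> {1..n} = F" "G \<inter> {1..n} = G" using F G by blast+
  then have eqn: "tab_path s n = tab_path t n"
    using tab_path_card[OF Fs(1)[symmetric], of n] tab_path_card[OF Fs(2)[symmetric], of n] F(2) G(2) by simp
  \<comment> \<open>The path of \<open>s\<close> followed by the path of \<open>t\<close> backwards.
    They meet at \<open>n\<close> because \<open>s\<close> and \<open>t\<close> have the same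
    shape.\<close>
  define P where "P j = (if j \<le> n then tab_path s j else tab_path t (2 * n - j))" for j
  have Pt: "P j = tab_path t (2 * n - j)" if "n \<le> j" for j
    using that eqn by (auto simp: P_def mult_2)
  have "\<exists>X. valid (2 * n) X \<and> (\<forall>j \<le> 2 * n. path X j = P j)"
  proof (rule path_surj)
    show "P 0 = 0" by (simp add: P_def)
    show "P (2 * n) = 0" using Pt[of "2 * n"] by simp
    fix j assume j: "j < 2 * n"
    show "\<bar>P (Suc j) - P j\<bar> = 1"
    proof (cases "j < n")
      case True
      then show ?thesis by (simp add: P_def)
    next
      case False
      then have "2 * n - j = Suc (2 * n - Suc j)" using j by simp
      then show ?thesis using False Pt[of j] Pt[of "Suc j"] by simp
    qed
  qed
  then obtain X where X: "valid (2 * n) X" "\<And>j. j \<le> 2 * n \<Longrightarrow> path X j = P j" by blast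
  have ut: "up_top n X = F"
  proof (rule set_eqI)
    fix i
    show "i \<in> up_top n X \<longleftrightarrow> i \<in> F"
    proof (cases "i \<in> {1..n}")
      case True
      then obtain j where j: "i = Suc j" "j < n" by (cases i) auto
      then show ?thesis using X(2)[of j] X(2)[of i] Fs by (simp add: up_top_def P_def)
    qed (use F(1) up_top_sub in blast)
  qed
  have ub: "up_bot n X = G"
  proof (rule set_eqI)
    fix i
    show "i \<in> up_bot n X \<longleftrightarrow> i \<in> G"
    proof (cases "i \<in> {1..n}")
      case True
      then obtain j where j: "i = Suc j" "j < n" by (cases i) auto
      have "path X (2 * n - i) = tab_path t i" "path X (2 * n + 1 - i) = tab_path t j"
        using X(2)[of "2 * n - i"] X(2)[of "2 * n + 1 - i"] Pt[of "2 * n - i"] Pt[of "2 * n + 1 - i"] j by simp_all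
      then show ?thesis using True j Fs by (simp add: up_bot_def)
    qed (use G(1) up_bot_sub in blast)
  qed
  show ?thesis
  proof (rule that[OF X(1)])
    show "edge_tableau n Top (diagram_of n X) = s" using edge_tableau_top[OF X(1)] ut F(3) by simp
    show "edge_tableau n Bot (diagram_of n X) = t" using edge_tableau_bot[OF X(1)] ub G(3) by simp
    show "lam = (card (up_top n X), n - card (up_top n X))" using ut F(2) ab by auto
  qed
qed

text \<open>The second clause expresses that diagrams of the same shape have the same bottom bitableau.\<close>

definition dominates :: "nat \<Rightarrow> nat \<Rightarrow> arcs \<Rightarrow> arcs \<Rightarrow> bool" where
  "dominates n k E D \<longleftrightarrow> (\<forall>j. k \<le> j \<and> j \<le> n \<longrightarrow> int_succeq (path E j) (path D j)) \<and>
     (path E n = path D n \<longrightarrow> (\<forall>j \<ge> n. path E j = path D j))"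

definition dominating :: "nat \<Rightarrow> arcs \<Rightarrow> arcs set" where
  "dominating n D = {E. valid (2 * n) E \<and> dominates n 0 E D \<and> (\<exists>j \<le> n. path E j \<noteq> path D j)}"

text \<open>The middle value of the path is the difference of the row lengths. If it is unchanged,
  so are the shape and the bottom tableau, and the top tableau has moved up; otherwise the shape has
  moved up and the diagram lies in the ideal.\<close>

lemma dominating_cases:
  assumes v: "valid (2 * n) D" and E: "E \<in> dominating n D"
  defines "lam \<equiv> (card (up_top n D), n - card (up_top n D))"
  obtains (tab) "edge_tableau n Top (diagram_of n E) \<in> Std lam" "tab_succ (edge_tableau n Top (diagram_of n E)) (edge_tableau n Top (diagram_of n D))"
      "diagram_of n E = blob_diagram_of n (edge_tableau n Top (diagram_of n E)) (edge_tableau n Bot (diagram_of n D))"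
  | (higher) "diagram_of n E \<in> {blob_diagram_of n \<alpha> \<beta> | \<alpha> \<beta> \<mu>.
       \<mu> \<in> Bip1 n \<and> bip_succ \<mu> lam \<and> \<alpha> \<in> Std \<mu> \<and> \<beta> \<in> Std \<mu>}"
proof -
  have vE: "valid (2 * n) E" and dom: "dominates n 0 E D" and ne: "\<exists>j \<le> n. path E j \<noteq> path D j"
    using E by (auto simp: dominating_def)
  define mu where "mu = (card (up_top n E), n - card (up_top n E))"
  note pn = path_n_card(1)[OF v] path_n_card(1)[OF vE]
  show ?thesis
  proof (cases "path E n = path D n")
    case True
    then have c: "card (up_top n E) = card (up_top n D)" using pn by simp
    have tail: "path E j = path D j" if "n \<le> j" for j using dom True that by (simp add: dominates_def)
    have "up_bot n E = up_bot n D"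
      unfolding up_bot_def using tail by (intro Collect_cong) auto
    then have b: "edge_tableau n Bot (diagram_of n E) = edge_tableau n Bot (diagram_of n D)"
      by (simp add: edge_tableau_bot[OF vE] edge_tableau_bot[OF v])
    have len: "length (fst (edge_tableau n Top (diagram_of n D))) + length (snd (edge_tableau n Top (diagram_of n D))) = n"
      using up_top_sub card_up_le[of n D] by (simp add: edge_tableau_top[OF v] card_Diff_subset)
    have "tab_succ (edge_tableau n Top (diagram_of n E)) (edge_tableau n Top (diagram_of n D))"
      unfolding tab_succ_def len
    proof (intro conjI allI impI)
      fix j assume "j \<le> n"
      then show "int_succeq (tab_path (edge_tableau n Top (diagram_of n E)) j) (tab_path (edge_tableau n Top (diagram_of n D)) j)"
        using dom tab_path_top[OF vE] tab_path_top[OF v] by (simp add: dominates_def)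
    next
      show "edge_tableau n Top (diagram_of n E) \<noteq> edge_tableau n Top (diagram_of n D)"
        using ne tab_path_top[OF vE] tab_path_top[OF v] by metis
    qed
    moreover have "edge_tableau n Top (diagram_of n E) \<in> Std lam" using edge_tableau_Std(1)[OF vE] c by (simp add: lam_def)
    ultimately show ?thesis using tab blob_diagram_of_diagram_of[OF vE] b by simp
  next
    case False
    have "int_succeq (path E n) (path D n)" using dom by (simp add: dominates_def)
    moreover have "int (fst mu) - int (snd mu) = path E n" "int (fst lam) - int (snd lam) = path D n"
      using pn card_up_le[of n E] card_up_le[of n D] by (auto simp: mu_def lam_def)
    ultimately have "bip_succ mu lam" using False by (auto simp: bip_succ_def)
    moreover have "mu \<in> Bip1 n" using card_up_le[of n E] by (simp add: mu_def Bip1_def)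
    moreover note edge_tableau_Std[OF vE, folded mu_def]
    ultimately show ?thesis using higher blob_diagram_of_diagram_of[OF vE] by (metis (mono_tags, lifting) mem_Collect_eq)
  qed
qed

text \<open>Among the first \<open>k - 1\<close> entries, \<open>(k - 1 + P (k - 1)) / 2\<close> lie
  in the first row and \<open>(k - 1 - P (k - 1)) / 2\<close> in the second; the exponent is twice
  the number of those in the row of \<open>k\<close>.\<close>

definition path_content :: "'a::field \<Rightarrow> 'a \<Rightarrow> (nat \<Rightarrow> int) \<Rightarrow> nat \<Rightarrow> 'a" where
  "path_content q Q P k = (if P k = P (k - 1) + 1 then q ^ nat (int k - 1 + P (k - 1)) * Q
     else q ^ nat (int k - 1 - P (k - 1)) * inverse Q)"

lemma box_index_sorted:
  assumes "finite (F :: nat set)" "k \<in> F"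
  shows "box_index (sorted_list_of_set F) k - 1 = card {x \<in> F. x < k}"
proof -
  define r where "r = sorted_list_of_set F"
  have r: "sorted_wrt (<) r" "distinct r" "set r = F" using assms by (simp_all add: r_def)
  obtain i where i: "i < length r" "r ! i = k" using r(3) assms(2) by (metis in_set_conv_nth)
  have "box_index r k = Suc i"
    unfolding box_index_def
  proof (rule the_equality)
    show "1 \<le> Suc i \<and> Suc i \<le> length r \<and> r ! (Suc i - 1) = k" using i by simp
    fix c assume c: "1 \<le> c \<and> c \<le> length r \<and> r ! (c - 1) = k"
    then have "c - 1 < length r" "1 \<le> c" by linarith+
    then have "c - 1 = i" using c i r(2) by (metis nth_eq_iff_index_eq)
    then show "c = Suc i" using \<open>1 \<le> c\<close> by simp
  qed
  moreover have "{x \<in> F. x < k} = (!) r ` {..<i}"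
  proof (intro set_eqI iffI)
    fix x assume "x \<in> {x \<in> F. x < k}"
    then obtain j where j: "j < length r" "x = r ! j" "r ! j < r ! i" using r(3) i by (auto simp: in_set_conv_nth)
    have "j < i"
    proof (rule ccontr)
      assume "\<not> j < i"
      then have "r ! i \<le> r ! j" using sorted_wrt_nth_less[OF r(1), of i j] j by (cases "i = j") auto
      then show False using j by simp
    qed
    then show "x \<in> (!) r ` {..<i}" using j by blast
  next
    fix x assume "x \<in> (!) r ` {..<i}"
    then obtain j where j: "j < i" "x = r ! j" by blast
    then show "x \<in> {x \<in> F. x < k}" using sorted_wrt_nth_less[OF r(1), of j i] i r(3) by (auto intro: nth_mem)
  qed
  moreover have "inj_on ((!) r) {..<i}" using r(2) i by (auto simp: inj_on_def nth_eq_iff_index_eq)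
  ultimately show ?thesis by (simp add: card_image flip: r_def)
qed

lemma tab_content_path:
  assumes v: "valid (2 * n) X" and k: "1 \<le> k" "k \<le> n"
  shows "tab_content q Q (edge_tableau n Top (diagram_of n X)) k = path_content q Q (path X) k"
proof -
  define F where "F = up_top n X"
  have F: "finite F" "F \<subseteq> {1..n}" using up_top_sub by (simp_all add: F_def)
  have e: "edge_tableau n Top (diagram_of n X) = (sorted_list_of_set F, sorted_list_of_set ({1..n} - F))"
    by (simp add: edge_tableau_top[OF v] F_def)
  have p: "path X (k - 1) = 2 * int (card (F \<inter> {1..k - 1})) - int (k - 1)"
    using tab_path_top[OF v, of "k - 1"] tab_path_card[OF refl, of "edge_tableau n Top (diagram_of n X)" "k - 1"] k F e by simp
  have mem: "k \<in> F \<longleftrightarrow> path X k = path X (k - 1) + 1" using k by (auto simp: F_def up_top_def)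
  have c1: "{x \<in> F. x < k} = F \<inter> {1..k - 1}" using F(2) k by auto
  have c2: "{x \<in> {1..n} - F. x < k} = {1..k - 1} - (F \<inter> {1..k - 1})" using k by auto
  have c2': "card ({1..k - 1} - (F \<inter> {1..k - 1})) = k - 1 - card (F \<inter> {1..k - 1})"
    using card_Diff_subset[of "F \<inter> {1..k - 1}" "{1..k - 1}"] F by simp
  have le: "card (F \<inter> {1..k - 1}) \<le> k - 1" using card_mono[of "{1..k - 1}" "F \<inter> {1..k - 1}"] by simp
  show ?thesis
  proof (cases "k \<in> F")
    case True
    have "nat (int k - 1 + path X (k - 1)) = 2 * card (F \<inter> {1..k - 1})" using p k by simp
    then show ?thesis using True mem box_index_sorted[OF F(1) True] c1 F
      by (simp add: tab_content_def path_content_def e)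
  next
    case False
    have "nat (int k - 1 - path X (k - 1)) = 2 * (k - 1 - card (F \<inter> {1..k - 1}))" using p k le by simp
    moreover have "k \<in> {1..n} - F" using False k by simp
    ultimately show ?thesis using False mem box_index_sorted[of "{1..n} - F" k] c2 c2' F
      by (simp add: tab_content_def path_content_def e)
  qed
qed

section \<open>Concatenation\<close>

definition above_point :: "nat \<Rightarrow> nat \<Rightarrow> point" where
  "above_point n x = (if x \<le> n then Upper x else Middle (2 * n + 1 - x))"

definition below_point :: "nat \<Rightarrow> nat \<Rightarrow> point" where
  "below_point n x = (if x \<le> n then Middle x else Lower (2 * n + 1 - x))"

definition outer_point :: "nat \<Rightarrow> nat \<Rightarrow> point" where
  "outer_point n x = (if x \<le> n then Upper x else Lower (2 * n + 1 - x))"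

definition pts :: "nat \<Rightarrow> point set" where
  "pts n = Upper ` {1..n} \<union> Middle ` {1..n} \<union> Lower ` {1..n}"

definition adj :: "nat \<Rightarrow> arcs \<Rightarrow> arcs \<Rightarrow> (point \<times> point) set" where
  "adj n X Y = {(u, v). (\<exists>x\<in>{1..2 * n}. u = above_point n x \<and> v = above_point n (mate X x)) \<or>
     (\<exists>y\<in>{1..2 * n}. u = below_point n y \<and> v = below_point n (mate Y y))}"

definition cls :: "('b \<times> 'b) set \<Rightarrow> 'b \<Rightarrow> 'b set" where
  "cls R u = {v. (u, v) \<in> R\<^sup>*}"

definition outer_positions :: "nat \<Rightarrow> point set \<Rightarrow> nat set" where
  "outer_positions n C = {z \<in> {1..2 * n}. outer_point n z \<in> C}"

definition decorated_by :: "nat \<Rightarrow> arcs \<Rightarrow> arcs \<Rightarrow> point set \<Rightarrow> bool" where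
  "decorated_by n X Y C \<longleftrightarrow> (\<exists>x. deco X x \<and> above_point n x \<in> C) \<or> (\<exists>y. deco Y y \<and> below_point n y \<in> C)"

lemma below_point_inj: "x \<in> {1..2 * n} \<Longrightarrow> y \<in> {1..2 * n} \<Longrightarrow> below_point n x = below_point n y \<longleftrightarrow> x = y"
  by (auto simp: below_point_def)

lemma outer_point_inj: "x \<in> {1..2 * n} \<Longrightarrow> y \<in> {1..2 * n} \<Longrightarrow> outer_point n x = outer_point n y \<longleftrightarrow> x = y"
  by (auto simp: outer_point_def)

lemma mem_pts [simp]: "Upper k \<in> pts n \<longleftrightarrow> k \<in> {1..n}" "Middle k \<in> pts n \<longleftrightarrow> k \<in> {1..n}" "Lower k \<in> pts n \<longleftrightarrow> k \<in> {1..n}"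
  by (auto simp: pts_def)

lemma pts_in: "x \<in> {1..2 * n} \<Longrightarrow> above_point n x \<in> pts n" "x \<in> {1..2 * n} \<Longrightarrow> below_point n x \<in> pts n" "x \<in> {1..2 * n} \<Longrightarrow> outer_point n x \<in> pts n"
  by (auto simp: above_point_def below_point_def outer_point_def)

lemma stack_adj:
  assumes X: "matching (2 * n) X" and Y: "matching (2 * n) Y"
  shows "{(u, v). {u, v} \<in> stack (lines (diagram_of n X)) (lines (diagram_of n Y))} = adj n X Y"
proof -
  have a: "place_above (node_at n x) = above_point n x" "place_below (node_at n x) = below_point n x" for x
    by (auto simp: node_at_def above_point_def below_point_def)
  have "{u, v} \<in> stack (lines (diagram_of n X)) (lines (diagram_of n Y)) \<longleftrightarrow>
     (\<exists>x\<in>{1..2 * n}. {u, v} = {above_point n x, above_point n (mate X x)}) \<or> (\<exists>x\<in>{1..2 * n}. {u, v} = {below_point n x, below_point n (mate Y x)})" for u v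
    by (auto simp: stack_def diagram_of_def image_image a)
  moreover have "(\<exists>x\<in>{1..2 * n}. {u, v} = {above_point n x, above_point n (mate X x)}) \<longleftrightarrow> (\<exists>x\<in>{1..2 * n}. u = above_point n x \<and> v = above_point n (mate X x))" for u v
    using matchingD(1)[OF X] mate_in[OF X] unfolding doubleton_eq_iff by metis
  moreover have "(\<exists>x\<in>{1..2 * n}. {u, v} = {below_point n x, below_point n (mate Y x)}) \<longleftrightarrow> (\<exists>x\<in>{1..2 * n}. u = below_point n x \<and> v = below_point n (mate Y x))" for u v
    using matchingD(1)[OF Y] mate_in[OF Y] unfolding doubleton_eq_iff by metis
  ultimately show ?thesis by (simp add: adj_def)
qed

lemma strands_adj:
  assumes "matching (2 * n) X" "matching (2 * n) Y"
  shows "strands n (diagram_of n X) (diagram_of n Y) = cls (adj n X Y) ` pts n"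
  unfolding strands_def stack_adj[OF assms] cls_def pts_def ..

lemma adj_sym:
  assumes X: "matching (2 * n) X" and Y: "matching (2 * n) Y"
  shows "sym (adj n X Y)"
proof (rule symI)
  fix u v assume "(u, v) \<in> adj n X Y"
  then consider x where "x \<in> {1..2 * n}" "u = above_point n x" "v = above_point n (mate X x)"
    | y where "y \<in> {1..2 * n}" "u = below_point n y" "v = below_point n (mate Y y)" by (auto simp: adj_def)
  then show "(v, u) \<in> adj n X Y"
  proof cases
    case (1 x)
    then have "\<exists>x\<in>{1..2 * n}. v = above_point n x \<and> u = above_point n (mate X x)"
      using mate_in[OF X] matchingD(1)[OF X] by (intro bexI[of _ "mate X x"]) auto
    then show ?thesis by (simp add: adj_def)
  next
    case (2 y)
    then have "\<exists>x\<in>{1..2 * n}. v = below_point n x \<and> u = below_point n (mate Y x)"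
      using mate_in[OF Y] matchingD(1)[OF Y] by (intro bexI[of _ "mate Y y"]) auto
    then show ?thesis by (simp add: adj_def)
  qed
qed

lemma cls_self [simp]: "u \<in> cls R u"
  by (simp add: cls_def)

lemma cls_step: "v \<in> cls R u \<Longrightarrow> (v, w) \<in> R \<Longrightarrow> w \<in> cls R u"
  by (auto simp: cls_def)

lemma cls_eq:
  assumes "sym R" "v \<in> cls R u" shows "cls R v = cls R u"
proof -
  have "(v, u) \<in> R\<^sup>*" using assms sym_rtrancl by (auto simp: cls_def dest: symD)
  then show ?thesis using assms(2) by (auto simp: cls_def)
qed

lemma cls_eqI:
  assumes "u \<in> C" "\<And>v w. v \<in> C \<Longrightarrow> (v, w) \<in> R \<Longrightarrow> w \<in> C" "\<And>v. v \<in> C \<Longrightarrow> (u, v) \<in> R\<^sup>*"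
  shows "cls R u = C"
proof -
  have "v \<in> C" if "(u, v) \<in> R\<^sup>*" for v
    using that by induction (use assms in auto)
  then show ?thesis using assms(3) by (auto simp: cls_def)
qed

lemma cls_pts:
  assumes X: "matching (2 * n) X" and Y: "matching (2 * n) Y" and u: "u \<in> pts n"
  shows "cls (adj n X Y) u \<subseteq> pts n"
proof
  fix v assume "v \<in> cls (adj n X Y) u"
  then have "(u, v) \<in> (adj n X Y)\<^sup>*" by (simp add: cls_def)
  then show "v \<in> pts n"
    by induction (use u pts_in mate_in[OF X] mate_in[OF Y] in \<open>auto simp: adj_def\<close>)
qed

lemma outer_nodes_outer_positions:
  assumes "C \<subseteq> pts n" shows "outer_nodes C = node_at n ` outer_positions n C"
proof (rule set_eqI)
  fix w
  show "w \<in> outer_nodes C \<longleftrightarrow> w \<in> node_at n ` outer_positions n C"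
  proof
    assume "w \<in> outer_nodes C"
    then consider i where "w = Top i" "Upper i \<in> C" | i where "w = Bot i" "Lower i \<in> C" by (auto simp: outer_nodes_def)
    then show "w \<in> node_at n ` outer_positions n C"
    proof cases
      case (1 i)
      then have "i \<in> {1..n}" using assms by auto
      then have "i \<in> outer_positions n C" "w = node_at n i" using 1 by (auto simp: outer_positions_def outer_point_def node_at_def)
      then show ?thesis by blast
    next
      case (2 i)
      then have "i \<in> {1..n}" using assms by auto
      then have "2 * n + 1 - i \<in> outer_positions n C" "w = node_at n (2 * n + 1 - i)" using 2 by (auto simp: outer_positions_def outer_point_def node_at_def)
      then show ?thesis by blast
    qed
  next
    assume "w \<in> node_at n ` outer_positions n C"
    then show "w \<in> outer_nodes C" by (auto simp: outer_positions_def outer_point_def node_at_def outer_nodes_def)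
  qed
qed

lemma decorated_strand_decorated_by:
  assumes X: "matching (2 * n) X" and Y: "matching (2 * n) Y" and C: "C = cls (adj n X Y) u"
  shows "decorated_strand (diagram_of n X) (diagram_of n Y) C \<longleftrightarrow> decorated_by n X Y C"
proof -
  have a: "place_above (node_at n x) = above_point n x" "place_below (node_at n x) = below_point n x" for x
    by (auto simp: node_at_def above_point_def below_point_def)
  have "decorated_strand (diagram_of n X) (diagram_of n Y) C \<longleftrightarrow>
     (\<exists>x\<in>{1..2 * n}. deco X x \<and> above_point n x \<in> C \<and> above_point n (mate X x) \<in> C) \<or> (\<exists>x\<in>{1..2 * n}. deco Y x \<and> below_point n x \<in> C \<and> below_point n (mate Y x) \<in> C)"
    by (simp add: decorated_strand_def stack_def diagram_of_def bex_Un a) (simp add: Bex_def conj_assoc)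
  moreover have "above_point n x \<in> C \<longleftrightarrow> above_point n (mate X x) \<in> C" if "x \<in> {1..2 * n}" for x
  proof -
    have "(above_point n x, above_point n (mate X x)) \<in> adj n X Y" using that by (auto simp: adj_def)
    then show ?thesis unfolding C using cls_step adj_sym[OF X Y] by (meson symD)
  qed
  moreover have "below_point n x \<in> C \<longleftrightarrow> below_point n (mate Y x) \<in> C" if "x \<in> {1..2 * n}" for x
  proof -
    have "(below_point n x, below_point n (mate Y x)) \<in> adj n X Y" using that by (auto simp: adj_def)
    then show ?thesis unfolding C using cls_step adj_sym[OF X Y] by (meson symD)
  qed
  ultimately show ?thesis unfolding decorated_by_def using matchingD(4)[OF X] matchingD(4)[OF Y] by blast
qed

text \<open>Expresses position by position that \<open>Z\<close> is the concatenation of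
  \<open>X\<close> and \<open>Y\<close>. In this form the effect of one more generator on top of
  \<open>X\<close> can be followed locally in the graph.\<close>

definition joins :: "nat \<Rightarrow> arcs \<Rightarrow> arcs \<Rightarrow> arcs \<Rightarrow> bool" where
  "joins n X Y Z \<longleftrightarrow> (\<forall>z \<in> {1..2 * n}. outer_positions n (cls (adj n X Y) (outer_point n z)) = {z, mate Z z} \<and>
     (decorated_by n X Y (cls (adj n X Y) (outer_point n z)) \<longleftrightarrow> deco Z z))"

lemma concat_iff_joins:
  assumes X: "matching (2 * n) X" and Y: "matching (2 * n) Y" and Z: "matching (2 * n) Z"
  shows "concat_diagram n (diagram_of n X) (diagram_of n Y) = diagram_of n Z \<longleftrightarrow> joins n X Y Z"
proof -
  let ?S = "\<lambda>z. cls (adj n X Y) (outer_point n z)"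
  have sub: "?S z \<subseteq> pts n" if "z \<in> {1..2 * n}" for z using cls_pts[OF X Y pts_in(3)[OF that]] .
  have out: "outer_nodes (?S z) = node_at n ` outer_positions n (?S z)" if "z \<in> {1..2 * n}" for z using outer_nodes_outer_positions[OF sub[OF that]] .
  have dec: "decorated_strand (diagram_of n X) (diagram_of n Y) (?S z) \<longleftrightarrow> decorated_by n X Y (?S z)" for z using decorated_strand_decorated_by[OF X Y refl] .
  have zS: "z \<in> outer_positions n (?S z)" if "z \<in> {1..2 * n}" for z using that by (simp add: outer_positions_def)
  have cl: "(\<exists>C. P C \<and> C \<in> strands n (diagram_of n X) (diagram_of n Y) \<and> outer_nodes C \<noteq> {}) \<longleftrightarrow> (\<exists>z \<in> {1..2 * n}. P (?S z))" for P
  proof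
    assume "\<exists>C. P C \<and> C \<in> strands n (diagram_of n X) (diagram_of n Y) \<and> outer_nodes C \<noteq> {}"
    then obtain C u where C: "P C" "C = cls (adj n X Y) u" "u \<in> pts n" "outer_nodes C \<noteq> {}"
      unfolding strands_adj[OF X Y] by blast
    have "C \<subseteq> pts n" using cls_pts[OF X Y C(3)] C(2) by simp
    then have "outer_positions n C \<noteq> {}" using outer_nodes_outer_positions C(4) by auto
    then obtain z where z: "z \<in> {1..2 * n}" "outer_point n z \<in> C" by (auto simp: outer_positions_def)
    then have "?S z = C" using cls_eq[OF adj_sym[OF X Y]] C(2) by simp
    then show "\<exists>z \<in> {1..2 * n}. P (?S z)" using C z by metis
  next
    assume "\<exists>z \<in> {1..2 * n}. P (?S z)"
    then obtain z where z: "z \<in> {1..2 * n}" "P (?S z)" by blast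
    moreover have "?S z \<in> strands n (diagram_of n X) (diagram_of n Y)" using pts_in(3)[OF z(1)] by (auto simp: strands_adj[OF X Y])
    moreover have "outer_nodes (?S z) \<noteq> {}" using out[OF z(1)] zS[OF z(1)] by auto
    ultimately show "\<exists>C. P C \<and> C \<in> strands n (diagram_of n X) (diagram_of n Y) \<and> outer_nodes C \<noteq> {}" by blast
  qed
  have L: "{outer_nodes C |C. C \<in> strands n (diagram_of n X) (diagram_of n Y) \<and> outer_nodes C \<noteq> {}} = (\<lambda>z. node_at n ` outer_positions n (?S z)) ` {1..2 * n}"
  proof (rule set_eqI)
    fix l
    show "l \<in> {outer_nodes C |C. C \<in> strands n (diagram_of n X) (diagram_of n Y) \<and> outer_nodes C \<noteq> {}} \<longleftrightarrow> l \<in> (\<lambda>z. node_at n ` outer_positions n (?S z)) ` {1..2 * n}"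
      using cl[of "\<lambda>C. l = outer_nodes C"] out by auto
  qed
  have B: "{outer_nodes C |C. C \<in> strands n (diagram_of n X) (diagram_of n Y) \<and> outer_nodes C \<noteq> {} \<and> decorated_strand (diagram_of n X) (diagram_of n Y) C}
     = (\<lambda>z. node_at n ` outer_positions n (?S z)) ` {z \<in> {1..2 * n}. decorated_by n X Y (?S z)}"
  proof (rule set_eqI)
    fix l
    show "l \<in> {outer_nodes C |C. C \<in> strands n (diagram_of n X) (diagram_of n Y) \<and> outer_nodes C \<noteq> {} \<and> decorated_strand (diagram_of n X) (diagram_of n Y) C} \<longleftrightarrow>
      l \<in> (\<lambda>z. node_at n ` outer_positions n (?S z)) ` {z \<in> {1..2 * n}. decorated_by n X Y (?S z)}"
      using cl[of "\<lambda>C. l = outer_nodes C \<and> decorated_strand (diagram_of n X) (diagram_of n Y) C"] out dec by auto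
  qed
  have ndS: "node_at n ` outer_positions n (?S z) = {node_at n z, node_at n w} \<longleftrightarrow> outer_positions n (?S z) = {z, w}" if "z \<in> {1..2 * n}" "w \<in> {1..2 * n}" for z w
  proof -
    have i: "inj_on (node_at n) {1..2 * n}" by (auto simp: inj_on_def node_at_inj)
    have s: "outer_positions n (?S z) \<subseteq> {1..2 * n}" "{z, w} \<subseteq> {1..2 * n}" using that by (auto simp: outer_positions_def)
    have "node_at n ` outer_positions n (?S z) = node_at n ` {z, w} \<longleftrightarrow> outer_positions n (?S z) = {z, w}"
      by (rule inj_on_image_eq_iff[OF i s])
    then show ?thesis by simp
  qed
  note mZ = mate_in[OF Z]
  show ?thesis
  proof
    assume e: "concat_diagram n (diagram_of n X) (diagram_of n Y) = diagram_of n Z"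
    then have "lines (concat_diagram n (diagram_of n X) (diagram_of n Y)) = lines (diagram_of n Z)"
      "blobs (concat_diagram n (diagram_of n X) (diagram_of n Y)) = blobs (diagram_of n Z)" by simp_all
    then have e1: "(\<lambda>z. node_at n ` outer_positions n (?S z)) ` {1..2 * n} = lines (diagram_of n Z)"
      and e2: "(\<lambda>z. node_at n ` outer_positions n (?S z)) ` {z \<in> {1..2 * n}. decorated_by n X Y (?S z)} = blobs (diagram_of n Z)"
      unfolding concat_diagram_def L B diagram.sel .
    show "joins n X Y Z"
      unfolding joins_def
    proof
      fix z assume z: "z \<in> {1..2 * n}"
      have "node_at n ` outer_positions n (?S z) \<in> lines (diagram_of n Z)" using e1 z by blast
      then obtain w where w: "w \<in> {1..2 * n}" "node_at n ` outer_positions n (?S z) = {node_at n w, node_at n (mate Z w)}" by (auto simp: diagram_of_def)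
      have "node_at n z \<in> {node_at n w, node_at n (mate Z w)}" using w zS[OF z] by blast
      then have "z = w \<or> z = mate Z w" using node_at_inj z w mZ by auto
      then have eq: "node_at n ` outer_positions n (?S z) = {node_at n z, node_at n (mate Z z)}" using w matchingD(1)[OF Z] by auto
      then have o: "outer_positions n (?S z) = {z, mate Z z}" using ndS[OF z mZ[OF z]] by simp
      have "decorated_by n X Y (?S z) \<longleftrightarrow> deco Z z"
      proof
        assume "decorated_by n X Y (?S z)"
        then have "{node_at n z, node_at n (mate Z z)} \<in> blobs (diagram_of n Z)" using e2 z eq by blast
        then show "deco Z z" using line_mem(2)[OF Z z mZ[OF z]] by simp
      next
        assume "deco Z z"
        then have "{node_at n z, node_at n (mate Z z)} \<in> blobs (diagram_of n Z)" using line_mem(2)[OF Z z mZ[OF z]] by simp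
        then obtain w where w: "w \<in> {1..2 * n}" "decorated_by n X Y (?S w)" "node_at n ` outer_positions n (?S w) = {node_at n z, node_at n (mate Z z)}"
          unfolding e2[symmetric] by blast
        then have "node_at n z \<in> node_at n ` outer_positions n (?S w)" by simp
        then have "z \<in> outer_positions n (?S w)" using node_at_inj z by (auto simp: outer_positions_def)
        then have "outer_point n z \<in> ?S w" by (simp add: outer_positions_def)
        then have "?S z = ?S w" using cls_eq[OF adj_sym[OF X Y]] by blast
        then show "decorated_by n X Y (?S z)" using w by simp
      qed
      with o show "outer_positions n (?S z) = {z, mate Z z} \<and> (decorated_by n X Y (?S z) \<longleftrightarrow> deco Z z)" by blast
    qed
  next
    assume j: "joins n X Y Z"
    then have o: "node_at n ` outer_positions n (?S z) = {node_at n z, node_at n (mate Z z)}" "decorated_by n X Y (?S z) \<longleftrightarrow> deco Z z" if "z \<in> {1..2 * n}" for z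
      using that by (simp_all add: joins_def)
    have "(\<lambda>z. node_at n ` outer_positions n (?S z)) ` {1..2 * n} = lines (diagram_of n Z)"
      unfolding diagram_of_def diagram.sel by (intro image_cong refl o)
    moreover have "(\<lambda>z. node_at n ` outer_positions n (?S z)) ` {z \<in> {1..2 * n}. decorated_by n X Y (?S z)} = blobs (diagram_of n Z)"
      unfolding diagram_of_def diagram.sel by (intro image_cong) (use o in auto)
    ultimately show "concat_diagram n (diagram_of n X) (diagram_of n Y) = diagram_of n Z"
      unfolding concat_diagram_def L B by simp
  qed
qed

section \<open>Stacking with a generator on top\<close>

definition identity_arcs :: "nat \<Rightarrow> arcs" where
  "identity_arcs n = Arcs (\<lambda>x. if x \<in> {1..2 * n} then 2 * n + 1 - x else x) (\<lambda>_. False)"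

lemma identity_arcs_valid: "valid (2 * n) (identity_arcs n)"
proof -
  \<comment> \<open>The two positions add up to an odd number.\<close>
  have "2 * n + 1 - x \<noteq> x" if "x \<in> {1..2 * n}" for x using that by simp presburger
  then show ?thesis unfolding valid_def matching_def identity_arcs_def by auto
qed

lemma loops_adj:
  assumes X: "matching (2 * n) X" and Y: "matching (2 * n) Y"
  shows "plain_loops n (diagram_of n X) (diagram_of n Y) = {C \<in> cls (adj n X Y) ` pts n. outer_positions n C = {} \<and> \<not> decorated_by n X Y C}"
    "blob_loops n (diagram_of n X) (diagram_of n Y) = {C \<in> cls (adj n X Y) ` pts n. outer_positions n C = {} \<and> decorated_by n X Y C}"
proof -
  have "outer_nodes C = {} \<longleftrightarrow> outer_positions n C = {}" "decorated_strand (diagram_of n X) (diagram_of n Y) C \<longleftrightarrow> decorated_by n X Y C"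
    if "C \<in> cls (adj n X Y) ` pts n" for C
    using that outer_nodes_outer_positions[of C n] cls_pts[OF X Y] decorated_strand_decorated_by[OF X Y] by auto
  then show "plain_loops n (diagram_of n X) (diagram_of n Y) = {C \<in> cls (adj n X Y) ` pts n. outer_positions n C = {} \<and> \<not> decorated_by n X Y C}"
    "blob_loops n (diagram_of n X) (diagram_of n Y) = {C \<in> cls (adj n X Y) ` pts n. outer_positions n C = {} \<and> decorated_by n X Y C}"
    unfolding plain_loops_def blob_loops_def strands_adj[OF X Y] by blast+
qed

definition weight :: "'a::field \<Rightarrow> 'a \<Rightarrow> nat \<Rightarrow> arcs \<Rightarrow> arcs \<Rightarrow> 'a" where
  "weight \<delta> y n X Y = y ^ card (blob_loops n (diagram_of n X) (diagram_of n Y)) * \<delta> ^ card (plain_loops n (diagram_of n X) (diagram_of n Y))"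

lemma id_joins:
  assumes Y: "matching (2 * n) Y"
  shows "joins n (identity_arcs n) Y Y" "weight \<delta> y n (identity_arcs n) Y = 1"
proof -
  note X = valid_matching[OF identity_arcs_valid[of n]]
  let ?R = "adj n (identity_arcs n) Y"
  have edge: "(u, v) \<in> ?R \<longleftrightarrow> (\<exists>j\<in>{1..n}. u = Upper j \<and> v = Middle j \<or> u = Middle j \<and> v = Upper j) \<or>
     (\<exists>y\<in>{1..2 * n}. u = below_point n y \<and> v = below_point n (mate Y y))" for u v
  proof -
    have "(\<exists>x\<in>{1..2 * n}. u = above_point n x \<and> v = above_point n (mate (identity_arcs n) x)) \<longleftrightarrow> (\<exists>j\<in>{1..n}. u = Upper j \<and> v = Middle j \<or> u = Middle j \<and> v = Upper j)"
    proof
      assume "\<exists>x\<in>{1..2 * n}. u = above_point n x \<and> v = above_point n (mate (identity_arcs n) x)"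
      then obtain x where x: "x \<in> {1..2 * n}" "u = above_point n x" "v = above_point n (2 * n + 1 - x)" by (auto simp: identity_arcs_def)
      show "\<exists>j\<in>{1..n}. u = Upper j \<and> v = Middle j \<or> u = Middle j \<and> v = Upper j"
        by (rule bexI[of _ "if x \<le> n then x else 2 * n + 1 - x"]) (use x in \<open>auto simp: above_point_def\<close>)
    next
      assume "\<exists>j\<in>{1..n}. u = Upper j \<and> v = Middle j \<or> u = Middle j \<and> v = Upper j"
      then obtain j where j: "j \<in> {1..n}" "u = Upper j \<and> v = Middle j \<or> u = Middle j \<and> v = Upper j" by blast
      then consider "u = Upper j \<and> v = Middle j" | "u = Middle j \<and> v = Upper j" by blast
      then show "\<exists>x\<in>{1..2 * n}. u = above_point n x \<and> v = above_point n (mate (identity_arcs n) x)"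
      proof cases
        case 1 then show ?thesis using j by (intro bexI[of _ j]) (auto simp: above_point_def identity_arcs_def)
      next
        case 2 then show ?thesis using j by (intro bexI[of _ "2 * n + 1 - j"]) (auto simp: above_point_def identity_arcs_def)
      qed
    qed
    then show ?thesis by (simp add: adj_def)
  qed
  have inv: "mate Y (mate Y x) = x" for x using matchingD(1)[OF Y] .
  \<comment> \<open>A component is an arc of \<open>Y\<close>, prolonged by straight lines of the
    identity at those of its ends that lie on the top edge.\<close>
  have S: "cls ?R (outer_point n z) = below_point n ` {z, mate Y z} \<union> outer_point n ` {z, mate Y z}" if z: "z \<in> {1..2 * n}" for z
  proof (rule cls_eqI)
    have mz: "mate Y z \<in> {1..2 * n}" using mate_in[OF Y z] .
    have op: "(outer_point n x, below_point n x) \<in> ?R\<^sup>*" "(below_point n x, outer_point n x) \<in> ?R\<^sup>*" if "x \<in> {1..2 * n}" for x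
      using that by (cases "x \<le> n"; fastforce simp: outer_point_def below_point_def edge)+
    have pp: "(below_point n z, below_point n (mate Y z)) \<in> ?R" using z by (auto simp: edge)
    show "outer_point n z \<in> below_point n ` {z, mate Y z} \<union> outer_point n ` {z, mate Y z}" by simp
    fix v assume v: "v \<in> below_point n ` {z, mate Y z} \<union> outer_point n ` {z, mate Y z}"
    then show "(outer_point n z, v) \<in> ?R\<^sup>*"
      using op[OF z] op[OF mz] pp by (auto intro: rtrancl_trans)
    fix w assume "(v, w) \<in> ?R"
    then consider j where "j \<in> {1..n}" "v = Upper j" "w = Middle j" | j where "j \<in> {1..n}" "v = Middle j" "w = Upper j"
      | y where "y \<in> {1..2 * n}" "v = below_point n y" "w = below_point n (mate Y y)" unfolding edge by blast
    then show "w \<in> below_point n ` {z, mate Y z} \<union> outer_point n ` {z, mate Y z}"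
    proof cases
      case (1 j)
      then have "j = z \<or> j = mate Y z" using v by (auto simp: outer_point_def below_point_def split: if_splits)
      then show ?thesis using 1 by (auto simp: below_point_def)
    next
      case (2 j)
      then have "j = z \<or> j = mate Y z" using v by (auto simp: outer_point_def below_point_def split: if_splits)
      then show ?thesis using 2 by (auto simp: outer_point_def)
    next
      case (3 y)
      have ob: "outer_point n x = below_point n y \<longrightarrow> x = y" if "x \<in> {1..2 * n}" for x
        using that 3(1) by (auto simp: outer_point_def below_point_def)
      obtain x where x: "x = z \<or> x = mate Y z" "v = below_point n x \<or> v = outer_point n x" using v by blast
      have "x \<in> {1..2 * n}" using x(1) z mz by auto
      then have "x = y" using x(2) 3(2) ob[of x] below_point_inj[OF _ 3(1), of x] by metis
      then have "y = z \<or> y = mate Y z" using x(1) by simp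
      then show ?thesis using 3 inv by auto
    qed
  qed
  have o: "outer_positions n (cls ?R (outer_point n z)) = {z, mate Y z}" if z: "z \<in> {1..2 * n}" for z
  proof -
    have mz: "mate Y z \<in> {1..2 * n}" using mate_in[OF Y z] .
    have "outer_point n w = below_point n x \<longrightarrow> w = x" if "w \<in> {1..2 * n}" "x \<in> {1..2 * n}" for w x
      using that by (auto simp: outer_point_def below_point_def)
    then show ?thesis unfolding outer_positions_def S[OF z] using z mz outer_point_inj by auto
  qed
  have d: "decorated_by n (identity_arcs n) Y (cls ?R (outer_point n z)) \<longleftrightarrow> deco Y z" if z: "z \<in> {1..2 * n}" for z
  proof -
    have mz: "mate Y z \<in> {1..2 * n}" using mate_in[OF Y z] .
    have "below_point n y = outer_point n x \<longrightarrow> y = x" if "y \<in> {1..2 * n}" "x \<in> {1..2 * n}" for y x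
      using that by (auto simp: outer_point_def below_point_def)
    then have "deco Y y \<and> below_point n y \<in> cls ?R (outer_point n z) \<longleftrightarrow> deco Y y \<and> (y = z \<or> y = mate Y z)" for y
      unfolding S[OF z] using matchingD(4)[OF Y, of y] below_point_inj z mz by auto
    then show ?thesis using matchingD(3)[OF Y, of z] by (auto simp: decorated_by_def identity_arcs_def)
  qed
  show "joins n (identity_arcs n) Y Y" using o d by (simp add: joins_def)
  have "outer_positions n (cls ?R u) \<noteq> {}" if u: "u \<in> pts n" for u
  proof -
    have U: "j \<in> outer_positions n C" if "Upper j \<in> C" "j \<in> {1..n}" for j C using that by (auto simp: outer_positions_def outer_point_def)
    have L: "2 * n + 1 - j \<in> outer_positions n C" if "Lower j \<in> C" "j \<in> {1..n}" for j C using that by (auto simp: outer_positions_def outer_point_def)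
    consider j where "j \<in> {1..n}" "u = Upper j" | j where "j \<in> {1..n}" "u = Middle j" | j where "j \<in> {1..n}" "u = Lower j"
      using u by (auto simp: pts_def)
    then show ?thesis
    proof cases
      case 1 then show ?thesis using U[OF _ 1(1), of "cls ?R u"] by auto
    next
      case (2 j)
      then have "(u, Upper j) \<in> ?R" by (auto simp: edge)
      then have "Upper j \<in> cls ?R u" using cls_step[OF cls_self] by metis
      then show ?thesis using U[OF _ 2(1)] by auto
    next
      case 3 then show ?thesis using L[OF _ 3(1), of "cls ?R u"] by auto
    qed
  qed
  then have "plain_loops n (diagram_of n (identity_arcs n)) (diagram_of n Y) = {}" "blob_loops n (diagram_of n (identity_arcs n)) (diagram_of n Y) = {}"
    unfolding loops_adj[OF X Y] by blast+
  then show "weight \<delta> y n (identity_arcs n) Y = 1" by (simp add: weight_def)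
qed

text \<open>The additional blob sits on the component of the outer node 1, which is never a closed
  loop; so the loop factors do not change.\<close>

lemma blob1_joins:
  assumes X: "matching (2 * n) X" and Y: "matching (2 * n) Y" and Z: "matching (2 * n) Z" and n: "1 \<le> n"
    and j: "joins n X Y Z"
  shows "joins n (blob1 X) Y (blob1 Z)" "weight \<delta> y n (blob1 X) Y = weight \<delta> y n X Y"
proof -
  have X': "matching (2 * n) (blob1 X)" using blob1_matching[OF X] n by simp
  have R: "adj n (blob1 X) Y = adj n X Y" by (simp add: adj_def)
  have p1: "above_point n 1 = outer_point n 1" using n by (simp add: above_point_def outer_point_def)
  have D: "decorated_by n (blob1 X) Y (cls (adj n X Y) u) \<longleftrightarrow> decorated_by n X Y (cls (adj n X Y) u) \<or> 1 \<in> outer_positions n (cls (adj n X Y) u)" for u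
  proof -
    have "(above_point n 1, above_point n (mate X 1)) \<in> adj n X Y" using n by (auto simp: adj_def)
    then have "above_point n (mate X 1) \<in> cls (adj n X Y) u \<longleftrightarrow> above_point n 1 \<in> cls (adj n X Y) u"
      using cls_step adj_sym[OF X Y] by (meson symD)
    moreover have "1 \<in> outer_positions n (cls (adj n X Y) u) \<longleftrightarrow> above_point n 1 \<in> cls (adj n X Y) u" using n p1 by (simp add: outer_positions_def)
    ultimately show ?thesis unfolding decorated_by_def deco_blob1 by blast
  qed
  have "1 = mate Z z \<longleftrightarrow> z = mate Z 1" for z using matchingD(1)[OF Z] by metis
  then show "joins n (blob1 X) Y (blob1 Z)"
    using j unfolding joins_def R D deco_blob1 mate_blob1 by auto
  have "plain_loops n (diagram_of n (blob1 X)) (diagram_of n Y) = plain_loops n (diagram_of n X) (diagram_of n Y)"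
    "blob_loops n (diagram_of n (blob1 X)) (diagram_of n Y) = blob_loops n (diagram_of n X) (diagram_of n Y)"
    unfolding loops_adj[OF X Y] loops_adj[OF X' Y] R using D by blast+
  then show "weight \<delta> y n (blob1 X) Y = weight \<delta> y n X Y" by (simp add: weight_def)
qed

lemma rtrancl_hom:
  assumes "(u, v) \<in> R\<^sup>*" "\<And>x y. (x, y) \<in> R \<Longrightarrow> (f x, f y) \<in> S\<^sup>*"
  shows "(f u, f v) \<in> S\<^sup>*"
  using assms(1) by induction (auto intro: rtrancl_trans assms(2))

lemma outer_positions_mem: "z \<in> {1..2 * n} \<Longrightarrow> z \<in> outer_positions n C \<longleftrightarrow> outer_point n z \<in> C"
  by (simp add: outer_positions_def)

lemma adj_paI: "x \<in> {1..2 * n} \<Longrightarrow> (above_point n x, above_point n (mate X x)) \<in> adj n X Y"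
  by (auto simp: adj_def)

lemma adj_cases:
  assumes "(u, v) \<in> adj n X Y"
  obtains x where "x \<in> {1..2 * n}" "u = above_point n x" "v = above_point n (mate X x)"
    | y where "y \<in> {1..2 * n}" "u = below_point n y" "v = below_point n (mate Y y)"
  using assms by (auto simp: adj_def)

text \<open>The ends of the arc \<open>(i, i + 1)\<close> of \<open>X\<close> form a component of
  their own, so the same loop is closed whether \<open>U_i\<close> is applied before or after
  stacking on \<open>Y\<close>.\<close>

lemma join_joins_loop:
  assumes X: "matching (2 * n) X" and Y: "matching (2 * n) Y" and Z: "matching (2 * n) Z" and i: "1 \<le> i" "i < n"
    and j: "joins n X Y Z" and loop: "mate X i = Suc i"
  shows "joins n (join i X) Y (join i Z)"
    "weight \<delta> y n (join i X) Y * scal \<delta> y i X = scal \<delta> y i Z * weight \<delta> y n X Y"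
proof -
  have X': "matching (2 * n) (join i X)" using join_matching[OF X] i by simp
  have mi: "mate X (Suc i) = i" using matchingD(1)[OF X, of i] loop by simp
  have mX: "mate (join i X) = mate X" using mi loop by (auto simp: mate_join fun_eq_iff)
  have R: "adj n (join i X) Y = adj n X Y" by (simp add: adj_def mX)
  have dX: "deco (join i X) x \<longleftrightarrow> deco X x \<and> x \<noteq> i \<and> x \<noteq> Suc i" for x using mi loop by (auto simp: deco_join)
  have pu: "above_point n i = Upper i" "above_point n (Suc i) = Upper (Suc i)" "outer_point n i = Upper i" "outer_point n (Suc i) = Upper (Suc i)"
    using i by (auto simp: above_point_def outer_point_def)
  have ir: "i \<in> {1..2 * n}" "Suc i \<in> {1..2 * n}" using i by auto
  have "above_point n x = Upper i \<longleftrightarrow> x = i" "above_point n x = Upper (Suc i) \<longleftrightarrow> x = Suc i" "below_point n x \<noteq> Upper i" "below_point n x \<noteq> Upper (Suc i)" for x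
    using i by (auto simp: above_point_def below_point_def)
  note pe = this
  have c: "cls (adj n X Y) (Upper i) = {Upper i, Upper (Suc i)}"
  proof (rule cls_eqI)
    have e: "(Upper i, Upper (Suc i)) \<in> adj n X Y" using adj_paI[OF ir(1), of X Y] pu loop by simp
    fix v assume v: "v \<in> {Upper i, Upper (Suc i)}"
    then show "(Upper i, v) \<in> (adj n X Y)\<^sup>*" using e by auto
    fix w assume "(v, w) \<in> adj n X Y"
    then show "w \<in> {Upper i, Upper (Suc i)}"
    proof (cases rule: adj_cases)
      case (1 x)
      then have "x = i \<or> x = Suc i" using v pe(1,2) by auto
      then show ?thesis using 1 loop mi pu by auto
    next
      case (2 y)
      then show ?thesis using v pe(3,4) by auto
    qed
  qed simp
  have c2: "cls (adj n X Y) (Upper (Suc i)) = {Upper i, Upper (Suc i)}"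
    using cls_eq[OF adj_sym[OF X Y], of "Upper (Suc i)" "Upper i"] c by simp
  have Zi: "mate Z i = Suc i"
  proof -
    have "{i, mate Z i} = outer_positions n {Upper i, Upper (Suc i)}" using j ir(1) pu c unfolding joins_def by metis
    moreover have "Suc i \<in> outer_positions n {Upper i, Upper (Suc i)}" using ir pu by (simp add: outer_positions_def)
    ultimately have "Suc i \<in> {i, mate Z i}" by simp
    then show ?thesis by simp
  qed
  have Zi2: "mate Z (Suc i) = i" using matchingD(1)[OF Z, of i] Zi by simp
  have mZ: "mate (join i Z) = mate Z" using Zi2 Zi by (auto simp: mate_join fun_eq_iff)
  have dZ: "deco (join i Z) x \<longleftrightarrow> deco Z x \<and> x \<noteq> i \<and> x \<noteq> Suc i" for x using Zi2 Zi by (auto simp: deco_join)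
  have dc: "decorated_by n X Y {Upper i, Upper (Suc i)} \<longleftrightarrow> deco X i"
    unfolding decorated_by_def using pe matchingD(3)[OF X, of i] loop by auto
  have dd: "deco Z i \<longleftrightarrow> deco X i" using j ir(1) pu c dc unfolding joins_def by metis
  have no: "\<not> decorated_by n (join i X) Y {Upper i, Upper (Suc i)}"
    unfolding decorated_by_def dX using pe by auto
  have same: "decorated_by n (join i X) Y (cls (adj n X Y) u) \<longleftrightarrow> decorated_by n X Y (cls (adj n X Y) u)"
    if "Upper i \<notin> cls (adj n X Y) u" for u
  proof -
    have "Upper (Suc i) \<notin> cls (adj n X Y) u"
      using that cls_eq[OF adj_sym[OF X Y], of "Upper (Suc i)" u] c2 by auto
    then have "x \<noteq> i \<and> x \<noteq> Suc i" if "above_point n x \<in> cls (adj n X Y) u" for x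
      using that \<open>Upper i \<notin> _\<close> pu by auto
    then show ?thesis unfolding decorated_by_def dX by blast
  qed
  have zz: "outer_point n z \<noteq> Upper i" "outer_point n z \<noteq> Upper (Suc i)" if "z \<noteq> i" "z \<noteq> Suc i" "z \<in> {1..2 * n}" for z
    using that by (auto simp: outer_point_def)
  show "joins n (join i X) Y (join i Z)"
    unfolding joins_def R mZ dZ
  proof
    fix z assume z: "z \<in> {1..2 * n}"
    have jz: "outer_positions n (cls (adj n X Y) (outer_point n z)) = {z, mate Z z}" "decorated_by n X Y (cls (adj n X Y) (outer_point n z)) \<longleftrightarrow> deco Z z"
      using j z by (simp_all add: joins_def)
    show "outer_positions n (cls (adj n X Y) (outer_point n z)) = {z, mate Z z} \<and>
      decorated_by n (join i X) Y (cls (adj n X Y) (outer_point n z)) = (deco Z z \<and> z \<noteq> i \<and> z \<noteq> Suc i)"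
    proof (cases "z = i \<or> z = Suc i")
      case True
      then have cc: "cls (adj n X Y) (outer_point n z) = {Upper i, Upper (Suc i)}" using c c2 pu by metis
      show ?thesis using jz(1) no True unfolding cc by blast
    next
      case False
      have "Upper i \<notin> cls (adj n X Y) (outer_point n z)"
      proof
        assume "Upper i \<in> cls (adj n X Y) (outer_point n z)"
        then have "outer_point n z \<in> {Upper i, Upper (Suc i)}"
          using cls_eq[OF adj_sym[OF X Y], of "Upper i" "outer_point n z"] c cls_self[of "outer_point n z"] by metis
        then show False using zz False z by auto
      qed
      then show ?thesis using same jz False by simp
    qed
  qed
  have lo: "outer_positions n C = {} \<Longrightarrow> Upper i \<notin> C" for C
    using outer_positions_mem[OF ir(1), of C] unfolding pu by auto
  have "plain_loops n (diagram_of n (join i X)) (diagram_of n Y) = plain_loops n (diagram_of n X) (diagram_of n Y)"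
    "blob_loops n (diagram_of n (join i X)) (diagram_of n Y) = blob_loops n (diagram_of n X) (diagram_of n Y)"
    unfolding loops_adj[OF X Y] loops_adj[OF X' Y] R using same lo by blast+
  then show "weight \<delta> y n (join i X) Y * scal \<delta> y i X = scal \<delta> y i Z * weight \<delta> y n X Y"
    using Zi loop dd by (simp add: weight_def scal_def)
qed

text \<open>Exchanging two edges of the graph merges the components of \<open>i\<close> and
  \<open>i + 1\<close>, apart from these two points. At most one loop arises, namely when they were
  the outer ends of one strand, and then \<open>join i Z\<close> closes that same loop.\<close>

lemma join_joins_noloop:
  assumes X: "matching (2 * n) X" and Y: "matching (2 * n) Y" and Z: "matching (2 * n) Z" and i: "1 \<le> i" "i < n"
    and j: "joins n X Y Z" and nl: "mate X i \<noteq> Suc i"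
  shows "joins n (join i X) Y (join i Z)"
    "weight \<delta> y n (join i X) Y * scal \<delta> y i X = scal \<delta> y i Z * weight \<delta> y n X Y"
proof -
  have X': "matching (2 * n) (join i X)" using join_matching[OF X] i by simp
  define R where "R = adj n X Y"
  define R' where "R' = adj n (join i X) Y"
  define a where "a = mate X i"
  define b where "b = mate X (Suc i)"
  define u1 where "u1 = Upper i"
  define u2 where "u2 = Upper (Suc i)"
  define A where "A = above_point n a"
  define B where "B = above_point n b"
  have ir: "i \<in> {1..2 * n}" "Suc i \<in> {1..2 * n}" using i by auto
  have inv: "mate X (mate X x) = x" for x using matchingD(1)[OF X] .
  have ab: "mate X i = a" "mate X (Suc i) = b" "mate X a = i" "mate X b = Suc i" using inv by (simp_all add: a_def b_def)
  have abr: "a \<in> {1..2 * n}" "b \<in> {1..2 * n}" using mate_in[OF X] ir by (simp_all add: a_def b_def)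
  have ne: "a \<noteq> i" "b \<noteq> Suc i" "a \<noteq> Suc i" "b \<noteq> i" "a \<noteq> b"
  proof -
    show "a \<noteq> i" "b \<noteq> Suc i" using matchingD(2)[OF X] ir by (simp_all add: a_def b_def)
    show "a \<noteq> Suc i" using nl by (simp add: a_def)
    then show "b \<noteq> i" using ab by metis
    show "a \<noteq> b" using mate_inj[OF X, of i "Suc i"] by (simp add: a_def b_def)
  qed
  have pu: "above_point n i = u1" "above_point n (Suc i) = u2" "outer_point n i = u1" "outer_point n (Suc i) = u2"
    using i by (auto simp: above_point_def outer_point_def u1_def u2_def)
  have pe: "above_point n x = u1 \<longleftrightarrow> x = i" "above_point n x = u2 \<longleftrightarrow> x = Suc i" "below_point n x \<noteq> u1" "below_point n x \<noteq> u2" for x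
    using i by (auto simp: above_point_def below_point_def u1_def u2_def)
  have u12: "u1 \<noteq> u2" by (simp add: u1_def u2_def)
  have AB: "A \<noteq> u1" "A \<noteq> u2" "B \<noteq> u1" "B \<noteq> u2" using pe ne by (simp_all add: A_def B_def)
  have symR: "sym R" "sym R'" using adj_sym X X' Y by (auto simp: R_def R'_def)
  have Redge: "(u1, A) \<in> R" "(u2, B) \<in> R" using adj_paI[OF ir(1), of X Y] adj_paI[OF ir(2), of X Y] pu ab by (simp_all add: R_def A_def B_def)
  have R1: "(u1, v) \<in> R \<longleftrightarrow> v = A" "(u2, v) \<in> R \<longleftrightarrow> v = B" for v
  proof -
    have "v = A" if "(u1, v) \<in> R"
      using that unfolding R_def A_def by (rule adj_cases) (metis pe(1,3) ab(1))+
    moreover have "v = B" if "(u2, v) \<in> R"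
      using that unfolding R_def B_def by (rule adj_cases) (metis pe(2,4) ab(2))+
    ultimately show "(u1, v) \<in> R \<longleftrightarrow> v = A" "(u2, v) \<in> R \<longleftrightarrow> v = B" using Redge by blast+
  qed
  have R2: "(v, u1) \<in> R \<longleftrightarrow> v = A" "(v, u2) \<in> R \<longleftrightarrow> v = B" for v
    using R1[of v] symD[OF symR(1), of v u1] symD[OF symR(1), of u1 v] symD[OF symR(1), of v u2] symD[OF symR(1), of u2 v] by blast+
  \<comment> \<open>With \<open>A\<close> and \<open>B\<close> the neighbours of the two outer
    points, the edges from \<open>u1\<close> to \<open>A\<close> and from \<open>u2\<close> to
    \<open>B\<close> are exchanged for edges from \<open>u1\<close> to \<open>u2\<close> and from
    \<open>A\<close> to \<open>B\<close>.\<close>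
  have R'_iff: "(u, v) \<in> R' \<longleftrightarrow> (u, v) \<in> R \<and> u \<notin> {u1, u2} \<and> v \<notin> {u1, u2} \<or>
     (u, v) \<in> {(u1, u2), (u2, u1), (A, B), (B, A)}" for u v
  proof
    assume "(u, v) \<in> R'"
    then have "(u, v) \<in> adj n (join i X) Y" by (simp add: R'_def)
    then show "(u, v) \<in> R \<and> u \<notin> {u1, u2} \<and> v \<notin> {u1, u2} \<or> (u, v) \<in> {(u1, u2), (u2, u1), (A, B), (B, A)}"
    proof (cases rule: adj_cases)
      case (1 x)
      show ?thesis
      proof (cases "x \<in> {i, Suc i, a, b}")
        case True
        then show ?thesis using 1 ne pu by (auto simp: mate_join ab A_def B_def)
      next
        case False
        then have "mate (join i X) x = mate X x" by (simp add: mate_join ab)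
        moreover have "mate X x \<noteq> i" "mate X x \<noteq> Suc i" using False inv[of x] ab by auto
        ultimately show ?thesis using 1 False pe by (auto simp: R_def adj_def)
      qed
    next
      case (2 y)
      then show ?thesis using pe by (auto simp: R_def adj_def)
    qed
  next
    assume r: "(u, v) \<in> R \<and> u \<notin> {u1, u2} \<and> v \<notin> {u1, u2} \<or> (u, v) \<in> {(u1, u2), (u2, u1), (A, B), (B, A)}"
    have E: "(above_point n x, above_point n (mate (join i X) x)) \<in> R'" if "x \<in> {1..2 * n}" for x using that by (auto simp: R'_def adj_def)
    show "(u, v) \<in> R'"
      using r
    proof
      assume "(u, v) \<in> {(u1, u2), (u2, u1), (A, B), (B, A)}"
      moreover have "(u1, u2) \<in> R'" "(u2, u1) \<in> R'" "(A, B) \<in> R'" "(B, A) \<in> R'"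
        using E[OF ir(1)] E[OF ir(2)] E[OF abr(1)] E[OF abr(2)] ne pu by (simp_all add: mate_join ab A_def B_def)
      ultimately show ?thesis by auto
    next
      assume r: "(u, v) \<in> R \<and> u \<notin> {u1, u2} \<and> v \<notin> {u1, u2}"
      then have "(u, v) \<in> adj n X Y" by (simp add: R_def)
      then show ?thesis
      proof (cases rule: adj_cases)
        case (1 x)
        then have "x \<noteq> i" "x \<noteq> Suc i" "mate X x \<noteq> i" "mate X x \<noteq> Suc i" using r pe by auto
        moreover from this have "x \<noteq> a" "x \<noteq> b" using ab by auto
        ultimately show ?thesis using E[OF 1(1)] 1 by (simp add: mate_join ab)
      next
        case (2 y)
        then show ?thesis by (auto simp: R'_def adj_def)
      qed
    qed
  qed
  \<comment> \<open>Collapsing the two removed end points onto their neighbours maps paths in the old graph to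
    paths in the new one.\<close>
  define f where "f v = (if v = u1 then A else if v = u2 then B else v)" for v
  have hom: "(f u, f v) \<in> R'\<^sup>*" if "(u, v) \<in> R\<^sup>*" for u v
    using that
  proof (rule rtrancl_hom)
    fix x y assume xy: "(x, y) \<in> R"
    consider "x = u1" | "x = u2" | "y = u1" | "y = u2" | "x \<notin> {u1, u2}" "y \<notin> {u1, u2}" by blast
    then show "(f x, f y) \<in> R'\<^sup>*"
    proof cases
      case 1 then show ?thesis using xy R1 AB by (simp add: f_def)
    next
      case 2 then show ?thesis using xy R1 AB u12 by (simp add: f_def)
    next
      case 3 then show ?thesis using xy R2 AB by (simp add: f_def)
    next
      case 4 then show ?thesis using xy R2 AB u12 by (simp add: f_def)
    next
      case 5 then show ?thesis using xy R'_iff[of x y] by (auto simp: f_def)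
    qed
  qed
  let ?S = "cls R"
  define T where "T = (?S A \<union> ?S B) - {u1, u2}"
  have u1A: "?S u1 = ?S A" "?S u2 = ?S B"
    using cls_eq[OF symR(1)] cls_step[OF cls_self Redge(1)] cls_step[OF cls_self Redge(2)] by auto
  have c1: "cls R' u1 = {u1, u2}"
  proof (rule cls_eqI)
    fix v assume v: "v \<in> {u1, u2}"
    then show "(u1, v) \<in> R'\<^sup>*" using R'_iff[of u1 u2] by auto
    fix w assume "(v, w) \<in> R'"
    then show "w \<in> {u1, u2}" using v R'_iff[of v w] AB by auto
  qed simp
  have c1': "cls R' u2 = {u1, u2}" using cls_eq[OF symR(2), of u2 u1] c1 by simp
  have c2: "cls R' u = T" if u: "u \<in> T" for u
  proof -
    have "cls R' A = T"
    proof (rule cls_eqI)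
      show "A \<in> T" using AB by (simp add: T_def)
      fix v assume v: "v \<in> T"
      have vf: "f v = v" using v by (auto simp: T_def f_def)
      have AB': "(A, B) \<in> R'" using R'_iff by blast
      show "(A, v) \<in> R'\<^sup>*"
      proof (cases "v \<in> ?S A")
        case True
        then have "(f A, f v) \<in> R'\<^sup>*" using hom by (simp add: cls_def)
        then show ?thesis using vf AB by (simp add: f_def)
      next
        case False
        then have "(B, v) \<in> R\<^sup>*" using v by (simp add: T_def cls_def)
        then have "(f B, f v) \<in> R'\<^sup>*" by (rule hom)
        then show ?thesis using vf AB AB' by (simp add: f_def)
      qed
      fix w assume vw: "(v, w) \<in> R'"
      show "w \<in> T"
        using vw v R'_iff[of v w] cls_step[of v R A w] cls_step[of v R B w] AB by (auto simp: T_def)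
    qed
    then show ?thesis using cls_eq[OF symR(2)] u by metis
  qed
  have c3: "cls R' u = ?S u" if u: "u \<notin> ?S A" "u \<notin> ?S B" for u
  proof -
    have disj: "v \<notin> ?S A" "v \<notin> ?S B" if "v \<in> ?S u" for v
      using cls_eq[OF symR(1)] that u cls_self by metis+
    have sp: "u1 \<in> ?S A" "u2 \<in> ?S B" using u1A cls_self by metis+
    have nn: "v \<noteq> u1 \<and> v \<noteq> u2 \<and> v \<noteq> A \<and> v \<noteq> B" if "v \<in> ?S u" for v
      using disj[OF that] sp by auto
    show ?thesis
    proof (rule cls_eqI)
      fix v assume v: "v \<in> ?S u"
      then have "(f u, f v) \<in> R'\<^sup>*" using hom by (simp add: cls_def)
      then show "(u, v) \<in> R'\<^sup>*" using nn[OF v] nn[OF cls_self] by (simp add: f_def)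
      fix w assume "(v, w) \<in> R'"
      then show "w \<in> ?S u" using nn[OF v] R'_iff[of v w] cls_step[OF v] by auto
    qed simp
  qed
  have dj: "deco (join i X) x \<longleftrightarrow> (if x = a \<or> x = b then deco X i \<or> deco X (Suc i) else x \<noteq> i \<and> x \<noteq> Suc i \<and> deco X x)" for x
    using ne by (auto simp: deco_join ab)
  have da: "deco X a = deco X i" "deco X b = deco X (Suc i)" using matchingD(3)[OF X] by (simp_all add: a_def b_def)
  have paA: "above_point n x \<in> C \<longleftrightarrow> x = i \<and> u1 \<in> C \<or> x = Suc i \<and> u2 \<in> C \<or> x = a \<and> A \<in> C \<or> x = b \<and> B \<in> C \<or> x \<notin> {i, Suc i, a, b} \<and> above_point n x \<in> C" for x C
    using pu by (auto simp: A_def B_def)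
  have d3: "decorated_by n (join i X) Y C \<longleftrightarrow> decorated_by n X Y C" if "u1 \<notin> C" "u2 \<notin> C" "A \<notin> C" "B \<notin> C" for C
  proof -
    have "deco (join i X) x \<and> above_point n x \<in> C \<longleftrightarrow> deco X x \<and> above_point n x \<in> C" for x
      using paA[of x C] that dj[of x] by auto
    then show ?thesis by (simp add: decorated_by_def)
  qed
  have dT: "decorated_by n (join i X) Y T \<longleftrightarrow> decorated_by n X Y (?S A) \<or> decorated_by n X Y (?S B)"
  proof -
    have AT: "A \<in> T" "B \<in> T" "u1 \<notin> T" "u2 \<notin> T" using AB by (auto simp: T_def)
    have uS: "u1 \<in> ?S A \<union> ?S B" "u2 \<in> ?S A \<union> ?S B" "A \<in> ?S A \<union> ?S B" "B \<in> ?S A \<union> ?S B" using u1A cls_self by auto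
    have pbT: "below_point n x \<in> T \<longleftrightarrow> below_point n x \<in> ?S A \<union> ?S B" for x using pe by (auto simp: T_def)
    have paT: "above_point n x \<in> T \<longleftrightarrow> above_point n x \<in> ?S A \<union> ?S B" if "x \<noteq> i" "x \<noteq> Suc i" for x using pe that by (auto simp: T_def)
    have "(\<exists>x. deco (join i X) x \<and> above_point n x \<in> T) \<longleftrightarrow> (\<exists>x. deco X x \<and> above_point n x \<in> ?S A \<union> ?S B)"
    proof
      assume "\<exists>x. deco (join i X) x \<and> above_point n x \<in> T"
      then obtain x where x: "deco (join i X) x" "above_point n x \<in> T" by blast
      show "\<exists>x. deco X x \<and> above_point n x \<in> ?S A \<union> ?S B"
      proof (cases "x = a \<or> x = b")
        case True
        then have "deco X i \<or> deco X (Suc i)" using x(1) dj by simp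
        then show ?thesis using pu uS by metis
      next
        case False
        then show ?thesis using x dj paT by auto
      qed
    next
      assume "\<exists>x. deco X x \<and> above_point n x \<in> ?S A \<union> ?S B"
      then obtain x where x: "deco X x" "above_point n x \<in> ?S A \<union> ?S B" by blast
      show "\<exists>x. deco (join i X) x \<and> above_point n x \<in> T"
      proof (cases "x \<in> {i, Suc i, a, b}")
        case True
        then have "deco (join i X) a" using x(1) dj da by auto
        then show ?thesis using AT by (auto simp: A_def)
      next
        case False
        then show ?thesis using x dj paT by auto
      qed
    qed
    then show ?thesis unfolding decorated_by_def using pbT by blast
  qed
  have jz: "outer_positions n (?S (outer_point n z)) = {z, mate Z z}" "decorated_by n X Y (?S (outer_point n z)) \<longleftrightarrow> deco Z z" if "z \<in> {1..2 * n}" for z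
    using j that by (simp_all add: joins_def R_def)
  have oA: "outer_positions n (?S A) = {i, mate Z i}" "outer_positions n (?S B) = {Suc i, mate Z (Suc i)}"
    and dA: "decorated_by n X Y (?S A) \<longleftrightarrow> deco Z i" "decorated_by n X Y (?S B) \<longleftrightarrow> deco Z (Suc i)"
    using jz[OF ir(1)] jz[OF ir(2)] pu u1A by simp_all
  have invZ: "mate Z (mate Z x) = x" for x using matchingD(1)[OF Z] .
  have neZ: "mate Z i \<noteq> i" "mate Z (Suc i) \<noteq> Suc i" "mate Z i \<noteq> mate Z (Suc i)"
    using matchingD(2)[OF Z] ir mate_inj[OF Z, of i "Suc i"] by auto
  have oiff: "outer_point n z = u1 \<longleftrightarrow> z = i" "outer_point n z = u2 \<longleftrightarrow> z = Suc i" if "z \<in> {1..2 * n}" for z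
    using outer_point_inj[OF that ir(1)] outer_point_inj[OF that ir(2)] pu by simp_all
  have oT: "outer_positions n T = {i, mate Z i, Suc i, mate Z (Suc i)} - {i, Suc i}"
  proof -
    have "outer_positions n T = (outer_positions n (?S A) \<union> outer_positions n (?S B)) - {i, Suc i}" using oiff by (auto simp: outer_positions_def T_def)
    then show ?thesis using oA by auto
  qed
  have mi2: "mate Z (Suc i) = i \<longleftrightarrow> mate Z i = Suc i" using invZ by metis
  show "joins n (join i X) Y (join i Z)"
    unfolding joins_def R'_def[symmetric]
  proof
    fix z assume z: "z \<in> {1..2 * n}"
    have zA: "outer_point n z \<in> ?S A \<longleftrightarrow> z = i \<or> z = mate Z i" "outer_point n z \<in> ?S B \<longleftrightarrow> z = Suc i \<or> z = mate Z (Suc i)"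
      using outer_positions_mem[OF z, of "?S A"] outer_positions_mem[OF z, of "?S B"] unfolding oA by blast+
    consider "z = i \<or> z = Suc i" | "z \<noteq> i" "z \<noteq> Suc i" "z = mate Z i \<or> z = mate Z (Suc i)"
      | "z \<noteq> i" "z \<noteq> Suc i" "z \<noteq> mate Z i" "z \<noteq> mate Z (Suc i)" by blast
    then show "outer_positions n (cls R' (outer_point n z)) = {z, mate (join i Z) z} \<and>
        (decorated_by n (join i X) Y (cls R' (outer_point n z)) \<longleftrightarrow> deco (join i Z) z)"
    proof cases
      case 1
      have c: "cls R' (outer_point n z) = {u1, u2}" using 1 c1 c1' pu by metis
      have o: "outer_positions n {u1, u2} = {i, Suc i}" unfolding outer_positions_def using oiff ir by blast
      have "\<not> decorated_by n (join i X) Y {u1, u2}" unfolding decorated_by_def using pe by auto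
      then show ?thesis using 1 unfolding c o by (elim disjE) auto
    next
      case 2
      have "outer_point n z \<in> T" using zA 2 oiff z by (auto simp: T_def)
      then have c: "cls R' (outer_point n z) = T" by (rule c2)
      have nz: "mate Z i \<noteq> Suc i" using 2 mi2 by auto
      have "outer_positions n T = {mate Z i, mate Z (Suc i)}" using oT nz neZ mi2 by auto
      moreover have "mate (join i Z) z = (if z = mate Z (Suc i) then mate Z i else mate Z (Suc i))" using 2 by (auto simp: mate_join)
      moreover have "deco (join i Z) z = (deco Z i \<or> deco Z (Suc i))" using 2 by (auto simp: deco_join)
      ultimately show ?thesis unfolding c dT dA using 2(3) by auto
    next
      case 3
      have nS: "outer_point n z \<notin> ?S A" "outer_point n z \<notin> ?S B" using zA 3 by simp_all
      have c: "cls R' (outer_point n z) = ?S (outer_point n z)" by (rule c3[OF nS])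
      have "v \<notin> ?S (outer_point n z)" if "v \<in> ?S A \<union> ?S B" for v
        using that nS cls_eq[OF symR(1)] cls_self by (metis Un_iff)
      moreover have "u1 \<in> ?S A \<union> ?S B" "u2 \<in> ?S A \<union> ?S B" "A \<in> ?S A \<union> ?S B" "B \<in> ?S A \<union> ?S B" using u1A cls_self by auto
      ultimately have "decorated_by n (join i X) Y (?S (outer_point n z)) \<longleftrightarrow> decorated_by n X Y (?S (outer_point n z))" by (intro d3) blast+
      moreover have "mate (join i Z) z = mate Z z" "deco (join i Z) z = deco Z z" using 3 by (simp_all add: mate_join deco_join)
      ultimately show ?thesis unfolding c using jz[OF z] by simp
    qed
  qed
  define LL where "LL = {C \<in> ?S ` pts n. outer_positions n C = {}}"
  define LL' where "LL' = {C \<in> cls R' ` pts n. outer_positions n C = {}}"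
  have u1o: "u1 \<in> C \<or> u2 \<in> C \<Longrightarrow> outer_positions n C \<noteq> {}" for C
    using outer_positions_mem[OF ir(1), of C] outer_positions_mem[OF ir(2), of C] unfolding pu by auto
  have oldL: "A \<notin> C \<and> B \<notin> C \<and> u1 \<notin> C \<and> u2 \<notin> C \<and> C \<in> cls R' ` pts n" if "C \<in> LL" for C
  proof -
    obtain u where u: "C = ?S u" "u \<in> pts n" "outer_positions n C = {}" using \<open>C \<in> LL\<close> by (auto simp: LL_def)
    have "A \<notin> C" "B \<notin> C" using u cls_eq[OF symR(1)] u1A u1o cls_self by metis+
    moreover from this have "u \<notin> ?S A" "u \<notin> ?S B" using u(1) cls_eq[OF symR(1)] cls_self by metis+
    ultimately show ?thesis using u c3 u1o by blast
  qed
  have AT: "A \<in> T" using AB by (simp add: T_def)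
  have Apts: "A \<in> pts n" using pts_in(1)[OF abr(1)] by (simp add: A_def)
  have TR': "T \<in> cls R' ` pts n" using c2[OF AT] Apts by blast
  have newL: "C \<in> LL \<or> C = T" if C: "C \<in> LL'" for C
  proof -
    obtain u where u: "C = cls R' u" "u \<in> pts n" "outer_positions n C = {}" using C by (auto simp: LL'_def)
    consider "u \<in> {u1, u2}" | "u \<in> T" | "u \<notin> ?S A" "u \<notin> ?S B" by (auto simp: T_def)
    then show ?thesis
    proof cases
      case 1 then show ?thesis using u u1o[of C] c1 c1' by auto
    next
      case 2 then show ?thesis using c2 u by auto
    next
      case 3 then show ?thesis using c3 u by (auto simp: LL_def)
    qed
  qed
  have oldL': "C \<in> LL'" if "C \<in> LL" for C using oldL[OF that] that by (auto simp: LL_def LL'_def)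
  \<comment> \<open>The merged component has lost the outer points \<open>i\<close> and
    \<open>i + 1\<close>, so it is a loop exactly if it had no others, that is, if \<open>Z\<close>
    joins these two.\<close>
  have LL'_eq: "LL' = (if mate Z i = Suc i then insert T LL else LL)"
  proof -
    have "outer_positions n T = {} \<longleftrightarrow> mate Z i = Suc i" using oT neZ mi2 by auto
    then have "T \<in> LL' \<longleftrightarrow> mate Z i = Suc i" using TR' by (simp add: LL'_def)
    then show ?thesis using newL oldL' by (cases "mate Z i = Suc i") (simp_all, blast+)
  qed
  have TL: "T \<notin> LL" using oldL AT by blast
  have decL: "decorated_by n (join i X) Y C \<longleftrightarrow> decorated_by n X Y C" if "C \<in> LL" for C using oldL[OF that] d3 by blast
  have pl: "plain_loops n (diagram_of n X) (diagram_of n Y) = {C \<in> LL. \<not> decorated_by n X Y C}" "blob_loops n (diagram_of n X) (diagram_of n Y) = {C \<in> LL. decorated_by n X Y C}"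
    unfolding loops_adj[OF X Y] LL_def R_def by blast+
  have pl': "plain_loops n (diagram_of n (join i X)) (diagram_of n Y) = {C \<in> LL'. \<not> decorated_by n (join i X) Y C}"
    "blob_loops n (diagram_of n (join i X)) (diagram_of n Y) = {C \<in> LL'. decorated_by n (join i X) Y C}"
    unfolding loops_adj[OF X' Y] LL'_def R'_def by blast+
  have fin: "finite LL" by (simp add: LL_def pts_def)
  show "weight \<delta> y n (join i X) Y * scal \<delta> y i X = scal \<delta> y i Z * weight \<delta> y n X Y"
  proof (cases "mate Z i = Suc i")
    case False
    then have "LL' = LL" using LL'_eq by simp
    then have "{C \<in> LL'. \<not> decorated_by n (join i X) Y C} = {C \<in> LL. \<not> decorated_by n X Y C}"
      "{C \<in> LL'. decorated_by n (join i X) Y C} = {C \<in> LL. decorated_by n X Y C}" using decL by auto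
    then show ?thesis using False nl by (simp add: weight_def pl pl' scal_def)
  next
    case True
    then have L: "LL' = insert T LL" using LL'_eq by simp
    have "deco Z (Suc i) = deco Z i" using matchingD(3)[OF Z, of i] True by simp
    then have dZ: "decorated_by n (join i X) Y T \<longleftrightarrow> deco Z i" using dT dA by simp
    show ?thesis
    proof (cases "deco Z i")
      case d: True
      then have "{C \<in> LL'. \<not> decorated_by n (join i X) Y C} = {C \<in> LL. \<not> decorated_by n X Y C}"
        "{C \<in> LL'. decorated_by n (join i X) Y C} = insert T {C \<in> LL. decorated_by n X Y C}" using decL dZ L by auto
      then show ?thesis using True nl d TL fin by (simp add: weight_def pl pl' scal_def)
    next
      case d: False
      then have "{C \<in> LL'. \<not> decorated_by n (join i X) Y C} = insert T {C \<in> LL. \<not> decorated_by n X Y C}"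
        "{C \<in> LL'. decorated_by n (join i X) Y C} = {C \<in> LL. decorated_by n X Y C}" using decL dZ L by auto
      then show ?thesis using True nl d TL fin by (simp add: weight_def pl pl' scal_def)
    qed
  qed
qed

text \<open>Associativity \<open>(U_i X) Y = U_i (X Y)\<close> with its loop factors: the second
  claim has those of the left product on its left and those of the right product on its
  right.\<close>

lemma join_joins:
  assumes "matching (2 * n) X" "matching (2 * n) Y" "matching (2 * n) Z" "1 \<le> i" "i < n" "joins n X Y Z"
  shows "joins n (join i X) Y (join i Z)"
    "weight \<delta> y n (join i X) Y * scal \<delta> y i X = scal \<delta> y i Z * weight \<delta> y n X Y"
  using join_joins_loop[OF assms] join_joins_noloop[OF assms] by blast+

lemma id_diagram_diagram_of: "id_diagram n = diagram_of n (identity_arcs n)"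
proof -
  have "(\<lambda>j. {Top j, Bot j}) ` {1..n} = (\<lambda>x. {node_at n x, node_at n (mate (identity_arcs n) x)}) ` {1..2 * n}" (is "?A = ?B")
  proof
    show "?A \<subseteq> ?B"
    proof (clarify)
      fix j assume "j \<in> {1..n}"
      then show "{Top j, Bot j} \<in> ?B" by (intro image_eqI[of _ _ j]) (auto simp: node_at_def identity_arcs_def)
    qed
    show "?B \<subseteq> ?A"
    proof (clarify)
      fix x assume x: "x \<in> {1..2 * n}"
      show "{node_at n x, node_at n (mate (identity_arcs n) x)} \<in> ?A"
        by (rule image_eqI[of _ _ "if x \<le> n then x else 2 * n + 1 - x"]) (use x in \<open>auto simp: node_at_def identity_arcs_def\<close>)
    qed
  qed
  then show ?thesis by (simp add: id_diagram_def diagram_of_def) (simp add: identity_arcs_def)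
qed

lemma e_diagram_diagram_of:
  assumes "1 \<le> n" shows "e_diagram n = diagram_of n (blob1 (identity_arcs n))"
proof -
  have "lines (e_diagram n) = lines (diagram_of n (blob1 (identity_arcs n)))"
    using id_diagram_diagram_of[of n] by (simp add: e_diagram_def id_diagram_def diagram_of_def)
  moreover have "{x \<in> {1..2 * n}. deco (blob1 (identity_arcs n)) x} = {1, 2 * n}"
    using assms by (auto simp: deco_blob1 identity_arcs_def)
  then have "blobs (diagram_of n (blob1 (identity_arcs n))) = {{Top 1, Bot 1}}"
    using assms by (auto simp: diagram_of_def node_at_def identity_arcs_def)
  ultimately show ?thesis by (simp add: e_diagram_def diagram.expand)
qed

lemma U_diagram_diagram_of:
  assumes i: "1 \<le> i" "i < n" shows "U_diagram n i = diagram_of n (join i (identity_arcs n))"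
proof -
  \<comment> \<open>Positions \<open>c\<close> and \<open>c + 1\<close> are the bottom nodes
    \<open>i + 1\<close> and \<open>i\<close>.\<close>
  define c where "c = 2 * n - i"
  have c: "i + c = 2 * n" "n < c" "Suc i \<noteq> c" "i \<noteq> c" "Suc i \<noteq> Suc c" "i \<noteq> Suc c" "c \<in> {1..2 * n}" "Suc c \<in> {1..2 * n}"
    using i by (auto simp: c_def)
  have mid: "mate (identity_arcs n) i = Suc c" "mate (identity_arcs n) (Suc i) = c" using i by (auto simp: identity_arcs_def c_def)
  have G: "mate (join i (identity_arcs n)) x = (if x = Suc i then i else if x = i then Suc i else
      if x = c then Suc c else if x = Suc c then c else mate (identity_arcs n) x)" for x
    unfolding mate_join mid ..
  have ndi: "node_at n i = Top i" "node_at n (Suc i) = Top (i + 1)" "node_at n (Suc c) = Bot i" "node_at n c = Bot (i + 1)"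
    using i by (auto simp: node_at_def c_def)
  have idj: "{node_at n x, node_at n (mate (identity_arcs n) x)} = {Top j, Bot j}" if "x = j \<or> x = 2 * n + 1 - j" "j \<in> {1..n}" for x j
    using that by (auto simp: node_at_def identity_arcs_def)
  have "lines (U_diagram n i) = (\<lambda>x. {node_at n x, node_at n (mate (join i (identity_arcs n)) x)}) ` {1..2 * n}" (is "_ = ?B")
  proof
    show "lines (U_diagram n i) \<subseteq> ?B"
    proof
      fix l assume "l \<in> lines (U_diagram n i)"
      then have "l = {Top i, Top (i + 1)} \<or> l = {Bot i, Bot (i + 1)} \<or> (\<exists>j \<in> {1..n} - {i, i + 1}. l = {Top j, Bot j})"
        by (auto simp: U_diagram_def)
      then consider "l = {Top i, Top (i + 1)}" | "l = {Bot i, Bot (i + 1)}" | j where "j \<in> {1..n}" "j \<noteq> i" "j \<noteq> Suc i" "l = {Top j, Bot j}"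
        by fastforce
      then show "l \<in> ?B"
      proof cases
        case 1 then show ?thesis using i G ndi by (intro image_eqI[of _ _ i]) simp_all
      next
        case 2 then show ?thesis using c G ndi by (intro image_eqI[of _ _ "Suc c"]) simp_all
      next
        case (3 j)
        then have "j \<noteq> c" "j \<noteq> Suc c" using c by auto
        then have "mate (join i (identity_arcs n)) j = mate (identity_arcs n) j" using G 3 by simp
        then show ?thesis using idj[of j j] 3 by (intro image_eqI[of _ _ j]) simp_all
      qed
    qed
    show "?B \<subseteq> lines (U_diagram n i)"
    proof (clarify)
      fix x assume x: "x \<in> {1..2 * n}"
      consider "x = i" | "x = Suc i" | "x = c" | "x = Suc c" | "x \<noteq> i" "x \<noteq> Suc i" "x \<noteq> c" "x \<noteq> Suc c" by blast
      then show "{node_at n x, node_at n (mate (join i (identity_arcs n)) x)} \<in> lines (U_diagram n i)"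
      proof cases
        case 1 then show ?thesis using G ndi by (simp add: U_diagram_def)
      next
        case 2 then show ?thesis using G ndi by (simp add: U_diagram_def insert_commute)
      next
        case 3 then show ?thesis using G ndi c by (simp add: U_diagram_def insert_commute)
      next
        case 4 then show ?thesis using G ndi c by (simp add: U_diagram_def)
      next
        case 5
        define j where "j = (if x \<le> n then x else 2 * n + 1 - x)"
        have j: "j \<in> {1..n}" "x = j \<or> x = 2 * n + 1 - j" using x by (auto simp: j_def)
        have "j \<noteq> i" "j \<noteq> Suc i" using 5 c i x by (auto simp: j_def split: if_splits)
        moreover have "{node_at n x, node_at n (mate (join i (identity_arcs n)) x)} = {Top j, Bot j}" using G 5 idj[OF j(2,1)] by simp
        ultimately show ?thesis using j(1) by (auto simp: U_diagram_def)
      qed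
    qed
  qed
  moreover have "\<not> deco (join i (identity_arcs n)) x" for x by (auto simp: deco_join identity_arcs_def)
  ultimately show ?thesis by (intro diagram.expand) (simp add: diagram_of_def U_diagram_def)
qed

section \<open>Jucys--Murphy operators\<close>

definition smul :: "'a::field \<Rightarrow> ('b \<Rightarrow>\<^sub>0 'a) \<Rightarrow> ('b \<Rightarrow>\<^sub>0 'a)" where
  "smul c x = Poly_Mapping.map ((*) c) x"

definition lin :: "('b \<Rightarrow> ('c \<Rightarrow>\<^sub>0 'a::field)) \<Rightarrow> ('b \<Rightarrow>\<^sub>0 'a) \<Rightarrow> ('c \<Rightarrow>\<^sub>0 'a)" where
  "lin f x = (\<Sum>b \<in> Poly_Mapping.keys x. smul (Poly_Mapping.lookup x b) (f b))"

definition linear_op :: "(('b \<Rightarrow>\<^sub>0 'a::field) \<Rightarrow> ('c \<Rightarrow>\<^sub>0 'a)) \<Rightarrow> bool" where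
  "linear_op T \<longleftrightarrow> (\<forall>x y. T (x + y) = T x + T y) \<and> (\<forall>c x. T (smul c x) = smul c (T x))"

lemma lookup_smul [simp]: "Poly_Mapping.lookup (smul c x) k = c * Poly_Mapping.lookup x k"
  by (cases "Poly_Mapping.lookup x k = 0") (simp_all add: smul_def Poly_Mapping.map.rep_eq when_def)

lemma smul_simps:
  "smul c (x + y) = smul c x + smul c y" "smul (c + d) x = smul c x + smul d x"
  "smul c (smul d x) = smul (c * d) x" "smul 1 x = x" "smul 0 x = 0" "smul c 0 = 0"
  "smul c (x - y) = smul c x - smul c y" "smul (c - d) x = smul c x - smul d x"
  "smul c (- x) = - smul c x" "smul (- c) x = - smul c x" "smul c (Poly_Mapping.single b d) = Poly_Mapping.single b (c * d)"
  by (rule poly_mapping_eqI; simp add: lookup_add lookup_minus algebra_simps lookup_single when_def)+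

lemma smul_sum: "smul c (\<Sum>i\<in>I. f i) = (\<Sum>i\<in>I. smul c (f i))"
  by (induction I rule: infinite_finite_induct) (simp_all add: smul_simps)

lemma linear_opD:
  assumes "linear_op T"
  shows "T (x + y) = T x + T y" "T (smul c x) = smul c (T x)" "T 0 = 0" "T (- x) = - T x" "T (x - y) = T x - T y"
proof -
  show a: "T (x + y) = T x + T y" and s: "T (smul c x) = smul c (T x)" for x y c using assms by (simp_all add: linear_op_def)
  show "T 0 = 0" using s[of 0 0] by (simp add: smul_simps)
  show m: "T (- x) = - T x" for x using s[of "- 1" x] by (simp add: smul_simps)
  show "T (x - y) = T x - T y" using a[of x "- y"] m[of y] by simp
qed

lemma linear_op_sum: "linear_op T \<Longrightarrow> T (\<Sum>i\<in>I. f i) = (\<Sum>i\<in>I. T (f i))"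
  by (induction I rule: infinite_finite_induct) (simp_all add: linear_opD)

lemma linear_opI: "(\<And>x y. T (x + y) = T x + T y) \<Longrightarrow> (\<And>c x. T (smul c x) = smul c (T x)) \<Longrightarrow> linear_op T"
  by (simp add: linear_op_def)

lemma keys_smul: "Poly_Mapping.keys (smul (c::'a::field) x) \<subseteq> Poly_Mapping.keys x"
  by (auto simp: in_keys_iff)

lemma lin_superset:
  fixes x :: "'b \<Rightarrow>\<^sub>0 'a::field"
  assumes "finite S" "Poly_Mapping.keys x \<subseteq> S"
  shows "lin f x = (\<Sum>b \<in> S. smul (Poly_Mapping.lookup x b) (f b))"
  unfolding lin_def
  by (rule sum.mono_neutral_left[OF assms]) (auto simp: in_keys_iff smul_simps)

lemma linear_lin:
  fixes f :: "'b \<Rightarrow> ('c \<Rightarrow>\<^sub>0 'a::field)"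
  shows "linear_op (lin f)"
proof (rule linear_opI)
  fix x y :: "'b \<Rightarrow>\<^sub>0 'a"
  let ?S = "Poly_Mapping.keys x \<union> Poly_Mapping.keys y"
  have "lin f (x + y) = (\<Sum>b \<in> ?S. smul (Poly_Mapping.lookup (x + y) b) (f b))"
    by (rule lin_superset) (auto simp: Poly_Mapping.keys_add)
  also have "\<dots> = lin f x + lin f y"
    unfolding lin_superset[of ?S x, simplified] lin_superset[of ?S y, simplified]
    by (simp add: lookup_add smul_simps sum.distrib)
  finally show "lin f (x + y) = lin f x + lin f y" .
next
  fix c and x :: "'b \<Rightarrow>\<^sub>0 'a"
  have "lin f (smul c x) = (\<Sum>b \<in> Poly_Mapping.keys x. smul (Poly_Mapping.lookup (smul c x) b) (f b))"
    by (rule lin_superset) (simp_all add: keys_smul)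
  then show "lin f (smul c x) = smul c (lin f x)"
    by (simp add: lin_def smul_sum smul_simps)
qed

lemma lin_single [simp]: "lin f (Poly_Mapping.single b c) = smul c (f b)"
  by (simp add: lin_def smul_simps)

lemma expand_single: "(x :: 'b \<Rightarrow>\<^sub>0 'a::field) = (\<Sum>b \<in> Poly_Mapping.keys x. smul (Poly_Mapping.lookup x b) (Poly_Mapping.single b 1))"
proof (rule poly_mapping_eqI)
  fix k
  show "Poly_Mapping.lookup x k = Poly_Mapping.lookup (\<Sum>b \<in> Poly_Mapping.keys x. smul (Poly_Mapping.lookup x b) (Poly_Mapping.single b 1)) k"
    by (simp add: lookup_sum lookup_single when_def in_keys_iff if_distrib[of "(*) _"] cong: if_cong)
qed

lemma linear_op_eqI:
  assumes "linear_op S" "linear_op T" "\<And>b. b \<in> Poly_Mapping.keys x \<Longrightarrow> S (Poly_Mapping.single b 1) = T (Poly_Mapping.single b 1)"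
  shows "S x = T x"
proof -
  have "S x = S (\<Sum>b \<in> Poly_Mapping.keys x. smul (Poly_Mapping.lookup x b) (Poly_Mapping.single b 1))" using expand_single by metis
  also have "\<dots> = T (\<Sum>b \<in> Poly_Mapping.keys x. smul (Poly_Mapping.lookup x b) (Poly_Mapping.single b 1))"
    using assms by (simp add: linear_op_sum linear_opD cong: sum.cong)
  also have "\<dots> = T x" using expand_single by metis
  finally show ?thesis .
qed

lemma linear_op_comp: "linear_op S \<Longrightarrow> linear_op T \<Longrightarrow> linear_op (\<lambda>x. S (T x))"
  by (auto intro!: linear_opI simp: linear_opD)

lemma linear_op_smul: "linear_op S \<Longrightarrow> linear_op (\<lambda>x. smul c (S x))"
  by (auto intro!: linear_opI simp: linear_opD smul_simps mult.commute)

lemma linear_op_add: "linear_op S \<Longrightarrow> linear_op T \<Longrightarrow> linear_op (\<lambda>x. S x + T x)"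
  by (auto intro!: linear_opI simp: linear_opD smul_simps)

lemma linear_op_diff: "linear_op S \<Longrightarrow> linear_op T \<Longrightarrow> linear_op (\<lambda>x. S x - T x)"
  by (auto intro!: linear_opI simp: linear_opD smul_simps)

lemma linear_op_id: "linear_op (\<lambda>x. x)" "linear_op (\<lambda>x. 0)"
  by (auto intro!: linear_opI simp: smul_simps)

text \<open>The operators are abstract and the parameters free, because the recursion is used both
  for \<open>(q, Q)\<close> and for their inverses on the same space.\<close>

fun jm :: "(nat \<Rightarrow> ('b \<Rightarrow>\<^sub>0 'a::field) \<Rightarrow> ('b \<Rightarrow>\<^sub>0 'a)) \<Rightarrow> (('b \<Rightarrow>\<^sub>0 'a) \<Rightarrow> ('b \<Rightarrow>\<^sub>0 'a)) \<Rightarrow> 'a \<Rightarrow> 'a \<Rightarrow>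
    nat \<Rightarrow> ('b \<Rightarrow>\<^sub>0 'a) \<Rightarrow> ('b \<Rightarrow>\<^sub>0 'a)" where
  "jm u e a b 0 x = 0"
| "jm u e a b (Suc 0) x = smul b x - smul (b - inverse b) (e x)"
| "jm u e a b (Suc (Suc k)) x =
     u (Suc k) (jm u e a b (Suc k) (u (Suc k) x + smul a x)) + smul a (jm u e a b (Suc k) (u (Suc k) x + smul a x))"

lemma linear_jm:
  assumes "\<And>i. linear_op (u i)" "linear_op e"
  shows "linear_op (jm u e a b k)"
proof (induction k rule: induct_nat_012)
  case 0 then show ?case by (simp add: linear_op_def smul_simps)
next
  case 1
  have "jm u e a b (Suc 0) = (\<lambda>x. smul b x - smul (b - inverse b) (e x))" by (rule ext) simp
  then show ?case using assms by (simp add: linear_op_diff linear_op_smul linear_op_id)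
next
  case (ge2 k)
  let ?g = "\<lambda>x. u (Suc k) x + smul a x"
  have g: "linear_op ?g" using assms by (simp add: linear_op_add linear_op_smul linear_op_id)
  have "jm u e a b (Suc (Suc k)) = (\<lambda>x. ?g (jm u e a b (Suc k) (?g x)))" by (rule ext) simp
  then show ?case using linear_op_comp[OF g linear_op_comp[OF ge2(2) g]] by simp
qed

section \<open>Jucys--Murphy identities in an arbitrary representation\<close>

locale blob_rep =
  fixes n :: nat and u :: "nat \<Rightarrow> ('b \<Rightarrow>\<^sub>0 'a::field) \<Rightarrow> ('b \<Rightarrow>\<^sub>0 'a)" and e :: "('b \<Rightarrow>\<^sub>0 'a) \<Rightarrow> ('b \<Rightarrow>\<^sub>0 'a)"
    and a b \<delta> y :: 'a
  assumes lu: "\<And>i. linear_op (u i)" and le: "linear_op e"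
    and uu: "\<And>i x. 1 \<le> i \<Longrightarrow> i < n \<Longrightarrow> u i (u i x) = smul \<delta> (u i x)"
    and uuu1: "\<And>i x. 1 \<le> i \<Longrightarrow> Suc i < n \<Longrightarrow> u i (u (Suc i) (u i x)) = u i x"
    and uuu2: "\<And>i x. 1 \<le> i \<Longrightarrow> Suc i < n \<Longrightarrow> u (Suc i) (u i (u (Suc i) x)) = u (Suc i) x"
    and ucomm: "\<And>i j x. 1 \<le> i \<Longrightarrow> Suc i < j \<Longrightarrow> j < n \<Longrightarrow> u i (u j x) = u j (u i x)"
    and ueu: "\<And>x. 1 < n \<Longrightarrow> u 1 (e (u 1 x)) = smul y (u 1 x)"
    and ee: "\<And>x. e (e x) = e x"
    and ue: "\<And>i x. 2 \<le> i \<Longrightarrow> i < n \<Longrightarrow> u i (e x) = e (u i x)"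
    and a0: "a \<noteq> 0" and b0: "b \<noteq> 0" and bb: "b \<noteq> inverse b"
    and del: "\<delta> = - (a + inverse a)" and yy: "y = - (b * inverse a - inverse b * a) / (b - inverse b)"
begin

text \<open>A Hecke generator: on the given range of indices it satisfies
  \<open>(g - a)(g + inverse a) = 0\<close> and the braid relations.\<close>

definition g :: "nat \<Rightarrow> ('b \<Rightarrow>\<^sub>0 'a) \<Rightarrow> ('b \<Rightarrow>\<^sub>0 'a)" where
  "g i x = u i x + smul a x"

abbreviation "L \<equiv> jm u e a b"

lemma L_Suc: "L (Suc (Suc k)) x = g (Suc k) (L (Suc k) (g (Suc k) x))"
  by (simp add: g_def)

lemma lg: "linear_op (g i)"
  unfolding g_def using lu by (simp add: linear_op_add linear_op_smul linear_op_id)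

lemma lL: "linear_op (L k)"
  by (rule linear_jm[OF lu le])

lemmas lins = linear_opD[OF lu] linear_opD[OF le] linear_opD[OF lg] linear_opD[OF lL]

text \<open>Moving a pair of Hecke generators past \<open>u\<close> shifts its index and costs a
  factor \<open>a\<close>. Two such moves account for the factor \<open>a\<^sup>2\<close> by which
  contents grow.\<close>

lemma gu_slide:
  assumes "1 \<le> i" "Suc i < n"
  shows "g i (g (Suc i) (u i x)) = smul a (u (Suc i) (u i x))"
    "g (Suc i) (g i (u (Suc i) x)) = smul a (u i (u (Suc i) x))"
    "u i (g (Suc i) (g i x)) = smul a (u i (u (Suc i) x))"
    "u (Suc i) (g i (g (Suc i) x)) = smul a (u (Suc i) (u i x))"
  using assms a0 unfolding g_def del
  by (rule_tac [!] poly_mapping_eqI)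
    (simp_all add: lins uu uuu1 uuu2 lookup_add lookup_minus del, simp_all add: field_simps)

lemma gu: "1 \<le> i \<Longrightarrow> i < n \<Longrightarrow> g i (u i x) = smul (- inverse a) (u i x)"
  unfolding g_def by (simp add: uu del smul_simps)

lemma ug_comm: "1 \<le> i \<Longrightarrow> Suc i < j \<Longrightarrow> j < n \<Longrightarrow> u i (g j x) = g j (u i x)"
  "1 \<le> i \<Longrightarrow> Suc i < j \<Longrightarrow> j < n \<Longrightarrow> g i (u j x) = u j (g i x)"
  unfolding g_def using ucomm[of i j x] by (simp_all add: lins)

lemma L_u_high: "1 \<le> k \<Longrightarrow> k < j \<Longrightarrow> j < n \<Longrightarrow> L k (u j x) = u j (L k x)"
proof (induction k arbitrary: x rule: induct_nat_012)
  case 1 then show ?case by (simp add: lins ue)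
next
  case (ge2 k)
  have "L (Suc (Suc k)) (u j x) = g (Suc k) (L (Suc k) (u j (g (Suc k) x)))"
    unfolding L_Suc using ge2.prems by (simp add: ug_comm(2))
  also have "\<dots> = u j (L (Suc (Suc k)) x)" unfolding L_Suc using ge2 by (simp add: ug_comm(2))
  finally show ?case .
qed simp

text \<open>Entering from either side, \<open>u i\<close> reaches the same expression. This yields
  both the commutation of \<open>u i\<close> with \<open>L (i + 2)\<close> and the formula for
  sliding an arc.\<close>

lemma L_Suc_Suc_u:
  assumes "1 \<le> i" "Suc i < n"
  shows "L (Suc (Suc i)) (u i x) = smul (a\<^sup>2) (u i (u (Suc i) (L i (u i x))))"
    "u i (L (Suc (Suc i)) x) = smul (a\<^sup>2) (u i (u (Suc i) (L i (u i x))))"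
proof -
  obtain k where k: "i = Suc k" using assms by (cases i) auto
  have L2: "L (Suc (Suc i)) x = g (Suc i) (g i (L i (g i (g (Suc i) x))))" for x unfolding k L_Suc ..
  have cm: "L i (u (Suc i) x) = u (Suc i) (L i x)" for x using L_u_high[of i "Suc i"] assms by simp
  have "L (Suc (Suc i)) (u i x) = smul a (g (Suc i) (g i (u (Suc i) (L i (u i x)))))"
    unfolding L2 gu_slide(1)[OF assms] by (simp add: lins cm)
  then show "L (Suc (Suc i)) (u i x) = smul (a\<^sup>2) (u i (u (Suc i) (L i (u i x))))"
    unfolding gu_slide(2)[OF assms] by (simp add: smul_simps power2_eq_square)
  have "u i (L (Suc (Suc i)) x) = smul a (u i (L i (u (Suc i) (g i (g (Suc i) x)))))"
    unfolding L2 gu_slide(3)[OF assms] by (simp add: cm)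
  then show "u i (L (Suc (Suc i)) x) = smul (a\<^sup>2) (u i (u (Suc i) (L i (u i x))))"
    unfolding gu_slide(4)[OF assms] by (simp add: lins cm smul_simps power2_eq_square)
qed

lemma L_u_low:
  assumes "1 \<le> i" "i + 2 \<le> k" "k \<le> n"
  shows "L k (u i x) = u i (L k x)"
  using assms(2,3)
proof (induction k arbitrary: x rule: dec_induct)
  case base
  then show ?case using L_Suc_Suc_u[of i x] assms(1) by simp
next
  case (step k)
  obtain k' where k': "k = Suc k'" using step by (cases k) auto
  have gi: "g k (u i z) = u i (g k z)" for z
    using ug_comm(1)[of i k z] step assms(1) by simp
  show ?case
    using step gi unfolding k' L_Suc by simp
qed

lemma L_slide:
  assumes "1 \<le> i" "Suc i < n"
  shows "L (Suc (Suc i)) (u i (u (Suc i) x)) = smul (a\<^sup>2) (u i (L i (u (Suc i) x)))"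
proof -
  have cm: "L i (u (Suc i) x) = u (Suc i) (L i x)" for x using L_u_high[of i "Suc i"] assms by simp
  show ?thesis unfolding L_Suc_Suc_u(1)[OF assms] cm[symmetric] uuu2[OF assms] ..
qed

text \<open>This is \<open>(L_1 - b)(L_1 - inverse b) = 0\<close>: the operator \<open>L_1\<close>
  is \<open>inverse b\<close> on the image of the idempotent \<open>e\<close> and \<open>b\<close>
  on its kernel.\<close>

lemma LL1: "L (Suc 0) (L (Suc 0) x) = smul (b + inverse b) (L (Suc 0) x) - x"
  using b0 by (intro poly_mapping_eqI) (simp add: lins ee lookup_minus lookup_add smul_simps field_simps)

lemma yb: "y * (b - inverse b) = - (b * inverse a - inverse b * a)"
  using bb by (simp add: yy)

text \<open>The value of \<open>y\<close> is made for this: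
  \<open>b \<delta> - (b - inverse b) y\<close> simplifies to \<open>- a (b + inverse b)\<close>,
  the factor needed for the braid relation of type B.\<close>

lemma uLu: 
  assumes "1 < n" shows "u 1 (L (Suc 0) (u 1 x)) = smul (- (a * (b + inverse b))) (u 1 x)"
proof (rule poly_mapping_eqI)
  fix k
  have "b * \<delta> - y * (b - inverse b) = - (a * (b + inverse b))"
    unfolding yb del using a0 b0 by (simp add: field_simps)
  then have "Poly_Mapping.lookup (u 1 x) k * (b * \<delta> - (b - inverse b) * y) = - (a * (b + inverse b)) * Poly_Mapping.lookup (u 1 x) k"
    by (simp add: mult.commute)
  then show "Poly_Mapping.lookup (u 1 (L (Suc 0) (u 1 x))) k = Poly_Mapping.lookup (smul (- (a * (b + inverse b))) (u 1 x)) k"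
    using assms uu[of 1] ueu by (simp add: lins lookup_minus algebra_simps)
qed

text \<open>With \<open>l = L_1\<close> and \<open>g = u + a\<close> the difference of
  \<open>l g l g\<close> and \<open>g l g l\<close> is
  \<open>l (u l u) - (u l u) l + a (l l u - u l l)\<close>. The first two terms give
  \<open>- a (b + inverse b)\<close> times \<open>l u - u l\<close>, and by the quadratic relation
  of \<open>l\<close> the others give the opposite.\<close>

lemma L_L1:
  assumes "1 < n" shows "L (Suc 0) (L (Suc (Suc 0)) x) = L (Suc (Suc 0)) (L (Suc 0) x)"
proof -
  define l where "l = L (Suc 0)"
  have ll: "linear_op l" using lL by (simp add: l_def)
  note lls = linear_opD[OF ll] linear_opD[OF lu]
  have u: "u 1 (l (u 1 x)) = smul (- (a * (b + inverse b))) (u 1 x)" for x using uLu[OF assms] by (simp add: l_def)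
  have l2: "l (l x) = smul (b + inverse b) (l x) - x" for x using LL1 by (simp add: l_def)
  have "l (g 1 (l (g 1 x))) = g 1 (l (g 1 (l x)))"
    unfolding g_def by (rule poly_mapping_eqI) (simp add: lls u[unfolded One_nat_def] l2 lookup_add lookup_minus smul_simps algebra_simps)
  then show ?thesis by (simp only: L_Suc l_def One_nat_def)
qed

text \<open>As \<open>b \<noteq> inverse b\<close>, the operator \<open>e\<close> is a linear
  combination of the identity and \<open>L_1\<close>, so it commutes with \<open>L_2\<close> because
  \<open>L_1\<close> does; the further factors \<open>g\<close> of the higher operators commute with
  \<open>e\<close>.\<close>

lemma L_e:
  assumes "2 \<le> k" "k \<le> n"
  shows "L k (e x) = e (L k x)"
  using assms
proof (induction k arbitrary: x rule: dec_induct)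
  case base
  have n: "1 < n" using base by simp
  have e: "e z = smul (inverse (b - inverse b)) (smul b z - L (Suc 0) z)" for z
  proof -
    have "smul b z - L (Suc 0) z = smul (b - inverse b) (e z)" by simp
    moreover have "inverse (b - inverse b) * (b - inverse b) = 1" using bb by (intro left_inverse) simp
    ultimately show ?thesis by (simp only: smul_simps(3,4))
  qed
  have "L 2 (e x) = smul (inverse (b - inverse b)) (smul b (L 2 x) - L 2 (L (Suc 0) x))"
    by (subst e) (simp only: linear_opD[OF lL])
  also have "L 2 (L (Suc 0) x) = L (Suc 0) (L 2 x)" using L_L1[OF n, of x] by (simp only: numeral_2_eq_2)
  also have "smul (inverse (b - inverse b)) (smul b (L 2 x) - L (Suc 0) (L 2 x)) = e (L 2 x)" by (rule e[symmetric])
  finally show ?case .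
next
  case (step k)
  obtain k' where k': "k = Suc k'" using step by (cases k) auto
  have ge: "g k (e z) = e (g k z)" for z
    unfolding g_def using step ue[of k z] by (simp add: lins)
  show ?case using step unfolding k' L_Suc by (simp add: ge[unfolded k'])
qed

end

text \<open>Both \<open>\<delta>\<close> and \<open>y\<close> are invariant under inverting
  \<open>a\<close> and \<open>b\<close> together, so one representation serves both pairs of
  parameters.\<close>

lemma blob_rep_inverse:
  assumes "blob_rep n u e a b \<delta> y"
  shows "blob_rep n u e (inverse a) (inverse b) \<delta> y"
proof -
  interpret blob_rep n u e a b \<delta> y by fact
  show ?thesis
  proof (unfold_locales; (fact lu le uu uuu1 uuu2 ucomm ueu ee ue)?)
    show "\<delta> = - (inverse a + inverse (inverse a))" by (simp add: del add.commute)
    show "inverse b \<noteq> inverse (inverse b)" using bb by simp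
    have "inverse b - inverse (inverse b) \<noteq> 0" "b - inverse b \<noteq> 0" using bb by auto
    then show "y = - (inverse b * inverse (inverse a) - inverse (inverse b) * inverse a) / (inverse b - inverse (inverse b))"
      unfolding yy by (simp add: frac_eq_eq) (simp add: algebra_simps)
  qed (use a0 b0 in auto)
qed

text \<open>The operator on the right is the inverse of \<open>L\<^sub>k\<close>.\<close>

lemma jm_inverse:
  assumes "blob_rep n u e a b \<delta> y" and k: "1 \<le> k" "k < n"
  shows "jm u e a b (Suc k) (u k x) = smul (a ^ (2 * (k - 1))) (jm u e (inverse a) (inverse b) k (u k x))"
proof -
  interpret blob_rep n u e a b \<delta> y by fact
  interpret I: blob_rep n u e "inverse a" "inverse b" \<delta> y
    by (rule blob_rep_inverse) fact
  \<comment> \<open>\<open>I.g\<close> is the inverse of \<open>g\<close>, so this is the braid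
    relation in the form \<open>g_{k+1} g_k g_{k+1}^{-1} = g_k^{-1} g_{k+1} g_k\<close>.\<close>
  have braid: "g (Suc k) (g k (I.g (Suc k) x)) = I.g k (g (Suc k) (g k x))" if "1 \<le> k" "Suc k < n" for k x
    unfolding g_def I.g_def using that a0
    by (intro poly_mapping_eqI)
      (simp add: lins uu uuu1 uuu2 lookup_add lookup_minus del, simp add: field_simps)
  \<comment> \<open>To be read as \<open>L_k g_k L_k U_k = - a^{2k-1} U_k\<close>. For
    \<open>k = 1\<close> it is the value of \<open>U_1 L_1 U_1\<close> together with
    \<open>L_1^{-1} = b + b^{-1} - L_1\<close>.\<close>
  have gI: "g k (L k (u k x)) = smul (- (a ^ (2 * k - 1))) (I.L k (u k x))" if "1 \<le> k" "k < n" for k x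
    using that
  proof (induction k arbitrary: x rule: dec_induct)
    case base
    have "u 1 (L 1 (u 1 x)) = smul (- (a * (b + inverse b))) (u 1 x)" using uLu base by simp
    then show ?case
      unfolding g_def by (intro poly_mapping_eqI) (simp add: lookup_add lookup_minus algebra_simps)
  next
    case (step k)
    obtain k' where k': "k = Suc k'" using step by (cases k) auto
    have k: "1 \<le> k" "Suc k < n" using step by auto
    define z where "z = u (Suc k) x"
    have gz: "g k z = smul a (I.g (Suc k) (u k z))" and gz': "g (Suc k) (u k z) = smul a (I.g k z)"
      unfolding g_def I.g_def z_def using uuu2[OF k] a0 by (simp_all add: smul_simps add.commute)
    have c: "L k (I.g (Suc k) w) = I.g (Suc k) (L k w)" "I.L k (g (Suc k) w) = g (Suc k) (I.L k w)" for w
      unfolding g_def I.g_def using L_u_high[of k "Suc k"] I.L_u_high[of k "Suc k"] k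
      by (simp_all add: linear_opD[OF lL] linear_opD[OF I.lL])
    have pw: "a * a ^ (2 * k - 1) * a = a ^ (2 * Suc k - 1)" unfolding k' by (simp add: power_add)
    have "g (Suc k) (L (Suc k) z) = g (Suc k) (g k (L k (g k z)))" unfolding k' L_Suc ..
    also have "\<dots> = smul a (I.g k (g (Suc k) (g k (L k (u k z)))))"
      unfolding gz by (simp add: linear_opD[OF lL] lins c braid[OF k])
    also have "\<dots> = smul (- (a * a ^ (2 * k - 1))) (I.g k (I.L k (g (Suc k) (u k z))))"
      using step by (simp add: c linear_opD[OF lg] linear_opD[OF I.lg] smul_simps)
    also have "\<dots> = smul (- (a ^ (2 * Suc k - 1))) (I.g k (I.L k (I.g k z)))"
      unfolding gz' pw[symmetric] by (simp add: linear_opD[OF I.lL] linear_opD[OF I.lg] smul_simps)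
    also have "\<dots> = smul (- (a ^ (2 * Suc k - 1))) (I.L (Suc k) z)" unfolding k' I.L_Suc ..
    finally show ?case unfolding z_def .
  qed
  obtain k' where k': "k = Suc k'" using k by (cases k) auto
  have pw: "inverse a * a ^ (2 * k - 1) = a ^ (2 * (k - 1))" unfolding k' using a0 by simp
  \<comment> \<open>The inner factor of \<open>L_{k+1} = g_k L_k g_k\<close> acts on the image of
    \<open>U_k\<close> as \<open>- a^{-1}\<close>, which turns the odd power into
    \<open>a^{2(k-1)}\<close>.\<close>
  have "L (Suc k) (u k x) = smul (- inverse a) (g k (L k (u k x)))"
    using gu[OF k, of x] unfolding k' L_Suc by (simp add: linear_opD[OF lL] linear_opD[OF lg])
  also have "\<dots> = smul (a ^ (2 * (k - 1))) (I.L k (u k x))"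
    unfolding gI[OF k] by (simp only: smul_simps(3) minus_mult_minus pw)
  finally show ?thesis .
qed

section \<open>The left action on the diagram basis\<close>

text \<open>The value 0 on invalid diagrams makes the relations hold on the whole vector
  space.\<close>

definition uop :: "'a::field \<Rightarrow> 'a \<Rightarrow> nat \<Rightarrow> nat \<Rightarrow> (arcs \<Rightarrow>\<^sub>0 'a) \<Rightarrow> (arcs \<Rightarrow>\<^sub>0 'a)" where
  "uop \<delta> y n i = lin (\<lambda>X. if valid (2 * n) X \<and> 1 \<le> i \<and> i < n then Poly_Mapping.single (join i X) (scal \<delta> y i X) else 0)"

definition eop :: "nat \<Rightarrow> (arcs \<Rightarrow>\<^sub>0 'a::field) \<Rightarrow> (arcs \<Rightarrow>\<^sub>0 'a)" where
  "eop n = lin (\<lambda>X. if valid (2 * n) X then Poly_Mapping.single (blob1 X) 1 else 0)"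

lemma linear_uop: "linear_op (uop \<delta> y n i)" and linear_eop: "linear_op (eop n)"
  unfolding uop_def eop_def by (rule linear_lin)+

lemma uop_single: "valid (2 * n) X \<Longrightarrow> 1 \<le> i \<Longrightarrow> i < n \<Longrightarrow>
    uop \<delta> y n i (Poly_Mapping.single X c) = Poly_Mapping.single (join i X) (c * scal \<delta> y i X)"
  by (simp add: uop_def smul_simps)

lemma eop_single: "valid (2 * n) X \<Longrightarrow> eop n (Poly_Mapping.single X c) = Poly_Mapping.single (blob1 X) c"
  by (simp add: eop_def smul_simps)

lemma op_invalid: "\<not> valid (2 * n) X \<Longrightarrow> uop \<delta> y n i (Poly_Mapping.single X c) = 0"
  "\<not> valid (2 * n) X \<Longrightarrow> eop n (Poly_Mapping.single X c) = 0"
  by (simp_all add: uop_def eop_def smul_simps)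

lemma scal_unit:
  "mate X i \<noteq> Suc i \<Longrightarrow> scal \<delta> y i X = 1"
  by (simp add: scal_def)

lemma mate_ne_of_next:
  assumes "matching N Y" "mate Y (Suc i) = Suc (Suc i)" shows "mate Y i \<noteq> Suc i"
  using matchingD(1)[OF assms(1), of i] assms(2) by auto

lemma blob_rep_arcs:
  fixes q Q :: "'a::field"
  assumes n: "1 \<le> n" and q: "q \<noteq> 0" and Q: "Q \<noteq> 0" "Q \<noteq> inverse Q"
  shows "blob_rep n (uop (- (q + inverse q)) (y_e q Q) n) (eop n) q Q (- (q + inverse q)) (y_e q Q)"
proof -
  define \<delta> where "\<delta> = - (q + inverse q)"
  define y where "y = y_e q Q"
  let ?u = "uop \<delta> y n"
  let ?e = "eop n :: (arcs \<Rightarrow>\<^sub>0 'a) \<Rightarrow> _"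
  have 1: "?u i (?u i x) = smul \<delta> (?u i x)" if i: "1 \<le> i" "i < n" for i x
  proof (rule linear_op_eqI[where S = "\<lambda>x. ?u i (?u i x)" and T = "\<lambda>x. smul \<delta> (?u i x)"])
    fix X
    have "i < 2 * n" using i by simp
    then show "?u i (?u i (Poly_Mapping.single X 1)) = smul \<delta> (?u i (Poly_Mapping.single X 1))"
      using i join_valid[of "2 * n" X i]
      by (cases "valid (2 * n) X") (simp_all add: uop_single op_invalid linear_opD[OF linear_uop] join_idem smul_simps mult.commute)
  qed (rule linear_op_comp[OF linear_uop linear_uop], rule linear_op_smul[OF linear_uop])
  have 2: "?u i (?u (Suc i) (?u i x)) = ?u i x" if i: "1 \<le> i" "Suc i < n" for i x
  proof (rule linear_op_eqI[where S = "\<lambda>x. ?u i (?u (Suc i) (?u i x))" and T = "\<lambda>x. ?u i x"])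
    fix X
    show "?u i (?u (Suc i) (?u i (Poly_Mapping.single X 1))) = ?u i (Poly_Mapping.single X 1)"
    proof (cases "valid (2 * n) X")
      case True
      have i2: "i < 2 * n" "Suc i < 2 * n" using i by auto
      have v1: "valid (2 * n) (join i X)" using join_valid[OF True i(1) i2(1)] .
      have v2: "valid (2 * n) (join (Suc i) (join i X))" using join_valid[OF v1 _ i2(2)] by simp
      have c: "join i (join (Suc i) (join i X)) = join i X"
        by (rule join_cancel_right[OF valid_matching[OF v1]]) simp_all
      have s: "scal \<delta> y (Suc i) (join i X) = 1" by (rule scal_unit) simp
      have "mate (join (Suc i) (join i X)) i \<noteq> Suc i"
        by (rule mate_ne_of_next[OF valid_matching[OF v2]]) simp
      then have "scal \<delta> y i (join (Suc i) (join i X)) = 1" by (rule scal_unit)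
      then show ?thesis using i True v1 v2 by (simp add: uop_single c s)
    qed (simp add: op_invalid linear_opD[OF linear_uop])
  qed (rule linear_op_comp[OF linear_uop linear_op_comp[OF linear_uop linear_uop]], rule linear_uop)
  have 3: "?u (Suc i) (?u i (?u (Suc i) x)) = ?u (Suc i) x" if i: "1 \<le> i" "Suc i < n" for i x
  proof (rule linear_op_eqI[where S = "\<lambda>x. ?u (Suc i) (?u i (?u (Suc i) x))" and T = "\<lambda>x. ?u (Suc i) x"])
    fix X
    show "?u (Suc i) (?u i (?u (Suc i) (Poly_Mapping.single X 1))) = ?u (Suc i) (Poly_Mapping.single X 1)"
    proof (cases "valid (2 * n) X")
      case True
      have i2: "i < 2 * n" "Suc i < 2 * n" using i by auto
      have v1: "valid (2 * n) (join (Suc i) X)" using join_valid[OF True _ i2(2)] by simp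
      have v2: "valid (2 * n) (join i (join (Suc i) X))" using join_valid[OF v1 i(1) i2(1)] .
      have c: "join (Suc i) (join i (join (Suc i) X)) = join (Suc i) X"
        by (rule join_cancel_left[OF valid_matching[OF v1]]) simp_all
      have "mate (join (Suc i) X) i \<noteq> Suc i"
        by (rule mate_ne_of_next[OF valid_matching[OF v1]]) simp
      then have s: "scal \<delta> y i (join (Suc i) X) = 1" by (rule scal_unit)
      have "scal \<delta> y (Suc i) (join i (join (Suc i) X)) = 1" by (rule scal_unit) simp
      then show ?thesis using i True v1 v2 by (simp add: uop_single c s)
    qed (simp add: op_invalid linear_opD[OF linear_uop])
  qed (rule linear_op_comp[OF linear_uop linear_op_comp[OF linear_uop linear_uop]], rule linear_uop)
  have 4: "?u i (?u j x) = ?u j (?u i x)" if i: "1 \<le> i" "Suc i < j" "j < n" for i j x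
  proof (rule linear_op_eqI[where S = "\<lambda>x. ?u i (?u j x)" and T = "\<lambda>x. ?u j (?u i x)"])
    fix X
    show "?u i (?u j (Poly_Mapping.single X 1)) = ?u j (?u i (Poly_Mapping.single X 1))"
    proof (cases "valid (2 * n) X")
      case True
      have "valid (2 * n) (join i X)" "valid (2 * n) (join j X)" using join_valid[OF True] i by auto
      moreover have j: "j < 2 * n" using i by simp
      ultimately show ?thesis
        using i True join_commute(1)[OF valid_matching[OF True] i(1,2) j]
          join_commute(2)[OF valid_matching[OF True] i(1,2) j, of \<delta> y]
        by (simp add: uop_single mult.commute)
    qed (simp add: op_invalid linear_opD[OF linear_uop])
  qed (rule linear_op_comp[OF linear_uop linear_uop], rule linear_op_comp[OF linear_uop linear_uop])
  have 5: "?u 1 (?e (?u 1 x)) = smul y (?u 1 x)" if n1: "1 < n" for x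
  proof (rule linear_op_eqI[where S = "\<lambda>x. ?u 1 (?e (?u 1 x))" and T = "\<lambda>x. smul y (?u 1 x)"])
    fix X
    show "?u 1 (?e (?u 1 (Poly_Mapping.single X 1))) = smul y (?u 1 (Poly_Mapping.single X 1))"
    proof (cases "valid (2 * n) X")
      case True
      have v: "valid (2 * n) (join 1 X)" using join_valid[OF True] n1 by auto
      moreover have "valid (2 * n) (blob1 (join 1 X))" using blob1_valid[OF v] n1 by simp
      ultimately show ?thesis using n1 True join_1_blob1(1)[of X] join_1_blob1(2)[of \<delta> y X]
        by (simp add: uop_single eop_single smul_simps mult.commute)
    qed (simp add: op_invalid linear_opD[OF linear_uop] linear_opD[OF linear_eop] smul_simps)
  qed (rule linear_op_comp[OF linear_uop linear_op_comp[OF linear_eop linear_uop]], rule linear_op_smul[OF linear_uop])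
  have 6: "?e (?e x) = ?e x" for x
  proof (rule linear_op_eqI[where S = "\<lambda>x. ?e (?e x)" and T = "\<lambda>x. ?e x"])
    fix X
    show "?e (?e (Poly_Mapping.single X 1)) = ?e (Poly_Mapping.single X 1)"
      using blob1_valid[of "2 * n" X] n
      by (cases "valid (2 * n) X") (simp_all add: eop_single op_invalid linear_opD[OF linear_eop] blob1_idem)
  qed (rule linear_op_comp[OF linear_eop linear_eop], rule linear_eop)
  have 7: "?u i (?e x) = ?e (?u i x)" if i: "2 \<le> i" "i < n" for i x
  proof (rule linear_op_eqI[where S = "\<lambda>x. ?u i (?e x)" and T = "\<lambda>x. ?e (?u i x)"])
    fix X
    show "?u i (?e (Poly_Mapping.single X 1)) = ?e (?u i (Poly_Mapping.single X 1))"
    proof (cases "valid (2 * n) X")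
      case True
      have i2: "i < 2 * n" "1 \<le> i" using i by auto
      then show ?thesis using join_valid[OF True, of i] blob1_valid[OF True] i True
          join_blob1(1)[OF valid_matching[OF True] i(1) i2(1)] join_blob1(2)[OF valid_matching[OF True] i(1) i2(1), of \<delta> y]
        by (simp add: uop_single eop_single)
    qed (simp add: op_invalid linear_opD[OF linear_uop] linear_opD[OF linear_eop])
  qed (rule linear_op_comp[OF linear_uop linear_eop], rule linear_op_comp[OF linear_eop linear_uop])
  show ?thesis
    unfolding \<delta>_def[symmetric] y_def[symmetric]
    by unfold_locales (use 1 2 3 4 5 6 7 q Q linear_uop linear_eop in \<open>auto simp: \<delta>_def y_def y_e_def\<close>)
qed

section \<open>Products in the blob algebra as operators\<close>

definition Phi :: "nat \<Rightarrow> (arcs \<Rightarrow>\<^sub>0 'a::field) \<Rightarrow> (diagram \<Rightarrow>\<^sub>0 'a)" where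
  "Phi n = lin (\<lambda>X. Poly_Mapping.single (diagram_of n X) 1)"

lemma linear_Phi: "linear_op (Phi n)"
  unfolding Phi_def by (rule linear_lin)

lemma Phi_single [simp]: "Phi n (Poly_Mapping.single X c) = Poly_Mapping.single (diagram_of n X) c"
  by (simp add: Phi_def smul_simps)

lemma scale_smul: "scale c x = smul c x"
  by (simp add: scale_def smul_def)

lemma blob_mult_lin: "blob_mult q Q n x y = lin (\<lambda>D. lin (\<lambda>D'. dia_mult q Q n D D') y) x"
  by (simp add: blob_mult_def lin_def scale_smul smul_sum smul_simps)

lemma blob_mult_linear_left: "linear_op (\<lambda>x. blob_mult q Q n x y)"
  unfolding blob_mult_lin by (rule linear_lin)

lemma blob_mult_linear_right: "linear_op (\<lambda>y. blob_mult q Q n x y)"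
proof (rule linear_opI)
  show "blob_mult q Q n x (y + z) = blob_mult q Q n x y + blob_mult q Q n x z" for y z
    unfolding blob_mult_lin linear_opD(1)[OF linear_lin] by (simp add: lin_def[of _ x] smul_simps sum.distrib)
  show "blob_mult q Q n x (smul c y) = smul c (blob_mult q Q n x y)" for c y
    unfolding blob_mult_lin linear_opD(2)[OF linear_lin] by (simp add: lin_def[of _ x] smul_simps smul_sum mult.commute)
qed

text \<open>Associativity is only needed for products of generators acting from the left.\<close>

inductive_set gen :: "nat \<Rightarrow> arcs set" for n where
  "identity_arcs n \<in> gen n"
| "X \<in> gen n \<Longrightarrow> 1 \<le> i \<Longrightarrow> i < n \<Longrightarrow> join i X \<in> gen n"
| "X \<in> gen n \<Longrightarrow> blob1 X \<in> gen n"

lemma gen_valid: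
  assumes "X \<in> gen n" "1 \<le> n" shows "valid (2 * n) X"
  using assms(1)
proof induction
  case 1 then show ?case by (rule identity_arcs_valid)
next
  case 2 then show ?case by (intro join_valid) auto
next
  case 3 then show ?case using assms(2) by (intro blob1_valid) auto
qed

lemma gen_joins:
  assumes "X \<in> gen n" "1 \<le> n" "valid (2 * n) Y"
  shows "\<exists>Z. valid (2 * n) Z \<and> joins n X Y Z"
  using assms(1)
proof induction
  case 1 then show ?case using id_joins(1)[OF valid_matching[OF assms(3)]] assms(3) by blast
next
  case (2 X i)
  then obtain Z where Z: "valid (2 * n) Z" "joins n X Y Z" by blast
  have "joins n (join i X) Y (join i Z)"
    using 2 by (intro join_joins(1) valid_matching gen_valid assms Z)
  moreover have "valid (2 * n) (join i Z)" using 2 Z by (intro join_valid) auto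
  ultimately show ?case by blast
next
  case (3 X)
  then obtain Z where Z: "valid (2 * n) Z" "joins n X Y Z" by blast
  have "joins n (blob1 X) Y (blob1 Z)"
    using 3 by (intro blob1_joins(1) valid_matching gen_valid assms Z)
  moreover have "valid (2 * n) (blob1 Z)" using assms Z by (intro blob1_valid) auto
  ultimately show ?case by blast
qed

definition stacked :: "nat \<Rightarrow> arcs \<Rightarrow> arcs \<Rightarrow> arcs" where
  "stacked n X Y = (SOME Z. valid (2 * n) Z \<and> joins n X Y Z)"

lemma stacked:
  assumes "X \<in> gen n" "1 \<le> n" "valid (2 * n) Y"
  shows "valid (2 * n) (stacked n X Y)" "joins n X Y (stacked n X Y)"
  using someI_ex[OF gen_joins[OF assms]] by (simp_all add: stacked_def)

lemma stacked_eq: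
  assumes "X \<in> gen n" "1 \<le> n" "valid (2 * n) Y" "matching (2 * n) Z" "joins n X Y Z"
  shows "stacked n X Y = Z"
proof (rule diagram_of_inj)
  note m = valid_matching[OF gen_valid[OF assms(1,2)]] valid_matching[OF assms(3)]
  show c: "matching (2 * n) (stacked n X Y)" using stacked[OF assms(1-3)] valid_matching by blast
  show "diagram_of n (stacked n X Y) = diagram_of n Z"
    using concat_iff_joins[OF m c] concat_iff_joins[OF m assms(4)] stacked(2)[OF assms(1-3)] assms(5) by simp
qed fact

definition act :: "'a::field \<Rightarrow> 'a \<Rightarrow> nat \<Rightarrow> (arcs \<Rightarrow>\<^sub>0 'a) \<Rightarrow> arcs \<Rightarrow> (arcs \<Rightarrow>\<^sub>0 'a)" where
  "act \<delta> y n x Y = lin (\<lambda>X. Poly_Mapping.single (stacked n X Y) (weight \<delta> y n X Y)) x"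

lemma linear_act: "linear_op (\<lambda>x. act \<delta> y n x Y)"
  unfolding act_def by (rule linear_lin)

text \<open>An operator commuting with right multiplication by diagrams is left multiplication by
  its value at the identity. This takes the place of associativity of the whole algebra.\<close>

definition equivariant :: "'a::field \<Rightarrow> 'a \<Rightarrow> nat \<Rightarrow> ((arcs \<Rightarrow>\<^sub>0 'a) \<Rightarrow> (arcs \<Rightarrow>\<^sub>0 'a)) \<Rightarrow> bool" where
  "equivariant \<delta> y n T \<longleftrightarrow> linear_op T \<and> (\<forall>x. Poly_Mapping.keys x \<subseteq> gen n \<longrightarrow> Poly_Mapping.keys (T x) \<subseteq> gen n) \<and>
     (\<forall>x Y. Poly_Mapping.keys x \<subseteq> gen n \<longrightarrow> valid (2 * n) Y \<longrightarrow> act \<delta> y n (T x) Y = T (act \<delta> y n x Y))"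

lemma keys_lin:
  assumes "\<And>b. b \<in> Poly_Mapping.keys x \<Longrightarrow> Poly_Mapping.keys (f b) \<subseteq> S"
  shows "Poly_Mapping.keys (lin f x) \<subseteq> S"
proof
  fix k assume "k \<in> Poly_Mapping.keys (lin f x)"
  then have "(\<Sum>b \<in> Poly_Mapping.keys x. Poly_Mapping.lookup x b * Poly_Mapping.lookup (f b) k) \<noteq> 0"
    by (simp add: in_keys_iff lin_def lookup_sum)
  then obtain b where "b \<in> Poly_Mapping.keys x" "Poly_Mapping.lookup (f b) k \<noteq> 0"
    by (metis (no_types, lifting) mult_zero_right sum.neutral)
  then show "k \<in> S" using assms[of b] in_keys_iff[of k "f b"] by blast
qed

lemma equivariant_uop:
  assumes n: "1 \<le> n" and i: "1 \<le> i" "i < n"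
  shows "equivariant \<delta> y n (uop \<delta> y n i)"
  unfolding equivariant_def
proof (intro conjI allI impI)
  show "linear_op (uop \<delta> y n i)" by (rule linear_uop)
  fix x :: "arcs \<Rightarrow>\<^sub>0 'a" assume x: "Poly_Mapping.keys x \<subseteq> gen n"
  show "Poly_Mapping.keys (uop \<delta> y n i x) \<subseteq> gen n"
    unfolding uop_def by (rule keys_lin) (use x i gen.intros(2) in \<open>auto split: if_splits\<close>)
  fix Y assume Y: "valid (2 * n) Y"
  show "act \<delta> y n (uop \<delta> y n i x) Y = uop \<delta> y n i (act \<delta> y n x Y)"
  proof (rule linear_op_eqI[where S = "\<lambda>x. act \<delta> y n (uop \<delta> y n i x) Y" and T = "\<lambda>x. uop \<delta> y n i (act \<delta> y n x Y)"])
    fix X assume "X \<in> Poly_Mapping.keys x"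
    then have X: "X \<in> gen n" using x by blast
    note m = valid_matching[OF gen_valid[OF X n]] valid_matching[OF Y] valid_matching[OF stacked(1)[OF X n Y]]
    have j: "joins n (join i X) Y (join i (stacked n X Y))"
      "weight \<delta> y n (join i X) Y * scal \<delta> y i X = scal \<delta> y i (stacked n X Y) * weight \<delta> y n X Y"
      using join_joins[OF m i stacked(2)[OF X n Y]] by blast+
    have "matching (2 * n) (join i (stacked n X Y))" using i by (intro join_matching m) auto
    then have c: "stacked n (join i X) Y = join i (stacked n X Y)"
      using stacked_eq[OF gen.intros(2)[OF X i] n Y _ j(1)] by blast
    show "act \<delta> y n (uop \<delta> y n i (Poly_Mapping.single X 1)) Y = uop \<delta> y n i (act \<delta> y n (Poly_Mapping.single X 1) Y)"
      using gen_valid[OF X n] i stacked(1)[OF X n Y] j(2) by (simp add: uop_single act_def smul_simps c mult.commute)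
  qed (rule linear_op_comp[OF linear_act linear_uop], rule linear_op_comp[OF linear_uop linear_act])
qed

lemma equivariant_eop:
  assumes n: "1 \<le> n"
  shows "equivariant \<delta> y n (eop n)"
  unfolding equivariant_def
proof (intro conjI allI impI)
  show "linear_op (eop n)" by (rule linear_eop)
  fix x :: "arcs \<Rightarrow>\<^sub>0 'a" assume x: "Poly_Mapping.keys x \<subseteq> gen n"
  show "Poly_Mapping.keys (eop n x) \<subseteq> gen n"
    unfolding eop_def by (rule keys_lin) (use x gen.intros(3) in \<open>auto split: if_splits\<close>)
  fix Y assume Y: "valid (2 * n) Y"
  show "act \<delta> y n (eop n x) Y = eop n (act \<delta> y n x Y)"
  proof (rule linear_op_eqI[where S = "\<lambda>x. act \<delta> y n (eop n x) Y" and T = "\<lambda>x. eop n (act \<delta> y n x Y)"])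
    fix X assume "X \<in> Poly_Mapping.keys x"
    then have X: "X \<in> gen n" using x by blast
    note m = valid_matching[OF gen_valid[OF X n]] valid_matching[OF Y] valid_matching[OF stacked(1)[OF X n Y]]
    have j: "joins n (blob1 X) Y (blob1 (stacked n X Y))" "weight \<delta> y n (blob1 X) Y = weight \<delta> y n X Y"
      using blob1_joins[OF m n stacked(2)[OF X n Y]] by blast+
    have "matching (2 * n) (blob1 (stacked n X Y))" using n by (intro blob1_matching m) auto
    then have c: "stacked n (blob1 X) Y = blob1 (stacked n X Y)"
      using stacked_eq[OF gen.intros(3)[OF X] n Y _ j(1)] by blast
    show "act \<delta> y n (eop n (Poly_Mapping.single X 1)) Y = eop n (act \<delta> y n (Poly_Mapping.single X 1) Y)"
      using gen_valid[OF X n] stacked(1)[OF X n Y] j(2) by (simp add: eop_single act_def smul_simps c)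
  qed (rule linear_op_comp[OF linear_act linear_eop], rule linear_op_comp[OF linear_eop linear_act])
qed

lemma equivariant_smul: "equivariant \<delta> y n (smul c)"
  unfolding equivariant_def
  by (intro conjI allI impI linear_op_smul linear_op_id subset_trans[OF keys_smul]) (simp_all add: linear_opD[OF linear_act])

lemma equivariantD:
  assumes "equivariant \<delta> y n T"
  shows "linear_op T" "Poly_Mapping.keys x \<subseteq> gen n \<Longrightarrow> Poly_Mapping.keys (T x) \<subseteq> gen n"
    "Poly_Mapping.keys x \<subseteq> gen n \<Longrightarrow> valid (2 * n) Y \<Longrightarrow> act \<delta> y n (T x) Y = T (act \<delta> y n x Y)"
  using assms unfolding equivariant_def by blast+

lemma equivariant_comp:
  assumes S: "equivariant \<delta> y n S" and T: "equivariant \<delta> y n T"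
  shows "equivariant \<delta> y n (\<lambda>x. S (T x))"
  unfolding equivariant_def
  by (intro conjI allI impI linear_op_comp[OF equivariantD(1)[OF S] equivariantD(1)[OF T]])
    (simp_all add: equivariantD[OF S] equivariantD[OF T])

lemma equivariant_add:
  fixes \<delta> :: "'a::field"
  assumes S: "equivariant \<delta> y n S" and T: "equivariant \<delta> y n T"
  shows "equivariant \<delta> y n (\<lambda>x. S x + T x)"
  unfolding equivariant_def
proof (intro conjI allI impI linear_op_add equivariantD(1)[OF S] equivariantD(1)[OF T])
  fix x :: "arcs \<Rightarrow>\<^sub>0 'a" assume x: "Poly_Mapping.keys x \<subseteq> gen n"
  show "Poly_Mapping.keys (S x + T x) \<subseteq> gen n"
    using Poly_Mapping.keys_add[of "S x" "T x"] equivariantD(2)[OF S x] equivariantD(2)[OF T x] by blast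
  show "act \<delta> y n (S x + T x) Y = S (act \<delta> y n x Y) + T (act \<delta> y n x Y)" if "valid (2 * n) Y" for Y
    using equivariantD(3)[OF S x that] equivariantD(3)[OF T x that] by (simp add: linear_opD[OF linear_act])
qed

lemma equivariant_diff: "equivariant \<delta> y n S \<Longrightarrow> equivariant \<delta> y n T \<Longrightarrow> equivariant \<delta> y n (\<lambda>x. S x - T x)"
  using equivariant_add[OF _ equivariant_comp[OF equivariant_smul[of \<delta> y n "- 1"]], of S T] by (simp add: smul_simps)

lemma equivariant_jm:
  assumes n: "1 \<le> n" and k: "k \<le> n"
  shows "equivariant \<delta> y n (jm (uop \<delta> y n) (eop n) a b k)"
  using k
proof (induction k rule: induct_nat_012)
  case 0
  have "jm (uop \<delta> y n) (eop n) a b 0 = smul 0" by (rule ext) (simp add: smul_simps)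
  then show ?case using equivariant_smul by metis
next
  case 1
  have "jm (uop \<delta> y n) (eop n) a b (Suc 0) = (\<lambda>x. smul b x - smul (b - inverse b) (eop n x))" by (rule ext) simp
  then show ?case using equivariant_diff[OF equivariant_smul equivariant_comp[OF equivariant_smul equivariant_eop[OF n]]] by metis
next
  case (ge2 k)
  let ?g = "\<lambda>x. uop \<delta> y n (Suc k) x + smul a x"
  have g: "equivariant \<delta> y n ?g" using ge2.prems by (intro equivariant_add equivariant_smul equivariant_uop n) auto
  have "jm (uop \<delta> y n) (eop n) a b (Suc (Suc k)) = (\<lambda>x. ?g (jm (uop \<delta> y n) (eop n) a b (Suc k) (?g x)))" by (rule ext) simp
  then show ?case using equivariant_comp[OF g equivariant_comp[OF ge2.IH(2) g]] ge2.prems by simp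
qed

lemma blob_mult_act:
  fixes q Q :: "'a::field"
  assumes n: "1 \<le> n" and x: "Poly_Mapping.keys x \<subseteq> gen n" and Y: "valid (2 * n) Y"
  shows "blob_mult q Q n (Phi n x) (Phi n (Poly_Mapping.single Y 1)) = Phi n (act (- (q + inverse q)) (y_e q Q) n x Y)"
proof (rule linear_op_eqI[where S = "\<lambda>x. blob_mult q Q n (Phi n x) (Phi n (Poly_Mapping.single Y 1))" 
      and T = "\<lambda>x. Phi n (act (- (q + inverse q)) (y_e q Q) n x Y)"])
  fix X assume "X \<in> Poly_Mapping.keys x"
  then have X: "X \<in> gen n" using x by blast
  note m = valid_matching[OF gen_valid[OF X n]] valid_matching[OF Y] valid_matching[OF stacked(1)[OF X n Y]]
  have "concat_diagram n (diagram_of n X) (diagram_of n Y) = diagram_of n (stacked n X Y)"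
    using concat_iff_joins[OF m] stacked(2)[OF X n Y] by blast
  then show "blob_mult q Q n (Phi n (Poly_Mapping.single X 1)) (Phi n (Poly_Mapping.single Y 1)) =
      Phi n (act (- (q + inverse q)) (y_e q Q) n (Poly_Mapping.single X 1) Y)"
    by (simp add: blob_mult_lin act_def smul_simps dia_mult_def scale_smul dia_def weight_def)
qed (rule linear_op_comp[OF blob_mult_linear_left linear_Phi], rule linear_op_comp[OF linear_Phi linear_act])

text \<open>By equivariance \<open>T x = T (1 x) = (T 1) x\<close>, so operators composed from those
  of the generators are genuine left multiplications.\<close>

lemma blob_mult_op:
  fixes q Q :: "'a::field"
  assumes n: "1 \<le> n" and T: "equivariant (- (q + inverse q)) (y_e q Q) n T" and x: "Poly_Mapping.keys x \<subseteq> {X. valid (2 * n) X}"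
  shows "blob_mult q Q n (Phi n (T (Poly_Mapping.single (identity_arcs n) 1))) (Phi n x) = Phi n (T x)"
proof (rule linear_op_eqI[where S = "\<lambda>x. blob_mult q Q n (Phi n (T (Poly_Mapping.single (identity_arcs n) 1))) (Phi n x)" and T = "\<lambda>x. Phi n (T x)"])
  fix Y assume "Y \<in> Poly_Mapping.keys x"
  then have Y: "valid (2 * n) Y" using x by blast
  have g: "Poly_Mapping.keys (Poly_Mapping.single (identity_arcs n) (1::'a)) \<subseteq> gen n" by (simp add: gen.intros(1))
  have "stacked n (identity_arcs n) Y = Y" by (rule stacked_eq[OF gen.intros(1) n Y valid_matching[OF Y] id_joins(1)[OF valid_matching[OF Y]]])
  then have "act (- (q + inverse q)) (y_e q Q) n (Poly_Mapping.single (identity_arcs n) 1) Y = Poly_Mapping.single Y 1"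
    using id_joins(2)[OF valid_matching[OF Y], of "- (q + inverse q)" "y_e q Q"] by (simp add: act_def smul_simps)
  then show "blob_mult q Q n (Phi n (T (Poly_Mapping.single (identity_arcs n) 1))) (Phi n (Poly_Mapping.single Y 1)) = Phi n (T (Poly_Mapping.single Y 1))"
    using T g Y blob_mult_act[OF n _ Y] unfolding equivariant_def by metis
qed (rule linear_op_comp[OF blob_mult_linear_right linear_Phi], rule linear_op_comp[OF linear_Phi],
    use T in \<open>simp add: equivariant_def\<close>)

text \<open>Every left factor in the recursion has the form \<open>T 1\<close> with an equivariant
  operator \<open>T\<close>, so the nested products can be evaluated one after the other.\<close>

lemma JM_Phi:
  fixes q Q :: "'a::field"
  assumes n: "1 \<le> n" and k: "k \<le> n"
  shows "JM q Q n k = Phi n (jm (uop (- (q + inverse q)) (y_e q Q) n) (eop n) q Q k (Poly_Mapping.single (identity_arcs n) 1))"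
  using k
proof (induction k rule: induct_nat_012)
  case 0 then show ?case by (simp add: linear_opD[OF linear_Phi])
next
  case 1
  have "eop n (Poly_Mapping.single (identity_arcs n) (1::'a)) = Poly_Mapping.single (blob1 (identity_arcs n)) 1"
    by (rule eop_single[OF identity_arcs_valid])
  then show ?case
    by (simp add: linear_opD[OF linear_Phi] scale_smul dia_def id_diagram_diagram_of e_diagram_diagram_of[OF n] smul_simps)
next
  case (ge2 k)
  let ?u = "uop (- (q + inverse q)) (y_e q Q) n"
  let ?one = "Poly_Mapping.single (identity_arcs n) (1::'a)"
  let ?g = "\<lambda>x. ?u (Suc k) x + smul q x"
  let ?L = "jm ?u (eop n) q Q (Suc k)"
  have g: "equivariant (- (q + inverse q)) (y_e q Q) n ?g"
    using ge2.prems by (intro equivariant_add equivariant_smul equivariant_uop n) auto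
  have L: "equivariant (- (q + inverse q)) (y_e q Q) n ?L" using ge2.prems by (intro equivariant_jm n) auto
  have kk: "1 \<le> Suc k" "Suc k < n" using ge2.prems by auto
  have ne: "mate (identity_arcs n) (Suc k) \<noteq> Suc (Suc k)" using kk by (auto simp: identity_arcs_def)
  have "?u (Suc k) ?one = Poly_Mapping.single (join (Suc k) (identity_arcs n)) 1"
    by (simp only: uop_single[OF identity_arcs_valid kk] scal_unit[OF ne] mult_1)
  then have U: "U_plus_q q n (Suc k) = Phi n (?g ?one)"
    by (simp add: U_plus_q_def linear_opD[OF linear_Phi] scale_smul dia_def id_diagram_diagram_of U_diagram_diagram_of[OF kk] smul_simps)
  have one: "Poly_Mapping.keys ?one \<subseteq> gen n" by (simp add: gen.intros(1))
  have gv: "gen n \<subseteq> {X. valid (2 * n) X}" using gen_valid n by blast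
  have k1: "Poly_Mapping.keys (?L ?one) \<subseteq> {X. valid (2 * n) X}" using L one gv unfolding equivariant_def by blast
  have k2: "Poly_Mapping.keys (?g ?one) \<subseteq> {X. valid (2 * n) X}" using g one gv unfolding equivariant_def by blast
  have "JM q Q n (Suc (Suc k)) = blob_mult q Q n (blob_mult q Q n (Phi n (?g ?one)) (Phi n (?L ?one))) (Phi n (?g ?one))"
    using ge2 U by simp
  also have "\<dots> = blob_mult q Q n (Phi n (?g (?L ?one))) (Phi n (?g ?one))"
    unfolding blob_mult_op[OF n g k1] ..
  also have "\<dots> = Phi n (?g (?L (?g ?one)))"
    by (rule blob_mult_op[OF n equivariant_comp[OF g L] k2])
  finally show ?case by simp
qed

lemma JM_mult:
  fixes q Q :: "'a::field"
  assumes n: "1 \<le> n" and k: "k \<le> n" and Y: "valid (2 * n) Y"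
  shows "blob_mult q Q n (JM q Q n k) (dia (diagram_of n Y)) =
    Phi n (jm (uop (- (q + inverse q)) (y_e q Q) n) (eop n) q Q k (Poly_Mapping.single Y 1))"
proof -
  have "Poly_Mapping.keys (Poly_Mapping.single Y (1::'a)) \<subseteq> {X. valid (2 * n) X}" using Y by simp
  from blob_mult_op[OF n equivariant_jm[OF n k] this, of q Q q Q]
  show ?thesis unfolding JM_Phi[OF n k] dia_def Phi_single .
qed

section \<open>Triangularity\<close>

definition subring :: "'a::field set \<Rightarrow> bool" where
  "subring A \<longleftrightarrow> 0 \<in> A \<and> 1 \<in> A \<and> (\<forall>x\<in>A. \<forall>y\<in>A. x + y \<in> A \<and> x * y \<in> A) \<and> (\<forall>x\<in>A. - x \<in> A)"

lemma subringD:
  assumes "subring A"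
  shows "0 \<in> A" "1 \<in> A" "x \<in> A \<Longrightarrow> y \<in> A \<Longrightarrow> x + y \<in> A" "x \<in> A \<Longrightarrow> y \<in> A \<Longrightarrow> x * y \<in> A" "x \<in> A \<Longrightarrow> - x \<in> A"
    "x \<in> A \<Longrightarrow> y \<in> A \<Longrightarrow> x - y \<in> A" "x \<in> A \<Longrightarrow> x ^ k \<in> A"
proof -
  show 1: "0 \<in> A" "1 \<in> A" "x \<in> A \<Longrightarrow> y \<in> A \<Longrightarrow> x + y \<in> A" "x \<in> A \<Longrightarrow> y \<in> A \<Longrightarrow> x * y \<in> A" "x \<in> A \<Longrightarrow> - x \<in> A" for x y
    using assms by (simp_all add: subring_def)
  show "x \<in> A \<Longrightarrow> y \<in> A \<Longrightarrow> x - y \<in> A" using 1(3)[of x "- y"] 1(5)[of y] by simp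
  show "x \<in> A \<Longrightarrow> x ^ k \<in> A" by (induction k) (use 1 in auto)
qed

lemma subring_sum: "subring A \<Longrightarrow> (\<And>i. i \<in> I \<Longrightarrow> f i \<in> A) \<Longrightarrow> (\<Sum>i\<in>I. f i) \<in> A"
  by (induction I rule: infinite_finite_induct) (auto simp: subringD)

definition coeff_span :: "'a::field set \<Rightarrow> 'b set \<Rightarrow> ('b \<Rightarrow>\<^sub>0 'a) set" where
  "coeff_span A S = {x. Poly_Mapping.keys x \<subseteq> S \<and> (\<forall>b. Poly_Mapping.lookup x b \<in> A)}"

lemma coeff_span_simps:
  assumes "subring A"
  shows "0 \<in> coeff_span A S" "x \<in> coeff_span A S \<Longrightarrow> y \<in> coeff_span A S \<Longrightarrow> x + y \<in> coeff_span A S"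
    "x \<in> coeff_span A S \<Longrightarrow> y \<in> coeff_span A S \<Longrightarrow> x - y \<in> coeff_span A S"
    "c \<in> A \<Longrightarrow> x \<in> coeff_span A S \<Longrightarrow> smul c x \<in> coeff_span A S"
    "b \<in> S \<Longrightarrow> c \<in> A \<Longrightarrow> Poly_Mapping.single b c \<in> coeff_span A S"
proof -
  show "0 \<in> coeff_span A S" by (simp add: coeff_span_def subringD[OF assms])
  show "x \<in> coeff_span A S \<Longrightarrow> y \<in> coeff_span A S \<Longrightarrow> x + y \<in> coeff_span A S"
    using Poly_Mapping.keys_add[of x y] by (auto simp: coeff_span_def lookup_add subringD[OF assms])
  show "x \<in> coeff_span A S \<Longrightarrow> y \<in> coeff_span A S \<Longrightarrow> x - y \<in> coeff_span A S"
    unfolding coeff_span_def by (auto simp: in_keys_iff lookup_minus subringD[OF assms]) (metis diff_zero in_keys_iff subsetD)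
  show "c \<in> A \<Longrightarrow> x \<in> coeff_span A S \<Longrightarrow> smul c x \<in> coeff_span A S"
    by (auto simp: coeff_span_def in_keys_iff subringD[OF assms])
  show "b \<in> S \<Longrightarrow> c \<in> A \<Longrightarrow> Poly_Mapping.single b c \<in> coeff_span A S"
    by (auto simp: coeff_span_def lookup_single when_def subringD[OF assms])
qed

lemma coeff_span_mono: "S \<subseteq> T \<Longrightarrow> x \<in> coeff_span A S \<Longrightarrow> x \<in> coeff_span A T"
  by (auto simp: coeff_span_def)

lemma coeff_span_lin:
  assumes A: "subring A" and x: "x \<in> coeff_span A S" and f: "\<And>b. b \<in> S \<Longrightarrow> f b \<in> coeff_span A T"
  shows "lin f x \<in> coeff_span A T"
proof -
  have "Poly_Mapping.keys (lin f x) \<subseteq> T"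
    by (rule keys_lin) (use x f in \<open>auto simp: coeff_span_def\<close>)
  moreover have "Poly_Mapping.lookup (lin f x) k \<in> A" for k
    unfolding lin_def lookup_sum
    by (rule subring_sum[OF A]) (use x f A in \<open>auto simp: coeff_span_def subringD\<close>)
  ultimately show ?thesis by (simp add: coeff_span_def)
qed

section \<open>Dominance of paths under the generators\<close>

lemma dominates_trans:
  assumes k: "k \<le> n" and EF: "dominates n k E F" and FD: "dominates n k F D"
  shows "dominates n k E D"
proof -
  have s: "int_succeq (path E j) (path D j)" if "k \<le> j" "j \<le> n" for j
    using EF FD that unfolding dominates_def by (blast intro: succeq_trans)
  have "path E j = path D j" if eq: "path E n = path D n" and j: "n \<le> j" for j
  proof -
    have "int_succeq (path E n) (path F n)" "int_succeq (path F n) (path D n)"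
      using EF FD k unfolding dominates_def by blast+
    \<comment> \<open>The middle value of \<open>F\<close> is squeezed between two equal ones, which
      activates the tail clauses of both hypotheses.\<close>
    then have F: "path F n = path D n" by (intro succeq_antisym) (simp_all add: eq)
    have "path E j = path F j" "path F j = path D j"
      using EF FD eq j F unfolding dominates_def by metis+
    then show ?thesis by simp
  qed
  then show ?thesis using s by (simp add: dominates_def)
qed

lemma dominates_refl: "dominates n k E E"
  by (simp add: dominates_def)

text \<open>Comparing only from \<open>k\<close> on ignores the peak that the join creates at
  \<open>i < k\<close>. The tail clause is \<open>join_path_tail\<close> at the middle
  position.\<close>

lemma join_dominates:
  assumes v: "valid (2 * n) E" and i: "1 \<le> i" "i < k" "k \<le> n"
  shows "dominates n k (join i E) E"
  unfolding dominates_def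
proof (intro conjI allI impI)
  have iN: "i < 2 * n" "i < n" using i by auto
  show "int_succeq (path (join i E) j) (path E j)" if "k \<le> j \<and> j \<le> n" for j
    using join_succeq[OF v i(1) iN(1), of j] that i by simp
  show "path (join i E) j = path E j" if "path (join i E) n = path E n" "n \<le> j" for j
    using join_path_tail[OF v i(1) iN(1) iN(2) that(2,1)] .
qed

lemma blob1_dominates:
  assumes v: "valid (2 * n) E" and n: "1 \<le> n"
  shows "dominates n k (blob1 E) E"
  unfolding dominates_def
  using blob1_succeq[OF valid_matching[OF v]] blob1_path_tail[OF v _ n] by blast

lemma opened_subset: "matching N X \<Longrightarrow> opened X j \<subseteq> {1..j}"
  using opened_least_pos by (auto simp: opened_def)

lemma height_le: "matching N X \<Longrightarrow> height X j \<le> j"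
  using card_mono[OF _ opened_subset[of N X j]] by simp

text \<open>Node \<open>i\<close> is joined to \<open>i + 1 \<le> k\<close>, so at \<open>k\<close>
  not all of the first \<open>k\<close> nodes are open. This separates the products containing some
  \<open>U_i\<close> from a diagram that is straight up to \<open>k\<close>.\<close>

lemma height_join_less:
  assumes mt: "matching N X" and i: "1 \<le> i" "i < k" "i < N"
  shows "height (join i X) k < k"
proof -
  have "opened (join i X) k \<subseteq> {1..k}" by (rule opened_subset[OF join_matching[OF mt i(1,3)]])
  moreover have "i \<notin> opened (join i X) k" using i by (simp add: opened_def)
  ultimately have "opened (join i X) k \<subseteq> {1..k} - {i}" by blast
  then have "height (join i X) k \<le> card ({1..k} - {i})" by (intro card_mono) auto
  also have "\<dots> < k" using i by simp
  finally show ?thesis .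
qed

lemma join_fix:
  assumes mt: "matching N X" and a: "mate X i = Suc i" "\<not> deco X i"
  shows "join i X = X"
proof -
  have f: "mate X (Suc i) = i" "\<not> deco X (Suc i)"
    using matchingD(1)[OF mt, of i] matchingD(3)[OF mt, of i] a by auto
  show ?thesis by (rule arcs_eqI) (use f a in \<open>auto simp: mate_join deco_join\<close>)
qed

lemma straight_path:
  assumes v: "valid N D" and st: "\<And>x. 1 \<le> x \<Longrightarrow> x \<le> k \<Longrightarrow> k < mate D x" and j: "j \<le> k"
  shows "path D j = (if deco D 1 then - int j else int j)"
proof (cases "j = 0")
  case True then show ?thesis using path_0[OF valid_matching[OF v]] by simp
next
  case False
  have o: "opened D j = {1..j}"
    using opened_subset[OF valid_matching[OF v], of j] st j by (fastforce simp: opened_def)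
  have "marked D j \<longleftrightarrow> deco D 1"
  proof
    assume "marked D j"
    then obtain x where x: "1 \<le> x" "x \<le> j" "deco D x" using o by (auto simp: marked_def)
    have "x = 1" using outermost[OF v x(3), of 1] st[of 1] x j False by force
    then show "deco D 1" using x by simp
  qed (use o False in \<open>auto simp: marked_def\<close>)
  then show ?thesis using o by (simp add: path_def)
qed

text \<open>A path has absolute value at most \<open>j\<close> at position \<open>j\<close>, so the
  undecorated straight path is the lowest possible there.\<close>

lemma succeq_int: "\<bar>x\<bar> \<le> int j \<Longrightarrow> int_succeq x (int j)"
  by (auto simp: int_succeq_def)

locale coeffs =
  fixes n :: nat and A :: "'a::field set" and \<delta> y :: 'a
  assumes n: "1 \<le> n" and A: "subring A" and dA: "\<delta> \<in> A" and yA: "y \<in> A"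
begin

abbreviation "u \<equiv> uop \<delta> y n"
abbreviation "e \<equiv> (eop n :: (arcs \<Rightarrow>\<^sub>0 'a) \<Rightarrow> (arcs \<Rightarrow>\<^sub>0 'a))"
abbreviation s :: "arcs \<Rightarrow> (arcs \<Rightarrow>\<^sub>0 'a)" where "s D \<equiv> Poly_Mapping.single D 1"

lemmas sp = coeff_span_simps[OF A]

lemma scal_A: "scal \<delta> y i X \<in> A"
  using dA yA subringD(2)[OF A] by (simp add: scal_def)

lemma u_span:
  assumes "x \<in> coeff_span A S" "\<And>X. X \<in> S \<Longrightarrow> valid (2 * n) X \<Longrightarrow> 1 \<le> i \<Longrightarrow> i < n \<Longrightarrow> join i X \<in> T"
  shows "u i x \<in> coeff_span A T"
  unfolding uop_def by (rule coeff_span_lin[OF A assms(1)]) (auto intro!: sp(1,5) scal_A assms(2))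

lemma e_span:
  assumes "x \<in> coeff_span A S" "\<And>X. X \<in> S \<Longrightarrow> valid (2 * n) X \<Longrightarrow> blob1 X \<in> T"
  shows "e x \<in> coeff_span A T"
  unfolding eop_def by (rule coeff_span_lin[OF A assms(1)]) (auto intro!: sp(1,5) subringD(2)[OF A] assms(2))

lemma jm_span:
  assumes ab: "a \<in> A" "b \<in> A" "inverse b \<in> A" and x: "x \<in> coeff_span A S"
    and S: "\<And>X i. X \<in> S \<Longrightarrow> valid (2 * n) X \<Longrightarrow> 1 \<le> i \<Longrightarrow> i < k \<Longrightarrow> i < n \<Longrightarrow> join i X \<in> S"
      "\<And>X. X \<in> S \<Longrightarrow> valid (2 * n) X \<Longrightarrow> blob1 X \<in> S"
  shows "jm u e a b k x \<in> coeff_span A S"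
  using x S(1)
proof (induction k arbitrary: x rule: induct_nat_012)
  case 0 then show ?case by (simp add: sp)
next
  case 1
  then show ?case using ab S(2) by (auto intro!: sp e_span subringD[OF A])
next
  case (ge2 k)
  have g: "u (Suc k) z + smul a z \<in> coeff_span A S" if "z \<in> coeff_span A S" for z
    using that ge2.prems(2) ab by (intro sp u_span) auto
  have "jm u e a b (Suc k) z \<in> coeff_span A S" if "z \<in> coeff_span A S" for z
    using that ge2.prems(2) by (intro ge2.IH(2)) auto
  then show ?case using g ge2.prems(1) by simp
qed

lemma keys_u: "X \<in> Poly_Mapping.keys (u i x) \<Longrightarrow> mate X i = Suc i \<and> \<not> deco X i"
proof -
  have "Poly_Mapping.keys (u i x) \<subseteq> {X. mate X i = Suc i \<and> \<not> deco X i}"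
    unfolding uop_def by (rule keys_lin) (auto split: if_splits)
  then show "X \<in> Poly_Mapping.keys (u i x) \<Longrightarrow> mate X i = Suc i \<and> \<not> deco X i" by blast
qed

text \<open>Expanding all factors \<open>U_i + a\<close> of \<open>L_m\<close>, the product without
  any \<open>U_i\<close> is \<open>a^{2(m-1)} L_1 D\<close>; every other one contains some
  \<open>U_i\<close> with \<open>i < k\<close> and therefore has height below \<open>k\<close> at
  \<open>k\<close>.\<close>

lemma jm_straight:
  assumes ab: "a \<in> A" "b \<in> A" "inverse b \<in> A" and D: "valid (2 * n) D" and k: "1 \<le> k" "k \<le> n"
    and m: "1 \<le> m" "m \<le> k"
  defines "W \<equiv> {E. valid (2 * n) E \<and> dominates n k E D}"
  shows "jm u e a b m (s D) - smul (a ^ (2 * (m - 1))) (smul b (s D) - smul (b - inverse b) (s (blob1 D)))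
     \<in> coeff_span A {E \<in> W. height E k < k}"
  using m
proof (induction m rule: dec_induct)
  case base
  then show ?case using eop_single[OF D, of "1::'a"] by (simp add: sp smul_simps)
next
  case (step m)
  let ?W' = "{E \<in> W. height E k < k}"
  obtain m' where m': "m = Suc m'" using step by (cases m) auto
  have WW: "join i E \<in> ?W'" if "E \<in> W" "1 \<le> i" "i < k" for E i
  proof -
    have E: "valid (2 * n) E" "dominates n k E D" using that by (auto simp: W_def)
    have "dominates n k (join i E) D" using dominates_trans[OF k(2) join_dominates[OF E(1) that(2,3) k(2)] E(2)] .
    moreover have "valid (2 * n) (join i E)" using join_valid[OF E(1) that(2)] that k by simp
    moreover have "height (join i E) k < k" using height_join_less[OF valid_matching[OF E(1)] that(2,3)] that k by simp
    ultimately show ?thesis by (simp add: W_def)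
  qed
  have Wb: "blob1 E \<in> W" if "E \<in> W" for E
    using that dominates_trans[OF k(2) blob1_dominates[OF _ n]] blob1_valid[of "2 * n" E] n by (auto simp: W_def)
  have Wb': "blob1 E \<in> ?W'" if "E \<in> ?W'" for E using Wb that by simp
  have DW: "D \<in> W" using D by (simp add: W_def dominates_refl)
  let ?L = "jm u e a b m"
  let ?g = "\<lambda>x. u m x + smul a x"
  define v where "v = smul b (s D) - smul (b - inverse b) (s (blob1 D))"
  define c where "c = a ^ (2 * (m - 1))"
  have cA: "c \<in> A" using ab subringD[OF A] by (simp add: c_def)
  have vW: "v \<in> coeff_span A W" unfolding v_def using ab DW Wb by (intro sp subringD[OF A]) auto
  have mk: "m < k" "m < n" using step.hyps step.prems k by auto
  have uW: "u m x \<in> coeff_span A ?W'" if "x \<in> coeff_span A W" for x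
    by (rule u_span[OF that]) (use WW step mk in auto)
  have L': "?L x \<in> coeff_span A ?W'" if "x \<in> coeff_span A ?W'" for x
    by (rule jm_span[OF ab that]) (use WW Wb' mk in auto)
  have sub: "coeff_span A ?W' \<subseteq> coeff_span A W" using coeff_span_mono[of ?W' W] by auto
  have g': "?g x \<in> coeff_span A ?W'" if "x \<in> coeff_span A ?W'" for x
    using uW that sub ab by (intro sp) auto
  define w where "w = ?L (s D) - smul c v"
  have w: "w \<in> coeff_span A ?W'" using step.IH step.prems unfolding w_def c_def v_def by simp
  have Lx: "?L (s D) = smul c v + w" by (simp add: w_def)
  note ll = linear_opD[OF linear_jm[OF linear_uop linear_eop]] linear_opD[OF linear_uop]
  have rec: "jm u e a b (Suc m) x = ?g (?L (?g x))" for x unfolding m' by simp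
  \<comment> \<open>The scalar parts of both outer factors \<open>u m + a\<close> are split off;
    what remains contains \<open>u m\<close> or the error term \<open>w\<close>.\<close>
  have eq: "jm u e a b (Suc m) x - smul (a * a * c) v = ?g (?L (u m x)) + smul (a * c) (u m v) + smul a (?g w)"
    if "?L x = smul c v + w" for x
    unfolding rec by (simp add: ll that smul_simps algebra_simps)
  have sD: "s D \<in> coeff_span A W" using DW by (intro sp subringD[OF A]) auto
  have "?g (?L (u m (s D))) + smul (a * c) (u m v) + smul a (?g w) \<in> coeff_span A ?W'"
    by (rule sp(2)[OF sp(2)[OF g'[OF L'[OF uW[OF sD]]] sp(4)[OF subringD(4)[OF A ab(1) cA] uW[OF vW]]] sp(4)[OF ab(1) g'[OF w]]])
  moreover have "a * a * c = a ^ (2 * (Suc m - 1))" unfolding c_def m' by (simp add: power_add)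
  ultimately show ?case using eq[OF Lx] unfolding v_def by simp
qed

end

context coeffs begin

text \<open>If the first line is decorated, products that leave it undecorated could spoil the path order to
  the left of \<open>k\<close>. Their coefficients cancel: \<open>e\<close> fixes the diagram and commutes with \<open>L\<^sub>k\<close>.\<close>

lemma straight_triangular:
  assumes rep: "blob_rep n u e a b \<delta> y" and ab: "a \<in> A" "b \<in> A" "inverse b \<in> A"
    and D: "valid (2 * n) D" and k: "1 \<le> k" "k \<le> n" and st: "\<And>x. 1 \<le> x \<Longrightarrow> x \<le> k \<Longrightarrow> k < mate D x"
  shows "jm u e a b k (s D) - smul (a ^ (2 * (k - 1)) * (if deco D 1 then inverse b else b)) (s D) \<in> coeff_span A (dominating n D)"
proof -
  interpret blob_rep n u e a b \<delta> y by fact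
  note mt = valid_matching[OF D]
  define W' where "W' = {E. valid (2 * n) E \<and> dominates n k E D \<and> height E k < k}"
  let ?c = "a ^ (2 * (k - 1))"
  have str: "L k (s D) - smul ?c (smul b (s D) - smul (b - inverse b) (s (blob1 D))) \<in> coeff_span A W'"
    using jm_straight[OF ab D k k(1) order_refl] unfolding W'_def by (simp add: conj_assoc)
  have P: "path D j = (if deco D 1 then - int j else int j)" if "j \<le> k" for j
    using straight_path[OF D st that] by blast
  have cA: "?c \<in> A" using subringD(7)[OF A ab(1)] .
  have hk: "height D k = k" using P[of k] abs_path[of D k] by (auto split: if_splits)
  \<comment> \<open>The strict comparison happens at \<open>k\<close> itself; only the positions to
    the left of \<open>k\<close> remain to be checked.\<close>
  have above1: "E \<in> dominating n D" if E: "E \<in> W'" "\<And>j. j < k \<Longrightarrow> int_succeq (path E j) (path D j)" for E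
  proof -
    have d: "dominates n k E D" "height E k < k" "valid (2 * n) E" using E by (auto simp: W'_def)
    have "dominates n 0 E D" using d(1) E(2) unfolding dominates_def by (metis le0 linorder_not_less)
    moreover have "path E k \<noteq> path D k" using d(2) hk abs_path[of E k] abs_path[of D k] by auto
    ultimately show ?thesis using d k unfolding dominating_def by blast
  qed
  show ?thesis
  proof (cases "deco D 1")
    case False
    have "W' \<subseteq> dominating n D"
    proof
      fix E assume E: "E \<in> W'"
      then have mE: "matching (2 * n) E" by (auto simp: W'_def valid_matching)
      have "int_succeq (path E j) (path D j)" if "j < k" for j
        using P[of j] that False succeq_int[of "path E j" j] height_le[OF mE, of j] abs_path[of E j] by simp
      then show "E \<in> dominating n D" using above1 E by blast
    qed
    then have "L k (s D) - smul ?c (smul b (s D) - smul (b - inverse b) (s (blob1 D))) \<in> coeff_span A (dominating n D)"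
      using str coeff_span_mono by blast
    \<comment> \<open>Decorating the first line changes the value at 1 from 1 to -1, which is higher
      in the order.\<close>
    moreover have "blob1 D \<in> dominating n D"
    proof -
      have "1 \<in> opened D 1" using st[of 1] k by (simp add: opened_def)
      then have "path (blob1 D) 1 < 0" using blob1_marked[OF mt] marked_iff_neg by blast
      then have "path (blob1 D) 1 \<noteq> path D 1" using P[of 1] k False by simp
      then show ?thesis using blob1_valid[OF D] blob1_dominates[OF D n] n unfolding dominating_def by auto
    qed
    then have "smul (?c * (b - inverse b)) (s (blob1 D)) \<in> coeff_span A (dominating n D)"
      using cA ab by (intro sp subringD[OF A])
    ultimately have "L k (s D) - smul ?c (smul b (s D) - smul (b - inverse b) (s (blob1 D))) - smul (?c * (b - inverse b)) (s (blob1 D)) \<in> coeff_span A (dominating n D)"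
      by (rule sp(3))
    moreover have eq: "x - smul ?c (smul b z - smul (b - inverse b) w) - smul (?c * (b - inverse b)) w = x - smul (?c * b) z" for x z w :: "arcs \<Rightarrow>\<^sub>0 'a"
      by (simp add: smul_simps algebra_simps)
    ultimately have "L k (s D) - smul (?c * b) (s D) \<in> coeff_span A (dominating n D)" by (simp only: eq)
    then show ?thesis using False by simp
  next
    case True
    have bD: "blob1 D = D" by (rule blob1_id[OF mt True])
    define z where "z = L k (s D) - smul (?c * inverse b) (s D)"
    have zW: "z \<in> coeff_span A W'"
    proof -
      have "smul ?c (smul b w - smul (b - inverse b) w) = smul (?c * inverse b) w" for w :: "arcs \<Rightarrow>\<^sub>0 'a"
        by (simp add: smul_simps algebra_simps)
      then show ?thesis using str unfolding bD z_def by simp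
    qed
    have eD: "e (s D) = s D" using eop_single[OF D, of 1] bD by simp
    have "e (L k (s D)) = L k (e (s D))"
    proof (cases "k = 1")
      case True then show ?thesis by (simp add: lins ee)
    next
      case False then show ?thesis using L_e[of k] k by simp
    qed
    then have "e z = z" unfolding z_def by (simp add: linear_opD[OF linear_eop] eD del: jm.simps)
    moreover have "e z \<in> coeff_span A (dominating n D)"
    proof (rule e_span[OF zW])
      fix E assume E: "E \<in> W'" "valid (2 * n) E"
      then have d: "dominates n k E D" "height E k < k" by (auto simp: W'_def)
      have vb: "valid (2 * n) (blob1 E)" using blob1_valid[OF E(2)] n by simp
      have "blob1 E \<in> W'"
        using vb dominates_trans[OF k(2) blob1_dominates[OF E(2) n] d(1)] d(2) by (simp add: W'_def)
      \<comment> \<open>To the left of \<open>k\<close> the path of \<open>D\<close> is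
        \<open>- j\<close>, and among the possible values only \<open>+ j\<close> is not above it.
        After \<open>e\<close> this value is excluded for \<open>j > 0\<close>: at full height the
        arc through 1 is open, and it is now decorated.\<close>
      moreover have "int_succeq (path (blob1 E) j) (path D j)" if j: "j < k" for j
      proof -
        have le: "height (blob1 E) j \<le> j" using height_le[OF valid_matching[OF vb]] .
        have "path (blob1 E) j = - int j" if "height (blob1 E) j = j" "j \<noteq> 0"
        proof -
          have "opened (blob1 E) j = {1..j}"
            using that opened_subset[OF valid_matching[OF vb], of j] by (intro card_subset_eq) auto
          then have "1 \<in> opened E j" using that by simp
          then have "marked (blob1 E) j" using blob1_marked[OF valid_matching[OF E(2)]] by blast
          then show ?thesis using that by (simp add: path_def)
        qed
        then show ?thesis
          using P[of j] j True le abs_path[of "blob1 E" j] by (cases "height (blob1 E) j = j"; cases "j = 0") (auto simp: int_succeq_def)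
      qed
      ultimately show "blob1 E \<in> dominating n D" using above1 by blast
    qed
    ultimately show ?thesis using True by (simp add: z_def)
  qed
qed

end

locale coeffs_q = coeffs n A "- (q + inverse q)" "y_e q Q" for n A and q Q :: "'a::field" +
  assumes q: "q \<noteq> 0" and Q: "Q \<noteq> 0" "Q \<noteq> inverse Q" and d0: "q + inverse q \<noteq> 0"
    and qA: "q \<in> A" "inverse q \<in> A" "Q \<in> A" "inverse Q \<in> A"
begin

sublocale rep: blob_rep n "uop (- (q + inverse q)) (y_e q Q) n" "eop n" q Q "- (q + inverse q)" "y_e q Q"
  by (rule blob_rep_arcs[OF n q Q])

lemma rep_inv: "blob_rep n u e (inverse q) (inverse Q) (- (q + inverse q)) (y_e q Q)"
  by (rule blob_rep_inverse) (rule rep.blob_rep_axioms)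

abbreviation "Lk \<equiv> jm u e q Q"

definition tri :: "nat \<Rightarrow> arcs \<Rightarrow> bool" where
  "tri k D \<longleftrightarrow> Lk k (s D) - smul (path_content q Q (path D) k) (s D) \<in> coeff_span A (dominating n D)"

lemma tri_straight:
  assumes D: "valid (2 * n) D" and k: "1 \<le> k" "k \<le> n" and st: "\<And>x. 1 \<le> x \<Longrightarrow> x \<le> k \<Longrightarrow> k < mate D x"
  shows "tri k D"
proof -
  have P: "path D j = (if deco D 1 then - int j else int j)" if "j \<le> k" for j
    using straight_path[OF D st that] by blast
  have e: "nat (int k - 1 + int (k - 1)) = 2 * (k - 1)" "int (k - 1) = int k - 1" using k by auto
  have "path_content q Q (path D) k = q ^ (2 * (k - 1)) * (if deco D 1 then inverse Q else Q)"
    using P[of k] P[of "k - 1"] e by (auto simp: path_content_def)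
  then show ?thesis
    using straight_triangular[OF rep.blob_rep_axioms qA(1,3,4) D k st] by (simp add: tri_def)
qed

text \<open>Here \<open>U_i D = \<delta> D\<close>, and as \<open>\<delta> \<noteq> 0\<close>, the
  identity for \<open>L_{i+1} U_i\<close> can be applied to \<open>D\<close> itself. The division
  takes place in the field and leaves no denominator in the result.\<close>

lemma L_arc:
  assumes D: "valid (2 * n) D" and i: "1 \<le> i" "i < n" and a: "mate D i = Suc i" "\<not> deco D i"
  shows "Lk (Suc i) (s D) = smul (q ^ (2 * (i - 1))) (jm u e (inverse q) (inverse Q) i (s D))"
proof -
  let ?d = "- (q + inverse q)"
  have jf: "join i D = D" by (rule join_fix[OF valid_matching[OF D] a])
  have u: "u i (s D) = smul ?d (s D)" using uop_single[OF D i, where c = 1] jf a by (simp add: scal_def smul_simps)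
  have d: "?d \<noteq> 0" using d0 by (metis neg_equal_0_iff_equal)
  note lL = linear_opD[OF linear_jm[OF linear_uop linear_eop]]
  have "Lk (Suc i) (u i (s D)) = smul (q ^ (2 * (i - 1))) (jm u e (inverse q) (inverse Q) i (u i (s D)))"
    by (rule jm_inverse[OF rep.blob_rep_axioms i])
  then have "smul ?d (Lk (Suc i) (s D)) = smul ?d (smul (q ^ (2 * (i - 1))) (jm u e (inverse q) (inverse Q) i (s D)))"
    unfolding u lL by (simp only: smul_simps(3) mult.commute)
  then have "smul (inverse ?d * ?d) (Lk (Suc i) (s D)) = smul (inverse ?d * ?d) (smul (q ^ (2 * (i - 1))) (jm u e (inverse q) (inverse Q) i (s D)))"
    by (metis smul_simps(3))
  moreover have "inverse ?d * ?d = 1" using d by (rule left_inverse)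
  ultimately show ?thesis by (simp only: smul_simps(4))
qed

text \<open>The entries up to \<open>i\<close> fill one row and \<open>i + 1\<close> begins the
  other, so its content is \<open>Q\<close> or its inverse: the power \<open>q^{2(i-1)}\<close> of
  the identity cancels against the one from the inverse operator.\<close>

lemma tri_turn:
  assumes D: "valid (2 * n) D" and i: "1 \<le> i" "i < n" and a: "mate D i = Suc i" "\<not> deco D i"
    and st: "\<And>x. 1 \<le> x \<Longrightarrow> x \<le> i \<Longrightarrow> i < mate D x"
  shows "tri (Suc i) D"
proof -
  obtain m where m: "i = Suc m" using i by (cases i) auto
  have P: "path D j = (if deco D 1 then - int j else int j)" if "j \<le> i" for j
    using straight_path[OF D st that] by blast
  have pk: "path D (Suc i) = path D m" using path_peak(2)[OF D, of m] a m by simp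
  let ?w = "if deco D 1 then Q else inverse Q"
  have c: "path_content q Q (path D) (Suc i) = ?w"
    using P[of i] P[of m] pk m by (auto simp: path_content_def)
  let ?c' = "inverse q ^ (2 * (i - 1)) * (if deco D 1 then inverse (inverse Q) else inverse Q)"
  have iQ: "inverse (inverse Q) \<in> A" using qA by simp
  have S: "jm u e (inverse q) (inverse Q) i (s D) - smul ?c' (s D) \<in> coeff_span A (dominating n D)"
    using straight_triangular[OF rep_inv qA(2,4) iQ D i(1) _ st] i by simp
  have qA': "q ^ (2 * (i - 1)) \<in> A" using subringD(7)[OF A qA(1)] .
  have "smul (q ^ (2 * (i - 1))) (jm u e (inverse q) (inverse Q) i (s D) - smul ?c' (s D)) \<in> coeff_span A (dominating n D)"
    by (rule sp(4)[OF qA' S])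
  moreover have "q ^ (2 * (i - 1)) * ?c' = ?w" using q by (simp add: power_inverse)
  ultimately show ?thesis
    unfolding tri_def L_arc[OF D i a] c smul_simps(7) smul_simps(3) by simp
qed

section \<open>Triangularity and sliding arcs\<close>

definition bump :: "int \<Rightarrow> int" where
  "bump x = x + (if x < 0 then - 1 else 1)"

lemma bump_succeq: "int_succeq x z \<Longrightarrow> int_succeq (bump x) (bump z)"
  by (auto simp: int_succeq_def bump_def)

text \<open>Outside \<open>m\<close> and \<open>m + 1\<close> both paths are unchanged, and at these
  two positions the new values are monotone functions of the value at \<open>m - 1\<close>.\<close>

lemma join_above:
  assumes E: "E \<in> dominating n F" and F: "valid (2 * n) F" and m: "1 \<le> m" "Suc m < n"
    and aE: "mate E (Suc m) = Suc (Suc m)" "\<not> deco E (Suc m)" and aF: "mate F (Suc m) = Suc (Suc m)" "\<not> deco F (Suc m)"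
  shows "join m E \<in> dominating n (join m F)"
proof -
  have vE: "valid (2 * n) E" and d: "dominates n 0 E F" and ne: "\<exists>j \<le> n. path E j \<noteq> path F j"
    using E by (auto simp: dominating_def)
  have m2: "Suc m < 2 * n" "m < 2 * n" using m by auto
  note sE = path_shift[OF vE m(1) m2(1) aE] and sF = path_shift[OF F m(1) m2(1) aF]
  note pE = path_peak[OF vE aE] and pF = path_peak[OF F aF]
  have ge: "int_succeq (path E j) (path F j)" if "j \<le> n" for j using d that by (simp add: dominates_def)
  have "int_succeq (path (join m E) j) (path (join m F) j)" if j: "j \<le> n" for j
  proof -
    consider "j < m \<or> Suc m < j" | "j = m" | "j = Suc m" by linarith
    then show ?thesis
    proof cases
      case 1 then show ?thesis using sE(1) sF(1) ge j by metis
    next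
      case 2
      have "m - 1 \<le> n" using m by simp
      then show ?thesis using 2 sE(2) sF(2) bump_succeq[OF ge, of "m - 1"] by (simp add: bump_def)
    next
      case 3
      have "m - 1 \<le> n" using m by simp
      then show ?thesis using 3 sE(3) sF(3) ge by metis
    qed
  qed
  moreover have "path (join m E) j = path (join m F) j" if "path (join m E) n = path (join m F) n" "n \<le> j" for j
  proof -
    have "path E n = path F n" using that(1) sE(1)[of n] sF(1)[of n] m by simp
    then have "path E j = path F j" using d that(2) by (simp add: dominates_def)
    then show ?thesis using sE(1)[of j] sF(1)[of j] m that(2) by simp
  qed
  ultimately have "dominates n 0 (join m E) (join m F)" by (simp add: dominates_def)
  moreover have "\<exists>j \<le> n. path (join m E) j \<noteq> path (join m F) j"
  proof -
    obtain j where j: "j \<le> n" "path E j \<noteq> path F j" using ne by blast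
    \<comment> \<open>A difference inside the peak is visible again at \<open>m + 2\<close>: there
      the path returns to its value at \<open>m\<close>, and this value determines the peak.\<close>
    have "\<exists>j' \<le> n. (j' < m \<or> Suc m < j') \<and> path E j' \<noteq> path F j'"
    proof (cases "j < m \<or> Suc m < j")
      case False
      then have "j = m \<or> j = Suc m" by linarith
      then have "path E m \<noteq> path F m" using j pE(1) pF(1) by auto
      then have "path E (Suc (Suc m)) \<noteq> path F (Suc (Suc m))" using pE(2) pF(2) by simp
      then show ?thesis using m by (intro exI[of _ "Suc (Suc m)"]) simp
    qed (use j in blast)
    then show ?thesis using sE(1) sF(1) by metis
  qed
  ultimately show ?thesis using join_valid[OF vE m(1) m2(2)] by (simp add: dominating_def)
qed

lemma transfer:
  assumes z: "z \<in> coeff_span A (dominating n F)" and F: "valid (2 * n) F" and m: "1 \<le> m" "Suc m < n"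
    and aF: "mate F (Suc m) = Suc (Suc m)" "\<not> deco F (Suc m)"
    and kz: "\<And>E. E \<in> Poly_Mapping.keys z \<Longrightarrow> mate E (Suc m) = Suc (Suc m) \<and> \<not> deco E (Suc m)"
  shows "u m z \<in> coeff_span A (dominating n (join m F))"
proof -
  let ?S = "{E \<in> dominating n F. mate E (Suc m) = Suc (Suc m) \<and> \<not> deco E (Suc m)}"
  have "z \<in> coeff_span A ?S" using z kz by (auto simp: coeff_span_def)
  then show ?thesis by (rule u_span) (use join_above[OF _ F m _ _ aF] in auto)
qed

lemma keys_diff: "Poly_Mapping.keys (x - z) \<subseteq> Poly_Mapping.keys x \<union> Poly_Mapping.keys (z :: 'c \<Rightarrow>\<^sub>0 'a)"
  by (auto simp: in_keys_iff lookup_minus)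

text \<open>With \<open>F = U_{i+1} D\<close> one has \<open>D = U_i F\<close>. The error terms for
  \<open>F\<close> all keep the plain arc \<open>(i + 1, i + 2)\<close>, because they lie in the
  image of \<open>U_{i+1}\<close> up to a multiple of \<open>F\<close>; on diagrams with this arc
  \<open>U_i\<close> is monotone.\<close>

lemma tri_slide:
  assumes D: "valid (2 * n) D" and i: "1 \<le> i" "Suc i < k" "k \<le> n" and a: "mate D i = Suc i" "\<not> deco D i"
    and IH: "\<And>F. valid (2 * n) F \<Longrightarrow> Suc (Suc i) = k \<Longrightarrow> tri i F"
      "\<And>F. valid (2 * n) F \<Longrightarrow> Suc (Suc i) < k \<Longrightarrow> mate F (Suc i) = Suc (Suc i) \<Longrightarrow> \<not> deco F (Suc i) \<Longrightarrow> tri k F"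
  shows "tri k D"
proof -
  note mt = valid_matching[OF D]
  define F where "F = join (Suc i) D"
  have i2: "i < n" "Suc i < n" "i < 2 * n" "Suc i < 2 * n" using i by auto
  have vF: "valid (2 * n) F" unfolding F_def using join_valid[OF D _ i2(4)] by simp
  have aF: "mate F (Suc i) = Suc (Suc i)" "\<not> deco F (Suc i)" by (simp_all add: F_def)
  have DF: "join i F = D" unfolding F_def by (rule join_cancel_right[OF mt a])
  have nD: "mate D (Suc i) \<noteq> Suc (Suc i)" using matchingD(1)[OF mt, of i] a by simp
  have uD: "u (Suc i) (s D) = s F"
    by (simp only: uop_single[OF D le_SucI[OF i(1)] i2(2)] scal_unit[OF nD] F_def mult_1)
  have nF: "mate F i \<noteq> Suc i" by (rule mate_ne_of_next[OF valid_matching[OF vF] aF(1)])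
  have uF: "u i (s F) = s D"
    by (simp only: uop_single[OF vF i(1) i2(1)] scal_unit[OF nF] DF mult_1)
  note sF = path_shift[OF vF i(1) i2(4) aF, unfolded DF]
  note pF = path_peak[OF vF aF]
  have kF: "mate E (Suc i) = Suc (Suc i) \<and> \<not> deco E (Suc i)" if "E \<in> Poly_Mapping.keys (u (Suc i) x - smul c (s F))" for E x c
    using that keys_diff[of "u (Suc i) x" "smul c (s F)"] keys_u[of E "Suc i" x] keys_smul[of c "s F"] aF by auto
  note ll = linear_opD[OF linear_uop]
  show ?thesis
  proof (cases "Suc (Suc i) = k")
    case True
    define c where "c = path_content q Q (path F) i"
    have t: "Lk i (s F) - smul c (s F) \<in> coeff_span A (dominating n F)" using IH(1)[OF vF True] by (simp add: tri_def c_def)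
    have LF: "Lk i (s F) = u (Suc i) (Lk i (s D))" unfolding uD[symmetric] by (rule rep.L_u_high) (use i i2 in auto)
    have "u i (Lk i (s F) - smul c (s F)) \<in> coeff_span A (dominating n D)"
      using transfer[OF t vF i(1) i2(2) aF] kF unfolding LF DF by blast
    then have "smul (q\<^sup>2) (u i (Lk i (s F) - smul c (s F))) \<in> coeff_span A (dominating n D)"
      by (rule sp(4)[OF subringD(7)[OF A qA(1)]])
    moreover have "Lk k (s D) = smul (q\<^sup>2) (u i (Lk i (s F)))"
      using rep.L_slide[OF i(1) i2(2), of "s D"] uD uF True by simp
    moreover have "path_content q Q (path D) k = q\<^sup>2 * c"
    proof -
      have p: "path D k = path F i" "path D (k - 1) = path F (i - 1)" using sF(1)[of k] sF(3) pF(2) True by auto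
      \<comment> \<open>The exponents of contents are truncated to naturals. The bound shows that
        nothing is cut off, so that the shift from \<open>i\<close> to \<open>k = i + 2\<close>
        yields exactly the factor \<open>q\<^sup>2\<close>.\<close>
      have "\<bar>path F (i - 1)\<bar> \<le> int i - 1"
        using height_le[OF valid_matching[OF vF], of "i - 1"] abs_path[of F "i - 1"] i(1) by simp
      then have "nat (int k - 1 + path F (i - 1)) = 2 + nat (int i - 1 + path F (i - 1))"
        "nat (int k - 1 - path F (i - 1)) = 2 + nat (int i - 1 - path F (i - 1))" using True by auto
      then show ?thesis unfolding c_def path_content_def p by (simp add: power2_eq_square)
    qed
    ultimately show ?thesis unfolding tri_def by (simp only: ll uF smul_simps(3,7))
  next
    case False
    then have k: "Suc (Suc i) < k" using i by simp
    define c where "c = path_content q Q (path F) k"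
    have t: "Lk k (s F) - smul c (s F) \<in> coeff_span A (dominating n F)" using IH(2)[OF vF k aF] by (simp add: tri_def c_def)
    have LF: "Lk k (s F) = u (Suc i) (Lk k (s D))" unfolding uD[symmetric] by (rule rep.L_u_low) (use k i in auto)
    have LD: "Lk k (s D) = u i (Lk k (s F))" unfolding uF[symmetric] by (rule rep.L_u_low) (use k i in auto)
    have "u i (Lk k (s F) - smul c (s F)) \<in> coeff_span A (dominating n D)"
      using transfer[OF t vF i(1) i2(2) aF] kF unfolding LF DF by blast
    moreover have "Suc i < k" "Suc i < k - 1" using k by auto
    then have "path_content q Q (path D) k = c" unfolding c_def path_content_def using sF(1)[of k] sF(1)[of "k - 1"] by simp
    ultimately show ?thesis unfolding tri_def LD by (simp only: ll uF)
  qed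
qed

lemma tri_arc:
  assumes IH: "\<And>k' F. k' < k \<Longrightarrow> 1 \<le> k' \<Longrightarrow> valid (2 * n) F \<Longrightarrow> tri k' F"
    and D: "valid (2 * n) D" and i: "1 \<le> i" "Suc i < k" "k \<le> n" and a: "mate D i = Suc i" "\<not> deco D i"
  shows "tri k D"
  using D i a
proof (induction "k - i" arbitrary: i D rule: less_induct)
  case less
  show ?case
  proof (rule tri_slide[OF less.prems])
    show "tri i F" if "valid (2 * n) F" "Suc (Suc i) = k" for F
      using IH[of i F] that less.prems by auto
    show "tri k F" if "valid (2 * n) F" "Suc (Suc i) < k" "mate F (Suc i) = Suc (Suc i)" "\<not> deco F (Suc i)" for F
      using less.hyps[of "Suc i" F] that less.prems by auto
  qed
qed

lemma undecorate:
  assumes D: "valid (2 * n) D" and a: "mate D 1 = 2" "deco D 1"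
  obtains F where "valid (2 * n) F" "mate F = mate D" "\<not> deco F 1" "blob1 F = D"
proof -
  note mt = valid_matching[OF D]
  define F where "F = Arcs (mate D) (\<lambda>x. deco D x \<and> x \<noteq> 1 \<and> x \<noteq> 2)"
  have m2: "mate D 2 = 1" using matchingD(1)[OF mt, of 1] a by simp
  have "mate D x = 1 \<longleftrightarrow> x = 2" "mate D x = 2 \<longleftrightarrow> x = 1" for x
    using matchingD(1)[OF mt, of x] a m2 by auto
  then have "matching (2 * n) F" using mt unfolding matching_def F_def by simp blast
  then have "valid (2 * n) F" using D unfolding valid_def F_def by simp
  moreover have "deco D 2" using matchingD(3)[OF mt, of 1] a by simp
  then have "blob1 F = D" by (intro arcs_eqI) (use a in \<open>auto simp: blob1_def F_def\<close>)
  ultimately show ?thesis using that[of F] by (simp add: F_def)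
qed

text \<open>Removing the blob from the arc \<open>(1, 2)\<close> changes the path only at 1, from -1
  to 1. For \<open>k \<ge> 3\<close> this does not touch the content of \<open>k\<close>, and
  \<open>e\<close> puts the blob back.\<close>

lemma tri_decorated_arc:
  assumes IH: "\<And>k' F. k' < k \<Longrightarrow> 1 \<le> k' \<Longrightarrow> valid (2 * n) F \<Longrightarrow> tri k' F"
    and D: "valid (2 * n) D" and k: "2 \<le> k" "k \<le> n" and a: "mate D 1 = 2" "deco D 1"
  shows "tri k D"
proof -
  obtain F where F: "valid (2 * n) F" "mate F = mate D" "\<not> deco F 1" "blob1 F = D"
    using undecorate[OF D a] by blast
  have eF: "e (s F) = s D" using eop_single[OF F(1), of 1] F(4) by simp
  have eS: "e (Poly_Mapping.single F c) = Poly_Mapping.single D c" "e (Poly_Mapping.single D c) = Poly_Mapping.single D c" for c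
    using eop_single[OF F(1), of c] eop_single[OF D, of c] F(4) blob1_id[OF valid_matching[OF D] a(2)] by simp_all
  note le = linear_opD[OF linear_eop]
  have LD: "Lk k (s D) = e (Lk k (s F))" unfolding eF[symmetric] using rep.L_e[OF k] by simp
  have aF: "mate F 1 = Suc 1" using F(2) a by simp
  have path1: "path (blob1 E) j = path E j" if E: "valid (2 * n) E" "mate E 1 = Suc 1" "j \<noteq> 1" for E j
  proof -
    have "1 \<notin> opened E j" using E(2,3) by (auto simp: opened_def)
    then show ?thesis using blob1_marked[OF valid_matching[OF E(1)], of j] by (simp add: path_def)
  qed
  have path1': "path (blob1 E) 1 = - 1" "\<not> deco E 1 \<Longrightarrow> path E 1 = 1" if E: "valid (2 * n) E" "mate E 1 = Suc 1" for E
  proof -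
    have "opened E 1 \<subseteq> {1..1}" by (rule opened_subset[OF valid_matching[OF E(1)]])
    then have o: "opened E 1 = {1}" using E(2) by (auto simp: opened_def)
    show "path (blob1 E) 1 = - 1" using o blob1_marked[OF valid_matching[OF E(1)], of 1] by (simp add: path_def)
    show "\<not> deco E 1 \<Longrightarrow> path E 1 = 1" using o by (simp add: path_def marked_def)
  qed
  have pD: "path D j = (if j = 1 then - 1 else path F j)" for j
    using path1[OF F(1) aF, of j] path1'(1)[OF F(1) aF] F(4) by auto
  show ?thesis
  proof (cases "k = 2")
    case True
    have n1: "1 < n" using k True by simp
    \<comment> \<open>The slide requires \<open>k \<ge> 3\<close>, so this case is computed:
      \<open>L_2 F = Q^{-1} F - (Q^{-1} - Q) D\<close>, and \<open>e\<close> maps both diagrams to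
      \<open>D\<close>, which leaves \<open>Q D\<close> without error term.\<close>
    have "Lk 2 (s F) = jm u e (inverse q) (inverse Q) 1 (s F)"
      using L_arc[OF F(1) _ n1 aF F(3)] by (simp add: numeral_2_eq_2 smul_simps del: jm.simps)
    also have "\<dots> = smul (inverse Q) (s F) - smul (inverse Q - Q) (s D)" by (simp add: eF)
    finally have "Lk 2 (s D) = smul Q (s D)" using LD True by (simp add: le eS smul_simps flip: single_diff)
    moreover have "path F 2 = 0"
      using path_peak(2)[OF F(1), of 0] aF F(3) path_0[OF valid_matching[OF F(1)]] by (simp add: numeral_2_eq_2)
    then have "path_content q Q (path D) 2 = Q" by (simp add: path_content_def pD)
    ultimately show ?thesis using True by (simp add: tri_def sp)
  next
    case False
    then have k3: "Suc 1 < k" "3 \<le> k" using k by auto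
    have n1: "1 < n" using k3 k by simp
    define c where "c = path_content q Q (path F) k"
    define z where "z = Lk k (s F) - smul c (s F)"
    have z: "z \<in> coeff_span A (dominating n F)"
      using tri_arc[OF IH F(1) _ k3(1) k(2) aF F(3)] by (simp add: tri_def z_def c_def)
    \<comment> \<open>\<open>F\<close> is a multiple of \<open>U_1 F\<close>, and \<open>U_1\<close>
      commutes with \<open>L_k\<close>. Hence every diagram in \<open>L_k F\<close> has the plain
      arc \<open>(1, 2)\<close>, and \<open>e\<close> alters its path only at 1.\<close>
    let ?d = "- (q + inverse q)"
    have d: "?d \<noteq> 0" using d0 by (metis neg_equal_0_iff_equal)
    have jf: "join 1 F = F" by (rule join_fix[OF valid_matching[OF F(1)] aF F(3)])
    have uF: "u 1 (s F) = smul ?d (s F)" using uop_single[OF F(1) _ n1, where c = 1] jf aF F(3) by (simp add: scal_def smul_simps)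
    have "Lk k (u 1 (s F)) = u 1 (Lk k (s F))" by (rule rep.L_u_low) (use k3 k in auto)
    then have "smul ?d (Lk k (s F)) = u 1 (Lk k (s F))"
      unfolding uF by (simp only: linear_opD[OF linear_jm[OF linear_uop linear_eop]])
    then have keysL: "Poly_Mapping.keys (smul ?d (Lk k (s F))) \<subseteq> {E. mate E 1 = Suc 1 \<and> \<not> deco E 1}" using keys_u by auto
    have "Poly_Mapping.keys (Lk k (s F)) \<subseteq> Poly_Mapping.keys (smul ?d (Lk k (s F)))"
      using d by (auto simp: in_keys_iff)
    then have "Poly_Mapping.keys z \<subseteq> {E. mate E 1 = Suc 1 \<and> \<not> deco E 1}"
      unfolding z_def using keysL keys_diff[of "Lk k (s F)" "smul c (s F)"] keys_smul[of c "s F"] aF F(3) by auto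
    then have z': "z \<in> coeff_span A {E \<in> dominating n F. mate E 1 = Suc 1 \<and> \<not> deco E 1}" using z by (auto simp: coeff_span_def)
    have "e z \<in> coeff_span A (dominating n D)"
    proof (rule e_span[OF z'])
      fix E assume E': "E \<in> {E \<in> dominating n F. mate E 1 = Suc 1 \<and> \<not> deco E 1}" "valid (2 * n) E"
      then have E: "valid (2 * n) E" "mate E 1 = Suc 1" "\<not> deco E 1" "dominates n 0 E F" "\<exists>j \<le> n. path E j \<noteq> path F j"
        by (auto simp: dominating_def)
      have pb: "path (blob1 E) j = (if j = 1 then - 1 else path E j)" for j
        using path1[OF E(1,2), of j] path1'(1)[OF E(1,2)] by auto
      have "dominates n 0 (blob1 E) D"
        using E(4) n1 unfolding dominates_def pb pD by auto
      moreover obtain j where j: "j \<le> n" "path E j \<noteq> path F j" using E(5) by blast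
      \<comment> \<open>With a plain arc \<open>(1, 2)\<close> both paths have the value 1 at 1, so
        their difference lies elsewhere and survives the change there.\<close>
      have "j \<noteq> 1" using j path1'(2)[OF E(1,2,3)] path1'(2)[OF F(1) aF F(3)] by auto
      then have "path (blob1 E) j \<noteq> path D j" using j by (simp add: pb pD)
      ultimately show "blob1 E \<in> dominating n D" using blob1_valid[OF E(1)] n j by (auto simp: dominating_def)
    qed
    moreover have "k \<noteq> 1" "k - 1 \<noteq> 1" using k3 by auto
    then have "path_content q Q (path D) k = c" unfolding c_def path_content_def pD by (simp only: if_False)
    moreover have "Lk k (s D) - smul c (s D) = e z" unfolding z_def LD by (simp add: le eF)
    ultimately show ?thesis by (simp add: tri_def)
  qed
qed

theorem triangular:
  assumes "valid (2 * n) D" "1 \<le> k" "k \<le> n"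
  shows "tri k D"
  using assms
proof (induction k arbitrary: D rule: less_induct)
  case (less k)
  note D = less.prems(1) and mt = valid_matching[OF less.prems(1)]
  have IH: "tri k' F" if "k' < k" "1 \<le> k'" "valid (2 * n) F" for k' F
    using less.IH[of k' F] that less.prems by simp
  have oc: "x < mate D x \<or> mate D x < x" if "1 \<le> x" "x \<le> n" for x
    using opener_or_closer[OF mt, of x] that by auto
  \<comment> \<open>A closing node directly after an opening one must be its partner, since
    otherwise the two arcs would cross.\<close>
  have prev: "mate D i = Suc i" if i: "1 \<le> i" "i < n" "mate D (Suc i) < Suc i" "i < mate D i" for i
  proof (rule ccontr)
    assume ne: "mate D i \<noteq> Suc i"
    have "mate D (Suc i) \<noteq> i" using matchingD(1)[OF mt, of "Suc i"] ne by auto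
    then show False
      using noncross[OF D, of "mate D (Suc i)" i] i ne matchingD(1)[OF mt, of "Suc i"] by simp
  qed
  show ?case
  proof (cases "\<exists>x. 1 \<le> x \<and> x < k \<and> mate D x < x")
    case True
    \<comment> \<open>The first closing node follows an opening one, which gives the innermost arc
      \<open>(x - 1, x)\<close>.\<close>
    define x where "x = (LEAST x. 1 \<le> x \<and> x < k \<and> mate D x < x)"
    have x: "1 \<le> x" "x < k" "mate D x < x" using LeastI_ex[OF True] by (simp_all add: x_def)
    have mn: "w < mate D w" if "1 \<le> w" "w < x" for w
      using not_less_Least[of w "\<lambda>x. 1 \<le> x \<and> x < k \<and> mate D x < x"] that x oc[of w] less.prems unfolding x_def[symmetric] by auto
    have x1: "x \<noteq> 1" using x matchingD(2)[OF mt, of 0] matchingD(1)[OF mt, of 1] by auto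
    define i where "i = x - 1"
    have i: "1 \<le> i" "x = Suc i" using x x1 by (auto simp: i_def)
    have ai: "mate D i = Suc i" using prev[of i] x i mn[of i] less.prems by simp
    show ?thesis
    proof (cases "deco D i")
      case False
      then show ?thesis using tri_arc[OF IH D i(1) _ less.prems(3) ai] x i by simp
    next
      case True
      \<comment> \<open>Otherwise the arc opened at 1 is still open at \<open>i\<close> and would
        enclose the decorated arc.\<close>
      have "i = 1"
      proof (rule ccontr)
        assume "i \<noteq> 1"
        then have w: "1 < mate D 1" "1 < i" using mn[of 1] i by auto
        have "mate D 1 \<noteq> i" "mate D 1 \<noteq> x" using ai w matchingD(1)[OF mt, of 1] matchingD(1)[OF mt, of i] i by auto
        moreover have "\<not> mate D 1 < i"
        proof
          assume "mate D 1 < i"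
          then show False using mn[of "mate D 1"] matchingD(1)[OF mt, of 1] w i by simp
        qed
        ultimately show False using outermost[OF D True, of 1] w by simp
      qed
      then show ?thesis using tri_decorated_arc[OF IH D _ less.prems(3)] ai True x i by simp
    qed
  next
    case False
    have op: "x < mate D x" if "1 \<le> x" "x < k" for x using False oc[of x] that less.prems by auto
    have op': "k \<le> mate D x" if x: "1 \<le> x" "x < k" for x
    proof (rule ccontr)
      assume "\<not> k \<le> mate D x"
      then show False using op[of "mate D x"] op[OF x] matchingD(1)[OF mt, of x] x by simp
    qed
    show ?thesis
    proof (cases "k < mate D k")
      case True
      have "k < mate D x" if x: "1 \<le> x" "x \<le> k" for x
      proof (cases "x = k")
        case False
        then have "k \<le> mate D x" using op' x by simp
        moreover have "mate D x \<noteq> k" using True matchingD(1)[OF mt, of x] x by auto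
        ultimately show ?thesis by simp
      qed (use True in simp)
      then show ?thesis using tri_straight[OF D less.prems(2,3)] by blast
    next
      case False
      then have c: "mate D k < k" using oc less.prems by blast
      have "k \<noteq> 1" using c matchingD(2)[OF mt, of 0] matchingD(1)[OF mt, of 1] by auto
      then obtain i where i: "k = Suc i" "1 \<le> i" using less.prems by (cases k) auto
      have ai: "mate D i = Suc i" using prev[of i] c i op[of i] less.prems by simp
      show ?thesis
      proof (cases "deco D i")
        case False
        have "i < mate D x" if "1 \<le> x" "x \<le> i" for x using op'[of x] that i by simp
        then show ?thesis using tri_turn[OF D i(2) _ ai False] i less.prems by simp
      next
        case True
        have "i = 1"
        proof (rule ccontr)
          assume "i \<noteq> 1"
          then show False using outermost[OF D True, of 1] op'[of 1] i by simp
        qed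
        then show ?thesis using tri_decorated_arc[OF IH D _ less.prems(3)] ai True i by simp
      qed
    qed
  qed
qed

end

section \<open>Base rings\<close>

lemma finite_Std: "finite (Std lam)"
proof -
  obtain a b where lam: "lam = (a, b)" by (cases lam)
  have "Std lam \<subseteq> (\<lambda>F. (sorted_list_of_set F, sorted_list_of_set ({1..a + b} - F))) ` Pow {1..a + b}"
    unfolding lam Std_iff using Std_iff by auto
  then show ?thesis by (rule finite_subset) simp
qed

lemma (in coeffs_q) JM_triangular:
  assumes lam: "lam \<in> Bip1 n" and \<sigma>: "\<sigma> \<in> Std lam" and \<tau>: "\<tau> \<in> Std lam" and k: "1 \<le> k" "k \<le> n"
  shows "\<exists>a. (\<forall>\<upsilon> \<in> Std lam. a \<upsilon> \<in> A) \<and>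
    blob_mult q Q n (JM q Q n k) (mst n \<sigma> \<tau>) -
      (scale (tab_content q Q \<sigma> k) (mst n \<sigma> \<tau>) +
       (\<Sum>\<upsilon> \<in> {\<upsilon> \<in> Std lam. tab_succ \<upsilon> \<sigma>}. scale (a \<upsilon>) (mst n \<upsilon> \<tau>)))
    \<in> blob_ideal A n lam"
proof -
  obtain X where X: "valid (2 * n) X" and top: "edge_tableau n Top (diagram_of n X) = \<sigma>"
    and bot: "edge_tableau n Bot (diagram_of n X) = \<tau>" and sh: "lam = (card (up_top n X), n - card (up_top n X))"
    by (rule tableaux_diagram[OF lam \<sigma> \<tau>])
  define c where "c = tab_content q Q \<sigma> k"
  define z where "z = Lk k (s X) - smul c (s X)"
  have c: "path_content q Q (path X) k = c" using tab_content_path[OF X k, of q Q] by (simp add: c_def top)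
  have z: "z \<in> coeff_span A (dominating n X)" using triangular[OF X k] by (simp add: tri_def z_def c)
  have mstX: "mst n \<sigma> \<tau> = dia (diagram_of n X)" using blob_diagram_of_diagram_of[OF X] by (simp add: mst_def top bot)
  define B where "B \<upsilon> = blob_diagram_of n \<upsilon> \<tau>" for \<upsilon>
  define U where "U = {\<upsilon> \<in> Std lam. tab_succ \<upsilon> \<sigma>}"
  define a where "a \<upsilon> = Poly_Mapping.lookup (Phi n z) (B \<upsilon>)" for \<upsilon>
  have P: "Phi n z \<in> coeff_span A (diagram_of n ` dominating n X)"
    unfolding Phi_def by (rule coeff_span_lin[OF A z]) (intro sp(5) imageI subringD(2)[OF A])
  \<comment> \<open>Distinct tableaux give distinct diagrams, so subtracting the sum clears each of
    their coefficients in \<open>Phi n z\<close> separately.\<close>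
  have injB: "inj_on B U"
  proof (rule inj_onI)
    fix u1 u2 assume u: "u1 \<in> U" "u2 \<in> U" "B u1 = B u2"
    have "edge_tableau n Top (B v) = v" if "v \<in> U" for v
    proof -
      have "v \<in> Std lam" using that by (simp add: U_def)
      then obtain Y where "valid (2 * n) Y" "edge_tableau n Top (diagram_of n Y) = v" "edge_tableau n Bot (diagram_of n Y) = \<tau>"
        using tableaux_diagram[OF lam _ \<tau>] by metis
      then show ?thesis using blob_diagram_of_diagram_of[of n Y] by (simp add: B_def)
    qed
    then show "u1 = u2" using u by metis
  qed
  have fin: "finite U" unfolding U_def using finite_Std by simp
  define w where "w = Phi n z - (\<Sum>\<upsilon>\<in>U. smul (a \<upsilon>) (Poly_Mapping.single (B \<upsilon>) 1))"
  have lw: "Poly_Mapping.lookup w D = (if D \<in> B ` U then 0 else Poly_Mapping.lookup (Phi n z) D)" for D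
  proof -
    have "Poly_Mapping.lookup (\<Sum>\<upsilon>\<in>U. smul (a \<upsilon>) (Poly_Mapping.single (B \<upsilon>) 1)) D = (\<Sum>\<upsilon>\<in>U. if B \<upsilon> = D then a \<upsilon> else 0)"
      unfolding lookup_sum by (intro sum.cong) (simp_all add: lookup_single when_def)
    also have "\<dots> = (if D \<in> B ` U then Poly_Mapping.lookup (Phi n z) D else 0)"
    proof (cases "D \<in> B ` U")
      case True
      then obtain v where v: "v \<in> U" "D = B v" by blast
      then have "(\<Sum>\<upsilon>\<in>U. if B \<upsilon> = D then a \<upsilon> else 0) = (\<Sum>\<upsilon>\<in>U. if \<upsilon> = v then a \<upsilon> else 0)"
        using injB by (intro sum.cong) (auto simp: inj_on_def)
      then show ?thesis using v fin True by (simp add: a_def)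
    next
      case False
      then show ?thesis by (auto intro!: sum.neutral)
    qed
    finally show ?thesis by (simp add: w_def lookup_minus)
  qed
  have "w \<in> blob_ideal A n lam"
    unfolding blob_ideal_def dia_span_def
  proof (intro CollectI conjI allI subsetI)
    fix D assume "D \<in> Poly_Mapping.keys w"
    then have D: "D \<notin> B ` U" "D \<in> Poly_Mapping.keys (Phi n z)" by (auto simp: in_keys_iff lw split: if_splits)
    then obtain E where E: "E \<in> dominating n X" "D = diagram_of n E" using P by (auto simp: coeff_span_def)
    show "\<exists>\<alpha> \<beta> \<mu>. D = blob_diagram_of n \<alpha> \<beta> \<and> \<mu> \<in> Bip1 n \<and> bip_succ \<mu> lam \<and> \<alpha> \<in> Std \<mu> \<and> \<beta> \<in> Std \<mu>"
      using X E(1)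
    proof (cases rule: dominating_cases)
      case tab
      then have "edge_tableau n Top (diagram_of n E) \<in> U" "D = B (edge_tableau n Top (diagram_of n E))"
        using E(2) by (simp_all add: U_def B_def sh top bot)
      then show ?thesis using D(1) by blast
    next
      case higher
      then show ?thesis unfolding E(2) sh by blast
    qed
  next
    fix D show "Poly_Mapping.lookup w D \<in> A"
      using P subringD(1)[OF A] by (simp add: lw coeff_span_def)
  qed
  moreover have "blob_mult q Q n (JM q Q n k) (mst n \<sigma> \<tau>) -
      (scale c (mst n \<sigma> \<tau>) + (\<Sum>\<upsilon> \<in> U. scale (a \<upsilon>) (mst n \<upsilon> \<tau>))) = w"
  proof -
    have "blob_mult q Q n (JM q Q n k) (mst n \<sigma> \<tau>) = Phi n (z + smul c (s X))"
      unfolding mstX JM_mult[OF n k(2) X] by (simp add: z_def)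
    also have "\<dots> = Phi n z + smul c (dia (diagram_of n X))"
      by (simp only: linear_opD[OF linear_Phi] Phi_single dia_def)
    finally show ?thesis unfolding w_def mstX scale_smul by (simp add: mst_def B_def dia_def)
  qed
  moreover have "a \<upsilon> \<in> A" for \<upsilon> using P by (simp add: a_def coeff_span_def)
  ultimately show ?thesis unfolding c_def U_def by blast
qed

section \<open>Evaluation of rational functions at the special point\<close>

definition eval2 :: "complex \<Rightarrow> complex \<Rightarrow> complex poly poly \<Rightarrow> complex" where
  "eval2 a b f = poly (poly f [:b:]) a"

lemma eval2_simps [simp]:
  "eval2 a b (f + g) = eval2 a b f + eval2 a b g" "eval2 a b (f * g) = eval2 a b f * eval2 a b g"
  "eval2 a b 0 = 0" "eval2 a b 1 = 1"
  by (simp_all add: eval2_def)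

text \<open>Evaluation at \<open>(\<zeta>, \<zeta>\<^sup>m)\<close>, defined on the fractions without a pole there; it shows that \<open>1\<close> does not
  lie in the maximal ideal, so that \<open>R_ring\<close> embeds into \<open>O_ring\<close>.\<close>

definition has_value :: "complex \<Rightarrow> complex \<Rightarrow> ratfun \<Rightarrow> complex \<Rightarrow> bool" where
  "has_value a b x c \<longleftrightarrow> (\<exists>f g. x = Fract f g \<and> eval2 a b g \<noteq> 0 \<and> c = eval2 a b f / eval2 a b g)"

lemma eval2_nz: "eval2 a b g \<noteq> 0 \<Longrightarrow> g \<noteq> 0"
  by auto

lemma has_value_unique:
  assumes "has_value a b x c" "has_value a b x d" shows "c = d"
proof -
  obtain f g where f: "x = Fract f g" "eval2 a b g \<noteq> 0" "c = eval2 a b f / eval2 a b g" using assms(1) by (auto simp: has_value_def)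
  obtain f' g' where f': "x = Fract f' g'" "eval2 a b g' \<noteq> 0" "d = eval2 a b f' / eval2 a b g'" using assms(2) by (auto simp: has_value_def)
  have "f * g' = f' * g" using f f' eval2_nz by (metis eq_fract(1))
  then have "eval2 a b f * eval2 a b g' = eval2 a b f' * eval2 a b g" by (metis eval2_simps(2))
  then show ?thesis using f f' by (simp add: frac_eq_eq)
qed

lemma has_value_Fract1: "has_value a b (Fract f 1) (eval2 a b f)"
  unfolding has_value_def by (intro exI[of _ f] exI[of _ 1]) simp

lemma has_value_add:
  assumes "has_value a b x c" "has_value a b z d" shows "has_value a b (x + z) (c + d)"
proof -
  obtain f g where f: "x = Fract f g" "eval2 a b g \<noteq> 0" "c = eval2 a b f / eval2 a b g" using assms(1) by (auto simp: has_value_def)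
  obtain f' g' where f': "z = Fract f' g'" "eval2 a b g' \<noteq> 0" "d = eval2 a b f' / eval2 a b g'" using assms(2) by (auto simp: has_value_def)
  have "x + z = Fract (f * g' + f' * g) (g * g')" using f f' eval2_nz by (simp add: add_fract)
  then show ?thesis unfolding has_value_def using f f'
    by (intro exI[of _ "f * g' + f' * g"] exI[of _ "g * g'"]) (simp add: add_frac_eq)
qed

lemma has_value_mult:
  assumes "has_value a b x c" "has_value a b z d" shows "has_value a b (x * z) (c * d)"
proof -
  obtain f g where f: "x = Fract f g" "eval2 a b g \<noteq> 0" "c = eval2 a b f / eval2 a b g" using assms(1) by (auto simp: has_value_def)
  obtain f' g' where f': "z = Fract f' g'" "eval2 a b g' \<noteq> 0" "d = eval2 a b f' / eval2 a b g'" using assms(2) by (auto simp: has_value_def)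
  have "x * z = Fract (f * f') (g * g')" using f f' by simp
  then show ?thesis unfolding has_value_def using f f'
    by (intro exI[of _ "f * f'"] exI[of _ "g * g'"]) simp
qed

lemma has_value_inverse:
  assumes "has_value a b x c" "c \<noteq> 0" shows "has_value a b (inverse x) (inverse c)"
proof -
  obtain f g where f: "x = Fract f g" "eval2 a b g \<noteq> 0" "c = eval2 a b f / eval2 a b g" using assms(1) by (auto simp: has_value_def)
  then show ?thesis unfolding has_value_def using assms(2)
    by (intro exI[of _ g] exI[of _ f]) simp
qed

lemma has_value_const: "has_value a b (const_rf c) c"
  using has_value_Fract1[of a b "[:[:c:]:]"] by (simp add: const_rf_def eval2_def)

lemma has_value_01: "has_value a b 0 0" "has_value a b 1 1"
  using has_value_Fract1[of a b 0] has_value_Fract1[of a b 1] by (simp_all add: Zero_fract_def One_fract_def)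

lemma has_value_uminus: "has_value a b x c \<Longrightarrow> has_value a b (- x) (- c)"
  using has_value_mult[OF has_value_Fract1[of a b "- 1"], of x c]
  by (simp add: eval2_def Fract_of_int_eq flip: One_fract_def minus_fract)

lemma has_value_diff: "has_value a b x c \<Longrightarrow> has_value a b z d \<Longrightarrow> has_value a b (x - z) (c - d)"
  using has_value_add[OF _ has_value_uminus, of a b x c z d] by simp

lemma has_value_power: "has_value a b x c \<Longrightarrow> has_value a b (x ^ k) (c ^ k)"
  by (induction k) (simp_all add: has_value_01 has_value_mult)

lemma has_value_powi: "has_value a b x c \<Longrightarrow> c \<noteq> 0 \<Longrightarrow> has_value a b (x powi k) (c powi k)"
  by (auto simp: power_int_def intro: has_value_power has_value_inverse)

lemma has_value_nz: "has_value a b x c \<Longrightarrow> c \<noteq> 0 \<Longrightarrow> x \<noteq> 0"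
  using has_value_unique has_value_01(1) by blast

lemma has_value_hat: "has_value a b q_hat a" "has_value a b Q_hat b"
  using has_value_Fract1[of a b "[:[:0, 1:]:]"] has_value_Fract1[of a b "[:0, 1:]"]
  by (simp_all add: q_hat_def Q_hat_def eval2_def)

locale specialization =
  fixes \<zeta> \<omega> :: complex
  assumes nz: "\<zeta> \<noteq> 0" "\<omega> \<noteq> 0" and gen: "\<zeta> ^ 4 \<noteq> 1" "\<omega> \<noteq> inverse \<omega>"
    "\<omega> \<noteq> \<zeta> ^ 2 * inverse \<omega>" "inverse \<omega> \<noteq> \<zeta> ^ 2 * \<omega>"
begin

lemmas hat = has_value_hat[of \<zeta> \<omega>]

lemma hat_nz: "q_hat \<noteq> 0" "Q_hat \<noteq> 0"
  using has_value_nz[OF hat(1) nz(1)] has_value_nz[OF hat(2) nz(2)] by simp_all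

lemma denominator_values:
  "has_value \<zeta> \<omega> (q_hat ^ 4 - 1) (\<zeta> ^ 4 - 1)" "has_value \<zeta> \<omega> (Q_hat - inverse Q_hat) (\<omega> - inverse \<omega>)"
  "has_value \<zeta> \<omega> (Q_hat - inverse Q_hat * q_hat ^ 2) (\<omega> - inverse \<omega> * \<zeta> ^ 2)"
  "has_value \<zeta> \<omega> (inverse Q_hat - Q_hat * q_hat ^ 2) (inverse \<omega> - \<omega> * \<zeta> ^ 2)"
  by (intro has_value_diff has_value_mult has_value_power has_value_inverse hat has_value_01 nz)+

lemma values_nz: "\<zeta> ^ 4 - 1 \<noteq> 0" "\<omega> - inverse \<omega> \<noteq> 0" "\<omega> - inverse \<omega> * \<zeta> ^ 2 \<noteq> 0" "inverse \<omega> - \<omega> * \<zeta> ^ 2 \<noteq> 0"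
  using gen by (auto simp: mult.commute)

lemma denominator_value: "s \<in> denominators \<Longrightarrow> \<exists>c. c \<noteq> 0 \<and> has_value \<zeta> \<omega> s c"
proof -
  assume "s \<in> denominators"
  then obtain a b c d where s: "s = (q_hat ^ 4 - 1) ^ a * (Q_hat - inverse Q_hat) ^ b *
      (Q_hat - inverse Q_hat * q_hat ^ 2) ^ c * (inverse Q_hat - Q_hat * q_hat ^ 2) ^ d"
    by (auto simp: denominators_def)
  let ?c = "(\<zeta> ^ 4 - 1) ^ a * (\<omega> - inverse \<omega>) ^ b * (\<omega> - inverse \<omega> * \<zeta> ^ 2) ^ c * (inverse \<omega> - \<omega> * \<zeta> ^ 2) ^ d"
  have "has_value \<zeta> \<omega> s ?c"
    unfolding s by (intro has_value_mult has_value_power denominator_values)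
  moreover have "?c \<noteq> 0" using values_nz by simp
  ultimately show ?thesis by blast
qed

lemma laurent_value: "x \<in> laurent_ring \<Longrightarrow> \<exists>c. has_value \<zeta> \<omega> x c"
proof -
  assume "x \<in> laurent_ring"
  then obtain f i j where x: "x = Fract f 1 / (q_hat ^ i * Q_hat ^ j)" by (auto simp: laurent_ring_def)
  have "has_value \<zeta> \<omega> x (eval2 \<zeta> \<omega> f * inverse (\<zeta> ^ i * \<omega> ^ j))"
    unfolding x divide_inverse using nz
    by (intro has_value_mult has_value_inverse has_value_power hat has_value_Fract1) simp
  then show ?thesis by blast
qed

lemma R_value: "x \<in> R_ring \<Longrightarrow> \<exists>c. has_value \<zeta> \<omega> x c"
proof -
  assume "x \<in> R_ring"
  then obtain z s where x: "x = z / s" "z \<in> laurent_ring" "s \<in> denominators" by (auto simp: R_ring_def)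
  then show ?thesis
    using laurent_value[OF x(2)] denominator_value[OF x(3)] has_value_mult has_value_inverse unfolding x(1) divide_inverse by blast
qed

lemma subring_laurent: "subring laurent_ring"
proof -
  have I: "Fract f 1 / (q_hat ^ i * Q_hat ^ j) \<in> laurent_ring" for f i j by (auto simp: laurent_ring_def)
  have mon: "q_hat ^ i * Q_hat ^ j = Fract ([:[:0, 1:]:] ^ i * [:0, 1:] ^ j) 1" for i j
  proof -
    have "Fract f 1 ^ k = Fract (f ^ k) 1" for f :: "complex poly poly" and k
      by (induction k) (simp_all add: One_fract_def)
    then show ?thesis by (simp add: q_hat_def Q_hat_def)
  qed
  have m0: "q_hat ^ i * Q_hat ^ j \<noteq> 0" for i j using hat_nz by simp
  show ?thesis
    unfolding subring_def
  proof (intro conjI ballI)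
    show "0 \<in> laurent_ring" using I[of 0 0 0] by (simp add: Zero_fract_def)
    show "1 \<in> laurent_ring" using I[of 1 0 0] by (simp flip: One_fract_def)
    fix x assume "x \<in> laurent_ring"
    then obtain f i j where x: "x = Fract f 1 / (q_hat ^ i * Q_hat ^ j)" by (auto simp: laurent_ring_def)
    have "- x = Fract (- f) 1 / (q_hat ^ i * Q_hat ^ j)" unfolding x by (simp flip: minus_fract)
    then show "- x \<in> laurent_ring" using I by simp
    fix z assume "z \<in> laurent_ring"
    then obtain g i' j' where z: "z = Fract g 1 / (q_hat ^ i' * Q_hat ^ j')" by (auto simp: laurent_ring_def)
    have den: "(q_hat ^ i * Q_hat ^ j) * (q_hat ^ i' * Q_hat ^ j') = q_hat ^ (i + i') * Q_hat ^ (j + j')"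
      by (simp add: power_add mult_ac)
    have "x + z = (Fract f 1 * (q_hat ^ i' * Q_hat ^ j') + Fract g 1 * (q_hat ^ i * Q_hat ^ j)) / (q_hat ^ (i + i') * Q_hat ^ (j + j'))"
      unfolding x z den[symmetric] by (rule add_frac_eq[OF m0 m0])
    also have "Fract f 1 * (q_hat ^ i' * Q_hat ^ j') + Fract g 1 * (q_hat ^ i * Q_hat ^ j) =
        Fract (f * ([:[:0, 1:]:] ^ i' * [:0, 1:] ^ j') + g * ([:[:0, 1:]:] ^ i * [:0, 1:] ^ j)) 1"
      unfolding mon by simp
    finally show "x + z \<in> laurent_ring" using I by simp
    have "x * z = Fract (f * g) 1 / (q_hat ^ (i + i') * Q_hat ^ (j + j'))" unfolding x z den[symmetric] times_divide_times_eq by simp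
    then show "x * z \<in> laurent_ring" using I by simp
  qed
qed

lemma laurent_gens: "q_hat \<in> laurent_ring" "inverse q_hat \<in> laurent_ring" "Q_hat \<in> laurent_ring" "inverse Q_hat \<in> laurent_ring"
proof -
  have I: "Fract f 1 / (q_hat ^ i * Q_hat ^ j) \<in> laurent_ring" for f i j by (auto simp: laurent_ring_def)
  show "q_hat \<in> laurent_ring" using I[of "[:[:0, 1:]:]" 0 0] by (simp add: q_hat_def)
  show "Q_hat \<in> laurent_ring" using I[of "[:0, 1:]" 0 0] by (simp add: Q_hat_def)
  show "inverse q_hat \<in> laurent_ring" using I[of 1 1 0] by (simp add: divide_inverse flip: One_fract_def)
  show "inverse Q_hat \<in> laurent_ring" using I[of 1 0 1] by (simp add: divide_inverse flip: One_fract_def)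
qed

lemma denominators_sub: "denominators \<subseteq> laurent_ring"
  unfolding denominators_def using laurent_gens
  by (auto intro!: subringD(4,6,7)[OF subring_laurent] subringD(2)[OF subring_laurent])

lemma denominators_mult:
  assumes "s \<in> denominators" "t \<in> denominators" shows "s * t \<in> denominators"
proof -
  obtain a b c d where s: "s = (q_hat ^ 4 - 1) ^ a * (Q_hat - inverse Q_hat) ^ b *
      (Q_hat - inverse Q_hat * q_hat ^ 2) ^ c * (inverse Q_hat - Q_hat * q_hat ^ 2) ^ d"
    using assms(1) by (auto simp: denominators_def)
  obtain a' b' c' d' where t: "t = (q_hat ^ 4 - 1) ^ a' * (Q_hat - inverse Q_hat) ^ b' *
      (Q_hat - inverse Q_hat * q_hat ^ 2) ^ c' * (inverse Q_hat - Q_hat * q_hat ^ 2) ^ d'"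
    using assms(2) by (auto simp: denominators_def)
  have "s * t = (q_hat ^ 4 - 1) ^ (a + a') * (Q_hat - inverse Q_hat) ^ (b + b') *
      (Q_hat - inverse Q_hat * q_hat ^ 2) ^ (c + c') * (inverse Q_hat - Q_hat * q_hat ^ 2) ^ (d + d')"
    unfolding s t power_add by (simp only: mult_ac)
  then show ?thesis unfolding denominators_def by blast
qed

lemma one_denominator: "1 \<in> denominators"
  unfolding denominators_def by (intro CollectI exI[of _ 0]) simp

lemma laurent_R: "x \<in> laurent_ring \<Longrightarrow> x \<in> R_ring"
  unfolding R_ring_def using one_denominator by (intro CollectI exI[of _ x] exI[of _ 1]) simp

lemma subring_R: "subring R_ring"
  unfolding subring_def
proof (intro conjI ballI)
  note L = subringD[OF subring_laurent]
  show "0 \<in> R_ring" "1 \<in> R_ring" using L(1,2) laurent_R by blast+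
  fix x assume "x \<in> R_ring"
  then obtain a s where x: "x = a / s" "a \<in> laurent_ring" "s \<in> denominators" by (auto simp: R_ring_def)
  have "- x = (- a) / s" by (simp add: x)
  then show "- x \<in> R_ring" unfolding R_ring_def using x L(5) by blast
  fix z assume "z \<in> R_ring"
  then obtain b t where z: "z = b / t" "b \<in> laurent_ring" "t \<in> denominators" by (auto simp: R_ring_def)
  have "s \<noteq> 0" "t \<noteq> 0" using denominator_value x(3) z(3) has_value_nz by blast+
  then have "x + z = (a * t + b * s) / (s * t)" unfolding x(1) z(1) by (rule add_frac_eq)
  moreover have "a * t + b * s \<in> laurent_ring" using x z denominators_sub by (intro L) auto
  ultimately show "x + z \<in> R_ring" unfolding R_ring_def using denominators_mult[OF x(3) z(3)] by blast
  have "x * z = (a * b) / (s * t)" unfolding x(1) z(1) by simp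
  then show "x * z \<in> R_ring" unfolding R_ring_def using denominators_mult[OF x(3) z(3)] L(4)[OF x(2) z(2)] by blast
qed

lemma y_R: "y_e q_hat Q_hat \<in> R_ring"
proof -
  have "- (Q_hat * inverse q_hat - inverse Q_hat * q_hat) \<in> laurent_ring"
    using laurent_gens by (intro subringD[OF subring_laurent])
  moreover have "Q_hat - inverse Q_hat \<in> denominators"
    unfolding denominators_def by (intro CollectI exI[of _ 0] exI[of _ 1]) simp
  ultimately show ?thesis unfolding R_ring_def y_e_def by blast
qed

lemma R_sub_O:
  assumes "\<zeta> = zeta l" "\<omega> = zeta l powi m"
  shows "R_ring \<subseteq> O_ring l m"
proof -
  have "1 \<notin> max_ideal l m"
  proof
    assume "1 \<in> max_ideal l m"
    then obtain x z where xz: "x \<in> R_ring" "z \<in> R_ring" "1 = (q_hat - const_rf (zeta l)) * x + (Q_hat - q_hat powi m) * z"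
      by (auto simp: max_ideal_def)
    obtain c d where cd: "has_value \<zeta> \<omega> x c" "has_value \<zeta> \<omega> z d" using R_value xz by blast
    have "has_value \<zeta> \<omega> ((q_hat - const_rf (zeta l)) * x + (Q_hat - q_hat powi m) * z) ((\<zeta> - zeta l) * c + (\<omega> - \<zeta> powi m) * d)"
      by (intro has_value_add has_value_mult has_value_diff has_value_powi hat has_value_const cd nz)
    \<comment> \<open>Both generators of the ideal vanish at the point.\<close>
    then have "has_value \<zeta> \<omega> 1 0" unfolding xz(3)[symmetric] using assms by simp
    then show False using has_value_unique has_value_01(2) by force
  qed
  then have one: "1 \<in> R_ring - max_ideal l m" using subringD(2)[OF subring_R] by blast
  show ?thesis
    unfolding O_ring_def using one by (intro subsetI CollectI) (metis div_by_1)
qed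

text \<open>\<open>\<zeta> + \<zeta>^{-1} = 0\<close> would mean
  \<open>\<zeta>\<^sup>2 = -1\<close>, hence \<open>\<zeta>^4 = 1\<close>; for the indeterminate the
  claim follows by evaluation.\<close>

lemma q_sum_nz: "\<zeta> + inverse \<zeta> \<noteq> 0" "q_hat + inverse q_hat \<noteq> 0"
proof -
  show 1: "\<zeta> + inverse \<zeta> \<noteq> 0"
  proof
    assume "\<zeta> + inverse \<zeta> = 0"
    then have "\<zeta> * \<zeta> = - 1" using nz by (simp add: field_simps) (metis add_eq_0_iff)
    then have "\<zeta> ^ 4 = 1" by (simp add: power4_eq_xxxx)
    then show False using gen by simp
  qed
  have "has_value \<zeta> \<omega> (q_hat + inverse q_hat) (\<zeta> + inverse \<zeta>)"
    by (intro has_value_add has_value_inverse hat nz)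
  then show "q_hat + inverse q_hat \<noteq> 0" using has_value_nz 1 by blast
qed

lemma Q_hat_ne: "Q_hat \<noteq> inverse Q_hat"
  using has_value_nz[OF denominator_values(2) values_nz(2)] by auto

end

lemma subring_UNIV: "subring UNIV"
  by (simp add: subring_def)

theorem theorem5p12:
  fixes l n k :: nat and m :: int and Q :: complex
    and lam :: bipartition and s t :: bitableau
  assumes "l \<ge> 3" and "odd l"
    and "Q = zeta l powi m"
    and "zeta l ^ 4 \<noteq> 1"
    and "Q \<noteq> inverse Q"
    and "Q \<noteq> zeta l ^ 2 * inverse Q"
    and "inverse Q \<noteq> zeta l ^ 2 * Q"
    and "lam \<in> Bip1 n" and "s \<in> Std lam" and "t \<in> Std lam"
    and "1 \<le> k" and "k \<le> n"
  shows
    "(\<exists>a :: bitableau \<Rightarrow> complex.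
        blob_mult (zeta l) Q n (JM (zeta l) Q n k) (mst n s t) -
          (scale (tab_content (zeta l) Q s k) (mst n s t) +
           (\<Sum>u \<in> {u \<in> Std lam. tab_succ u s}. scale (a u) (mst n u t)))
        \<in> blob_ideal UNIV n lam) \<and>
     (\<exists>a :: bitableau \<Rightarrow> ratfun.
        (\<forall>u \<in> Std lam. a u \<in> O_ring l m) \<and>
        blob_mult q_hat Q_hat n (JM q_hat Q_hat n k) (mst n s t) -
          (scale (tab_content q_hat Q_hat s k) (mst n s t) +
           (\<Sum>u \<in> {u \<in> Std lam. tab_succ u s}. scale (a u) (mst n u t)))
        \<in> blob_ideal (O_ring l m) n lam) \<and>
     (\<exists>a :: bitableau \<Rightarrow> ratfun.
        blob_mult q_hat Q_hat n (JM q_hat Q_hat n k) (mst n s t) -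
          (scale (tab_content q_hat Q_hat s k) (mst n s t) +
           (\<Sum>u \<in> {u \<in> Std lam. tab_succ u s}. scale (a u) (mst n u t)))
        \<in> blob_ideal UNIV n lam)"
proof -
  have z0: "zeta l \<noteq> 0" by (simp add: zeta_def)
  then have Q0: "Q \<noteq> 0" using assms(3) by simp
  have n: "1 \<le> n" using assms(11,12) by simp
  interpret sp: specialization "zeta l" Q
    using assms z0 Q0 by unfold_locales auto
  interpret C: coeffs_q n UNIV "zeta l" Q
    by unfold_locales (use n subring_UNIV z0 Q0 assms(5) sp.q_sum_nz in auto)
  \<comment> \<open>All parameters lie in \<open>R\<close> already, so the coefficients found there
    serve for the local ring and for the fraction field alike; only the spans have to be
    enlarged.\<close>
  interpret R: coeffs_q n R_ring q_hat Q_hat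
  proof
    show "- (q_hat + inverse q_hat) \<in> R_ring"
      using sp.laurent_gens by (intro sp.laurent_R subringD[OF sp.subring_laurent])
  qed (use n sp.subring_R sp.hat_nz sp.Q_hat_ne sp.q_sum_nz sp.laurent_gens sp.laurent_R sp.y_R in auto)
  obtain a where a: "\<forall>u \<in> Std lam. a u \<in> R_ring"
    "blob_mult q_hat Q_hat n (JM q_hat Q_hat n k) (mst n s t) -
          (scale (tab_content q_hat Q_hat s k) (mst n s t) +
           (\<Sum>u \<in> {u \<in> Std lam. tab_succ u s}. scale (a u) (mst n u t)))
        \<in> blob_ideal R_ring n lam"
    using R.JM_triangular[OF assms(8-12)] by blast
  have mono: "blob_ideal R_ring n lam \<subseteq> blob_ideal (O_ring l m) n lam" "blob_ideal R_ring n lam \<subseteq> blob_ideal UNIV n lam"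
    using sp.R_sub_O[OF refl assms(3)] unfolding blob_ideal_def dia_span_def by blast+
  show ?thesis
    using C.JM_triangular[OF assms(8-12)] a mono sp.R_sub_O[OF refl assms(3)] by blast
qed

end
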